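(* Let $m\ge1$ be such that $\lambda_m<\lambda_{m+1}$. Then \[ i(C_m^-\setminus\{0\})=i(X\setminus C_m^+)=m, \] where $i$ denotes the $\mathbb{Z}_2$-cohomological index of Fadell and Rabinowitz.
   Context: Let $N\ge1$, $s\in(0,1)$, $p\in(1,\infty)$, and let $\Omega\subset\mathbb{R}^N$ be a bounded domain with Lipschitz boundary. Set $C\Omega=\mathbb{R}^N\setminus\Omega$, $\mathcal{Q}=\mathbb{R}^{2N}\setminus (C\Omega)^2$, $[u]=\big(\iint_{\mathcal{Q}}\frac{|u(x)-u(y)|^p}{|x-y|^{N+ps}}dxdy\big)^{1/p}$, $\|u\|=([u]^p+\|u\|_{L^p(\Omega)}^p)^{1/p}$, and $X=\{u:\mathbb{R}^N\to\mathbb{R}\text{ measurable}:\|u\|<\infty\}$. Let $M=\{u\in X:\int_\Omega|u|^p\,dx=1\}$, and for $m\ge1$ define \[ \lambda_m=\inf\Big\{\sup_{u\in K}[u]^p:\ K\subseteq M \text{ symmetric, compact, } i(K)\ge m\Big\}, \] where $i$ is the $\mathbb{Z}_2$-cohomological index of Fadell–Rabinowitz; these are eigenvalues of the fractional $p$-Laplacian with nonlocal Neumann conditions, $\lambda_1=0$, and $\lambda_m\to\infty$. Define the cones \[ C_m^-=\{u\in X:[u]^p\le\lambda_m\textstyle\int_\Omega|u|^p dx\},\qquad C_m^+=\{u\in X:[u]^p\ge\lambda_{m+1}\textstyle\int_\Omega|u|^p dx\}. \] *)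

theory Defs
  imports "HOL-Analysis.Analysis" "HOL-Library.Z2"
begin

text \<open>A q-cochain on a space Y is a function from (q+1)-tuples (lists of length q+1)
  of points to Z2 (type bit). Only its values on lists of length q+1 are relevant.\<close>

type_synonym 'b cochain = "'b list \<Rightarrow> bit"

definition as_locally_zero :: "'b topology \<Rightarrow> nat \<Rightarrow> 'b cochain \<Rightarrow> bool" where
  "as_locally_zero Y q \<phi> \<longleftrightarrow>
     (\<exists>\<U>. (\<forall>U\<in>\<U>. openin Y U) \<and> \<Union>\<U> = topspace Y \<and>
          (\<forall>ys. length ys = Suc q \<and> (\<exists>U\<in>\<U>. set ys \<subseteq> U) \<longrightarrow> \<phi> ys = 0))"

definition as_cobound :: "'b cochain \<Rightarrow> 'b cochain" where
  "as_cobound \<phi> ys = (\<Sum>i<length ys. \<phi> (take i ys @ drop (Suc i) ys))"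

definition as_cup :: "nat \<Rightarrow> 'b cochain \<Rightarrow> 'b cochain \<Rightarrow> 'b cochain" where
  "as_cup p \<phi> \<psi> ys = \<phi> (take (Suc p) ys) * \<psi> (drop p ys)"

fun as_pow :: "'b cochain \<Rightarrow> nat \<Rightarrow> 'b cochain" where
  "as_pow \<phi> 0 = (\<lambda>_. 1)"
| "as_pow \<phi> (Suc j) = as_cup j (as_pow \<phi> j) \<phi>"

text \<open>phi defines a cohomology class of degree q in the Alexander--Spanier complex
  (cochains modulo locally zero cochains): its coboundary is locally zero.\<close>
definition as_cocycle :: "'b topology \<Rightarrow> nat \<Rightarrow> 'b cochain \<Rightarrow> bool" where
  "as_cocycle Y q \<phi> \<longleftrightarrow> as_locally_zero Y (Suc q) (as_cobound \<phi>)"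

definition as_class_zero :: "'b topology \<Rightarrow> nat \<Rightarrow> 'b cochain \<Rightarrow> bool" where
  "as_class_zero Y q \<phi> \<longleftrightarrow>
     (if q = 0 then as_locally_zero Y 0 \<phi>
      else (\<exists>\<psi>. as_locally_zero Y q (\<lambda>ys. \<phi> ys + as_cobound \<psi> ys)))"

definition as_pullback :: "('b \<Rightarrow> 'c) \<Rightarrow> 'c cochain \<Rightarrow> 'b cochain" where
  "as_pullback f \<phi> ys = \<phi> (map f ys)"

definition quotient_top :: "'a topology \<Rightarrow> ('a \<Rightarrow> 'b) \<Rightarrow> 'b topology" where
  "quotient_top X f = topology (\<lambda>U. U \<subseteq> f ` topspace X \<and> openin X {x \<in> topspace X. f x \<in> U})"

definition orbit2 :: "('a \<Rightarrow> 'a) \<Rightarrow> 'a \<Rightarrow> 'a set" where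
  "orbit2 neg u = {u, neg u}"

definition orbit_space :: "'a topology \<Rightarrow> ('a \<Rightarrow> 'a) \<Rightarrow> 'a set \<Rightarrow> 'a set topology" where
  "orbit_space T neg A = quotient_top (subtopology T A) (orbit2 neg)"

text \<open>The infinite dimensional sphere S^infinity (unit sphere of the space of finitely
  supported real sequences) with the direct limit (weak) topology of the spheres S^n.\<close>
definition Sinf :: "(nat \<Rightarrow> real) set" where
  "Sinf = {x. finite {i. x i \<noteq> 0} \<and> (\<Sum>i\<in>{i. x i \<noteq> 0}. (x i)\<^sup>2) = 1}"

definition Sfin :: "nat \<Rightarrow> (nat \<Rightarrow> real) set" where
  "Sfin n = {x \<in> Sinf. \<forall>i>n. x i = 0}"

definition Sinf_top :: "(nat \<Rightarrow> real) topology" where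
  "Sinf_top = topology (\<lambda>U. U \<subseteq> Sinf \<and>
     (\<forall>n. \<forall>x\<in>U \<inter> Sfin n. \<exists>e>0. \<forall>y\<in>Sfin n. (\<Sum>i\<le>n. (x i - y i)\<^sup>2) < e\<^sup>2 \<longrightarrow> y \<in> U))"

definition RPinf_top :: "(nat \<Rightarrow> real) set topology" where
  "RPinf_top = orbit_space Sinf_top uminus Sinf"

text \<open>A representative of the generator omega of H^1(RP^infinity; Z2) = Z2.\<close>
definition omega_RP :: "(nat \<Rightarrow> real) set cochain" where
  "omega_RP = (SOME \<phi>. as_cocycle RPinf_top 1 \<phi> \<and> \<not> as_class_zero RPinf_top 1 \<phi>)"

definition induced_orbit_map :: "('a \<Rightarrow> nat \<Rightarrow> real) \<Rightarrow> 'a set \<Rightarrow> (nat \<Rightarrow> real) set" where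
  "induced_orbit_map g Orb = orbit2 uminus (g (SOME u. u \<in> Orb))"

text \<open>Fadell--Rabinowitz Z2-cohomological index of a symmetric set A (free Z2-action):
  i(A) = sup { k >= 1 : f*(omega^(k-1)) \<noteq> 0 } where f : A/Z2 -> RP^infinity is the
  classifying map (induced by an odd continuous map A -> S^infinity); i(empty) = 0.\<close>
definition FR_index :: "'a topology \<Rightarrow> ('a \<Rightarrow> 'a) \<Rightarrow> 'a set \<Rightarrow> enat" where
  "FR_index T neg A = Sup {enat k | k. k \<ge> 1 \<and>
     (\<exists>g. continuous_map (subtopology T A) Sinf_top g \<and> (\<forall>u\<in>A. g (neg u) = - g u) \<and>
          \<not> as_class_zero (orbit_space T neg A) (k - 1)
               (as_pullback (induced_orbit_map g) (as_pow omega_RP (k - 1))))}"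

definition Lipschitz_boundary :: "(real^'n) set \<Rightarrow> bool" where
  "Lipschitz_boundary \<Omega> \<longleftrightarrow>
     (\<forall>x\<in>frontier \<Omega>. \<exists>r>0. \<exists>e::real^'n. norm e = 1 \<and> (\<exists>C \<gamma>. C-lipschitz_on UNIV (\<gamma> :: real^'n \<Rightarrow> real) \<and>
        \<Omega> \<inter> ball x r = {y \<in> ball x r. y \<bullet> e < \<gamma> (y - (y \<bullet> e) *\<^sub>R e)}))"

definition bounded_Lipschitz_domain :: "(real^'n) set \<Rightarrow> bool" where
  "bounded_Lipschitz_domain \<Omega> \<longleftrightarrow>
     open \<Omega> \<and> connected \<Omega> \<and> \<Omega> \<noteq> {} \<and> bounded \<Omega> \<and> Lipschitz_boundary \<Omega>"

definition Qset :: "(real^'n) set \<Rightarrow> ((real^'n) \<times> (real^'n)) set" where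
  "Qset \<Omega> = {(x, y). x \<in> \<Omega> \<or> y \<in> \<Omega>}"

definition gagp :: "real \<Rightarrow> real \<Rightarrow> (real^'n) set \<Rightarrow> (real^'n \<Rightarrow> real) \<Rightarrow> ennreal" where
  "gagp p s \<Omega> u = (\<integral>\<^sup>+ z \<in> Qset \<Omega>.
      ennreal (\<bar>u (fst z) - u (snd z)\<bar> powr p / norm (fst z - snd z) powr (real CARD('n) + p * s))
      \<partial>lebesgue)"

definition Lpp :: "real \<Rightarrow> (real^'n) set \<Rightarrow> (real^'n \<Rightarrow> real) \<Rightarrow> ennreal" where
  "Lpp p \<Omega> u = (\<integral>\<^sup>+ x \<in> \<Omega>. ennreal (\<bar>u x\<bar> powr p) \<partial>lebesgue)"

definition Xraw :: "real \<Rightarrow> real \<Rightarrow> (real^'n) set \<Rightarrow> (real^'n \<Rightarrow> real) set" where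
  "Xraw p s \<Omega> = {u. u \<in> borel_measurable lebesgue \<and> gagp p s \<Omega> u < \<infinity> \<and> Lpp p \<Omega> u < \<infinity>}"

text \<open>Elements of X are identified when equal almost everywhere in R^N: an element of X
  is represented by its class.\<close>
definition Xcls :: "real \<Rightarrow> real \<Rightarrow> (real^'n) set \<Rightarrow> (real^'n \<Rightarrow> real) \<Rightarrow> (real^'n \<Rightarrow> real) set" where
  "Xcls p s \<Omega> u = {v \<in> Xraw p s \<Omega>. AE x in lebesgue. v x = u x}"

definition Xsp :: "real \<Rightarrow> real \<Rightarrow> (real^'n) set \<Rightarrow> (real^'n \<Rightarrow> real) set set" where
  "Xsp p s \<Omega> = Xcls p s \<Omega> ` Xraw p s \<Omega>"

definition rep :: "(real^'n \<Rightarrow> real) set \<Rightarrow> (real^'n \<Rightarrow> real)" where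
  "rep U = (SOME u. u \<in> U)"

definition semp :: "real \<Rightarrow> real \<Rightarrow> (real^'n) set \<Rightarrow> (real^'n \<Rightarrow> real) set \<Rightarrow> real" where
  "semp p s \<Omega> U = enn2real (gagp p s \<Omega> (rep U))"

definition lpp :: "real \<Rightarrow> (real^'n) set \<Rightarrow> (real^'n \<Rightarrow> real) set \<Rightarrow> real" where
  "lpp p \<Omega> U = enn2real (Lpp p \<Omega> (rep U))"

definition Xdist :: "real \<Rightarrow> real \<Rightarrow> (real^'n) set \<Rightarrow> (real^'n \<Rightarrow> real) set \<Rightarrow> (real^'n \<Rightarrow> real) set \<Rightarrow> real" where
  "Xdist p s \<Omega> U V = (let w = (\<lambda>x. rep U x - rep V x) in
      (enn2real (gagp p s \<Omega> w) + enn2real (Lpp p \<Omega> w)) powr (1 / p))"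

definition Xtop :: "real \<Rightarrow> real \<Rightarrow> (real^'n) set \<Rightarrow> (real^'n \<Rightarrow> real) set topology" where
  "Xtop p s \<Omega> = Metric_space.mtopology (Xsp p s \<Omega>) (Xdist p s \<Omega>)"

definition Xneg :: "(real^'n \<Rightarrow> real) set \<Rightarrow> (real^'n \<Rightarrow> real) set" where
  "Xneg U = (\<lambda>v x. - v x) ` U"

definition Xzero :: "real \<Rightarrow> real \<Rightarrow> (real^'n) set \<Rightarrow> (real^'n \<Rightarrow> real) set" where
  "Xzero p s \<Omega> = Xcls p s \<Omega> (\<lambda>x. 0)"

definition Xindex :: "real \<Rightarrow> real \<Rightarrow> (real^'n) set \<Rightarrow> (real^'n \<Rightarrow> real) set set \<Rightarrow> enat" where
  "Xindex p s \<Omega> A = FR_index (Xtop p s \<Omega>) Xneg A"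

definition Mset :: "real \<Rightarrow> real \<Rightarrow> (real^'n) set \<Rightarrow> (real^'n \<Rightarrow> real) set set" where
  "Mset p s \<Omega> = {U \<in> Xsp p s \<Omega>. lpp p \<Omega> U = 1}"

definition eigval :: "real \<Rightarrow> real \<Rightarrow> (real^'n) set \<Rightarrow> nat \<Rightarrow> real" where
  "eigval p s \<Omega> m = Inf {(SUP U\<in>K. semp p s \<Omega> U) | K.
      K \<subseteq> Mset p s \<Omega> \<and> (\<forall>U\<in>K. Xneg U \<in> K) \<and> compactin (Xtop p s \<Omega>) K \<and>
      Xindex p s \<Omega> K \<ge> enat m}"

definition Cminus :: "real \<Rightarrow> real \<Rightarrow> (real^'n) set \<Rightarrow> nat \<Rightarrow> (real^'n \<Rightarrow> real) set set" where
  "Cminus p s \<Omega> m = {U \<in> Xsp p s \<Omega>. semp p s \<Omega> U \<le> eigval p s \<Omega> m * lpp p \<Omega> U}"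

definition Cplus :: "real \<Rightarrow> real \<Rightarrow> (real^'n) set \<Rightarrow> nat \<Rightarrow> (real^'n \<Rightarrow> real) set set" where
  "Cplus p s \<Omega> m = {U \<in> Xsp p s \<Omega>. semp p s \<Omega> U \<ge> eigval p s \<Omega> (Suc m) * lpp p \<Omega> U}"

end

theory Submission
  imports Defs "HOL-Library.Function_Algebras" "HOL-Library.Diagonal_Subsequence"
begin

text \<open>Upstairs on a symmetric set \<open>A\<close>, the class \<open>\<omega>\<close> of the double cover is the coboundary of an arbitrary
  odd \<open>\<int>\<^sub>2\<close>-valued function, so the index is governed by the relation \<open>omega_power_zero\<close>: the \<open>q\<close>-th
  power of \<open>\<omega>\<close> is, near the diagonal, the coboundary of an invariant cochain. Write \<open>G = [u]\<^sup>p\<close> and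
  \<open>L = \<integral>\<^sub>\<Omega> \<bar>u\<bar>\<^sup>p\<close>. The resolvent sending \<open>u\<close> to the minimiser of \<open>v \<mapsto> G v + c L (u - v)\<close> is odd, does not
  increase the Rayleigh quotient \<open>G / L\<close>, and is compact because bounded sets of \<open>X\<close> are precompact in
  \<open>L\<^sup>p(\<Omega>)\<close>. Hence vanishing of \<open>\<omega>\<^sup>q\<close> on \<open>{G \<le> \<lambda>\<^sub>m L}\<close> extends to a neighbourhood that absorbs the
  levels slightly above \<open>\<lambda>\<^sub>m\<close>, which contradicts the definition of \<open>\<lambda>\<^sub>m\<close> for \<open>q = m - 1\<close>; this is the
  lower bound. For the upper bound, if \<open>\<omega>\<^sup>m\<close> does not vanish on the open cone \<open>{G < \<lambda>\<^sub>m\<^sub>+\<^sub>1 L}\<close>, then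
  by iterated barycentric subdivision and the compactness of products of finite sets it does not
  vanish on some compact symmetric subset, which contradicts the definition of \<open>\<lambda>\<^sub>m\<^sub>+\<^sub>1\<close>.\<close>

subsection \<open>Cochains and double covers\<close>

declare add_bit_eq_xor [simp del] mult_bit_eq_and [simp del]

lemma bit_add_self [simp]: "(a::bit) + a = 0"
  by (cases a) auto

lemma bit_add_left_cancel [simp]: "(a::bit) + (a + b) = b"
  by (cases a; cases b) auto

lemma bit_add_eq_0_iff: "(a::bit) + b = 0 \<longleftrightarrow> a = b"
  by (cases a; cases b) auto

lemma as_cobound_Nil [simp]: "as_cobound \<phi> [] = 0"
  by (simp add: as_cobound_def)

lemma as_cobound_Cons: "as_cobound \<phi> (x # ys) = \<phi> ys + as_cobound (\<lambda>t. \<phi> (x # t)) ys"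
  unfolding as_cobound_def by (simp add: sum.lessThan_Suc_shift del: sum.lessThan_Suc)

lemma as_cobound_add: "as_cobound (\<lambda>t. \<phi> t + \<psi> t) ys = as_cobound \<phi> ys + as_cobound \<psi> ys"
  unfolding as_cobound_def by (simp add: sum.distrib)

lemma as_cobound_mult: "as_cobound (\<lambda>t. c * \<phi> t) ys = c * as_cobound \<phi> ys"
  unfolding as_cobound_def by (simp add: sum_distrib_left)

lemma as_cobound_zero [simp]: "as_cobound (\<lambda>t. 0) ys = 0"
  unfolding as_cobound_def by simp

lemma as_cobound_cobound [simp]: "as_cobound (as_cobound \<phi>) ys = 0"
proof (induction ys arbitrary: \<phi>)
  case (Cons x ys)
  have "as_cobound (as_cobound \<phi>) (x # ys)
      = as_cobound \<phi> ys + as_cobound (\<lambda>t. \<phi> t + as_cobound (\<lambda>t. \<phi> (x # t)) t) ys"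
    by (simp add: as_cobound_Cons)
  also have "\<dots> = 0" using Cons by (simp add: as_cobound_add)
  finally show ?case .
qed simp

lemma as_cobound_pullback: "as_cobound (as_pullback f \<phi>) ys = as_cobound \<phi> (map f ys)"
  unfolding as_cobound_def as_pullback_def by (simp add: take_map drop_map)

lemma as_cobound_cong:
  assumes "\<And>t. length ys = Suc (length t) \<Longrightarrow> set t \<subseteq> set ys \<Longrightarrow> \<phi> t = \<psi> t"
  shows "as_cobound \<phi> ys = as_cobound \<psi> ys"
  unfolding as_cobound_def
proof (rule sum.cong)
  fix i assume i: "i \<in> {..<length ys}"
  have "set (take i ys @ drop (Suc i) ys) \<subseteq> set ys"
    by (auto dest: in_set_takeD in_set_dropD)
  then show "\<phi> (take i ys @ drop (Suc i) ys) = \<psi> (take i ys @ drop (Suc i) ys)"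
    using i by (intro assms) auto
qed simp

fun diff_prod :: "('a \<Rightarrow> bit) \<Rightarrow> 'a cochain" where
  "diff_prod s [] = 0"
| "diff_prod s [x] = 1"
| "diff_prod s (x # y # zs) = (s x + s y) * diff_prod s (y # zs)"

lemma as_cobound_diff_prod [simp]: "as_cobound (diff_prod s) ys = 0"
proof (induction ys rule: induct_list012)
  case (3 x y zs)
  have IH: "as_cobound (\<lambda>t. diff_prod s (y # t)) zs = diff_prod s zs"
    using 3(2) by (simp add: as_cobound_Cons bit_add_eq_0_iff)
  have "as_cobound (diff_prod s) (x # y # zs)
      = diff_prod s (y # zs) + (diff_prod s (x # zs) + (s x + s y) * diff_prod s zs)"
    using IH by (simp add: as_cobound_Cons as_cobound_mult)
  also have "\<dots> = 0" by (cases zs) (auto simp: algebra_simps)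
  finally show ?case .
qed (auto simp: as_cobound_Cons)

lemma diff_prod_snoc: "diff_prod s (xs @ [a, b]) = diff_prod s (xs @ [a]) * (s a + s b)"
  by (induction xs rule: induct_list012) (auto simp: algebra_simps)

lemma diff_prod_map: "diff_prod s (map f ys) = diff_prod (\<lambda>x. s (f x)) ys"
  by (induction ys rule: induct_list012) auto

lemma diff_prod_cong: "(\<And>x. x \<in> set ys \<Longrightarrow> s x = s' x) \<Longrightarrow> diff_prod s ys = diff_prod s' ys"
  by (induction ys rule: induct_list012) auto

lemma diff_prod_shift: "diff_prod (\<lambda>x. s x + c) ys = diff_prod s ys"
  by (induction ys rule: induct_list012) (auto simp: algebra_simps)

lemma as_pow_map_eq_diff_prod:
  assumes "length ys = Suc q" "\<And>a b. a \<in> set ys \<Longrightarrow> b \<in> set ys \<Longrightarrow> \<phi> [F a, F b] = s a + s b"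
  shows "as_pow \<phi> q (map F ys) = diff_prod s ys"
  using assms
proof (induction q arbitrary: ys)
  case 0
  then show ?case by (auto simp: length_Suc_conv)
next
  case (Suc j)
  from Suc.prems(1) obtain zs b where zs: "ys = zs @ [b]" "length zs = Suc j"
    by (metis length_Suc_conv_rev)
  then obtain xs a where xs: "zs = xs @ [a]" "length xs = j" by (metis length_Suc_conv_rev)
  have "as_pow \<phi> j (map F (xs @ [a])) = diff_prod s (xs @ [a])"
    using Suc.prems zs xs by (intro Suc.IH) auto
  moreover have "\<phi> [F a, F b] = s a + s b" using Suc.prems zs xs by auto
  ultimately show ?case using zs xs diff_prod_snoc[of s xs a b] by (simp add: as_cup_def)
qed

fun diff_prod_homotopy :: "('a \<Rightarrow> bit) \<Rightarrow> ('a \<Rightarrow> bit) \<Rightarrow> 'a cochain" where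
  "diff_prod_homotopy s s' [] = 0"
| "diff_prod_homotopy s s' [x] = s x + s' x"
| "diff_prod_homotopy s s' (x # y # zs) =
     (s x + s' x) * diff_prod s' (x # y # zs) + (s x + s y) * diff_prod_homotopy s s' (y # zs)"

lemma as_cobound_diff_prod_homotopy:
  "as_cobound (diff_prod_homotopy s s') ys = diff_prod s ys + diff_prod s' ys"
proof (induction ys rule: induct_list012)
  case (3 x y zs)
  have IH: "as_cobound (\<lambda>t. diff_prod_homotopy s s' (y # t)) zs
      = diff_prod s (y # zs) + diff_prod s' (y # zs) + diff_prod_homotopy s s' zs"
    using 3(2) by (simp add: as_cobound_Cons) (metis add.commute bit_add_left_cancel)
  have "as_cobound (diff_prod s') (y # zs) = 0" by simp
  then have shifted: "as_cobound (\<lambda>t. diff_prod s' (y # t)) zs = diff_prod s' zs"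
    by (simp add: as_cobound_Cons bit_add_eq_0_iff del: as_cobound_diff_prod)
  have expand: "as_cobound (diff_prod_homotopy s s') (x # y # zs)
     = diff_prod_homotopy s s' (y # zs) + (diff_prod_homotopy s s' (x # zs)
       + ((s x + s' x) * ((s' x + s' y) * diff_prod s' zs)
       + (s x + s y) * (diff_prod s (y # zs) + diff_prod s' (y # zs) + diff_prod_homotopy s s' zs)))"
    by (simp add: as_cobound_Cons as_cobound_add as_cobound_mult IH shifted)
  show ?case
  proof (cases zs)
    case Nil
    then show ?thesis unfolding expand by (simp add: algebra_simps)
  next
    case (Cons z r)
    show ?thesis unfolding expand unfolding Cons
      by (cases "s x"; cases "s y"; cases "s z"; cases "s' x"; cases "s' y"; cases "s' z")
        (simp_all add: algebra_simps)
  qed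
qed (auto simp: as_cobound_Cons)

fun diff_cup :: "('a \<Rightarrow> bit) \<Rightarrow> 'a cochain \<Rightarrow> 'a cochain" where
  "diff_cup s \<psi> [] = 0"
| "diff_cup s \<psi> [x] = 0"
| "diff_cup s \<psi> (x # y # zs) = (s x + s y) * \<psi> (y # zs)"

lemma as_cobound_diff_cup:
  assumes "\<psi> [] = 0"
  shows "as_cobound (diff_cup s \<psi>) (x # y # zs) = (s x + s y) * as_cobound \<psi> (y # zs)"
proof (cases zs)
  case Nil
  then show ?thesis using assms by (simp add: as_cobound_Cons)
next
  case (Cons z r)
  show ?thesis
    unfolding Cons by (simp add: as_cobound_Cons as_cobound_mult as_cobound_add algebra_simps)
qed

definition odd_on :: "('a \<Rightarrow> 'a) \<Rightarrow> 'a set \<Rightarrow> ('a \<Rightarrow> bit) \<Rightarrow> bool" where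
  "odd_on ng A s \<longleftrightarrow> (\<forall>x\<in>A. s (ng x) = s x + 1)"

definition invariant_on :: "('a \<Rightarrow> 'a) \<Rightarrow> 'a set \<Rightarrow> 'a cochain \<Rightarrow> bool" where
  "invariant_on ng A \<psi> \<longleftrightarrow> (\<forall>xs. set xs \<subseteq> A \<longrightarrow> \<psi> (map ng xs) = \<psi> xs)"

lemma odd_onD: "odd_on ng A s \<Longrightarrow> x \<in> A \<Longrightarrow> s (ng x) = s x + 1"
  by (simp add: odd_on_def)

lemma invariant_onI: "(\<And>xs. set xs \<subseteq> A \<Longrightarrow> \<psi> (map ng xs) = \<psi> xs) \<Longrightarrow> invariant_on ng A \<psi>"
  by (simp add: invariant_on_def)

lemma invariant_onD: "invariant_on ng A \<psi> \<Longrightarrow> set xs \<subseteq> A \<Longrightarrow> \<psi> (map ng xs) = \<psi> xs"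
  by (simp add: invariant_on_def)

lemma invariant_on_add:
  "invariant_on ng A \<phi> \<Longrightarrow> invariant_on ng A \<psi> \<Longrightarrow> invariant_on ng A (\<lambda>t. \<phi> t + \<psi> t)"
  by (simp add: invariant_on_def)

lemma invariant_on_diff_prod:
  assumes "odd_on ng A s"
  shows "invariant_on ng A (diff_prod s)"
proof (rule invariant_onI)
  fix xs assume "set xs \<subseteq> A"
  then have "diff_prod (\<lambda>x. s (ng x)) xs = diff_prod (\<lambda>x. s x + 1) xs"
    using odd_onD[OF assms] by (intro diff_prod_cong) auto
  then show "diff_prod s (map ng xs) = diff_prod s xs" by (simp add: diff_prod_map diff_prod_shift)
qed

lemma invariant_on_diff_prod_homotopy:
  assumes "odd_on ng A s" "odd_on ng A s'"
  shows "invariant_on ng A (diff_prod_homotopy s s')"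
proof (rule invariant_onI)
  fix xs assume "set xs \<subseteq> A"
  then show "diff_prod_homotopy s s' (map ng xs) = diff_prod_homotopy s s' xs"
  proof (induction xs rule: induct_list012)
    case (3 x y zs)
    then have "diff_prod s' (map ng (x # y # zs)) = diff_prod s' (x # y # zs)"
      by (intro invariant_onD[OF invariant_on_diff_prod[OF assms(2)]])
    then show ?case using 3 odd_onD[OF assms(1)] odd_onD[OF assms(2)] by (simp add: algebra_simps)
  qed (use odd_onD[OF assms(1)] odd_onD[OF assms(2)] in \<open>auto simp: algebra_simps\<close>)
qed

lemma invariant_on_diff_cup:
  assumes "odd_on ng A s" "invariant_on ng A \<psi>"
  shows "invariant_on ng A (diff_cup s \<psi>)"
proof (rule invariant_onI)
  fix xs assume xs: "set xs \<subseteq> A"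
  show "diff_cup s \<psi> (map ng xs) = diff_cup s \<psi> xs"
  proof (cases xs rule: remdups_adj.cases)
    case (3 x y zs)
    then have "\<psi> (map ng (y # zs)) = \<psi> (y # zs)" using xs by (intro invariant_onD[OF assms(2)]) auto
    then show ?thesis using odd_onD[OF assms(1)] xs by (simp add: 3 algebra_simps)
  qed auto
qed

lemma odd_on_exists:
  assumes "\<And>x. x \<in> A \<Longrightarrow> ng x \<in> A" "\<And>x. x \<in> A \<Longrightarrow> ng (ng x) = x" "\<And>x. x \<in> A \<Longrightarrow> ng x \<noteq> x"
  obtains s where "odd_on ng A s"
proof -
  define repr where "repr x = (SOME y. y \<in> {x, ng x})" for x
  define s :: "'a \<Rightarrow> bit" where "s x = (if repr x = x then 0 else 1)" for x
  have "s (ng x) = s x + 1" if "x \<in> A" for x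
  proof -
    have "{ng x, ng (ng x)} = {x, ng x}" using assms that by auto
    then have "repr (ng x) = repr x" unfolding repr_def by simp
    moreover have "repr x \<in> {x, ng x}" unfolding repr_def by (rule someI[of _ x]) simp
    ultimately show ?thesis using assms(3)[OF that] unfolding s_def by auto
  qed
  then show ?thesis using that unfolding odd_on_def by blast
qed

lemma equivariant_choice:
  assumes ng: "\<And>x. x \<in> B \<Longrightarrow> ng x \<in> B" "\<And>x. x \<in> B \<Longrightarrow> ng (ng x) = x" "\<And>x. x \<in> B \<Longrightarrow> ng x \<noteq> x"
    and exists_value: "\<And>x. x \<in> B \<Longrightarrow> \<exists>v. P x v"
    and sym: "\<And>x v. x \<in> B \<Longrightarrow> P x v \<Longrightarrow> P (ng x) (ng' v)"
    and involutive: "\<And>x v. x \<in> B \<Longrightarrow> P x v \<Longrightarrow> ng' (ng' v) = v"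
  obtains f where "\<And>x. x \<in> B \<Longrightarrow> P x (f x)" "\<And>x. x \<in> B \<Longrightarrow> f (ng x) = ng' (f x)"
proof -
  obtain s where s: "odd_on ng B s" using odd_on_exists ng by metis
  obtain f0 where f0: "\<And>x. x \<in> B \<Longrightarrow> P x (f0 x)" using exists_value by metis
  define f where "f x = (if s x = 0 then f0 x else ng' (f0 (ng x)))" for x
  show ?thesis
  proof (rule that[of f])
    fix x assume x: "x \<in> B"
    show "P x (f x)" unfolding f_def using f0 x sym[OF _ f0, of "ng x"] ng by auto
    show "f (ng x) = ng' (f x)"
      unfolding f_def using odd_onD[OF s x] involutive[OF _ f0, of "ng x"] x ng
      by (cases "s x") auto
  qed
qed

subsection \<open>Vanishing of the powers of the characteristic class\<close>

definition small_tuple :: "('a \<Rightarrow> 'a \<Rightarrow> real) \<Rightarrow> 'a set \<Rightarrow> ('a \<Rightarrow> real) \<Rightarrow> 'a list \<Rightarrow> bool" where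
  "small_tuple d A e ys \<longleftrightarrow> set ys \<subseteq> A \<and> (\<exists>x\<in>A. \<forall>y\<in>set ys. d x y < e x)"

text \<open>Cochains on the orbit space \<open>A/ng\<close> are represented by \<open>ng\<close>-invariant cochains on \<open>A\<close>. Upstairs the
  characteristic class \<open>\<omega>\<close> of the double cover is the coboundary of any odd \<open>s\<close>, and \<open>diff_prod s\<close> is
  the product of its translates. The radii \<open>e\<close> describe the open cover.\<close>

definition omega_power_primitive ::
  "('a \<Rightarrow> 'a \<Rightarrow> real) \<Rightarrow> ('a \<Rightarrow> 'a) \<Rightarrow> 'a set \<Rightarrow> nat \<Rightarrow> ('a \<Rightarrow> real) \<Rightarrow> ('a \<Rightarrow> bit) \<Rightarrow> 'a cochain \<Rightarrow> bool" where
  "omega_power_primitive d ng A q e s \<psi> \<longleftrightarrow> odd_on ng A s \<and> \<psi> [] = 0 \<and> invariant_on ng A \<psi> \<and>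
     (\<forall>ys. length ys = Suc q \<longrightarrow> small_tuple d A e ys \<longrightarrow> diff_prod s ys = as_cobound \<psi> ys)"

definition omega_power_zero :: "('a \<Rightarrow> 'a \<Rightarrow> real) \<Rightarrow> ('a \<Rightarrow> 'a) \<Rightarrow> 'a set \<Rightarrow> nat \<Rightarrow> bool" where
  "omega_power_zero d ng A q \<longleftrightarrow> (\<exists>e s \<psi>. (\<forall>x\<in>A. 0 < e x) \<and> omega_power_primitive d ng A q e s \<psi>)"

lemma omega_power_zeroI:
  "(\<And>x. x \<in> A \<Longrightarrow> 0 < e x) \<Longrightarrow> omega_power_primitive d ng A q e s \<psi> \<Longrightarrow> omega_power_zero d ng A q"
  unfolding omega_power_zero_def by blast

lemma omega_power_zeroE:
  assumes "omega_power_zero d ng A q"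
  obtains e s \<psi> where "\<And>x. x \<in> A \<Longrightarrow> 0 < e x" "omega_power_primitive d ng A q e s \<psi>"
  using assms unfolding omega_power_zero_def by blast

lemma omega_power_primitiveD:
  assumes "omega_power_primitive d ng A q e s \<psi>"
  shows "odd_on ng A s" "\<psi> [] = 0" "invariant_on ng A \<psi>"
    "length ys = Suc q \<Longrightarrow> small_tuple d A e ys \<Longrightarrow> diff_prod s ys = as_cobound \<psi> ys"
  using assms unfolding omega_power_primitive_def by blast+

lemma omega_power_primitive_refine:
  assumes "omega_power_primitive d ng A q e s \<psi>"
    and "\<And>ys. small_tuple d A e' ys \<Longrightarrow> small_tuple d A e ys"
  shows "omega_power_primitive d ng A q e' s \<psi>"
  using assms unfolding omega_power_primitive_def by blast

lemma omega_power_primitive_change_section: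
  assumes "omega_power_primitive d ng A q e s \<psi>" "odd_on ng A s'"
  shows "omega_power_primitive d ng A q e s' (\<lambda>t. \<psi> t + diff_prod_homotopy s s' t)"
  using assms invariant_on_diff_prod_homotopy[of ng A s s']
  by (simp add: omega_power_primitive_def invariant_on_add as_cobound_add
      as_cobound_diff_prod_homotopy add.assoc[symmetric])

lemma omega_power_primitive_Suc:
  assumes "omega_power_primitive d ng A q e s \<psi>"
  shows "omega_power_primitive d ng A (Suc q) e s (diff_cup s \<psi>)"
  unfolding omega_power_primitive_def
proof (intro conjI allI impI)
  note prim = omega_power_primitiveD[OF assms]
  show "odd_on ng A s" "invariant_on ng A (diff_cup s \<psi>)"
    using prim(1,3) by (auto intro: invariant_on_diff_cup)
  fix ys assume ys: "length ys = Suc (Suc q)" "small_tuple d A e ys"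
  then obtain a b zs where abzs: "ys = a # b # zs" by (metis length_Suc_conv)
  then have "diff_prod s (b # zs) = as_cobound \<psi> (b # zs)"
    using ys by (intro prim(4)) (auto simp: small_tuple_def)
  then show "diff_prod s ys = as_cobound (diff_cup s \<psi>) ys"
    unfolding abzs by (simp add: as_cobound_diff_cup[of \<psi>, OF prim(2)])
qed simp

lemma omega_power_zero_le: "q \<le> r \<Longrightarrow> omega_power_zero d ng A q \<Longrightarrow> omega_power_zero d ng A r"
  by (induction r rule: dec_induct)
    (auto elim!: omega_power_zeroE intro: omega_power_zeroI omega_power_primitive_Suc)

lemma omega_power_zero_empty: "omega_power_zero d ng {} q"
  unfolding omega_power_zero_def omega_power_primitive_def odd_on_def invariant_on_def
    small_tuple_def
  by (intro exI[of _ "\<lambda>_. 0"]) auto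

lemma not_omega_power_zero_0:
  assumes "x \<in> A" "d x x = 0"
  shows "\<not> omega_power_zero d ng A 0"
proof
  assume "omega_power_zero d ng A 0"
  then obtain e s \<psi> where "0 < e x" and prim: "omega_power_primitive d ng A 0 e s \<psi>"
    using assms(1) by (metis omega_power_zeroE)
  then have "diff_prod s [x] = as_cobound \<psi> [x]"
    using assms by (intro omega_power_primitiveD(4)[OF prim])
      (auto simp: small_tuple_def intro!: bexI[of _ x])
  then show False using omega_power_primitiveD(2)[OF prim] by (simp add: as_cobound_Cons)
qed

lemma omega_power_primitive_pullback:
  assumes prim: "omega_power_primitive dA ngA A q e s \<psi>"
    and f: "\<And>y. y \<in> B \<Longrightarrow> f y \<in> A" "\<And>y. y \<in> B \<Longrightarrow> f (ngB y) = ngA (f y)"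
    and small: "\<And>ys. small_tuple dB B \<delta> ys \<Longrightarrow> small_tuple dA A e (map f ys)"
  shows "omega_power_primitive dB ngB B q \<delta> (\<lambda>y. s (f y)) (as_pullback f \<psi>)"
  unfolding omega_power_primitive_def
proof (intro conjI allI impI)
  show "odd_on ngB B (\<lambda>y. s (f y))"
    using omega_power_primitiveD(1)[OF prim] f by (simp add: odd_on_def)
  show "invariant_on ngB B (as_pullback f \<psi>)"
  proof (rule invariant_onI)
    fix xs assume xs: "set xs \<subseteq> B"
    then have "map f (map ngB xs) = map ngA (map f xs)" using f(2) by auto
    moreover have "\<psi> (map ngA (map f xs)) = \<psi> (map f xs)"
      using xs f(1) by (intro invariant_onD[OF omega_power_primitiveD(3)[OF prim]]) auto
    ultimately show "as_pullback f \<psi> (map ngB xs) = as_pullback f \<psi> xs"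
      by (simp only: as_pullback_def)
  qed
  fix ys assume "length ys = Suc q" "small_tuple dB B \<delta> ys"
  then have "diff_prod s (map f ys) = as_cobound \<psi> (map f ys)"
    using small by (intro omega_power_primitiveD(4)[OF prim]) auto
  then show "diff_prod (\<lambda>y. s (f y)) ys = as_cobound (as_pullback f \<psi>) ys"
    by (simp add: as_cobound_pullback diff_prod_map)
qed (simp add: as_pullback_def omega_power_primitiveD(2)[OF prim])

lemma omega_power_zero_pullback:
  assumes zero: "omega_power_zero dA ngA A q"
    and f: "\<And>y. y \<in> B \<Longrightarrow> f y \<in> A" "\<And>y. y \<in> B \<Longrightarrow> f (ngB y) = ngA (f y)"
    and cont: "\<And>y e. y \<in> B \<Longrightarrow> e > 0 \<Longrightarrow> \<exists>\<delta>>0. \<forall>z\<in>B. dB y z < \<delta> \<longrightarrow> dA (f y) (f z) < e"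
  shows "omega_power_zero dB ngB B q"
proof -
  obtain e s \<psi> where e: "\<And>x. x \<in> A \<Longrightarrow> 0 < e x" and prim: "omega_power_primitive dA ngA A q e s \<psi>"
    using zero by (elim omega_power_zeroE) blast
  have "\<forall>y\<in>B. \<exists>\<delta>>0. \<forall>z\<in>B. dB y z < \<delta> \<longrightarrow> dA (f y) (f z) < e (f y)" using cont e f(1) by blast
  then obtain \<delta> where \<delta>: "\<And>y. y \<in> B \<Longrightarrow> 0 < \<delta> y"
    "\<And>y z. y \<in> B \<Longrightarrow> z \<in> B \<Longrightarrow> dB y z < \<delta> y \<Longrightarrow> dA (f y) (f z) < e (f y)"
    by metis
  have "small_tuple dA A e (map f ys)" if "small_tuple dB B \<delta> ys" for ys
  proof -
    from that obtain y where y: "y \<in> B" "set ys \<subseteq> B" "\<forall>z\<in>set ys. dB y z < \<delta> y"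
      unfolding small_tuple_def by blast
    then have "\<forall>z\<in>set (map f ys). dA (f y) z < e (f y)" using \<delta>(2) by auto
    then show ?thesis unfolding small_tuple_def using y f(1) by auto
  qed
  from omega_power_primitive_pullback[OF prim f this] show ?thesis
    by (intro omega_power_zeroI[OF \<delta>(1)])
qed

lemma omega_power_zero_subset:
  assumes "omega_power_zero d ng A q" "B \<subseteq> A"
  shows "omega_power_zero d ng B q"
  by (rule omega_power_zero_pullback[OF assms(1), where f = "\<lambda>x. x"]) (use assms(2) in auto)

locale isometric_involution =
  fixes M :: "'a set" and d :: "'a \<Rightarrow> 'a \<Rightarrow> real" and ng :: "'a \<Rightarrow> 'a"
  assumes d_refl: "x \<in> M \<Longrightarrow> d x x = 0"
    and d_commute: "x \<in> M \<Longrightarrow> y \<in> M \<Longrightarrow> d x y = d y x"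
    and d_triangle: "x \<in> M \<Longrightarrow> y \<in> M \<Longrightarrow> z \<in> M \<Longrightarrow> d x z \<le> d x y + d y z"
    and ng_closed: "x \<in> M \<Longrightarrow> ng x \<in> M"
    and ng_ng: "x \<in> M \<Longrightarrow> ng (ng x) = x"
    and d_ng: "x \<in> M \<Longrightarrow> y \<in> M \<Longrightarrow> d (ng x) (ng y) = d x y"
begin

lemma d_nonneg: "x \<in> M \<Longrightarrow> y \<in> M \<Longrightarrow> 0 \<le> d x y"
  using d_triangle[of x y x] d_refl[of x] d_commute[of x y] by simp

lemma d_ng_right: "x \<in> M \<Longrightarrow> y \<in> M \<Longrightarrow> d x (ng y) = d (ng x) y"
  using d_ng[of x "ng y"] ng_closed ng_ng by simp

text \<open>The Lebesgue number of the cover by the balls \<open>B(c, e c)\<close>, as a function of the centre.\<close>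

lemma lipschitz_refinement:
  assumes C: "C \<subseteq> M" and e: "\<And>x. x \<in> C \<Longrightarrow> 0 < e x"
  obtains \<rho> where "\<And>x. x \<in> C \<Longrightarrow> 0 < \<rho> x" "\<And>x y. x \<in> C \<Longrightarrow> y \<in> C \<Longrightarrow> \<rho> x \<le> \<rho> y + d x y"
    "\<And>ys. small_tuple d C \<rho> ys \<Longrightarrow> small_tuple d C e ys"
proof -
  define R where "R x = {r. 0 < r \<and> r \<le> 1 \<and> (\<exists>c\<in>C. \<forall>y\<in>C. d x y < r \<longrightarrow> d c y < e c)}" for x
  have bdd: "bdd_above (R x)" for x unfolding R_def by (rule bdd_aboveI[of _ 1]) auto
  have radius_mem: "min 1 (e x) \<in> R x" if "x \<in> C" for x
    unfolding R_def using that e by (auto intro!: bexI[of _ x])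
  have Sup_pos: "0 < Sup (R x)" if "x \<in> C" for x
    using cSup_upper[OF radius_mem[OF that] bdd] e[OF that] by linarith
  have lip: "Sup (R x) \<le> Sup (R y) + d x y" if "x \<in> C" "y \<in> C" for x y
  proof (rule cSup_least)
    show "R x \<noteq> {}" using radius_mem that(1) by blast
    fix r assume r: "r \<in> R x"
    have xy: "x \<in> M" "y \<in> M" using that C by auto
    show "r \<le> Sup (R y) + d x y"
    proof (cases "r \<le> d x y")
      case False
      from r obtain c where c: "c \<in> C" "\<forall>z\<in>C. d x z < r \<longrightarrow> d c z < e c" unfolding R_def by blast
      have "d c z < e c" if "z \<in> C" "d y z < r - d x y" for z
        using d_triangle[OF xy, of z] c(2) that C by force
      then have "r - d x y \<in> R y"
        using r c(1) False d_nonneg[OF xy] unfolding R_def by auto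
      from cSup_upper[OF this bdd] show ?thesis by simp
    qed (use Sup_pos[OF that(2)] in linarith)
  qed
  show ?thesis
  proof (rule that[of "\<lambda>x. Sup (R x) / 2"])
    fix ys assume "small_tuple d C (\<lambda>x. Sup (R x) / 2) ys"
    then obtain x where x: "x \<in> C" "set ys \<subseteq> C" "\<forall>y\<in>set ys. d x y < Sup (R x) / 2"
      unfolding small_tuple_def by blast
    have "Sup (R x) / 2 < Sup (R x)" using Sup_pos[OF x(1)] by simp
    then obtain r where r: "r \<in> R x" "Sup (R x) / 2 < r"
      using less_cSupE[of "Sup (R x) / 2" "R x"] radius_mem[OF x(1)] by blast
    then obtain c where "c \<in> C" "\<forall>y\<in>C. d x y < r \<longrightarrow> d c y < e c" unfolding R_def by blast
    moreover have "d x y < r" if "y \<in> set ys" for y using bspec[OF x(3) that] r(2) by linarith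
    ultimately show "small_tuple d C e ys" unfolding small_tuple_def using x(2) by blast
  next
    fix x y assume xy: "x \<in> C" "y \<in> C"
    then have "0 \<le> d x y" using C d_nonneg by blast
    then show "Sup (R x) / 2 \<le> Sup (R y) / 2 + d x y" using lip[OF xy] by simp
  qed (use Sup_pos in auto)
qed

lemma free_near:
  assumes M: "x \<in> M" "y \<in> M" and d: "d x y < d x (ng x) / 2"
  shows "ng y \<noteq> y"
proof
  assume fixed: "ng y = y"
  have "d x (ng x) \<le> d x y + d y (ng x)" using M ng_closed d_triangle by blast
  also have "d y (ng x) = d x y" using d_ng_right[of y x] d_commute M fixed by simp
  finally show False using d by linarith
qed

lemma equivariant_refinement:
  assumes C: "C \<subseteq> M" "\<And>x. x \<in> C \<Longrightarrow> ng x \<in> C" "\<And>x. x \<in> C \<Longrightarrow> 0 < d x (ng x)"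
    and e: "\<And>x. x \<in> C \<Longrightarrow> 0 < e x"
  obtains \<rho> where "\<And>x. x \<in> C \<Longrightarrow> 0 < \<rho> x" "\<And>x. x \<in> C \<Longrightarrow> \<rho> (ng x) = \<rho> x"
    "\<And>x. \<rho> x \<le> d x (ng x)" "\<And>x y. x \<in> C \<Longrightarrow> y \<in> C \<Longrightarrow> \<rho> x \<le> \<rho> y + 2 * d x y"
    "\<And>ys. small_tuple d C \<rho> ys \<Longrightarrow> small_tuple d C e ys"
proof -
  obtain \<sigma> where \<sigma>: "\<And>x. x \<in> C \<Longrightarrow> 0 < \<sigma> x" "\<And>x y. x \<in> C \<Longrightarrow> y \<in> C \<Longrightarrow> \<sigma> x \<le> \<sigma> y + d x y"
    "\<And>ys. small_tuple d C \<sigma> ys \<Longrightarrow> small_tuple d C e ys"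
    using lipschitz_refinement[where e = e, OF C(1) e] by blast
  define \<rho> where "\<rho> x = min (min (\<sigma> x) (\<sigma> (ng x))) (d x (ng x))" for x
  have \<rho>_ng: "\<rho> (ng x) = \<rho> x" if "x \<in> C" for x
  proof -
    have M: "x \<in> M" "ng x \<in> M" using that C by auto
    show ?thesis unfolding \<rho>_def ng_ng[OF M(1)] d_commute[OF M(2,1)] by (simp add: min.commute)
  qed
  have \<rho>_lipschitz: "\<rho> x \<le> \<rho> y + 2 * d x y" if xy: "x \<in> C" "y \<in> C" for x y
  proof -
    have M: "x \<in> M" "y \<in> M" "ng x \<in> M" "ng y \<in> M" using xy C by auto
    have "d x (ng x) \<le> d x y + (d y (ng y) + d (ng y) (ng x))"
      using d_triangle[OF M(1,2,3)] d_triangle[OF M(2,4,3)] by linarith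
    moreover have "d (ng y) (ng x) = d x y" using d_ng d_commute M by simp
    ultimately show ?thesis
      using \<sigma>(2)[OF xy] \<sigma>(2)[of "ng x" "ng y"] C(2) d_ng[OF M(1,2)] d_nonneg[OF M(1,2)] xy
      unfolding \<rho>_def by auto
  qed
  have "small_tuple d C e ys" if "small_tuple d C \<rho> ys" for ys
    using that by (intro \<sigma>(3)) (fastforce simp: small_tuple_def \<rho>_def)
  then show ?thesis
    using \<sigma>(1) C by (intro that[of \<rho>] \<rho>_ng \<rho>_lipschitz) (auto simp: \<rho>_def)
qed

lemma equivariant_near_choice:
  assumes C: "C \<subseteq> M" "\<And>x. x \<in> C \<Longrightarrow> ng x \<in> C"
    and e: "\<And>x. x \<in> C \<Longrightarrow> 0 < e x" "\<And>x. x \<in> C \<Longrightarrow> e (ng x) = e x" "\<And>x. e x \<le> d x (ng x)"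
  obtains f where "\<And>y. y \<in> M \<Longrightarrow> \<exists>x\<in>C. d x y < e x / 8 \<Longrightarrow> f y \<in> C \<and> d (f y) y < e (f y) / 8"
    "\<And>y. y \<in> M \<Longrightarrow> \<exists>x\<in>C. d x y < e x / 8 \<Longrightarrow> f (ng y) = ng (f y)"
proof -
  define N where "N = {y\<in>M. \<exists>x\<in>C. d x y < e x / 8}"
  have N_ng: "ng y \<in> N" if "y \<in> N" for y
  proof -
    from that obtain x where x: "x \<in> C" "d x y < e x / 8" "y \<in> M" unfolding N_def by auto
    then have "d (ng x) (ng y) < e (ng x) / 8" using d_ng e(2) C by auto
    then show ?thesis unfolding N_def using x C ng_closed by auto
  qed
  have N_free: "ng y \<noteq> y" if "y \<in> N" for y
  proof -
    from that obtain x where x: "x \<in> C" "y \<in> M" "d x y < e x / 8" unfolding N_def by auto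
    then have "d x y < d x (ng x) / 2" using e(1)[OF x(1)] e(3)[of x] by linarith
    then show ?thesis using free_near x C by blast
  qed
  obtain f where "\<And>y. y \<in> N \<Longrightarrow> f y \<in> C \<and> d (f y) y < e (f y) / 8"
    and "\<And>y. y \<in> N \<Longrightarrow> f (ng y) = ng (f y)"
  proof (rule equivariant_choice[of N ng "\<lambda>y x. x \<in> C \<and> d x y < e x / 8" ng])
    show "ng v \<in> C \<and> d (ng v) (ng x) < e (ng v) / 8" if "x \<in> N" "v \<in> C \<and> d v x < e v / 8" for x v
      using that d_ng e(2) C unfolding N_def by auto
  qed (use N_ng N_free ng_ng C in \<open>auto simp: N_def\<close>)
  then show ?thesis by (intro that[of f]) (auto simp: N_def)
qed

lemma omega_power_zero_neighbourhood:
  assumes C: "C \<subseteq> M" "\<And>x. x \<in> C \<Longrightarrow> ng x \<in> C" "\<And>x. x \<in> C \<Longrightarrow> 0 < d x (ng x)"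
    and zero: "omega_power_zero d ng C q"
  obtains r where "\<And>x. x \<in> C \<Longrightarrow> 0 < r x" "omega_power_zero d ng {y\<in>M. \<exists>x\<in>C. d x y < r x} q"
proof -
  obtain e0 s \<psi> where e0: "\<And>x. x \<in> C \<Longrightarrow> 0 < e0 x" and prim: "omega_power_primitive d ng C q e0 s \<psi>"
    using zero by (elim omega_power_zeroE) blast
  obtain e where e: "\<And>x. x \<in> C \<Longrightarrow> 0 < e x" "\<And>x. x \<in> C \<Longrightarrow> e (ng x) = e x"
    "\<And>x. e x \<le> d x (ng x)" "\<And>x y. x \<in> C \<Longrightarrow> y \<in> C \<Longrightarrow> e x \<le> e y + 2 * d x y"
    "\<And>ys. small_tuple d C e ys \<Longrightarrow> small_tuple d C e0 ys"
    using equivariant_refinement[where e = e0, OF C e0] by (metis (full_types))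
  define N where "N = {y\<in>M. \<exists>x\<in>C. d x y < e x / 8}"
  obtain f where f: "\<And>y. y \<in> N \<Longrightarrow> f y \<in> C \<and> d (f y) y < e (f y) / 8"
    and f_ng: "\<And>y. y \<in> N \<Longrightarrow> f (ng y) = ng (f y)"
    by (rule equivariant_near_choice[where e = e, OF C(1,2) e(1-3)])
      (assumption+, rule that, unfold N_def, blast+)
  have f_close: "d (f y) (f z) < e (f y)"
    if y: "y \<in> N" and z: "z \<in> N" and yz: "d y z < e (f y) / 8" for y z
  proof -
    have M: "y \<in> M" "z \<in> M" "f y \<in> M" "f z \<in> M" using y z f C unfolding N_def by auto
    have "d (f y) (f z) \<le> d (f y) y + (d y z + d z (f z))"
      using d_triangle[OF M(3,1,4)] d_triangle[OF M(1,2,4)] by linarith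
    moreover have "d z (f z) < e (f z) / 8" using f[OF z] d_commute[OF M(2,4)] by simp
    moreover have "e (f z) \<le> e (f y) + 2 * d (f y) (f z)"
      using e(4)[of "f z" "f y"] f y z d_commute[OF M(3,4)] by simp
    ultimately show ?thesis using f[OF y] yz e(1)[of "f y"] by linarith
  qed
  have "small_tuple d C e (map f ys)" if "small_tuple d N (\<lambda>y. e (f y) / 8) ys" for ys
    using that f f_close unfolding small_tuple_def by (fastforce simp: subset_iff)
  from omega_power_primitive_pullback[OF omega_power_primitive_refine[OF prim e(5)]
      conjunct1[OF f] f_ng this]
  have "omega_power_zero d ng N q" by (rule omega_power_zeroI[rotated]) (use f e(1) in auto)
  then show ?thesis using that[of "\<lambda>x. e x / 8"] e(1) unfolding N_def by auto
qed

lemma near_pairwise: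
  assumes M: "x \<in> M" "a \<in> M" "b \<in> M" and "d x a < d x (ng x) / 4" "d x b < d x (ng x) / 4"
  shows "d a b < d a (ng b)"
proof -
  have ng: "ng x \<in> M" "ng b \<in> M" using M ng_closed by auto
  have "d a b \<le> d x a + d x b" using d_triangle[OF M(2,1,3)] d_commute[OF M(2,1)] by simp
  moreover have "d x (ng x) \<le> d x a + (d a (ng b) + d (ng b) (ng x))"
    using d_triangle[OF M(1,2) ng(1)] d_triangle[OF M(2) ng(2,1)] by linarith
  moreover have "d (ng b) (ng x) = d x b" using d_ng d_commute M by simp
  ultimately show ?thesis using assms(4,5) by linarith
qed

end

subsection \<open>Seminormed spaces and local cocycles\<close>

instantiation "fun" :: (type, real_vector) real_vector
begin

definition scaleR_fun :: "real \<Rightarrow> ('a \<Rightarrow> 'b) \<Rightarrow> 'a \<Rightarrow> 'b" where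
  "scaleR_fun c f = (\<lambda>x. c *\<^sub>R f x)"

instance
  by standard (auto simp: scaleR_fun_def fun_eq_iff algebra_simps)

end

lemma scaleR_fun_apply [simp]: "(c *\<^sub>R f) x = c *\<^sub>R f x"
  by (simp add: scaleR_fun_def)

lemma uminus_eq_self_iff: "- x = x \<longleftrightarrow> x = (0::'a::real_vector)"
proof
  assume "- x = x"
  then have "2 *\<^sub>R x = 0" by (metis add.right_inverse scaleR_2)
  then show "x = 0" by simp
qed simp

locale seminormed =
  fixes E :: "'a::real_vector set" and N :: "'a \<Rightarrow> real"
  assumes subspace_E: "subspace E"
    and N_triangle: "x \<in> E \<Longrightarrow> y \<in> E \<Longrightarrow> N (x + y) \<le> N x + N y"
    and N_hom: "x \<in> E \<Longrightarrow> N (c *\<^sub>R x) = \<bar>c\<bar> * N x"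
begin

lemma E_simps [simp, intro]:
  "0 \<in> E" "x \<in> E \<Longrightarrow> y \<in> E \<Longrightarrow> x + y \<in> E" "x \<in> E \<Longrightarrow> y \<in> E \<Longrightarrow> x - y \<in> E"
  "x \<in> E \<Longrightarrow> c *\<^sub>R x \<in> E" "x \<in> E \<Longrightarrow> - x \<in> E"
  using subspace_E
  by (auto intro: subspace_0 subspace_add subspace_diff subspace_scale subspace_neg)

lemma N_0 [simp]: "N 0 = 0"
  using N_hom[of 0 0] by simp

lemma N_minus [simp]: "x \<in> E \<Longrightarrow> N (- x) = N x"
  using N_hom[of x "-1"] by simp

lemma N_nonneg: "x \<in> E \<Longrightarrow> 0 \<le> N x"
  using N_triangle[of x "- x"] by auto

lemma N_diff_commute: "x \<in> E \<Longrightarrow> y \<in> E \<Longrightarrow> N (x - y) = N (y - x)"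
  using N_minus[of "x - y"] by auto

lemma N_triangle_diff: "x \<in> E \<Longrightarrow> y \<in> E \<Longrightarrow> z \<in> E \<Longrightarrow> N (x - z) \<le> N (x - y) + N (y - z)"
  using N_triangle[of "x - y" "y - z"] by auto

lemma N_le_add_diff: "x \<in> E \<Longrightarrow> y \<in> E \<Longrightarrow> N x \<le> N y + N (x - y)"
  using N_triangle[of y "x - y"] by auto

lemma abs_N_diff_le: "x \<in> E \<Longrightarrow> y \<in> E \<Longrightarrow> \<bar>N x - N y\<bar> \<le> N (x - y)"
  using N_le_add_diff[of x y] N_le_add_diff[of y x] N_diff_commute[of x y] by auto

lemma N_diff_uminus: "x \<in> E \<Longrightarrow> N (x - - x) = 2 * N x"
  using N_hom[of x 2] by (simp add: scaleR_2)

sublocale dist: isometric_involution E "\<lambda>x y. N (x - y)" uminus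
proof
  show "N (- x - - y) = N (x - y)" if "x \<in> E" "y \<in> E" for x y
    using N_minus[of "x - y"] that by simp
qed (auto intro: N_diff_commute N_triangle_diff)

definition normalize :: "'a \<Rightarrow> 'a" where
  "normalize x = (1 / N x) *\<^sub>R x"

lemma normalize_in [simp, intro]: "x \<in> E \<Longrightarrow> normalize x \<in> E"
  by (auto simp: normalize_def)

lemma N_normalize: "x \<in> E \<Longrightarrow> N x > 0 \<Longrightarrow> N (normalize x) = 1"
  by (simp add: normalize_def N_hom)

lemma normalize_eq_self: "N x = 1 \<Longrightarrow> normalize x = x"
  by (simp add: normalize_def)

lemma normalize_minus: "x \<in> E \<Longrightarrow> normalize (- x) = - normalize x"
  by (simp add: normalize_def)

lemma normalize_dist:
  assumes "x \<in> E" "z \<in> E" "N x > 0" "N z > 0"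
  shows "N (normalize x - normalize z) \<le> 2 * N (x - z) / N z"
proof -
  have "normalize x - normalize z = (1 / N z) *\<^sub>R (x - z) + (1 / N x - 1 / N z) *\<^sub>R x"
    unfolding normalize_def by (simp add: scaleR_diff_right scaleR_diff_left)
  then have "N (normalize x - normalize z)
      \<le> N ((1 / N z) *\<^sub>R (x - z)) + N ((1 / N x - 1 / N z) *\<^sub>R x)"
    using assms N_triangle[of "(1 / N z) *\<^sub>R (x - z)" "(1 / N x - 1 / N z) *\<^sub>R x"] by simp
  also have "\<dots> = N (x - z) / N z + \<bar>(1 / N x - 1 / N z) * N x\<bar>"
    using assms by (simp add: N_hom abs_mult)
  also have "(1 / N x - 1 / N z) * N x = (N z - N x) / N z"
    using assms by (simp add: left_diff_distrib diff_divide_distrib)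
  also have "\<bar>(N z - N x) / N z\<bar> \<le> N (x - z) / N z"
    using abs_N_diff_le[OF assms(1,2)] assms by (auto intro!: divide_right_mono)
  finally show ?thesis by simp
qed

lemma normalize_dist_less:
  assumes "x \<in> E" "z \<in> E" "N x > 0" "N z > 0" "N (x - z) < e * N z / 2"
  shows "N (normalize x - normalize z) < e"
proof -
  have "2 * N (x - z) / N z < e" using assms(4,5) by (simp add: field_simps)
  then show ?thesis using normalize_dist[OF assms(1-4)] by linarith
qed

definition locally_constant_on :: "'a set \<Rightarrow> ('a \<Rightarrow> 'b) \<Rightarrow> bool" where
  "locally_constant_on D f \<longleftrightarrow> (\<forall>z\<in>D. \<exists>e>0. \<forall>x\<in>D. N (x - z) < e \<longrightarrow> f x = f z)"

definition local_cocycle_on :: "'a set \<Rightarrow> ('a \<Rightarrow> 'a \<Rightarrow> bit) \<Rightarrow> bool" where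
  "local_cocycle_on D \<phi> \<longleftrightarrow> (\<forall>z\<in>D. \<exists>e>0. \<forall>x\<in>D. \<forall>y\<in>D. \<forall>w\<in>D.
     N (x - z) < e \<longrightarrow> N (y - z) < e \<longrightarrow> N (w - z) < e \<longrightarrow> \<phi> x y + \<phi> y w + \<phi> x w = 0)"

definition local_primitive_on :: "'a set \<Rightarrow> ('a \<Rightarrow> 'a \<Rightarrow> bit) \<Rightarrow> ('a \<Rightarrow> bit) \<Rightarrow> bool" where
  "local_primitive_on D \<phi> h \<longleftrightarrow> (\<forall>z\<in>D. \<exists>e>0. \<forall>x\<in>D. N (x - z) < e \<longrightarrow> \<phi> z x = h z + h x)"

definition relatively_open_in :: "'a set \<Rightarrow> 'a set \<Rightarrow> bool" where
  "relatively_open_in D U \<longleftrightarrow> (\<forall>z\<in>U. \<exists>e>0. \<forall>x\<in>D. N (x - z) < e \<longrightarrow> x \<in> U)"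

lemma relatively_open_in_Int:
  assumes "relatively_open_in D U" "relatively_open_in D V"
  shows "relatively_open_in D (U \<inter> V)"
  unfolding relatively_open_in_def
proof
  fix z assume "z \<in> U \<inter> V"
  then obtain e e' where "e > 0" "\<forall>x\<in>D. N (x - z) < e \<longrightarrow> x \<in> U" "e' > 0"
    "\<forall>x\<in>D. N (x - z) < e' \<longrightarrow> x \<in> V"
    using assms unfolding relatively_open_in_def by blast
  then show "\<exists>e>0. \<forall>x\<in>D. N (x - z) < e \<longrightarrow> x \<in> U \<inter> V" by (intro exI[of _ "min e e'"]) auto
qed

lemma relatively_open_in_Union:
  "(\<And>U. U \<in> \<U> \<Longrightarrow> relatively_open_in D U) \<Longrightarrow> relatively_open_in D (\<Union>\<U>)"
  unfolding relatively_open_in_def by (meson Union_iff)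

lemma local_primitive_on_cong:
  "local_primitive_on D \<phi> h \<Longrightarrow> (\<And>x. x \<in> D \<Longrightarrow> h x = h' x) \<Longrightarrow> local_primitive_on D \<phi> h'"
  unfolding local_primitive_on_def by metis

lemma local_cocycle_on_subset: "local_cocycle_on D \<phi> \<Longrightarrow> D' \<subseteq> D \<Longrightarrow> local_cocycle_on D' \<phi>"
  unfolding local_cocycle_on_def by (meson subsetD)

lemma N_segment:
  assumes "b \<in> E" "x \<in> E"
  shows "N (((1 - t) *\<^sub>R b + t *\<^sub>R x) - ((1 - t') *\<^sub>R b + t' *\<^sub>R x)) = \<bar>t - t'\<bar> * N (x - b)"
proof -
  have "((1 - t) *\<^sub>R b + t *\<^sub>R x) - ((1 - t') *\<^sub>R b + t' *\<^sub>R x) = (t - t') *\<^sub>R (x - b)"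
    by (simp add: algebra_simps)
  then show ?thesis using assms by (simp add: N_hom)
qed

lemma locally_constant_on_segment:
  assumes "locally_constant_on D f" and seg: "closed_segment a b \<subseteq> D" and D_subset: "D \<subseteq> E"
  shows "f a = f b"
proof -
  define \<gamma> where "\<gamma> t = (1 - t) *\<^sub>R a + t *\<^sub>R b" for t
  have \<gamma>: "\<gamma> t \<in> D" if "t \<in> {0..1}" for t
    using that seg unfolding \<gamma>_def by (auto simp: in_segment subset_iff)
  have ab: "a \<in> E" "b \<in> E" using seg D_subset by auto
  have nonneg: "0 \<le> N (b - a)" using ab by (intro N_nonneg) auto
  have "f (\<gamma> 0) = f (\<gamma> 1)"
  proof (rule connected_local_const[of "{0..1::real}" 0 1 "\<lambda>t. f (\<gamma> t)"])
    show "\<forall>t\<in>{0..1}. eventually (\<lambda>t'. f (\<gamma> t) = f (\<gamma> t')) (at t within {0..1})"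
    proof
      fix t :: real assume t: "t \<in> {0..1}"
      obtain e where e: "e > 0" "\<forall>x\<in>D. N (x - \<gamma> t) < e \<longrightarrow> f x = f (\<gamma> t)"
        using assms(1) \<gamma>[OF t] unfolding locally_constant_on_def by blast
      have "f (\<gamma> t) = f (\<gamma> t')" if "t' \<in> {0..1}" "dist t' t < e / (N (b - a) + 1)" for t'
      proof -
        have "\<bar>t' - t\<bar> * (N (b - a) + 1) < e"
          using that(2) nonneg by (simp add: dist_real_def field_simps)
        then have "\<bar>t' - t\<bar> * N (b - a) < e" by (simp add: algebra_simps)
        then have "N (\<gamma> t' - \<gamma> t) < e" unfolding \<gamma>_def N_segment[OF ab] .
        then show ?thesis using e(2) \<gamma>[OF that(1)] by simp
      qed
      then show "eventually (\<lambda>t'. f (\<gamma> t) = f (\<gamma> t')) (at t within {0..1})"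
        using e(1) nonneg unfolding eventually_at by (intro exI[of _ "e / (N (b - a) + 1)"]) auto
    qed
  qed auto
  then show ?thesis by (simp add: \<gamma>_def)
qed

lemma local_primitives_sum_locally_constant:
  assumes "local_primitive_on D\<^sub>1 \<phi> h\<^sub>1" "local_primitive_on D\<^sub>2 \<phi> h\<^sub>2"
  shows "locally_constant_on (D\<^sub>1 \<inter> D\<^sub>2) (\<lambda>x. h\<^sub>1 x + h\<^sub>2 x)"
  unfolding locally_constant_on_def
proof
  fix z assume z: "z \<in> D\<^sub>1 \<inter> D\<^sub>2"
  obtain e\<^sub>1 where e1: "e\<^sub>1 > 0" "\<forall>x\<in>D\<^sub>1. N (x - z) < e\<^sub>1 \<longrightarrow> \<phi> z x = h\<^sub>1 z + h\<^sub>1 x"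
    using assms(1) z unfolding local_primitive_on_def by blast
  obtain e\<^sub>2 where e2: "e\<^sub>2 > 0" "\<forall>x\<in>D\<^sub>2. N (x - z) < e\<^sub>2 \<longrightarrow> \<phi> z x = h\<^sub>2 z + h\<^sub>2 x"
    using assms(2) z unfolding local_primitive_on_def by blast
  have "h\<^sub>1 x + h\<^sub>2 x = h\<^sub>1 z + h\<^sub>2 z" if "x \<in> D\<^sub>1 \<inter> D\<^sub>2" "N (x - z) < min e\<^sub>1 e\<^sub>2" for x
  proof -
    have "h\<^sub>1 z + h\<^sub>1 x = h\<^sub>2 z + h\<^sub>2 x" using that e1 e2 by auto
    then show ?thesis by (cases "h\<^sub>1 x"; cases "h\<^sub>2 x"; cases "h\<^sub>1 z"; cases "h\<^sub>2 z") auto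
  qed
  then show "\<exists>e>0. \<forall>x\<in>D\<^sub>1 \<inter> D\<^sub>2. N (x - z) < e \<longrightarrow> h\<^sub>1 x + h\<^sub>2 x = h\<^sub>1 z + h\<^sub>2 z"
    using e1(1) e2(1) by (intro exI[of _ "min e\<^sub>1 e\<^sub>2"]) auto
qed

lemma local_primitive_on_Un:
  assumes prim: "local_primitive_on D\<^sub>1 \<phi> h\<^sub>1" "local_primitive_on D\<^sub>2 \<phi> h\<^sub>2"
    and rel_open: "relatively_open_in (D\<^sub>1 \<union> D\<^sub>2) D\<^sub>1" "relatively_open_in (D\<^sub>1 \<union> D\<^sub>2) D\<^sub>2"
    and const: "\<And>x. x \<in> D\<^sub>1 \<inter> D\<^sub>2 \<Longrightarrow> h\<^sub>1 x + h\<^sub>2 x = c"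
  shows "local_primitive_on (D\<^sub>1 \<union> D\<^sub>2) \<phi> (\<lambda>x. if x \<in> D\<^sub>1 then h\<^sub>1 x else h\<^sub>2 x + c)"
    (is "local_primitive_on _ _ ?h")
  unfolding local_primitive_on_def
proof
  fix z assume z: "z \<in> D\<^sub>1 \<union> D\<^sub>2"
  have second_branch: "?h x = h\<^sub>2 x + c" if "x \<in> D\<^sub>2" for x
    using const[of x] that by (cases "h\<^sub>1 x"; cases "h\<^sub>2 x"; cases c) auto
  show "\<exists>e>0. \<forall>x\<in>D\<^sub>1 \<union> D\<^sub>2. N (x - z) < e \<longrightarrow> \<phi> z x = ?h z + ?h x"
  proof (cases "z \<in> D\<^sub>1")
    case True
    obtain e where e: "e > 0" "\<forall>x\<in>D\<^sub>1. N (x - z) < e \<longrightarrow> \<phi> z x = h\<^sub>1 z + h\<^sub>1 x"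
      using prim(1) True unfolding local_primitive_on_def by blast
    obtain e' where e': "e' > 0" "\<forall>x\<in>D\<^sub>1 \<union> D\<^sub>2. N (x - z) < e' \<longrightarrow> x \<in> D\<^sub>1"
      using rel_open(1) True unfolding relatively_open_in_def by blast
    show ?thesis using e e' True by (intro exI[of _ "min e e'"]) auto
  next
    case False
    then have z2: "z \<in> D\<^sub>2" using z by auto
    obtain e where e: "e > 0" "\<forall>x\<in>D\<^sub>2. N (x - z) < e \<longrightarrow> \<phi> z x = h\<^sub>2 z + h\<^sub>2 x"
      using prim(2) z2 unfolding local_primitive_on_def by blast
    obtain e' where e': "e' > 0" "\<forall>x\<in>D\<^sub>1 \<union> D\<^sub>2. N (x - z) < e' \<longrightarrow> x \<in> D\<^sub>2"
      using rel_open(2) z2 unfolding relatively_open_in_def by blast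
    have "\<phi> z x = ?h z + ?h x" if "x \<in> D\<^sub>1 \<union> D\<^sub>2" "N (x - z) < min e e'" for x
    proof -
      have x2: "x \<in> D\<^sub>2" using that e'(2) by simp
      show ?thesis unfolding second_branch[OF z2] second_branch[OF x2]
        using e(2) x2 that by (simp add: algebra_simps)
    qed
    then show ?thesis using e(1) e'(1) by (intro exI[of _ "min e e'"]) auto
  qed
qed

end

text \<open>The integral of a local cocycle along a segment: the sums over dyadic subdivisions are
  eventually constant, so the description is meaningful for such \<open>\<phi>\<close>.\<close>

definition dyadic_path_sum :: "('a::real_vector \<Rightarrow> 'a \<Rightarrow> bit) \<Rightarrow> 'a \<Rightarrow> 'a \<Rightarrow> nat \<Rightarrow> bit" where
  "dyadic_path_sum \<phi> b x n = (\<Sum>i<2 ^ n.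
     \<phi> ((1 - real i / 2 ^ n) *\<^sub>R b + (real i / 2 ^ n) *\<^sub>R x)
       ((1 - real (Suc i) / 2 ^ n) *\<^sub>R b + (real (Suc i) / 2 ^ n) *\<^sub>R x))"

definition segment_integral :: "('a::real_vector \<Rightarrow> 'a \<Rightarrow> bit) \<Rightarrow> 'a \<Rightarrow> 'a \<Rightarrow> bit" where
  "segment_integral \<phi> b x = (THE c. eventually (\<lambda>n. dyadic_path_sum \<phi> b x n = c) sequentially)"

lemma segment_integral_eqI:
  assumes "eventually (\<lambda>n. dyadic_path_sum \<phi> b x n = c) sequentially"
  shows "segment_integral \<phi> b x = c"
  unfolding segment_integral_def
proof (rule the_equality)
  show "eventually (\<lambda>n. dyadic_path_sum \<phi> b x n = c) sequentially" by (rule assms)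
  fix c' assume "eventually (\<lambda>n. dyadic_path_sum \<phi> b x n = c') sequentially"
  with assms have "eventually (\<lambda>n. c' = c) sequentially" by eventually_elim simp
  then show "c' = c" by simp
qed

lemma sum_lessThan_double: "(\<Sum>j<2 * k. f j) = (\<Sum>i<k. f (2 * i) + f (Suc (2 * i)))"
  for f :: "nat \<Rightarrow> 'a::comm_monoid_add"
  by (induction k) (auto simp: add.assoc)

lemma cocycle_sum_telescope:
  fixes \<phi> :: "'a \<Rightarrow> 'a \<Rightarrow> bit" and a b :: "nat \<Rightarrow> 'a"
  assumes "\<And>i. i < k \<Longrightarrow> \<phi> (a i) (a (Suc i)) + \<phi> (a (Suc i)) (b (Suc i)) + \<phi> (a i) (b (Suc i)) = 0"
    and "\<And>i. i < k \<Longrightarrow> \<phi> (a i) (b i) + \<phi> (b i) (b (Suc i)) + \<phi> (a i) (b (Suc i)) = 0"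
  shows "(\<Sum>i<k. \<phi> (a i) (a (Suc i))) + (\<Sum>i<k. \<phi> (b i) (b (Suc i))) = \<phi> (a 0) (b 0) + \<phi> (a k) (b k)"
  using assms
proof (induction k)
  case (Suc k)
  have regroup: "x = u + v \<Longrightarrow> p + q + r = 0 \<Longrightarrow> v + t + r = 0 \<Longrightarrow> x + (p + t) = u + q"
    for x u v p q r t :: bit
    by (cases u; cases v; cases p; cases q; cases r; cases t) auto
  have "(\<Sum>i<k. \<phi> (a i) (a (Suc i))) + (\<Sum>i<k. \<phi> (b i) (b (Suc i))) = \<phi> (a 0) (b 0) + \<phi> (a k) (b k)"
    using Suc by auto
  from regroup[OF this Suc.prems(1)[of k] Suc.prems(2)[of k]] show ?case by (simp add: ac_simps)
qed simp

definition cocycle_at_scale :: "('a::real_vector \<Rightarrow> 'a \<Rightarrow> bit) \<Rightarrow> 'a \<Rightarrow> 'a set \<Rightarrow> real \<Rightarrow> bool" where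
  "cocycle_at_scale \<phi> b S r \<longleftrightarrow> (let \<gamma> = (\<lambda>x t. (1 - t) *\<^sub>R b + t *\<^sub>R x) in
     \<forall>x\<in>S. \<forall>y\<in>S. \<forall>w\<in>S. \<forall>t\<in>{0..1}. \<forall>t\<^sub>1\<in>{0..1}. \<forall>t\<^sub>2\<in>{0..1}. \<forall>t\<^sub>3\<in>{0..1}.
       \<bar>t\<^sub>1 - t\<bar> \<le> r \<longrightarrow> \<bar>t\<^sub>2 - t\<bar> \<le> r \<longrightarrow> \<bar>t\<^sub>3 - t\<bar> \<le> r \<longrightarrow>
       \<phi> (\<gamma> x t\<^sub>1) (\<gamma> y t\<^sub>2) + \<phi> (\<gamma> y t\<^sub>2) (\<gamma> w t\<^sub>3) + \<phi> (\<gamma> x t\<^sub>1) (\<gamma> w t\<^sub>3) = 0)"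

lemma cocycle_at_scaleD:
  assumes "cocycle_at_scale \<phi> b S r" "x \<in> S" "y \<in> S" "w \<in> S"
    and "t \<in> {0..1}" "t\<^sub>1 \<in> {0..1}" "t\<^sub>2 \<in> {0..1}" "t\<^sub>3 \<in> {0..1}"
    and "\<bar>t\<^sub>1 - t\<bar> \<le> r" "\<bar>t\<^sub>2 - t\<bar> \<le> r" "\<bar>t\<^sub>3 - t\<bar> \<le> r"
  shows "\<phi> ((1 - t\<^sub>1) *\<^sub>R b + t\<^sub>1 *\<^sub>R x) ((1 - t\<^sub>2) *\<^sub>R b + t\<^sub>2 *\<^sub>R y)
      + \<phi> ((1 - t\<^sub>2) *\<^sub>R b + t\<^sub>2 *\<^sub>R y) ((1 - t\<^sub>3) *\<^sub>R b + t\<^sub>3 *\<^sub>R w)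
      + \<phi> ((1 - t\<^sub>1) *\<^sub>R b + t\<^sub>1 *\<^sub>R x) ((1 - t\<^sub>3) *\<^sub>R b + t\<^sub>3 *\<^sub>R w) = 0"
  using assms unfolding cocycle_at_scale_def Let_def by blast

lemma dyadic_path_sum_Suc:
  assumes coc: "cocycle_at_scale \<phi> b S ((1/2) ^ n)" and x: "x \<in> S"
  shows "dyadic_path_sum \<phi> b x (Suc n) = dyadic_path_sum \<phi> b x n"
proof -
  define p where "p j = (1 - real j / 2 ^ Suc n) *\<^sub>R b + (real j / 2 ^ Suc n) *\<^sub>R x" for j
  have "\<phi> (p (2 * i)) (p (Suc (2 * i))) + \<phi> (p (Suc (2 * i))) (p (Suc (Suc (2 * i))))
      + \<phi> (p (2 * i)) (p (Suc (Suc (2 * i)))) = 0" if i: "i < 2 ^ n" for i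
  proof -
    have mesh: "real j / 2 ^ Suc n \<in> {0..1}" "\<bar>real j / 2 ^ Suc n - real i / 2 ^ n\<bar> \<le> (1/2) ^ n"
      if j: "2 * i \<le> j" "j \<le> Suc (Suc (2 * i))" for j
    proof -
      have "j \<le> 2 ^ Suc n" using i j by simp
      then have "real j \<le> 2 ^ Suc n" using of_nat_le_iff[of j "2 ^ Suc n", where 'a = real] by simp
      then show "real j / 2 ^ Suc n \<in> {0..1}" by simp
      have "\<bar>real j - 2 * real i\<bar> \<le> 2" using j by linarith
      then show "\<bar>real j / 2 ^ Suc n - real i / 2 ^ n\<bar> \<le> (1/2) ^ n"
        by (simp add: power_one_over field_simps abs_le_iff)
    qed
    show ?thesis
      unfolding p_def using i
      by (intro cocycle_at_scaleD[OF coc x x x, where t = "real i / 2 ^ n"] mesh) simp_all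
  qed
  then have "(\<Sum>i<2 ^ n. \<phi> (p (2 * i)) (p (Suc (2 * i)))
      + \<phi> (p (Suc (2 * i))) (p (Suc (Suc (2 * i)))))
      = (\<Sum>i<2 ^ n. \<phi> (p (2 * i)) (p (Suc (Suc (2 * i)))))"
    by (intro sum.cong) (auto simp: bit_add_eq_0_iff)
  moreover have "dyadic_path_sum \<phi> b x n = (\<Sum>i<2 ^ n. \<phi> (p (2 * i)) (p (Suc (Suc (2 * i)))))"
    unfolding dyadic_path_sum_def p_def by (simp add: add_divide_distrib)
  moreover have "dyadic_path_sum \<phi> b x (Suc n) = (\<Sum>j<2 * 2 ^ n. \<phi> (p j) (p (Suc j)))"
    unfolding dyadic_path_sum_def p_def by simp
  ultimately show ?thesis by (simp only: sum_lessThan_double)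
qed

lemma dyadic_path_sum_add:
  assumes coc: "cocycle_at_scale \<phi> b S ((1/2) ^ n)" and xz: "x \<in> S" "z \<in> S"
  shows "dyadic_path_sum \<phi> b z n + dyadic_path_sum \<phi> b x n = \<phi> z x"
proof -
  define p where "p v i = (1 - real i / 2 ^ n) *\<^sub>R b + (real i / 2 ^ n) *\<^sub>R v" for v i
  have step: "\<phi> (p u i) (p v (i + j)) + \<phi> (p v (i + j)) (p x (Suc i)) + \<phi> (p u i) (p x (Suc i)) = 0"
    if "u \<in> S" "v \<in> S" "i < 2 ^ n" "j \<le> 1" for u v i j
  proof -
    have mesh: "real k / 2 ^ n \<in> {0..1}" "\<bar>real k / 2 ^ n - real i / 2 ^ n\<bar> \<le> (1/2) ^ n"
      if "i \<le> k" "k \<le> Suc i" for k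
    proof -
      have "k \<le> 2 ^ n" using that \<open>i < 2 ^ n\<close> by simp
      then show "real k / 2 ^ n \<in> {0..1}" by simp
      have "\<bar>real k - real i\<bar> \<le> 1" using that by linarith
      then show "\<bar>real k / 2 ^ n - real i / 2 ^ n\<bar> \<le> (1/2) ^ n"
        by (simp add: power_one_over diff_divide_distrib[symmetric] divide_le_cancel)
    qed
    show ?thesis
      unfolding p_def using that xz(1)
      by (intro cocycle_at_scaleD[OF coc, where t = "real i / 2 ^ n"] mesh) simp_all
  qed
  have "dyadic_path_sum \<phi> b z n + dyadic_path_sum \<phi> b x n
      = \<phi> (p z 0) (p x 0) + \<phi> (p z (2 ^ n)) (p x (2 ^ n))"
    unfolding dyadic_path_sum_def p_def[symmetric]
    using step[of z z _ 1] step[of z x _ 0] xz by (intro cocycle_sum_telescope) auto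
  moreover have "\<phi> b b = 0" using cocycle_at_scaleD[OF coc xz(1,1,1), of 0 0 0 0] by simp
  ultimately show ?thesis by (simp add: p_def)
qed

lemma uniform_radius_Icc:
  fixes P :: "real \<Rightarrow> real \<Rightarrow> bool"
  assumes loc: "\<And>t. t \<in> {0..1} \<Longrightarrow> \<exists>\<delta>>0. \<exists>l>0. \<forall>t'\<in>{0..1}. \<bar>t' - t\<bar> < \<delta> \<longrightarrow> P l t'"
    and mono: "\<And>l l' t. P l t \<Longrightarrow> l' \<le> l \<Longrightarrow> P l' t"
  obtains l where "l > 0" "\<And>t. t \<in> {0..1} \<Longrightarrow> P l t"
proof -
  obtain \<delta> l where \<delta>: "\<And>t. t \<in> {0..1} \<Longrightarrow> \<delta> t > 0" and l: "\<And>t. t \<in> {0..1} \<Longrightarrow> l t > 0"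
    and P: "\<And>t t'. t \<in> {0..1} \<Longrightarrow> t' \<in> {0..1} \<Longrightarrow> \<bar>t' - t\<bar> < \<delta> t \<Longrightarrow> P (l t) t'"
    using loc by metis
  have "{0..1} \<subseteq> (\<Union>t\<in>{0..1}. ball t (\<delta> t))" using \<delta> by force
  then obtain T where T: "T \<subseteq> {0..1}" "finite T" "{0..1} \<subseteq> (\<Union>t\<in>T. ball t (\<delta> t))"
    using compactE_image[of "{0..1}" "{0..1}" "\<lambda>t. ball t (\<delta> t)"] by (metis compact_Icc open_ball)
  define m where "m = Min (insert 1 (l ` T))"
  show ?thesis
  proof (rule that[of m])
    show "m > 0" unfolding m_def using T l by (subst Min_gr_iff) auto
    fix t :: real assume t: "t \<in> {0..1}"
    then obtain u where u: "u \<in> T" "dist u t < \<delta> u" using T(3) by auto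
    then have "P (l u) t" using P[of u t] T(1) t by (auto simp: dist_real_def abs_minus_commute)
    moreover have "m \<le> l u" unfolding m_def using T(2) u(1) by (intro Min_le) auto
    ultimately show "P m t" by (rule mono)
  qed
qed

context seminormed
begin

context
  fixes D :: "'a set" and b :: 'a and \<phi> :: "'a \<Rightarrow> 'a \<Rightarrow> bit"
  assumes D_subset: "D \<subseteq> E" and base: "b \<in> D" and star: "\<And>x. x \<in> D \<Longrightarrow> closed_segment b x \<subseteq> D"
    and cocycle: "local_cocycle_on D \<phi>"
begin

private abbreviation "\<gamma> x t \<equiv> (1 - t) *\<^sub>R b + t *\<^sub>R x"

lemma segment_in_star: "x \<in> D \<Longrightarrow> t \<in> {0..1} \<Longrightarrow> \<gamma> x t \<in> D"
  using star[of x] by (auto simp: in_segment subset_iff)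

lemma cocycle_uniform_on_segment:
  assumes z: "z \<in> D"
  obtains l where "l > 0" "\<And>t x y w. t \<in> {0..1} \<Longrightarrow> x \<in> D \<Longrightarrow> y \<in> D \<Longrightarrow> w \<in> D \<Longrightarrow>
    N (x - \<gamma> z t) < l \<Longrightarrow> N (y - \<gamma> z t) < l \<Longrightarrow> N (w - \<gamma> z t) < l \<Longrightarrow> \<phi> x y + \<phi> y w + \<phi> x w = 0"
proof (rule uniform_radius_Icc[where P = "\<lambda>l t. \<forall>x\<in>D. \<forall>y\<in>D. \<forall>w\<in>D.
    N (x - \<gamma> z t) < l \<longrightarrow> N (y - \<gamma> z t) < l \<longrightarrow> N (w - \<gamma> z t) < l \<longrightarrow> \<phi> x y + \<phi> y w + \<phi> x w = 0"])
  fix t :: real assume t: "t \<in> {0..1}"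
  obtain e where e: "e > 0" "\<forall>x\<in>D. \<forall>y\<in>D. \<forall>w\<in>D. N (x - \<gamma> z t) < e \<longrightarrow> N (y - \<gamma> z t) < e \<longrightarrow>
      N (w - \<gamma> z t) < e \<longrightarrow> \<phi> x y + \<phi> y w + \<phi> x w = 0"
    using cocycle segment_in_star[OF z t] unfolding local_cocycle_on_def by blast
  have bz: "b \<in> E" "z \<in> E" using base z D_subset by auto
  have nonneg: "0 \<le> N (z - b)" using bz by (intro N_nonneg) auto
  have near: "N (x - \<gamma> z t) < e"
    if t': "t' \<in> {0..1}" "\<bar>t' - t\<bar> < (e / 2) / (N (z - b) + 1)"
      and x: "x \<in> D" "N (x - \<gamma> z t') < e / 2" for t' x
  proof -
    have "\<bar>t' - t\<bar> * (N (z - b) + 1) < e / 2"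
      using t'(2) nonneg by (subst (asm) pos_less_divide_eq) auto
    moreover have "\<bar>t' - t\<bar> * N (z - b) \<le> \<bar>t' - t\<bar> * (N (z - b) + 1)" by (intro mult_left_mono) auto
    ultimately have "\<bar>t' - t\<bar> * N (z - b) < e / 2" by (rule order_le_less_trans[rotated])
    moreover have "N (x - \<gamma> z t) \<le> N (x - \<gamma> z t') + N (\<gamma> z t' - \<gamma> z t)"
      using N_triangle_diff x(1) segment_in_star[OF z] t t'(1) D_subset by blast
    ultimately show ?thesis using x(2) unfolding N_segment[OF bz] by linarith
  qed
  have "\<forall>t'\<in>{0..1}. \<bar>t' - t\<bar> < (e / 2) / (N (z - b) + 1) \<longrightarrow>
      (\<forall>x\<in>D. \<forall>y\<in>D. \<forall>w\<in>D. N (x - \<gamma> z t') < e / 2 \<longrightarrow>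
      N (y - \<gamma> z t') < e / 2 \<longrightarrow> N (w - \<gamma> z t') < e / 2 \<longrightarrow> \<phi> x y + \<phi> y w + \<phi> x w = 0)"
    using e(2) near by blast
  moreover have "0 < (e / 2) / (N (z - b) + 1)" "0 < e / 2" using e(1) nonneg by auto
  ultimately show "\<exists>\<delta>>0. \<exists>l>0. \<forall>t'\<in>{0..1}. \<bar>t' - t\<bar> < \<delta> \<longrightarrow> (\<forall>x\<in>D. \<forall>y\<in>D. \<forall>w\<in>D.
      N (x - \<gamma> z t') < l \<longrightarrow> N (y - \<gamma> z t') < l \<longrightarrow> N (w - \<gamma> z t') < l \<longrightarrow> \<phi> x y + \<phi> y w + \<phi> x w = 0)"
    by blast
qed (use that in auto)

lemma near_segment:
  assumes "x \<in> D" "z \<in> D" "t \<in> {0..1}" and t': "t' \<in> {0..1}" "\<bar>t' - t\<bar> \<le> r"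
  shows "N (\<gamma> x t' - \<gamma> z t) \<le> r * N (x - b) + N (x - z)"
proof -
  have E: "x \<in> E" "z \<in> E" "b \<in> E" using assms base D_subset by auto
  have "\<gamma> x t - \<gamma> z t = t *\<^sub>R (x - z)" by (simp add: algebra_simps)
  then have "N (\<gamma> x t - \<gamma> z t) = t * N (x - z)" using E assms(3) by (simp add: N_hom)
  also have "\<dots> \<le> N (x - z)" using assms(3) N_nonneg[of "x - z"] E by (simp add: mult_left_le_one_le)
  finally have "N (\<gamma> x t - \<gamma> z t) \<le> N (x - z)" .
  moreover have "N (\<gamma> x t' - \<gamma> x t) \<le> r * N (x - b)"
    unfolding N_segment[OF E(3,1)] using t'(2) N_nonneg[of "x - b"] E
    by (intro mult_right_mono) auto
  moreover have "N (\<gamma> x t' - \<gamma> z t) \<le> N (\<gamma> x t' - \<gamma> x t) + N (\<gamma> x t - \<gamma> z t)"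
    using E by (intro N_triangle_diff) auto
  ultimately show ?thesis by linarith
qed

lemma cocycle_at_scale_near:
  assumes z: "z \<in> D"
  obtains e n0 where "e > 0" "\<And>n. n0 \<le> n \<Longrightarrow> cocycle_at_scale \<phi> b {x\<in>D. N (x - z) < e} ((1/2) ^ n)"
proof -
  obtain l where l: "l > 0" "\<And>t x y w. t \<in> {0..1} \<Longrightarrow> x \<in> D \<Longrightarrow> y \<in> D \<Longrightarrow> w \<in> D \<Longrightarrow>
    N (x - \<gamma> z t) < l \<Longrightarrow> N (y - \<gamma> z t) < l \<Longrightarrow> N (w - \<gamma> z t) < l \<Longrightarrow> \<phi> x y + \<phi> y w + \<phi> x w = 0"
    using cocycle_uniform_on_segment[OF z] by blast
  have E: "z \<in> E" "b \<in> E" using z base D_subset by auto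
  have "(\<lambda>n. (1/2) ^ n * (N (z - b) + l)) \<longlonglongrightarrow> 0 * (N (z - b) + l)"
    by (intro tendsto_intros LIMSEQ_realpow_zero) auto
  then have "eventually (\<lambda>n. (1/2) ^ n * (N (z - b) + l) < l / 2) sequentially"
    using l(1) by (intro order_tendstoD) auto
  then obtain n0 where n0: "\<And>n. n0 \<le> n \<Longrightarrow> (1/2) ^ n * (N (z - b) + l) < l / 2"
    by (auto simp: eventually_sequentially)
  have near: "N (\<gamma> x t' - \<gamma> z t) < l"
    if x: "x \<in> D" "N (x - z) < l / 2" and n: "n0 \<le> n"
      and t: "t \<in> {0..1}" "t' \<in> {0..1}" "\<bar>t' - t\<bar> \<le> (1/2) ^ n" for x n t t'
  proof -
    have "N (x - b) \<le> N (x - z) + N (z - b)" using x(1) E D_subset by (intro N_triangle_diff) auto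
    then have "(1/2) ^ n * N (x - b) \<le> (1/2) ^ n * (N (z - b) + l)"
      using x(2) l(1) by (intro mult_left_mono) auto
    then show ?thesis using near_segment[OF x(1) z t] n0[OF n] x(2) by linarith
  qed
  have "cocycle_at_scale \<phi> b {x\<in>D. N (x - z) < l / 2} ((1/2) ^ n)" if "n0 \<le> n" for n
    unfolding cocycle_at_scale_def Let_def
    using l(2) near[OF _ _ that] segment_in_star by (auto simp del: One_nat_def)
  then show ?thesis using that[of "l / 2" n0] l(1) by auto
qed

lemma eventually_dyadic_path_sum:
  assumes x: "x \<in> D"
  shows "eventually (\<lambda>n. dyadic_path_sum \<phi> b x n = segment_integral \<phi> b x) sequentially"
proof -
  obtain e n0 where e: "e > 0"
    and coc: "\<And>n. n0 \<le> n \<Longrightarrow> cocycle_at_scale \<phi> b {y\<in>D. N (y - x) < e} ((1/2) ^ n)"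
    using cocycle_at_scale_near[OF x] by blast
  have "dyadic_path_sum \<phi> b x n = dyadic_path_sum \<phi> b x n0" if "n0 \<le> n" for n
    using that by (induction n rule: dec_induct) (use dyadic_path_sum_Suc[OF coc] x e in auto)
  then have ev: "eventually (\<lambda>n. dyadic_path_sum \<phi> b x n = dyadic_path_sum \<phi> b x n0) sequentially"
    unfolding eventually_sequentially by blast
  then show ?thesis using segment_integral_eqI[OF ev] by simp
qed

lemma local_primitive_on_star: "local_primitive_on D \<phi> (segment_integral \<phi> b)"
  unfolding local_primitive_on_def
proof
  fix z assume z: "z \<in> D"
  obtain e n0 where e: "e > 0"
    and coc: "\<And>n. n0 \<le> n \<Longrightarrow> cocycle_at_scale \<phi> b {x\<in>D. N (x - z) < e} ((1/2) ^ n)"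
    using cocycle_at_scale_near[OF z] by blast
  have "\<phi> z x = segment_integral \<phi> b z + segment_integral \<phi> b x" if x: "x \<in> D" "N (x - z) < e" for x
  proof -
    have "eventually (\<lambda>n. \<phi> z x = segment_integral \<phi> b z + segment_integral \<phi> b x) sequentially"
      using eventually_dyadic_path_sum[OF z] eventually_dyadic_path_sum[OF x(1)]
        eventually_ge_at_top[of n0]
      by eventually_elim (use dyadic_path_sum_add[OF coc, of _ x z] x z e in force)
    then show ?thesis by simp
  qed
  then show "\<exists>e>0. \<forall>x\<in>D. N (x - z) < e \<longrightarrow> \<phi> z x = segment_integral \<phi> b z + segment_integral \<phi> b x"
    using e by blast
qed

end

end

subsection \<open>Orbit spaces\<close>

lemma openin_quotient_top:
  "openin (quotient_top X f) U \<longleftrightarrow> U \<subseteq> f ` topspace X \<and> openin X {x \<in> topspace X. f x \<in> U}"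
proof -
  have preimage_Int: "{x \<in> topspace X. f x \<in> S \<inter> T}
      = {x \<in> topspace X. f x \<in> S} \<inter> {x \<in> topspace X. f x \<in> T}" for S T
    by auto
  have preimage_Union: "{x \<in> topspace X. f x \<in> \<Union>\<K>} = \<Union>((\<lambda>K. {x \<in> topspace X. f x \<in> K}) ` \<K>)" for \<K>
    by auto
  have "istopology (\<lambda>U. U \<subseteq> f ` topspace X \<and> openin X {x \<in> topspace X. f x \<in> U})"
    unfolding istopology_def
  proof (intro conjI allI impI)
    fix \<K> assume "\<forall>K\<in>\<K>. K \<subseteq> f ` topspace X \<and> openin X {x \<in> topspace X. f x \<in> K}"
    then show "openin X {x \<in> topspace X. f x \<in> \<Union> \<K>}"
      unfolding preimage_Union by (intro openin_Union) auto
  next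
    fix S T assume "S \<subseteq> f ` topspace X \<and> openin X {x \<in> topspace X. f x \<in> S}"
      "T \<subseteq> f ` topspace X \<and> openin X {x \<in> topspace X. f x \<in> T}"
    then show "openin X {x \<in> topspace X. f x \<in> S \<inter> T}" unfolding preimage_Int by auto
  qed auto
  then show ?thesis unfolding quotient_top_def by (simp add: topology_inverse')
qed

lemma topspace_quotient_top [simp]: "topspace (quotient_top X f) = f ` topspace X"
proof -
  have "{x \<in> topspace X. f x \<in> f ` topspace X} = topspace X" by auto
  then have "openin (quotient_top X f) (f ` topspace X)" unfolding openin_quotient_top by simp
  then show ?thesis by (metis openin_quotient_top openin_subset openin_topspace subset_antisym)
qed

lemma orbit2_eqD: "orbit2 ng x = orbit2 ng y \<Longrightarrow> y = x \<or> y = ng x"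
  unfolding orbit2_def by blast

lemma orbit2_ng: "ng (ng x) = x \<Longrightarrow> orbit2 ng (ng x) = orbit2 ng x"
  unfolding orbit2_def by auto

lemma some_in_orbit2: "(SOME u. u \<in> orbit2 ng x) = x \<or> (SOME u. u \<in> orbit2 ng x) = ng x"
  using someI[of "\<lambda>u. u \<in> orbit2 ng x" x] by (simp add: orbit2_def)

lemma as_locally_zero_iff:
  "as_locally_zero Y q \<phi> \<longleftrightarrow> (\<forall>y\<in>topspace Y. \<exists>U. openin Y U \<and> y \<in> U \<and>
     (\<forall>ys. length ys = Suc q \<longrightarrow> set ys \<subseteq> U \<longrightarrow> \<phi> ys = 0))" (is "?L \<longleftrightarrow> ?R")
proof
  assume ?L
  then obtain \<U> where \<U>: "\<forall>U\<in>\<U>. openin Y U" "\<Union>\<U> = topspace Y"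
    "\<forall>ys. length ys = Suc q \<and> (\<exists>U\<in>\<U>. set ys \<subseteq> U) \<longrightarrow> \<phi> ys = 0"
    unfolding as_locally_zero_def by (elim exE conjE) (rule that)
  show ?R
  proof
    fix y assume "y \<in> topspace Y"
    then obtain U where "U \<in> \<U>" "y \<in> U" using \<U>(2) by blast
    then show "\<exists>U. openin Y U \<and> y \<in> U \<and> (\<forall>ys. length ys = Suc q \<longrightarrow> set ys \<subseteq> U \<longrightarrow> \<phi> ys = 0)"
      using \<U>(1,3) by (intro exI[of _ U]) auto
  qed
next
  assume R: ?R
  show ?L
    unfolding as_locally_zero_def
  proof (intro exI[of _ "{U. openin Y U \<and> (\<forall>ys. length ys = Suc q \<longrightarrow> set ys \<subseteq> U \<longrightarrow> \<phi> ys = 0)}"] conjI)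
    show "\<Union>{U. openin Y U \<and> (\<forall>ys. length ys = Suc q \<longrightarrow> set ys \<subseteq> U \<longrightarrow> \<phi> ys = 0)} = topspace Y"
      using R openin_subset by fastforce
  qed auto
qed

locale involution_space =
  fixes Y :: "'a topology" and ng :: "'a \<Rightarrow> 'a"
  assumes continuous_ng: "continuous_map Y Y ng"
    and ng_ng: "x \<in> topspace Y \<Longrightarrow> ng (ng x) = x"
begin

lemma openin_orbit_image:
  assumes V: "openin Y V"
  shows "openin (quotient_top Y (orbit2 ng)) (orbit2 ng ` V)"
proof -
  have "{y \<in> topspace Y. orbit2 ng y \<in> orbit2 ng ` V} = V \<union> {y \<in> topspace Y. ng y \<in> V}"
  proof (intro equalityI subsetI)
    fix y assume "y \<in> V \<union> {y \<in> topspace Y. ng y \<in> V}"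
    then show "y \<in> {y \<in> topspace Y. orbit2 ng y \<in> orbit2 ng ` V}"
      using orbit2_ng[of ng y, OF ng_ng] openin_subset[OF V] by (auto simp: subset_iff)
  qed (auto dest: orbit2_eqD)
  moreover have "openin Y {y \<in> topspace Y. ng y \<in> V}"
    using V continuous_ng unfolding continuous_map by blast
  ultimately show ?thesis
    using V openin_subset[OF V] unfolding openin_quotient_top by auto
qed

lemma as_locally_zero_orbits_iff:
  "as_locally_zero (quotient_top Y (orbit2 ng)) q \<Phi> \<longleftrightarrow> (\<forall>x\<in>topspace Y. \<exists>V. openin Y V \<and> x \<in> V \<and>
     (\<forall>xs. length xs = Suc q \<longrightarrow> set xs \<subseteq> V \<longrightarrow> \<Phi> (map (orbit2 ng) xs) = 0))"
  (is "_ \<longleftrightarrow> (\<forall>x\<in>topspace Y. ?locally_zero_at x)")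
proof
  assume zero: "as_locally_zero (quotient_top Y (orbit2 ng)) q \<Phi>"
  show "\<forall>x\<in>topspace Y. ?locally_zero_at x"
  proof
    fix x assume x: "x \<in> topspace Y"
    then have "orbit2 ng x \<in> topspace (quotient_top Y (orbit2 ng))" by simp
    then obtain U where U: "openin (quotient_top Y (orbit2 ng)) U" "orbit2 ng x \<in> U"
      "\<And>ys. length ys = Suc q \<Longrightarrow> set ys \<subseteq> U \<Longrightarrow> \<Phi> ys = 0"
      using zero unfolding as_locally_zero_iff by meson
    then show "?locally_zero_at x" using x unfolding openin_quotient_top
      by (intro exI[of _ "{x \<in> topspace Y. orbit2 ng x \<in> U}"]) (auto intro!: U(3))
  qed
next
  assume zero: "\<forall>x\<in>topspace Y. ?locally_zero_at x"
  show "as_locally_zero (quotient_top Y (orbit2 ng)) q \<Phi>"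
    unfolding as_locally_zero_iff
  proof
    fix y assume "y \<in> topspace (quotient_top Y (orbit2 ng))"
    then obtain x where x: "x \<in> topspace Y" "y = orbit2 ng x" by auto
    then obtain V where V: "openin Y V" "x \<in> V"
      "\<forall>xs. length xs = Suc q \<longrightarrow> set xs \<subseteq> V \<longrightarrow> \<Phi> (map (orbit2 ng) xs) = 0"
      using zero by blast
    have "\<Phi> ys = 0" if ys: "length ys = Suc q" "set ys \<subseteq> orbit2 ng ` V" for ys
    proof -
      have "ys \<in> map (orbit2 ng) ` lists V" using ys(2) unfolding lists_image[symmetric] by auto
      then show ?thesis using V(3) ys(1) by auto
    qed
    then show "\<exists>U. openin (quotient_top Y (orbit2 ng)) U \<and> y \<in> U \<and>
        (\<forall>ys. length ys = Suc q \<longrightarrow> set ys \<subseteq> U \<longrightarrow> \<Phi> ys = 0)"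
      using openin_orbit_image[OF V(1)] x(2) V(2) by (intro exI[of _ "orbit2 ng ` V"]) auto
  qed
qed

end

context isometric_involution
begin

lemma near_lift_unique:
  assumes xs: "set xs \<subseteq> M" "set xs' \<subseteq> M" and same_orbits: "map (orbit2 ng) xs' = map (orbit2 ng) xs"
    and near: "\<And>x y. x \<in> set xs \<Longrightarrow> y \<in> set xs \<Longrightarrow> d x y < d x (ng y)"
    and near': "\<And>x y. x \<in> set xs' \<Longrightarrow> y \<in> set xs' \<Longrightarrow> d x y < d x (ng y)"
  shows "xs' = xs \<or> xs' = map ng xs"
proof (cases "xs = []")
  case True
  then show ?thesis using same_orbits by simp
next
  case False
  have len: "length xs' = length xs" using same_orbits by (metis length_map)
  have lift: "xs' ! i = xs ! i \<or> xs' ! i = ng (xs ! i)" if "i < length xs" for i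
  proof -
    have "orbit2 ng (xs ! i) = orbit2 ng (xs' ! i)" using same_orbits that len by (metis nth_map)
    then show ?thesis by (rule orbit2_eqD)
  qed
  have M: "xs ! i \<in> M" if "i < length xs" for i using xs that by auto
  have nonempty: "0 < length xs" using False by simp
  have near_head: "d (xs ! 0) (xs ! j) < d (xs ! 0) (ng (xs ! j))" if "j < length xs" for j
    using that nonempty near by simp
  have near_head': "d (xs' ! 0) (xs' ! j) < d (xs' ! 0) (ng (xs' ! j))" if "j < length xs" for j
    using that nonempty near' len by simp
  show ?thesis
  proof (cases "xs' ! 0 = xs ! 0")
    case True
    have "xs' ! j = xs ! j" if "j < length xs" for j
      using lift[OF that] near_head[OF that] near_head'[OF that] ng_ng[OF M[OF that]] True by auto
    then have "xs' = xs" using len by (auto intro: nth_equalityI)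
    then show ?thesis by simp
  next
    case False
    then have head: "xs' ! 0 = ng (xs ! 0)" using lift[OF nonempty] by auto
    have "xs' ! j = ng (xs ! j)" if "j < length xs" for j
      using lift[OF that] near_head[OF that] near_head'[OF that] d_ng[OF M[OF nonempty] M[OF that]]
        d_ng_right[OF M[OF nonempty] M[OF that]] head by auto
    then have "xs' = map ng xs" using len by (auto intro: nth_equalityI)
    then show ?thesis by simp
  qed
qed

lemma orbit_cochain_descends:
  assumes A_subset: "A \<subseteq> M" and invariant: "invariant_on ng A \<psi>"
  obtains \<Psi> where
    "\<And>x xs. x \<in> A \<Longrightarrow> set xs \<subseteq> {y\<in>A. d x y < d x (ng x) / 4} \<Longrightarrow> \<Psi> (map (orbit2 ng) xs) = \<psi> xs"
    "\<And>x xs. x \<in> A \<Longrightarrow> set xs \<subseteq> {y\<in>A. d x y < d x (ng x) / 4} \<Longrightarrow>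
       as_cobound \<Psi> (map (orbit2 ng) xs) = as_cobound \<psi> xs"
proof -
  define liftable where
    "liftable xs \<longleftrightarrow> set xs \<subseteq> A \<and> (\<forall>x\<in>set xs. \<forall>y\<in>set xs. d x y < d x (ng y))" for xs
  define \<Psi> where "\<Psi> os = \<psi> (SOME xs. liftable xs \<and> map (orbit2 ng) xs = os)" for os
  have \<Psi>_lift: "\<Psi> (map (orbit2 ng) xs) = \<psi> xs" if xs: "liftable xs" for xs
  proof -
    define xs' where "xs' = (SOME ys. liftable ys \<and> map (orbit2 ng) ys = map (orbit2 ng) xs)"
    have "liftable xs' \<and> map (orbit2 ng) xs' = map (orbit2 ng) xs"
      unfolding xs'_def by (rule someI[of _ xs]) (use xs in auto)
    then have "xs' = xs \<or> xs' = map ng xs"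
      using xs A_subset unfolding liftable_def by (intro near_lift_unique) auto
    then show ?thesis
      unfolding \<Psi>_def xs'_def[symmetric] using invariant_onD[OF invariant] xs unfolding liftable_def
      by auto
  qed
  have small_liftable: "liftable xs" if "x \<in> A" "set xs \<subseteq> {y\<in>A. d x y < d x (ng x) / 4}" for x xs
    unfolding liftable_def using that A_subset by (auto intro!: near_pairwise[of x])
  show ?thesis
  proof (rule that[of \<Psi>])
    fix x xs assume x: "x \<in> A" "set xs \<subseteq> {y\<in>A. d x y < d x (ng x) / 4}"
    then show "\<Psi> (map (orbit2 ng) xs) = \<psi> xs" by (intro \<Psi>_lift small_liftable)
    show "as_cobound \<Psi> (map (orbit2 ng) xs) = as_cobound \<psi> xs"
      unfolding as_cobound_pullback[symmetric]
    proof (rule as_cobound_cong)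
      fix t assume "set t \<subseteq> set xs"
      then show "as_pullback (orbit2 ng) \<Psi> t = \<psi> t"
        unfolding as_pullback_def using x by (intro \<Psi>_lift small_liftable[of x]) auto
    qed
  qed
qed

end

subsection \<open>The infinite sphere\<close>

definition seqs_upto :: "nat \<Rightarrow> (nat \<Rightarrow> real) set" where
  "seqs_upto n = {x. \<forall>i>n. x i = 0}"

definition finite_seqs :: "(nat \<Rightarrow> real) set" where
  "finite_seqs = {x. finite {i. x i \<noteq> 0}}"

definition l2_norm :: "(nat \<Rightarrow> real) \<Rightarrow> real" where
  "l2_norm x = L2_set x {i. x i \<noteq> 0}"

definition unit_seq :: "nat \<Rightarrow> nat \<Rightarrow> real" where
  "unit_seq k i = (if i = k then 1 else 0)"

lemma seqs_upto_mono: "n \<le> m \<Longrightarrow> seqs_upto n \<subseteq> seqs_upto m"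
  unfolding seqs_upto_def by auto

lemma seqs_upto_support: "x \<in> seqs_upto n \<Longrightarrow> {i. x i \<noteq> 0} \<subseteq> {..n}"
  unfolding seqs_upto_def using not_le by blast

lemma finite_seqs_eq: "finite_seqs = (\<Union>n. seqs_upto n)"
proof (intro equalityI subsetI)
  fix x assume "x \<in> finite_seqs"
  then obtain n where "\<forall>i\<in>{i. x i \<noteq> 0}. i \<le> n"
    unfolding finite_seqs_def using finite_nat_set_iff_bounded_le by blast
  then have "x \<in> seqs_upto n" unfolding seqs_upto_def using not_le by blast
  then show "x \<in> (\<Union>n. seqs_upto n)" by auto
qed (auto simp: finite_seqs_def dest: seqs_upto_support intro: finite_subset)

lemma seqs_upto_subset_finite_seqs: "seqs_upto n \<subseteq> finite_seqs"
  unfolding finite_seqs_eq by auto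

lemma finite_seqs_pairE:
  assumes "x \<in> finite_seqs" "y \<in> finite_seqs"
  obtains n where "x \<in> seqs_upto n" "y \<in> seqs_upto n"
proof -
  from assms obtain a b where "x \<in> seqs_upto a" "y \<in> seqs_upto b" unfolding finite_seqs_eq by auto
  then show ?thesis
    using that[of "max a b"] seqs_upto_mono[of a "max a b"] seqs_upto_mono[of b "max a b"] by auto
qed

lemma l2_norm_seqs_upto: "x \<in> seqs_upto n \<Longrightarrow> l2_norm x = L2_set x {..n}"
  unfolding l2_norm_def L2_set_def
  by (intro arg_cong[where f = sqrt] sum.mono_neutral_left seqs_upto_support) auto

lemma subspace_seqs_upto: "subspace (seqs_upto n)"
  unfolding subspace_def seqs_upto_def by auto

lemma subspace_finite_seqs: "subspace finite_seqs"
  unfolding subspace_def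
proof (intro conjI ballI allI)
  show "0 \<in> finite_seqs" unfolding finite_seqs_def by simp
  fix x y c assume xy: "x \<in> finite_seqs" "y \<in> finite_seqs"
  obtain n where "x \<in> seqs_upto n" "y \<in> seqs_upto n" by (rule finite_seqs_pairE[OF xy])
  then show "x + y \<in> finite_seqs"
    unfolding finite_seqs_eq using subspace_add[OF subspace_seqs_upto] by blast
next
  fix x and c :: real assume "x \<in> finite_seqs"
  then show "c *\<^sub>R x \<in> finite_seqs"
    unfolding finite_seqs_eq using subspace_scale[OF subspace_seqs_upto] by blast
qed

interpretation l2: seminormed finite_seqs l2_norm
proof
  show "subspace finite_seqs" by (rule subspace_finite_seqs)
  fix x y assume xy: "x \<in> finite_seqs" "y \<in> finite_seqs"
  obtain n where n: "x \<in> seqs_upto n" "y \<in> seqs_upto n" by (rule finite_seqs_pairE[OF xy])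
  then have "x + y \<in> seqs_upto n" using subspace_add[OF subspace_seqs_upto] by blast
  then show "l2_norm (x + y) \<le> l2_norm x + l2_norm y"
    using n L2_set_triangle_ineq[of x y "{..n}"] by (simp add: l2_norm_seqs_upto plus_fun_def)
next
  fix x and c :: real assume "x \<in> finite_seqs"
  then obtain n where n: "x \<in> seqs_upto n" unfolding finite_seqs_eq by auto
  then have "c *\<^sub>R x \<in> seqs_upto n" using subspace_scale[OF subspace_seqs_upto] by blast
  then show "l2_norm (c *\<^sub>R x) = \<bar>c\<bar> * l2_norm x" using n
    by (simp add: l2_norm_seqs_upto L2_set_def power_mult_distrib sum_distrib_left[symmetric]
      real_sqrt_mult)
qed

lemma l2_norm_le:
  assumes "x \<in> seqs_upto n" "\<And>i. \<bar>x i\<bar> \<le> c"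
  shows "l2_norm x \<le> (real n + 1) * c"
proof -
  have "l2_norm x \<le> (\<Sum>i\<le>n. \<bar>x i\<bar>)"
    unfolding l2_norm_seqs_upto[OF assms(1)] by (rule L2_set_le_sum_abs)
  also have "\<dots> \<le> (\<Sum>i\<le>n. c)" using assms(2) by (rule sum_mono)
  finally show ?thesis by (simp add: add.commute)
qed

lemma abs_le_l2_norm: "x \<in> finite_seqs \<Longrightarrow> \<bar>x i\<bar> \<le> l2_norm x"
  using member_le_L2_set[of "{i. x i \<noteq> 0}" i "\<lambda>i. \<bar>x i\<bar>"] L2_set_nonneg[of x]
  by (cases "x i = 0") (auto simp: l2_norm_def finite_seqs_def L2_set_def)

lemma l2_norm_pos: "x \<in> finite_seqs \<Longrightarrow> x \<noteq> 0 \<Longrightarrow> l2_norm x > 0"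
  using abs_le_l2_norm by (metis abs_le_zero_iff ext linorder_not_less order_trans zero_fun_apply)

lemma unit_seq_in_seqs_upto: "k \<le> n \<Longrightarrow> unit_seq k \<in> seqs_upto n"
  unfolding seqs_upto_def unit_seq_def by auto

lemma Sinf_iff: "x \<in> Sinf \<longleftrightarrow> x \<in> finite_seqs \<and> l2_norm x = 1"
  unfolding Sinf_def finite_seqs_def l2_norm_def L2_set_def by auto

lemma Sfin_iff: "x \<in> Sfin n \<longleftrightarrow> x \<in> seqs_upto n \<and> l2_norm x = 1"
  unfolding Sfin_def Sinf_iff seqs_upto_def finite_seqs_eq by auto

lemma Sfin_subset_Sinf: "Sfin n \<subseteq> Sinf"
  unfolding Sfin_def by auto

lemma uminus_Sinf [simp]: "- x \<in> Sinf \<longleftrightarrow> x \<in> Sinf"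
  unfolding Sinf_iff using l2.N_minus l2.E_simps(5) by (metis minus_minus)

lemma uminus_Sfin [simp]: "- x \<in> Sfin n \<longleftrightarrow> x \<in> Sfin n"
  by (simp add: Sfin_def)

lemma unit_seq_in_Sinf: "unit_seq k \<in> Sinf"
proof -
  have "{i. unit_seq k i \<noteq> 0} = {k}" by (auto simp: unit_seq_def)
  then show ?thesis unfolding Sinf_def by (simp add: unit_seq_def)
qed

lemma normalize_in_Sfin: "x \<in> seqs_upto n - {0} \<Longrightarrow> l2.normalize x \<in> Sfin n"
  using l2_norm_pos[of x] seqs_upto_subset_finite_seqs[of n]
    subspace_scale[OF subspace_seqs_upto, of x n]
  unfolding Sfin_iff by (auto simp: l2.N_normalize subset_iff) (simp add: l2.normalize_def)

lemma Sfin_subset_nonzero: "Sfin n \<subseteq> seqs_upto n - {0}"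
  by (auto simp: Sfin_iff)

lemma Sfin_dist_less_iff:
  assumes "x \<in> Sfin n" "y \<in> Sfin n" "e > 0"
  shows "(\<Sum>i\<le>n. (x i - y i)\<^sup>2) < e\<^sup>2 \<longleftrightarrow> l2_norm (y - x) < e"
proof -
  have "l2_norm (y - x) = l2_norm (x - y)"
    using assms by (intro l2.N_diff_commute) (auto simp: Sfin_iff finite_seqs_eq)
  also have "\<dots> = sqrt (\<Sum>i\<le>n. (x i - y i)\<^sup>2)"
    using assms subspace_diff[OF subspace_seqs_upto]
    by (subst l2_norm_seqs_upto[of _ n]) (auto simp: Sfin_iff L2_set_def)
  finally show ?thesis using assms(3) by (metis abs_of_pos real_sqrt_abs real_sqrt_less_iff)
qed

lemma openin_Sinf_top:
  "openin Sinf_top U \<longleftrightarrow> U \<subseteq> Sinf \<and> (\<forall>n. l2.relatively_open_in (Sfin n) (U \<inter> Sfin n))"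
proof -
  let ?P = "\<lambda>U. U \<subseteq> Sinf \<and> (\<forall>n. l2.relatively_open_in (Sfin n) (U \<inter> Sfin n))"
  have Sinf_top_eq: "(\<lambda>U. U \<subseteq> Sinf \<and>
     (\<forall>n. \<forall>x\<in>U \<inter> Sfin n. \<exists>e>0. \<forall>y\<in>Sfin n. (\<Sum>i\<le>n. (x i - y i)\<^sup>2) < e\<^sup>2 \<longrightarrow> y \<in> U)) = ?P"
    unfolding l2.relatively_open_in_def
    by (intro ext conj_cong refl all_cong1 ball_cong ex_cong1) (auto simp: Sfin_dist_less_iff)
  have "istopology ?P"
    unfolding istopology_def
  proof (intro conjI allI impI)
    fix S T n assume "?P S" "?P T"
    then have "l2.relatively_open_in (Sfin n) (S \<inter> Sfin n \<inter> (T \<inter> Sfin n))"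
      by (blast intro: l2.relatively_open_in_Int)
    moreover have "S \<inter> Sfin n \<inter> (T \<inter> Sfin n) = S \<inter> T \<inter> Sfin n" by auto
    ultimately show "l2.relatively_open_in (Sfin n) (S \<inter> T \<inter> Sfin n)" by simp
  next
    fix \<K> n assume "\<forall>K\<in>\<K>. ?P K"
    then have "l2.relatively_open_in (Sfin n) (\<Union>((\<lambda>K. K \<inter> Sfin n) ` \<K>))"
      by (intro l2.relatively_open_in_Union) auto
    then show "l2.relatively_open_in (Sfin n) (\<Union>\<K> \<inter> Sfin n)" by (simp add: Int_UN_distrib2)
  qed auto
  then show ?thesis unfolding Sinf_top_def Sinf_top_eq by (simp add: topology_inverse')
qed

lemma openin_Sinf_topE:
  assumes "openin Sinf_top U" "x \<in> U" "x \<in> Sfin n"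
  obtains e where "e > 0" "\<And>y. y \<in> Sfin n \<Longrightarrow> l2_norm (y - x) < e \<Longrightarrow> y \<in> U"
proof -
  have "x \<in> U \<inter> Sfin n" using assms by simp
  then have "\<exists>e>0. \<forall>y\<in>Sfin n. l2_norm (y - x) < e \<longrightarrow> y \<in> U \<inter> Sfin n"
    using assms(1) unfolding openin_Sinf_top l2.relatively_open_in_def by blast
  then show ?thesis using that by blast
qed

lemma topspace_Sinf_top [simp]: "topspace Sinf_top = Sinf"
proof -
  have "openin Sinf_top Sinf"
    unfolding openin_Sinf_top l2.relatively_open_in_def
    by (auto simp: Sfin_def intro!: exI[of _ "1::real"])
  then show ?thesis by (metis openin_Sinf_top openin_subset openin_topspace subset_antisym)
qed

lemma openin_Sinf_top_ball:
  assumes x: "x \<in> Sinf"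
  shows "openin Sinf_top {y\<in>Sinf. l2_norm (x - y) < r}" (is "openin _ ?B")
  unfolding openin_Sinf_top l2.relatively_open_in_def
proof (intro conjI allI ballI)
  fix n z assume z: "z \<in> ?B \<inter> Sfin n"
  show "\<exists>e>0. \<forall>y\<in>Sfin n. l2_norm (y - z) < e \<longrightarrow> y \<in> ?B \<inter> Sfin n"
  proof (intro exI[of _ "r - l2_norm (x - z)"] conjI ballI impI)
    fix y assume y: "y \<in> Sfin n" "l2_norm (y - z) < r - l2_norm (x - z)"
    then have yS: "y \<in> Sinf" using Sfin_subset_Sinf by auto
    then have "l2_norm (x - y) \<le> l2_norm (x - z) + l2_norm (y - z)"
      using x z l2.N_triangle_diff[of x z y] l2.N_diff_commute[of z y] unfolding Sinf_iff by auto
    then show "y \<in> ?B \<inter> Sfin n" using y yS by auto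
  qed (use z in auto)
qed auto

interpretation sphere: involution_space Sinf_top uminus
proof
  show "continuous_map Sinf_top Sinf_top uminus"
    unfolding continuous_map
  proof (intro conjI allI impI)
    fix U assume U: "openin Sinf_top U"
    show "openin Sinf_top {x \<in> topspace Sinf_top. - x \<in> U}"
      unfolding openin_Sinf_top l2.relatively_open_in_def
    proof (intro conjI allI ballI)
      fix n z assume z: "z \<in> {x \<in> topspace Sinf_top. - x \<in> U} \<inter> Sfin n"
      then obtain e where e: "e > 0" "\<And>y. y \<in> Sfin n \<Longrightarrow> l2_norm (y - - z) < e \<Longrightarrow> y \<in> U"
        using openin_Sinf_topE[OF U, of "- z" n] by auto
      have "- y \<in> U" if y: "y \<in> Sfin n" "l2_norm (y - z) < e" for y
      proof (rule e(2))
        have "l2_norm (- y - - z) = l2_norm (y - z)"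
          using y z l2.dist.d_ng[of y z] by (auto simp: Sfin_iff finite_seqs_eq)
        then show "l2_norm (- y - - z) < e" using y(2) by simp
      qed (use y in simp)
      then show "\<exists>e>0. \<forall>y\<in>Sfin n. l2_norm (y - z) < e \<longrightarrow>
          y \<in> {x \<in> topspace Sinf_top. - x \<in> U} \<inter> Sfin n"
        using e(1) Sfin_subset_Sinf[of n] by (intro exI[of _ e]) auto
    qed auto
  qed auto
qed simp

lemma RPinf_top_eq: "RPinf_top = quotient_top Sinf_top (orbit2 uminus)"
  unfolding RPinf_top_def orbit_space_def by (metis subtopology_topspace topspace_Sinf_top)

lemma normalize_near:
  assumes z: "z \<in> seqs_upto n - {0}" and e: "e > 0"
  obtains \<delta> where "\<delta> > 0"
    "\<And>v. v \<in> seqs_upto n - {0} \<Longrightarrow> l2_norm (v - z) < \<delta> \<Longrightarrow>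
        l2_norm (l2.normalize v - l2.normalize z) < e"
proof -
  have pos: "v \<in> finite_seqs" "l2_norm v > 0" if "v \<in> seqs_upto n - {0}" for v
    using that l2_norm_pos seqs_upto_subset_finite_seqs[of n] by auto
  show ?thesis
  proof (rule that[of "e * l2_norm z / 2"])
    show "l2_norm (l2.normalize v - l2.normalize z) < e"
      if "v \<in> seqs_upto n - {0}" "l2_norm (v - z) < e * l2_norm z / 2" for v
      using that pos z by (intro l2.normalize_dist_less) auto
  qed (use pos[OF z] e in auto)
qed

lemma locally_constant_finite_seqs:
  assumes W: "W \<subseteq> finite_seqs" and loc: "\<And>n. l2.locally_constant_on (seqs_upto n \<inter> W) f"
    and seg: "\<And>n x k. x \<in> seqs_upto n \<inter> W \<Longrightarrow> n < k \<Longrightarrow> closed_segment x (unit_seq k) \<subseteq> W"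
    and xy: "x \<in> W" "y \<in> W"
  shows "f x = f y"
proof -
  have "x \<in> finite_seqs" "y \<in> finite_seqs" using xy W by auto
  then obtain n where n: "x \<in> seqs_upto n" "y \<in> seqs_upto n" by (rule finite_seqs_pairE)
  have "f v = f (unit_seq (Suc n))" if v: "v \<in> seqs_upto n \<inter> W" for v
  proof (rule l2.locally_constant_on_segment[OF loc[of "Suc n"]])
    have "v \<in> seqs_upto (Suc n)" "unit_seq (Suc n) \<in> seqs_upto (Suc n)"
      using v seqs_upto_mono[of n "Suc n"] unit_seq_in_seqs_upto by auto
    then have "closed_segment v (unit_seq (Suc n)) \<subseteq> seqs_upto (Suc n)"
      by (intro closed_segment_subset subspace_imp_convex subspace_seqs_upto)
    then show "closed_segment v (unit_seq (Suc n)) \<subseteq> seqs_upto (Suc n) \<inter> W" using seg[OF v] by simp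
  qed (use W in auto)
  then show ?thesis using n xy by simp
qed

lemma segment_unit_seq_coord:
  assumes "x \<in> seqs_upto n" "n < k" "v \<in> closed_segment x (unit_seq k)"
  shows "v = x \<or> v k \<noteq> 0"
proof -
  obtain t where t: "v = (1 - t) *\<^sub>R x + t *\<^sub>R unit_seq k" using assms(3) by (auto simp: in_segment)
  then have "v k = t" using assms unfolding seqs_upto_def unit_seq_def by auto
  then show ?thesis using t by (cases "t = 0") auto
qed

lemma locally_constant_Sinf:
  assumes loc: "\<And>z. z \<in> Sinf \<Longrightarrow> \<exists>V. openin Sinf_top V \<and> z \<in> V \<and> (\<forall>x\<in>V. f x = f z)"
    and xy: "x \<in> Sinf" "y \<in> Sinf"
  shows "f x = f y"
proof -
  have "f (l2.normalize x) = f (l2.normalize y)"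
  proof (rule locally_constant_finite_seqs[of "finite_seqs - {0}" "\<lambda>x. f (l2.normalize x)"])
    fix n
    show "l2.locally_constant_on (seqs_upto n \<inter> (finite_seqs - {0})) (\<lambda>x. f (l2.normalize x))"
      unfolding l2.locally_constant_on_def
    proof
      fix z assume "z \<in> seqs_upto n \<inter> (finite_seqs - {0})"
      then have z: "z \<in> seqs_upto n - {0}" by auto
      then have zS: "l2.normalize z \<in> Sfin n" by (rule normalize_in_Sfin)
      then obtain V where V: "openin Sinf_top V" "l2.normalize z \<in> V"
        "\<forall>x\<in>V. f x = f (l2.normalize z)"
        using loc[of "l2.normalize z"] Sfin_subset_Sinf by blast
      obtain e where e: "e > 0" "\<And>y. y \<in> Sfin n \<Longrightarrow> l2_norm (y - l2.normalize z) < e \<Longrightarrow> y \<in> V"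
        using openin_Sinf_topE[OF V(1,2) zS] by blast
      obtain \<delta> where "\<delta> > 0"
        "\<And>v. v \<in> seqs_upto n - {0} \<Longrightarrow> l2_norm (v - z) < \<delta> \<Longrightarrow>
            l2_norm (l2.normalize v - l2.normalize z) < e"
        by (rule normalize_near[OF z e(1)]) blast
      then show "\<exists>e>0. \<forall>x\<in>seqs_upto n \<inter> (finite_seqs - {0}). l2_norm (x - z) < e \<longrightarrow>
          f (l2.normalize x) = f (l2.normalize z)"
        using e(2) V(3) normalize_in_Sfin by (intro exI[of _ \<delta>]) auto
    qed
  next
    fix n x k assume x: "x \<in> seqs_upto n \<inter> (finite_seqs - {0})" and k: "n < (k::nat)"
    have "closed_segment x (unit_seq k) \<subseteq> finite_seqs"
      using x unit_seq_in_seqs_upto[of k k] seqs_upto_subset_finite_seqs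
      by (intro closed_segment_subset subspace_imp_convex subspace_finite_seqs) auto
    moreover have "0 \<notin> closed_segment x (unit_seq k)"
      using segment_unit_seq_coord[of x n k 0] x k by auto
    ultimately show "closed_segment x (unit_seq k) \<subseteq> finite_seqs - {0}" by blast
  qed (use xy in \<open>auto simp: Sinf_iff\<close>)
  then show ?thesis using xy l2.normalize_eq_self by (simp add: Sinf_iff)
qed

subsection \<open>The generator of the cohomology of the infinite projective space\<close>

definition primitive_on_sphere :: "(nat \<Rightarrow> real) set cochain \<Rightarrow> ((nat \<Rightarrow> real) \<Rightarrow> bit) \<Rightarrow> bool" where
  "primitive_on_sphere \<phi> h \<longleftrightarrow> (\<forall>x\<in>Sinf. \<exists>V. openin Sinf_top V \<and> x \<in> V \<and>
     (\<forall>a\<in>V. \<forall>b\<in>V. \<phi> [orbit2 uminus a, orbit2 uminus b] = h a + h b))"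

definition cocycle_on_sphere :: "(nat \<Rightarrow> real) set cochain \<Rightarrow> bool" where
  "cocycle_on_sphere \<phi> \<longleftrightarrow> (\<forall>x\<in>Sinf. \<exists>U. openin Sinf_top U \<and> x \<in> U \<and>
     (\<forall>a\<in>U. \<forall>b\<in>U. \<forall>c\<in>U. \<phi> [orbit2 uminus a, orbit2 uminus b] + \<phi> [orbit2 uminus b, orbit2 uminus c]
        + \<phi> [orbit2 uminus a, orbit2 uminus c] = 0))"

definition slit_seqs :: "real \<Rightarrow> (nat \<Rightarrow> real) set" where
  "slit_seqs \<sigma> = {x. 0 < \<sigma> * x 0 \<or> (\<exists>i>0. x i \<noteq> 0)}"

lemma slit_seqs_star:
  assumes \<sigma>: "\<sigma> \<noteq> 0" and x: "x \<in> slit_seqs \<sigma>"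
  shows "closed_segment (\<sigma> *\<^sub>R unit_seq 0) x \<subseteq> slit_seqs \<sigma>"
proof
  fix v assume "v \<in> closed_segment (\<sigma> *\<^sub>R unit_seq 0) x"
  then obtain t where t: "0 \<le> t" "t \<le> 1" "v = (1 - t) *\<^sub>R (\<sigma> *\<^sub>R unit_seq 0) + t *\<^sub>R x"
    by (auto simp: in_segment)
  have v0: "\<sigma> * v 0 = (1 - t) * \<sigma>\<^sup>2 + t * (\<sigma> * x 0)" and vi: "v i = t * x i" if "i > 0" for i
    using that unfolding t(3) unit_seq_def by (simp_all add: power2_eq_square algebra_simps)
  have "\<sigma>\<^sup>2 > 0" using \<sigma> by simp
  show "v \<in> slit_seqs \<sigma>"
  proof (cases "t = 0 \<or> (\<forall>i>0. x i = 0)")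
    case True
    have "0 < (1 - t) * \<sigma>\<^sup>2 + t * (\<sigma> * x 0)"
    proof (cases "t = 0")
      case False
      then have "0 < t * (\<sigma> * x 0)" using True x t(1) unfolding slit_seqs_def by auto
      then show ?thesis using t(2) by (intro add_nonneg_pos) auto
    qed (use \<open>\<sigma>\<^sup>2 > 0\<close> in simp)
    then show ?thesis unfolding slit_seqs_def using v0[of 1] by simp
  next
    case False
    then show ?thesis unfolding slit_seqs_def using vi by auto
  qed
qed

lemma relatively_open_slit_seqs:
  "l2.relatively_open_in (seqs_upto n - {0}) (seqs_upto n \<inter> slit_seqs \<sigma>)"
  unfolding l2.relatively_open_in_def
proof
  fix z assume z: "z \<in> seqs_upto n \<inter> slit_seqs \<sigma>"
  have coord: "\<bar>x i - z i\<bar> \<le> l2_norm (x - z)" if "x \<in> seqs_upto n" for x i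
    using abs_le_l2_norm[of "x - z" i] seqs_upto_subset_finite_seqs[of n] that z by auto
  consider "0 < \<sigma> * z 0" | i where "i > 0" "z i \<noteq> 0" using z unfolding slit_seqs_def by auto
  then obtain i where i: "z i \<noteq> 0" "\<And>x. \<bar>x i - z i\<bar> < \<bar>z i\<bar> \<Longrightarrow> x \<in> slit_seqs \<sigma>"
  proof cases
    case 1
    have "0 < \<sigma> * x 0" if "\<bar>x 0 - z 0\<bar> < \<bar>z 0\<bar>" for x :: "nat \<Rightarrow> real"
      using 1 that by (auto simp: zero_less_mult_iff abs_if split: if_splits)
    moreover have "z 0 \<noteq> 0" using 1 by auto
    ultimately show ?thesis using that[of 0] unfolding slit_seqs_def by auto
  next
    case 2
    show ?thesis
    proof (rule that[of i])
      show "x \<in> slit_seqs \<sigma>" if "\<bar>x i - z i\<bar> < \<bar>z i\<bar>" for x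
      proof -
        have "x i \<noteq> 0" using that by auto
        then show ?thesis using 2(1) unfolding slit_seqs_def by auto
      qed
    qed (rule 2(2))
  qed
  have "x \<in> seqs_upto n \<inter> slit_seqs \<sigma>" if "x \<in> seqs_upto n - {0}" "l2_norm (x - z) < \<bar>z i\<bar>" for x
    using that coord[of x i] i(2)[of x] by auto
  then show "\<exists>e>0. \<forall>x\<in>seqs_upto n - {0}. l2_norm (x - z) < e \<longrightarrow> x \<in> seqs_upto n \<inter> slit_seqs \<sigma>"
    using i(1) by (intro exI[of _ "\<bar>z i\<bar>"]) auto
qed

lemma local_primitive_slit_seqs:
  assumes "l2.local_cocycle_on (seqs_upto n - {0}) \<phi>" "\<sigma> \<noteq> 0"
  shows "l2.local_primitive_on (seqs_upto n \<inter> slit_seqs \<sigma>) \<phi> (segment_integral \<phi> (\<sigma> *\<^sub>R unit_seq 0))"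
proof (rule l2.local_primitive_on_star)
  have base: "\<sigma> *\<^sub>R unit_seq 0 \<in> seqs_upto n"
    using subspace_scale[OF subspace_seqs_upto] unit_seq_in_seqs_upto by blast
  then show "\<sigma> *\<^sub>R unit_seq 0 \<in> seqs_upto n \<inter> slit_seqs \<sigma>"
    using assms(2) by (auto simp: slit_seqs_def unit_seq_def zero_less_mult_iff)
  show "closed_segment (\<sigma> *\<^sub>R unit_seq 0) x \<subseteq> seqs_upto n \<inter> slit_seqs \<sigma>"
    if "x \<in> seqs_upto n \<inter> slit_seqs \<sigma>" for x
    using that slit_seqs_star[OF assms(2)]
      closed_segment_subset[OF base _ subspace_imp_convex[OF subspace_seqs_upto]]
    by auto
  have "seqs_upto n \<inter> slit_seqs \<sigma> \<subseteq> seqs_upto n - {0}" by (auto simp: slit_seqs_def)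
  then show "l2.local_cocycle_on (seqs_upto n \<inter> slit_seqs \<sigma>) \<phi>"
    by (rule l2.local_cocycle_on_subset[OF assms(1)])
qed (use seqs_upto_subset_finite_seqs in auto)

lemma slit_seqs_Un: "slit_seqs 1 \<union> slit_seqs (- 1) = - {0}"
proof (intro equalityI subsetI)
  fix x :: "nat \<Rightarrow> real" assume "x \<in> - {0}"
  then obtain i where "x i \<noteq> 0" by (auto simp: fun_eq_iff)
  then show "x \<in> slit_seqs 1 \<union> slit_seqs (- 1)" unfolding slit_seqs_def by (cases "i = 0") auto
qed (auto simp: slit_seqs_def)

lemma slit_seqs_Int: "slit_seqs 1 \<inter> slit_seqs (- 1) = {x. \<exists>i>0. x i \<noteq> 0}"
  unfolding slit_seqs_def by auto

lemma slit_primitives_sum_constant: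
  assumes prim: "\<And>n. l2.local_primitive_on (seqs_upto n \<inter> slit_seqs 1) \<phi> h"
      "\<And>n. l2.local_primitive_on (seqs_upto n \<inter> slit_seqs (- 1)) \<phi> h'"
    and x: "x \<in> finite_seqs \<inter> (slit_seqs 1 \<inter> slit_seqs (- 1))"
  shows "h x + h' x = h (unit_seq 1) + h' (unit_seq 1)"
proof -
  define W where "W = finite_seqs \<inter> (slit_seqs 1 \<inter> slit_seqs (- 1))"
  show ?thesis
  proof (rule locally_constant_finite_seqs[of W "\<lambda>x. h x + h' x"])
    fix n
    have "seqs_upto n \<inter> W = seqs_upto n \<inter> slit_seqs 1 \<inter> (seqs_upto n \<inter> slit_seqs (- 1))"
      unfolding W_def using seqs_upto_subset_finite_seqs[of n] by auto
    then show "l2.locally_constant_on (seqs_upto n \<inter> W) (\<lambda>x. h x + h' x)"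
      using l2.local_primitives_sum_locally_constant[OF prim(1)[of n] prim(2)[of n]] by simp
    fix x k assume x: "x \<in> seqs_upto n \<inter> W" and k: "n < (k::nat)"
    have "closed_segment x (unit_seq k) \<subseteq> finite_seqs"
      using x unit_seq_in_seqs_upto[of k k] seqs_upto_subset_finite_seqs
      by (intro closed_segment_subset subspace_imp_convex subspace_finite_seqs) auto
    moreover have "v \<in> {x. \<exists>i>0. x i \<noteq> 0}" if "v \<in> closed_segment x (unit_seq k)" for v
      using segment_unit_seq_coord[of x n k v] that x k unfolding W_def slit_seqs_Int
      by (cases "v = x") (auto intro: exI[of _ k])
    ultimately show "closed_segment x (unit_seq k) \<subseteq> W" unfolding W_def slit_seqs_Int by blast
  next
    show "unit_seq 1 \<in> W"
      using unit_seq_in_Sinf[of 1] unfolding W_def slit_seqs_Int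
      by (auto simp: Sinf_iff unit_seq_def)
  qed (use x in \<open>auto simp: W_def\<close>)
qed

text \<open>The complements of two opposite rays are star-shaped and their intersection is connected, so
  the primitives on them differ by a constant.\<close>

lemma local_primitive_nonzero_seqs:
  assumes coc: "\<And>n. l2.local_cocycle_on (seqs_upto n - {0}) \<phi>"
  obtains h where "\<And>n. l2.local_primitive_on (seqs_upto n - {0}) \<phi> h"
proof -
  define h where "h \<sigma> = segment_integral \<phi> (\<sigma> *\<^sub>R unit_seq 0)" for \<sigma> :: real
  define c where "c = h 1 (unit_seq 1) + h (- 1) (unit_seq 1)"
  have prim: "l2.local_primitive_on (seqs_upto n \<inter> slit_seqs \<sigma>) \<phi> (h \<sigma>)" if "\<sigma> \<noteq> 0" for n \<sigma>
    unfolding h_def using coc that by (rule local_primitive_slit_seqs)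
  have "l2.local_primitive_on (seqs_upto n - {0}) \<phi>
      (\<lambda>x. if x \<in> slit_seqs 1 then h 1 x else h (- 1) x + c)" for n
  proof -
    have union: "seqs_upto n \<inter> slit_seqs 1 \<union> seqs_upto n \<inter> slit_seqs (- 1) = seqs_upto n - {0}"
      using slit_seqs_Un by auto
    have "l2.local_primitive_on (seqs_upto n \<inter> slit_seqs 1 \<union> seqs_upto n \<inter> slit_seqs (- 1)) \<phi>
       (\<lambda>x. if x \<in> seqs_upto n \<inter> slit_seqs 1 then h 1 x else h (- 1) x + c)"
    proof (rule l2.local_primitive_on_Un)
      show "h 1 x + h (- 1) x = c"
        if "x \<in> seqs_upto n \<inter> slit_seqs 1 \<inter> (seqs_upto n \<inter> slit_seqs (- 1))" for x
        unfolding c_def using that seqs_upto_subset_finite_seqs[of n]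
        by (intro slit_primitives_sum_constant[OF prim prim]) auto
    qed (use prim relatively_open_slit_seqs union in auto)
    then show ?thesis unfolding union by (rule l2.local_primitive_on_cong) auto
  qed
  then show ?thesis using that by blast
qed

lemma primitive_on_sphereI:
  assumes coc: "cocycle_on_sphere \<phi>"
    and prim: "\<And>n. l2.local_primitive_on (Sfin n) (\<lambda>a b. \<phi> [orbit2 uminus a, orbit2 uminus b]) h"
  shows "primitive_on_sphere \<phi> h"
  unfolding primitive_on_sphere_def
proof
  fix x assume x: "x \<in> Sinf"
  let ?\<phi> = "\<lambda>a b. \<phi> [orbit2 uminus a, orbit2 uminus b]"
  obtain U where U: "openin Sinf_top U" "x \<in> U"
    and zero: "\<And>a b c. a \<in> U \<Longrightarrow> b \<in> U \<Longrightarrow> c \<in> U \<Longrightarrow> ?\<phi> a b + ?\<phi> b c + ?\<phi> a c = 0"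
    using coc x unfolding cocycle_on_sphere_def by meson
  define V where "V = {z \<in> U. ?\<phi> x z = h x + h z}"
  have "openin Sinf_top V"
    unfolding openin_Sinf_top l2.relatively_open_in_def
  proof (intro conjI allI ballI)
    show "V \<subseteq> Sinf" using U(1) unfolding V_def openin_Sinf_top by auto
    fix n z assume z: "z \<in> V \<inter> Sfin n"
    obtain e1 where e1: "e1 > 0" "\<And>y. y \<in> Sfin n \<Longrightarrow> l2_norm (y - z) < e1 \<Longrightarrow> y \<in> U"
      using openin_Sinf_topE[OF U(1), of z n] z unfolding V_def by auto
    obtain e2 where e2: "e2 > 0" "\<And>y. y \<in> Sfin n \<Longrightarrow> l2_norm (y - z) < e2 \<Longrightarrow> ?\<phi> z y = h z + h y"
      using prim[of n] z unfolding l2.local_primitive_on_def by blast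
    have "y \<in> V" if y: "y \<in> Sfin n" "l2_norm (y - z) < min e1 e2" for y
    proof -
      have "y \<in> U" "?\<phi> z y = h z + h y" using e1 e2 y by auto
      moreover have "?\<phi> x z = h x + h z" using z unfolding V_def by auto
      ultimately show ?thesis using zero[OF U(2), of z y] z unfolding V_def
        by (cases "?\<phi> x y"; cases "h x"; cases "h z"; cases "h y") auto
    qed
    then show "\<exists>e>0. \<forall>y\<in>Sfin n. l2_norm (y - z) < e \<longrightarrow> y \<in> V \<inter> Sfin n"
      using e1(1) e2(1) by (intro exI[of _ "min e1 e2"]) auto
  qed
  moreover have "x \<in> V" using zero[OF U(2) U(2) U(2)] U(2) unfolding V_def by auto
  moreover have "?\<phi> a b = h a + h b" if "a \<in> V" "b \<in> V" for a b
    using zero[OF U(2), of a b] that unfolding V_def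
    by (cases "?\<phi> a b"; cases "h x"; cases "h a"; cases "h b") auto
  ultimately show "\<exists>V. openin Sinf_top V \<and> x \<in> V \<and> (\<forall>a\<in>V. \<forall>b\<in>V. ?\<phi> a b = h a + h b)" by blast
qed

lemma cocycle_on_sphereI:
  assumes "as_cocycle RPinf_top 1 \<phi>"
  shows "cocycle_on_sphere \<phi>"
  unfolding cocycle_on_sphere_def
proof
  fix x assume "x \<in> Sinf"
  let ?\<phi> = "\<lambda>a b. \<phi> [orbit2 uminus a, orbit2 uminus b]"
  obtain U where U: "openin Sinf_top U" "x \<in> U"
    "\<forall>xs. length xs = Suc (Suc 1) \<longrightarrow> set xs \<subseteq> U \<longrightarrow> as_cobound \<phi> (map (orbit2 uminus) xs) = 0"
    using assms \<open>x \<in> Sinf\<close>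
    unfolding as_cocycle_def RPinf_top_eq sphere.as_locally_zero_orbits_iff topspace_Sinf_top
    by blast
  have "?\<phi> a b + ?\<phi> b c + ?\<phi> a c = 0" if "a \<in> U" "b \<in> U" "c \<in> U" for a b c
    using U(3)[rule_format, of "[a, b, c]"] that by (auto simp: as_cobound_Cons ac_simps)
  then show "\<exists>U. openin Sinf_top U \<and> x \<in> U \<and> (\<forall>a\<in>U. \<forall>b\<in>U. \<forall>c\<in>U. ?\<phi> a b + ?\<phi> b c + ?\<phi> a c = 0)"
    using U(1,2) by blast
qed

lemma local_cocycle_on_normalize:
  assumes "cocycle_on_sphere \<phi>"
  shows "l2.local_cocycle_on (seqs_upto n - {0})
    (\<lambda>x y. \<phi> [orbit2 uminus (l2.normalize x), orbit2 uminus (l2.normalize y)])"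
  unfolding l2.local_cocycle_on_def
proof
  let ?\<phi> = "\<lambda>a b. \<phi> [orbit2 uminus a, orbit2 uminus b]"
  let ?\<nu> = l2.normalize
  fix z assume z: "z \<in> seqs_upto n - {0}"
  have zS: "?\<nu> z \<in> Sfin n" by (rule normalize_in_Sfin[OF z])
  then have "?\<nu> z \<in> Sinf" using Sfin_subset_Sinf by blast
  then obtain U where U: "openin Sinf_top U" "?\<nu> z \<in> U"
    "\<forall>a\<in>U. \<forall>b\<in>U. \<forall>c\<in>U. ?\<phi> a b + ?\<phi> b c + ?\<phi> a c = 0"
    using bspec[OF assms[unfolded cocycle_on_sphere_def]] by meson
  obtain e where e: "e > 0" "\<And>y. y \<in> Sfin n \<Longrightarrow> l2_norm (y - ?\<nu> z) < e \<Longrightarrow> y \<in> U"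
    using openin_Sinf_topE[OF U(1,2) zS] by blast
  obtain \<delta> where \<delta>: "\<delta> > 0"
    "\<And>v. v \<in> seqs_upto n - {0} \<Longrightarrow> l2_norm (v - z) < \<delta> \<Longrightarrow> l2_norm (?\<nu> v - ?\<nu> z) < e"
    by (rule normalize_near[OF z e(1)]) blast
  have "?\<nu> v \<in> U" if "v \<in> seqs_upto n - {0}" "l2_norm (v - z) < \<delta>" for v
    using that e(2) \<delta>(2) normalize_in_Sfin by blast
  then show "\<exists>e>0. \<forall>x\<in>seqs_upto n - {0}. \<forall>y\<in>seqs_upto n - {0}. \<forall>w\<in>seqs_upto n - {0}.
     l2_norm (x - z) < e \<longrightarrow> l2_norm (y - z) < e \<longrightarrow> l2_norm (w - z) < e \<longrightarrow>
     ?\<phi> (?\<nu> x) (?\<nu> y) + ?\<phi> (?\<nu> y) (?\<nu> w) + ?\<phi> (?\<nu> x) (?\<nu> w) = 0"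
    using \<delta>(1) U(3) by blast
qed

lemma RPinf_cocycle_has_primitive:
  assumes "as_cocycle RPinf_top 1 \<phi>"
  obtains h where "primitive_on_sphere \<phi> h"
proof -
  let ?\<phi> = "\<lambda>a b. \<phi> [orbit2 uminus a, orbit2 uminus b]"
  let ?\<nu> = l2.normalize
  note coc = cocycle_on_sphereI[OF assms]
  obtain h where h: "\<And>n. l2.local_primitive_on (seqs_upto n - {0}) (\<lambda>x y. ?\<phi> (?\<nu> x) (?\<nu> y)) h"
    using local_primitive_nonzero_seqs[OF local_cocycle_on_normalize[OF coc]] by blast
  have "l2.local_primitive_on (Sfin n) ?\<phi> h" for n
    unfolding l2.local_primitive_on_def
  proof
    fix z assume z: "z \<in> Sfin n"
    have \<nu>: "?\<nu> x = x" if "x \<in> Sfin n" for x using that by (simp add: Sfin_iff l2.normalize_eq_self)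
    obtain e where e: "e > 0"
      "\<forall>x\<in>seqs_upto n - {0}. l2_norm (x - z) < e \<longrightarrow> ?\<phi> (?\<nu> z) (?\<nu> x) = h z + h x"
      using h[of n] z Sfin_subset_nonzero unfolding l2.local_primitive_on_def by blast
    have "?\<phi> z x = h z + h x" if x: "x \<in> Sfin n" "l2_norm (x - z) < e" for x
      using e(2) x Sfin_subset_nonzero unfolding \<nu>[OF z] by (metis \<nu> subsetD)
    then show "\<exists>e>0. \<forall>x\<in>Sfin n. l2_norm (x - z) < e \<longrightarrow> ?\<phi> z x = h z + h x" using e(1) by blast
  qed
  then show ?thesis using that primitive_on_sphereI[OF coc] by blast
qed

lemma not_class_zero_of_odd_primitive:
  assumes s: "odd_on uminus Sinf s" and prim: "primitive_on_sphere \<phi> s"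
  shows "\<not> as_class_zero RPinf_top 1 \<phi>"
proof
  assume "as_class_zero RPinf_top 1 \<phi>"
  then obtain \<Psi> where \<Psi>: "as_locally_zero RPinf_top 1 (\<lambda>ys. \<phi> ys + as_cobound \<Psi> ys)"
    unfolding as_class_zero_def by auto
  define t where "t x = s x + \<Psi> [orbit2 uminus x]" for x
  have "\<exists>V. openin Sinf_top V \<and> z \<in> V \<and> (\<forall>x\<in>V. t x = t z)" if z: "z \<in> Sinf" for z
  proof -
    obtain V where V: "openin Sinf_top V" "z \<in> V" "\<forall>xs. length xs = Suc 1 \<longrightarrow> set xs \<subseteq> V \<longrightarrow>
        \<phi> (map (orbit2 uminus) xs) + as_cobound \<Psi> (map (orbit2 uminus) xs) = 0"
      using \<Psi> z unfolding RPinf_top_eq sphere.as_locally_zero_orbits_iff topspace_Sinf_top by blast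
    obtain W where W: "openin Sinf_top W" "z \<in> W"
      "\<forall>a\<in>W. \<forall>b\<in>W. \<phi> [orbit2 uminus a, orbit2 uminus b] = s a + s b"
      using prim z unfolding primitive_on_sphere_def by blast
    have "t x = t z" if "x \<in> V \<inter> W" for x
    proof -
      have "s z + s x + (\<Psi> [orbit2 uminus x] + \<Psi> [orbit2 uminus z]) = 0"
        using V(2) V(3)[rule_format, of "[z, x]"] W(2,3) that by (simp add: as_cobound_Cons)
      then show ?thesis unfolding t_def
        by (cases "s z"; cases "s x"; cases "\<Psi> [orbit2 uminus x]"; cases "\<Psi> [orbit2 uminus z]") auto
    qed
    moreover have "openin Sinf_top (V \<inter> W)" using V(1) W(1) by (rule openin_Int)
    ultimately show ?thesis using V(2) W(2) by blast
  qed
  then have "t (unit_seq 0) = t (- unit_seq 0)"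
    by (rule locally_constant_Sinf) (auto simp: unit_seq_in_Sinf)
  then show False
    unfolding t_def using odd_onD[OF s unit_seq_in_Sinf, of 0] orbit2_ng[of uminus "unit_seq 0"]
    by (cases "s (unit_seq 0)"; cases "\<Psi> [orbit2 uminus (unit_seq 0)]") auto
qed

lemma RPinf_nontrivial_cocycle: "\<exists>\<phi>. as_cocycle RPinf_top 1 \<phi> \<and> \<not> as_class_zero RPinf_top 1 \<phi>"
proof -
  obtain s where s: "odd_on uminus Sinf s"
    by (rule odd_on_exists[of Sinf uminus]) (auto simp: uminus_eq_self_iff Sinf_iff)
  define B where "B x = {y\<in>Sinf. l2_norm (x - y) < l2_norm (x - - x) / 4}" for x
  have B: "openin Sinf_top (B x)" "x \<in> B x" if "x \<in> Sinf" for x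
  proof -
    show "openin Sinf_top (B x)" unfolding B_def by (rule openin_Sinf_top_ball[OF that])
    show "x \<in> B x" using that l2.N_diff_uminus[of x] unfolding B_def Sinf_iff by simp
  qed
  have "Sinf \<subseteq> finite_seqs" by (auto simp: Sinf_iff)
  then obtain \<phi> where
    \<phi>: "\<And>x xs. x \<in> Sinf \<Longrightarrow> set xs \<subseteq> B x \<Longrightarrow> \<phi> (map (orbit2 uminus) xs) = diff_prod s xs"
      "\<And>x xs. x \<in> Sinf \<Longrightarrow> set xs \<subseteq> B x \<Longrightarrow>
          as_cobound \<phi> (map (orbit2 uminus) xs) = as_cobound (diff_prod s) xs"
    unfolding B_def using l2.dist.orbit_cochain_descends[OF _ invariant_on_diff_prod[OF s]] by blast
  have "as_cocycle RPinf_top 1 \<phi>"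
    unfolding as_cocycle_def RPinf_top_eq sphere.as_locally_zero_orbits_iff
  proof
    fix x assume "x \<in> topspace Sinf_top"
    then show "\<exists>V. openin Sinf_top V \<and> x \<in> V \<and> (\<forall>xs. length xs = Suc (Suc 1) \<longrightarrow> set xs \<subseteq> V \<longrightarrow>
        as_cobound \<phi> (map (orbit2 uminus) xs) = 0)"
      using B \<phi>(2) by (intro exI[of _ "B x"]) auto
  qed
  moreover have "primitive_on_sphere \<phi> s"
    unfolding primitive_on_sphere_def
  proof
    fix x assume x: "x \<in> Sinf"
    have "\<phi> [orbit2 uminus a, orbit2 uminus b] = s a + s b" if "a \<in> B x" "b \<in> B x" for a b
      using \<phi>(1)[OF x, of "[a, b]"] that by simp
    then show "\<exists>V. openin Sinf_top V \<and> x \<in> V \<and>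
        (\<forall>a\<in>V. \<forall>b\<in>V. \<phi> [orbit2 uminus a, orbit2 uminus b] = s a + s b)"
      using B[OF x] by blast
  qed
  ultimately show ?thesis using not_class_zero_of_odd_primitive[OF s] by blast
qed

lemma primitive_antipodal_sum_constant:
  assumes h: "primitive_on_sphere \<phi> h" and xy: "x \<in> Sinf" "y \<in> Sinf"
  shows "h x + h (- x) = h y + h (- y)"
proof (rule locally_constant_Sinf[of "\<lambda>x. h x + h (- x)", OF _ xy])
  fix z assume z: "z \<in> Sinf"
  obtain V where V: "openin Sinf_top V" "z \<in> V"
    "\<And>a b. a \<in> V \<Longrightarrow> b \<in> V \<Longrightarrow> \<phi> [orbit2 uminus a, orbit2 uminus b] = h a + h b"
    using h z unfolding primitive_on_sphere_def by meson
  obtain V' where V': "openin Sinf_top V'" "- z \<in> V'"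
    "\<And>a b. a \<in> V' \<Longrightarrow> b \<in> V' \<Longrightarrow> \<phi> [orbit2 uminus a, orbit2 uminus b] = h a + h b"
    using h z uminus_Sinf[of z] unfolding primitive_on_sphere_def by meson
  have "openin Sinf_top {x \<in> topspace Sinf_top. - x \<in> V'}"
    using V'(1) sphere.continuous_ng unfolding continuous_map by blast
  then have "openin Sinf_top (V \<inter> {x \<in> Sinf. - x \<in> V'})" using openin_Int[OF V(1)] by simp
  moreover have "h x + h (- x) = h z + h (- z)" if "x \<in> V" "- x \<in> V'" for x
  proof -
    have "orbit2 uminus (- v) = orbit2 uminus v" for v :: "nat \<Rightarrow> real" by (rule orbit2_ng) simp
    then have "h z + h x = h (- z) + h (- x)"
      using V(3)[of z x] V'(3)[of "- z" "- x"] V(2) V'(2) that by simp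
    then show ?thesis by (cases "h x"; cases "h z"; cases "h (- x)"; cases "h (- z)") auto
  qed
  ultimately show "\<exists>V. openin Sinf_top V \<and> z \<in> V \<and> (\<forall>x\<in>V. h x + h (- x) = h z + h (- z))"
    using V(2) V'(2) z by blast
qed

lemma even_primitive_class_zero:
  assumes h: "primitive_on_sphere \<phi> h" and even: "\<And>x. x \<in> Sinf \<Longrightarrow> h (- x) = h x"
  shows "as_class_zero RPinf_top 1 \<phi>"
proof -
  define \<Psi> where "\<Psi> os = h (SOME u. u \<in> hd os)" for os :: "(nat \<Rightarrow> real) set list"
  have \<Psi>: "\<Psi> [orbit2 uminus y] = h y" if "y \<in> Sinf" for y
    using some_in_orbit2[of uminus y] even[OF that] unfolding \<Psi>_def by auto
  have "as_locally_zero RPinf_top 1 (\<lambda>ys. \<phi> ys + as_cobound \<Psi> ys)"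
    unfolding RPinf_top_eq sphere.as_locally_zero_orbits_iff topspace_Sinf_top
  proof
    fix x assume "x \<in> Sinf"
    then obtain V where V: "openin Sinf_top V" "x \<in> V"
      "\<And>a b. a \<in> V \<Longrightarrow> b \<in> V \<Longrightarrow> \<phi> [orbit2 uminus a, orbit2 uminus b] = h a + h b"
      using h unfolding primitive_on_sphere_def by meson
    have "\<phi> (map (orbit2 uminus) xs) + as_cobound \<Psi> (map (orbit2 uminus) xs) = 0"
      if xs: "length xs = Suc 1" "set xs \<subseteq> V" for xs
    proof -
      obtain a b where "xs = [a, b]" using xs(1) by (auto simp: length_Suc_conv)
      moreover from this have "a \<in> V" "b \<in> V" using xs(2) by auto
      moreover from this have "a \<in> Sinf" "b \<in> Sinf" using V(1) unfolding openin_Sinf_top by auto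
      ultimately show ?thesis using V(3) \<Psi> by (simp add: as_cobound_Cons ac_simps)
    qed
    then show "\<exists>V. openin Sinf_top V \<and> x \<in> V \<and> (\<forall>xs. length xs = Suc 1 \<longrightarrow> set xs \<subseteq> V \<longrightarrow>
        \<phi> (map (orbit2 uminus) xs) + as_cobound \<Psi> (map (orbit2 uminus) xs) = 0)"
      using V(1,2) by blast
  qed
  then show ?thesis unfolding as_class_zero_def by auto
qed

lemma omega_RP_odd_primitive:
  obtains h where "odd_on uminus Sinf h" "primitive_on_sphere omega_RP h"
proof -
  have \<omega>: "as_cocycle RPinf_top 1 omega_RP" "\<not> as_class_zero RPinf_top 1 omega_RP"
    using someI_ex[OF RPinf_nontrivial_cocycle] unfolding omega_RP_def by auto
  obtain h where h: "primitive_on_sphere omega_RP h"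
    using RPinf_cocycle_has_primitive[OF \<omega>(1)] by blast
  have "h (- x) = h x + 1" if x: "x \<in> Sinf" for x
  proof (rule ccontr)
    assume "h (- x) \<noteq> h x + 1"
    then have "h x + h (- x) = 0" by (cases "h x"; cases "h (- x)") auto
    then have "h (- y) = h y" if "y \<in> Sinf" for y
      using primitive_antipodal_sum_constant[OF h x that] by (simp add: bit_add_eq_0_iff)
    then show False using even_primitive_class_zero[OF h] \<omega>(2) by blast
  qed
  then show ?thesis using that[of h] h by (simp add: odd_on_def)
qed

subsection \<open>The index in terms of invariant cochains\<close>

locale metric_involution = Metric_space M d + isometric_involution M d ng
  for M :: "'a set" and d :: "'a \<Rightarrow> 'a \<Rightarrow> real" and ng :: "'a \<Rightarrow> 'a"
begin

lemma openin_subtopology_mtopology_iff: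
  assumes "A \<subseteq> M"
  shows "openin (subtopology mtopology A) S \<longleftrightarrow> S \<subseteq> A \<and> (\<forall>x\<in>S. \<exists>r>0. \<forall>y\<in>A. d x y < r \<longrightarrow> y \<in> S)"
proof -
  interpret A: Submetric M d A using assms by unfold_locales
  have "A.sub.mball x r \<subseteq> S \<longleftrightarrow> (\<forall>y\<in>A. d x y < r \<longrightarrow> y \<in> S)" if "x \<in> A" for x r
    using that by auto
  then show ?thesis unfolding A.mtopology_submetric[symmetric] A.sub.openin_mtopology by blast
qed

definition odd_map :: "'a set \<Rightarrow> ('a \<Rightarrow> nat \<Rightarrow> real) \<Rightarrow> bool" where
  "odd_map A g \<longleftrightarrow> continuous_map (subtopology mtopology A) Sinf_top g \<and> (\<forall>u\<in>A. g (ng u) = - g u)"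

context
  fixes A :: "'a set"
  assumes A: "A \<subseteq> M" and ng_A: "\<And>x. x \<in> A \<Longrightarrow> ng x \<in> A" and free: "\<And>x. x \<in> A \<Longrightarrow> ng x \<noteq> x"
begin

lemma topspace_subtopology_A: "topspace (subtopology mtopology A) = A"
  using A by auto

lemma openin_ball_in_subset: "x \<in> M \<Longrightarrow> openin (subtopology mtopology A) {y\<in>A. d x y < r}"
  unfolding openin_subtopology_mtopology_iff[OF A]
proof (intro conjI ballI)
  fix z assume x: "x \<in> M" and z: "z \<in> {y\<in>A. d x y < r}"
  have "d x y < r" if y: "y \<in> A" "d z y < r - d x z" for y
  proof -
    have "d x y \<le> d x z + d z y" using x z y A by (intro d_triangle) auto
    then show ?thesis using y by simp
  qed
  then show "\<exists>r'>0. \<forall>y\<in>A. d z y < r' \<longrightarrow> y \<in> {y\<in>A. d x y < r}"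
    using z by (intro exI[of _ "r - d x z"]) auto
qed auto

lemma involution_space_subtopology: "involution_space (subtopology mtopology A) ng"
proof
  show "continuous_map (subtopology mtopology A) (subtopology mtopology A) ng"
    unfolding continuous_map topspace_subtopology_A
  proof (intro conjI allI impI)
    fix U assume U: "openin (subtopology mtopology A) U"
    show "openin (subtopology mtopology A) {x \<in> A. ng x \<in> U}"
      unfolding openin_subtopology_mtopology_iff[OF A]
    proof (intro conjI ballI)
      fix x assume x: "x \<in> {x \<in> A. ng x \<in> U}"
      then obtain r where r: "r > 0" "\<forall>y\<in>A. d (ng x) y < r \<longrightarrow> y \<in> U"
        using U unfolding openin_subtopology_mtopology_iff[OF A] by blast
      have "ng y \<in> U" if y: "y \<in> A" "d x y < r" for y
      proof -
        have "d (ng x) (ng y) = d x y" using x y A by (intro d_ng) auto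
        then show ?thesis using r(2) ng_A y by simp
      qed
      then show "\<exists>r>0. \<forall>y\<in>A. d x y < r \<longrightarrow> y \<in> {x \<in> A. ng x \<in> U}" using r(1) by auto
    qed auto
  qed (use ng_A in auto)
qed (use A ng_ng in auto)

interpretation involution_space "subtopology mtopology A" ng
  by (rule involution_space_subtopology)

lemma as_locally_zero_orbit_space_iff:
  "as_locally_zero (orbit_space mtopology ng A) q \<Phi> \<longleftrightarrow> (\<forall>x\<in>A. \<exists>r>0.
     \<forall>xs. length xs = Suc q \<longrightarrow> set xs \<subseteq> {y\<in>A. d x y < r} \<longrightarrow> \<Phi> (map (orbit2 ng) xs) = 0)"
  unfolding orbit_space_def as_locally_zero_orbits_iff topspace_subtopology_A
proof (intro ball_cong refl iffI)
  fix x assume x: "x \<in> A"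
  assume "\<exists>V. openin (subtopology mtopology A) V \<and> x \<in> V \<and>
    (\<forall>xs. length xs = Suc q \<longrightarrow> set xs \<subseteq> V \<longrightarrow> \<Phi> (map (orbit2 ng) xs) = 0)"
  then obtain V where V: "openin (subtopology mtopology A) V" "x \<in> V"
    "\<forall>xs. length xs = Suc q \<longrightarrow> set xs \<subseteq> V \<longrightarrow> \<Phi> (map (orbit2 ng) xs) = 0"
    by blast
  obtain r where "r > 0" "\<forall>y\<in>A. d x y < r \<longrightarrow> y \<in> V"
    using V(1,2) unfolding openin_subtopology_mtopology_iff[OF A] by blast
  then show "\<exists>r>0. \<forall>xs. length xs = Suc q \<longrightarrow> set xs \<subseteq> {y\<in>A. d x y < r} \<longrightarrow> \<Phi> (map (orbit2 ng) xs) = 0"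
    using V(3) by (intro exI[of _ r]) (auto simp: subset_iff)
next
  fix x assume x: "x \<in> A"
  assume "\<exists>r>0. \<forall>xs. length xs = Suc q \<longrightarrow> set xs \<subseteq> {y\<in>A. d x y < r} \<longrightarrow> \<Phi> (map (orbit2 ng) xs) = 0"
  then obtain r where r: "r > 0"
    "\<forall>xs. length xs = Suc q \<longrightarrow> set xs \<subseteq> {y\<in>A. d x y < r} \<longrightarrow> \<Phi> (map (orbit2 ng) xs) = 0" by blast
  have "x \<in> M" using x A by auto
  then show "\<exists>V. openin (subtopology mtopology A) V \<and> x \<in> V \<and>
    (\<forall>xs. length xs = Suc q \<longrightarrow> set xs \<subseteq> V \<longrightarrow> \<Phi> (map (orbit2 ng) xs) = 0)"
    using openin_ball_in_subset[of x r] r x by (intro exI[of _ "{y\<in>A. d x y < r}"]) auto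
qed

context
  fixes g :: "'a \<Rightarrow> nat \<Rightarrow> real"
  assumes g: "odd_map A g"
begin

lemma odd_map_in_Sinf: "x \<in> A \<Longrightarrow> g x \<in> Sinf"
  using g A unfolding odd_map_def continuous_map by (auto simp: Int_absorb1)

lemma odd_map_preimage:
  assumes "openin Sinf_top V" "x \<in> A" "g x \<in> V"
  obtains r where "r > 0" "\<And>y. y \<in> A \<Longrightarrow> d x y < r \<Longrightarrow> g y \<in> V"
proof -
  have "openin (subtopology mtopology A) {x \<in> A. g x \<in> V}"
    using g assms(1) unfolding odd_map_def continuous_map topspace_subtopology_A by blast
  then show ?thesis
    using assms(2,3) that unfolding openin_subtopology_mtopology_iff[OF A] by blast
qed

lemma induced_orbit_map_orbit: "x \<in> A \<Longrightarrow> induced_orbit_map g (orbit2 ng x) = orbit2 uminus (g x)"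
  using g some_in_orbit2[of ng x] orbit2_ng[of uminus "g x"]
  unfolding induced_orbit_map_def odd_map_def by auto

lemma omega_pullback_local:
  assumes x: "x \<in> A" and h: "primitive_on_sphere omega_RP h"
  obtains r where "r > 0" "\<And>xs. length xs = Suc q \<Longrightarrow> set xs \<subseteq> {y\<in>A. d x y < r} \<Longrightarrow>
    as_pullback (induced_orbit_map g) (as_pow omega_RP q) (map (orbit2 ng) xs) = diff_prod (\<lambda>x. h (g x)) xs"
proof -
  obtain V where V: "openin Sinf_top V" "g x \<in> V"
    "\<forall>a\<in>V. \<forall>b\<in>V. omega_RP [orbit2 uminus a, orbit2 uminus b] = h a + h b"
    using h odd_map_in_Sinf[OF x] unfolding primitive_on_sphere_def by blast
  obtain r where r: "r > 0" "\<And>y. y \<in> A \<Longrightarrow> d x y < r \<Longrightarrow> g y \<in> V"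
    using odd_map_preimage[OF V(1) x V(2)] by blast
  show ?thesis
  proof (rule that[OF r(1)])
    fix xs assume xs: "length xs = Suc q" "set xs \<subseteq> {y\<in>A. d x y < r}"
    have "map (induced_orbit_map g) (map (orbit2 ng) xs) = map (\<lambda>x. orbit2 uminus (g x)) xs"
      using xs induced_orbit_map_orbit by auto
    moreover have "as_pow omega_RP q (map (\<lambda>x. orbit2 uminus (g x)) xs)
        = diff_prod (\<lambda>x. h (g x)) xs"
    proof (rule as_pow_map_eq_diff_prod[OF xs(1)])
      fix a b assume "a \<in> set xs" "b \<in> set xs"
      then have "g a \<in> V" "g b \<in> V" using xs(2) r(2) by auto
      then show "omega_RP [orbit2 uminus (g a), orbit2 uminus (g b)] = h (g a) + h (g b)"
        using V(3) by blast
    qed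
    ultimately show "as_pullback (induced_orbit_map g) (as_pow omega_RP q) (map (orbit2 ng) xs)
        = diff_prod (\<lambda>x. h (g x)) xs"
      by (simp only: as_pullback_def)
  qed
qed

lemma odd_on_comp_odd_map: "odd_on uminus Sinf h \<Longrightarrow> odd_on ng A (\<lambda>x. h (g x))"
  using g odd_onD[OF _ odd_map_in_Sinf] unfolding odd_on_def odd_map_def by auto

lemma invariant_on_orbit_pullback: "invariant_on ng A (as_pullback (orbit2 ng) \<Psi>)"
proof (rule invariant_onI)
  fix xs assume "set xs \<subseteq> A"
  then have "map (orbit2 ng) (map ng xs) = map (orbit2 ng) xs"
    using A ng_ng by (auto intro!: orbit2_ng)
  then show "as_pullback (orbit2 ng) \<Psi> (map ng xs) = as_pullback (orbit2 ng) \<Psi> xs"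
    unfolding as_pullback_def by metis
qed

lemma omega_power_zero_of_class_zero:
  assumes q: "0 < q"
    and zero: "as_class_zero (orbit_space mtopology ng A) q
      (as_pullback (induced_orbit_map g) (as_pow omega_RP q))" (is "as_class_zero _ _ ?\<phi>")
  shows "omega_power_zero d ng A q"
proof -
  obtain h where h: "odd_on uminus Sinf h" "primitive_on_sphere omega_RP h"
    by (rule omega_RP_odd_primitive)
  obtain \<Psi> where \<Psi>: "as_locally_zero (orbit_space mtopology ng A) q (\<lambda>ys. ?\<phi> ys + as_cobound \<Psi> ys)"
    using zero q unfolding as_class_zero_def by auto
  define \<psi> where "\<psi> xs = (if xs = [] then 0 else as_pullback (orbit2 ng) \<Psi> xs)" for xs
  have "\<exists>r>0. \<forall>ys. length ys = Suc q \<longrightarrow> set ys \<subseteq> {y\<in>A. d x y < r} \<longrightarrow>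
      diff_prod (\<lambda>x. h (g x)) ys = as_cobound \<psi> ys" if x: "x \<in> A" for x
  proof -
    obtain r where r: "r > 0" "\<forall>xs. length xs = Suc q \<longrightarrow> set xs \<subseteq> {y\<in>A. d x y < r} \<longrightarrow>
        ?\<phi> (map (orbit2 ng) xs) + as_cobound \<Psi> (map (orbit2 ng) xs) = 0"
      using \<Psi> x unfolding as_locally_zero_orbit_space_iff by blast
    obtain r' where r': "r' > 0" "\<And>xs. length xs = Suc q \<Longrightarrow> set xs \<subseteq> {y\<in>A. d x y < r'} \<Longrightarrow>
        ?\<phi> (map (orbit2 ng) xs) = diff_prod (\<lambda>x. h (g x)) xs"
      by (rule omega_pullback_local[OF x h(2)]) blast
    have "diff_prod (\<lambda>x. h (g x)) ys = as_cobound \<psi> ys"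
      if ys: "length ys = Suc q" "set ys \<subseteq> {y\<in>A. d x y < min r r'}" for ys
    proof -
      have "?\<phi> (map (orbit2 ng) ys) + as_cobound \<Psi> (map (orbit2 ng) ys) = 0"
        "?\<phi> (map (orbit2 ng) ys) = diff_prod (\<lambda>x. h (g x)) ys"
        using ys r(2) r'(2) by auto
      moreover have "as_cobound \<psi> ys = as_cobound (as_pullback (orbit2 ng) \<Psi>) ys"
        using q ys(1) by (intro as_cobound_cong) (auto simp: \<psi>_def)
      ultimately show ?thesis by (simp add: as_cobound_pullback bit_add_eq_0_iff)
    qed
    then show ?thesis using r(1) r'(1) by (intro exI[of _ "min r r'"]) auto
  qed
  then obtain e where e: "\<And>x. x \<in> A \<Longrightarrow> 0 < e x"
    "\<And>x ys. x \<in> A \<Longrightarrow> length ys = Suc q \<Longrightarrow> set ys \<subseteq> {y\<in>A. d x y < e x} \<Longrightarrow>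
      diff_prod (\<lambda>x. h (g x)) ys = as_cobound \<psi> ys"
    by metis
  have "omega_power_primitive d ng A q e (\<lambda>x. h (g x)) \<psi>"
    unfolding omega_power_primitive_def
  proof (intro conjI allI impI)
    show "odd_on ng A (\<lambda>x. h (g x))" by (rule odd_on_comp_odd_map[OF h(1)])
    show "invariant_on ng A \<psi>"
      using invariant_on_orbit_pullback[of \<Psi>] unfolding \<psi>_def invariant_on_def by simp
    fix ys assume "length ys = Suc q" "small_tuple d A e ys"
    then show "diff_prod (\<lambda>x. h (g x)) ys = as_cobound \<psi> ys"
      using e(2) unfolding small_tuple_def by (auto simp: subset_iff)
  qed (simp add: \<psi>_def)
  then show ?thesis by (rule omega_power_zeroI[rotated]) (rule e(1))
qed

lemma class_zero_of_omega_power_zero: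
  assumes q: "0 < q" and zero: "omega_power_zero d ng A q"
  shows "as_class_zero (orbit_space mtopology ng A) q
      (as_pullback (induced_orbit_map g) (as_pow omega_RP q))" (is "as_class_zero _ _ ?\<phi>")
proof -
  obtain h where h: "odd_on uminus Sinf h" "primitive_on_sphere omega_RP h"
    by (rule omega_RP_odd_primitive)
  let ?s = "\<lambda>x. h (g x)"
  obtain e s \<psi> where e: "\<And>x. x \<in> A \<Longrightarrow> 0 < e x" and s: "omega_power_primitive d ng A q e s \<psi>"
    using zero by (elim omega_power_zeroE) blast
  define \<psi>' where "\<psi>' t = \<psi> t + diff_prod_homotopy s ?s t" for t
  have prim: "omega_power_primitive d ng A q e ?s \<psi>'"
    unfolding \<psi>'_def
    by (rule omega_power_primitive_change_section[OF s odd_on_comp_odd_map[OF h(1)]])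
  obtain \<Psi> where \<Psi>: "\<And>x xs. x \<in> A \<Longrightarrow> set xs \<subseteq> {y\<in>A. d x y < d x (ng x) / 4} \<Longrightarrow>
      as_cobound \<Psi> (map (orbit2 ng) xs) = as_cobound \<psi>' xs"
    by (rule orbit_cochain_descends[OF A omega_power_primitiveD(3)[OF prim]]) (rule that)
  have "as_locally_zero (orbit_space mtopology ng A) q (\<lambda>ys. ?\<phi> ys + as_cobound \<Psi> ys)"
    unfolding as_locally_zero_orbit_space_iff
  proof
    fix x assume x: "x \<in> A"
    obtain r where r: "r > 0" "\<And>xs. length xs = Suc q \<Longrightarrow> set xs \<subseteq> {y\<in>A. d x y < r} \<Longrightarrow>
        ?\<phi> (map (orbit2 ng) xs) = diff_prod ?s xs"
      by (rule omega_pullback_local[OF x h(2)]) blast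
    have "?\<phi> (map (orbit2 ng) xs) + as_cobound \<Psi> (map (orbit2 ng) xs) = 0"
      if xs: "length xs = Suc q" "set xs \<subseteq> {y\<in>A. d x y < min (min r (e x)) (d x (ng x) / 4)}" for xs
    proof -
      have "diff_prod ?s xs = as_cobound \<psi>' xs"
        using xs x by (intro omega_power_primitiveD(4)[OF prim]) (auto simp: small_tuple_def)
      moreover have "as_cobound \<Psi> (map (orbit2 ng) xs) = as_cobound \<psi>' xs"
        using xs by (intro \<Psi>[OF x]) auto
      moreover have "?\<phi> (map (orbit2 ng) xs) = diff_prod ?s xs" using xs by (intro r(2)) auto
      ultimately show ?thesis by simp
    qed
    moreover have "0 < d x (ng x)" using x A ng_A free by (metis mdist_pos_less subsetD)
    ultimately show "\<exists>r>0. \<forall>xs. length xs = Suc q \<longrightarrow> set xs \<subseteq> {y\<in>A. d x y < r} \<longrightarrow>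
        ?\<phi> (map (orbit2 ng) xs) + as_cobound \<Psi> (map (orbit2 ng) xs) = 0"
      using r(1) e[OF x] by (intro exI[of _ "min (min r (e x)) (d x (ng x) / 4)"]) auto
  qed
  then show ?thesis using q unfolding as_class_zero_def by auto
qed

lemma class_zero_iff_omega_power_zero:
  "as_class_zero (orbit_space mtopology ng A) q (as_pullback (induced_orbit_map g) (as_pow omega_RP q))
     \<longleftrightarrow> omega_power_zero d ng A q"
proof (cases "q = 0")
  case True
  have "as_locally_zero (orbit_space mtopology ng A) 0
      (as_pullback (induced_orbit_map g) (as_pow omega_RP 0)) \<longleftrightarrow> A = {}"
  proof
    assume zero: "as_locally_zero (orbit_space mtopology ng A) 0
      (as_pullback (induced_orbit_map g) (as_pow omega_RP 0))"
    show "A = {}"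
    proof (rule ccontr)
      assume "A \<noteq> {}"
      then obtain x where x: "x \<in> A" by blast
      then obtain r where r: "r > 0" "\<forall>xs. length xs = Suc 0 \<longrightarrow> set xs \<subseteq> {y\<in>A. d x y < r} \<longrightarrow>
          as_pullback (induced_orbit_map g) (as_pow omega_RP 0) (map (orbit2 ng) xs) = 0"
        using zero unfolding as_locally_zero_orbit_space_iff by blast
      have "d x x = 0" using x A by auto
      then show False using r(1) r(2)[rule_format, of "[x]"] x by (simp add: as_pullback_def)
    qed
  qed (unfold as_locally_zero_orbit_space_iff, simp)
  moreover have "omega_power_zero d ng A 0 \<longleftrightarrow> A = {}"
    using not_omega_power_zero_0[of _ A d ng] d_refl A omega_power_zero_empty by blast
  ultimately show ?thesis using True by (simp add: as_class_zero_def)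
next
  case False
  then show ?thesis
    using omega_power_zero_of_class_zero class_zero_of_omega_power_zero by blast
qed

end

lemma FR_index_ge_iff:
  assumes m: "1 \<le> m"
  shows "enat m \<le> FR_index mtopology ng A \<longleftrightarrow> (\<exists>g. odd_map A g) \<and> \<not> omega_power_zero d ng A (m - 1)"
proof -
  define S where "S = {k. k \<ge> 1 \<and> (\<exists>g. odd_map A g) \<and> \<not> omega_power_zero d ng A (k - 1)}"
  have "(\<exists>g. continuous_map (subtopology mtopology A) Sinf_top g \<and> (\<forall>u\<in>A. g (ng u) = - g u) \<and>
          \<not> as_class_zero (orbit_space mtopology ng A) (k - 1)
               (as_pullback (induced_orbit_map g) (as_pow omega_RP (k - 1))))
      \<longleftrightarrow> (\<exists>g. odd_map A g) \<and> \<not> omega_power_zero d ng A (k - 1)" for k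
    using class_zero_iff_omega_power_zero[of _ "k - 1"] unfolding odd_map_def by blast
  then have index_eq: "FR_index mtopology ng A = Sup (enat ` S)"
    unfolding FR_index_def S_def by (intro arg_cong[where f = Sup]) auto
  show ?thesis
  proof
    assume index_ge: "enat m \<le> FR_index mtopology ng A"
    have "\<exists>k\<in>S. m \<le> k"
    proof (rule ccontr)
      assume "\<not> ?thesis"
      then have "\<forall>x\<in>enat ` S. x \<le> enat (m - 1)" by auto
      then have "Sup (enat ` S) \<le> enat (m - 1)" by (intro Sup_least) auto
      then have "enat m \<le> enat (m - 1)" using index_ge index_eq by (metis order_trans)
      then show False using m by simp
    qed
    then obtain k where k: "k \<in> S" "m \<le> k" by auto
    then show "(\<exists>g. odd_map A g) \<and> \<not> omega_power_zero d ng A (m - 1)"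
      unfolding S_def using omega_power_zero_le[of "m - 1" "k - 1" d ng A]
      by (auto simp: diff_le_mono)
  next
    assume "(\<exists>g. odd_map A g) \<and> \<not> omega_power_zero d ng A (m - 1)"
    then have "m \<in> S" unfolding S_def using m by auto
    then show "enat m \<le> FR_index mtopology ng A" unfolding index_eq by (intro Sup_upper) auto
  qed
qed

lemma FR_index_eqI:
  assumes "1 \<le> m" "odd_map A g" "\<not> omega_power_zero d ng A (m - 1)" "omega_power_zero d ng A m"
  shows "FR_index mtopology ng A = enat m"
proof -
  have "enat m \<le> FR_index mtopology ng A" "\<not> enat (Suc m) \<le> FR_index mtopology ng A"
    using FR_index_ge_iff[of m] FR_index_ge_iff[of "Suc m"] assms by auto
  then show ?thesis by (cases "FR_index mtopology ng A") auto
qed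

lemma odd_map_normalize:
  assumes f: "\<And>u. u \<in> A \<Longrightarrow> f u \<in> seqs_upto n - {0}" "\<And>u. u \<in> A \<Longrightarrow> f (ng u) = - f u"
    and cont: "\<And>u e. u \<in> A \<Longrightarrow> e > 0 \<Longrightarrow> \<exists>\<delta>>0. \<forall>v\<in>A. d u v < \<delta> \<longrightarrow> l2_norm (f v - f u) < e"
  shows "odd_map A (\<lambda>u. l2.normalize (f u))"
  unfolding odd_map_def continuous_map topspace_subtopology_A
proof (intro conjI allI impI ballI)
  show "l2.normalize (f (ng u)) = - l2.normalize (f u)" if "u \<in> A" for u
  proof -
    have "f u \<in> finite_seqs" using f(1)[OF that] seqs_upto_subset_finite_seqs by auto
    then show ?thesis using f(2)[OF that] l2.normalize_minus by simp
  qed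
  show "(\<lambda>u. l2.normalize (f u)) ` A \<subseteq> topspace Sinf_top"
    using normalize_in_Sfin[OF f(1)] Sfin_subset_Sinf by auto
  fix U assume U: "openin Sinf_top U"
  show "openin (subtopology mtopology A) {u \<in> A. l2.normalize (f u) \<in> U}"
    unfolding openin_subtopology_mtopology_iff[OF A]
  proof (intro conjI ballI)
    fix u assume u: "u \<in> {u \<in> A. l2.normalize (f u) \<in> U}"
    obtain e where e: "e > 0" "\<And>y. y \<in> Sfin n \<Longrightarrow> l2_norm (y - l2.normalize (f u)) < e \<Longrightarrow> y \<in> U"
      using openin_Sinf_topE[OF U _ normalize_in_Sfin[OF f(1)]] u by blast
    obtain \<epsilon> where \<epsilon>: "\<epsilon> > 0" "\<And>v. v \<in> seqs_upto n - {0} \<Longrightarrow> l2_norm (v - f u) < \<epsilon> \<Longrightarrow>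
        l2_norm (l2.normalize v - l2.normalize (f u)) < e"
      using normalize_near[OF f(1) e(1)] u by blast
    obtain \<delta> where "\<delta> > 0" "\<forall>v\<in>A. d u v < \<delta> \<longrightarrow> l2_norm (f v - f u) < \<epsilon>"
      using cont[OF _ \<epsilon>(1)] u by blast
    then show "\<exists>r>0. \<forall>v\<in>A. d u v < r \<longrightarrow> v \<in> {u \<in> A. l2.normalize (f u) \<in> U}"
      using e(2) \<epsilon>(2) f(1) normalize_in_Sfin[OF f(1)] by (intro exI[of _ \<delta>]) auto
  qed auto
qed

end

end

subsection \<open>Barycentric subdivision of cochains\<close>

declare as_cobound_cong [fundef_cong]

fun subdivide :: "('a list \<Rightarrow> 'a) \<Rightarrow> 'a cochain \<Rightarrow> 'a cochain" where
  "subdivide b \<phi> xs = (if xs = [] then \<phi> [] else as_cobound (subdivide b (\<lambda>t. \<phi> (b xs # t))) xs)"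

fun subdivide_homotopy :: "('a list \<Rightarrow> 'a) \<Rightarrow> 'a cochain \<Rightarrow> 'a cochain" where
  "subdivide_homotopy b \<phi> xs = (if xs = [] then 0
     else \<phi> (b xs # xs) + as_cobound (subdivide_homotopy b (\<lambda>t. \<phi> (b xs # t))) xs)"

declare subdivide.simps [simp del] subdivide_homotopy.simps [simp del]

lemma subdivide_Nil [simp]: "subdivide b \<phi> [] = \<phi> []"
  by (simp add: subdivide.simps)

lemma subdivide_nonempty:
  "xs \<noteq> [] \<Longrightarrow> subdivide b \<phi> xs = as_cobound (subdivide b (\<lambda>t. \<phi> (b xs # t))) xs"
  by (simp add: subdivide.simps)

lemma subdivide_homotopy_Nil [simp]: "subdivide_homotopy b \<phi> [] = 0"
  by (simp add: subdivide_homotopy.simps)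

lemma subdivide_homotopy_nonempty:
  "xs \<noteq> [] \<Longrightarrow> subdivide_homotopy b \<phi> xs
     = \<phi> (b xs # xs) + as_cobound (subdivide_homotopy b (\<lambda>t. \<phi> (b xs # t))) xs"
  by (simp add: subdivide_homotopy.simps)

lemma subdivide_add: "subdivide b (\<lambda>t. \<phi> t + \<psi> t) xs = subdivide b \<phi> xs + subdivide b \<psi> xs"
proof (induction xs arbitrary: \<phi> \<psi> rule: length_induct)
  case (1 xs)
  show ?case
  proof (cases "xs = []")
    case False
    have "as_cobound (subdivide b (\<lambda>t. \<phi> (b xs # t) + \<psi> (b xs # t))) xs
        = as_cobound (\<lambda>t. subdivide b (\<lambda>t. \<phi> (b xs # t)) t + subdivide b (\<lambda>t. \<psi> (b xs # t)) t) xs"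
      by (rule as_cobound_cong) (simp add: 1)
    then show ?thesis using False by (simp add: subdivide_nonempty as_cobound_add)
  qed simp
qed

lemma subdivide_homotopy_add:
  "subdivide_homotopy b (\<lambda>t. \<phi> t + \<psi> t) xs = subdivide_homotopy b \<phi> xs + subdivide_homotopy b \<psi> xs"
proof (induction xs arbitrary: \<phi> \<psi> rule: length_induct)
  case (1 xs)
  show ?case
  proof (cases "xs = []")
    case False
    have "as_cobound (subdivide_homotopy b (\<lambda>t. \<phi> (b xs # t) + \<psi> (b xs # t))) xs
        = as_cobound (\<lambda>t. subdivide_homotopy b (\<lambda>t. \<phi> (b xs # t)) t + subdivide_homotopy b (\<lambda>t. \<psi> (b xs # t)) t) xs"
      by (rule as_cobound_cong) (simp add: 1)
    then show ?thesis using False by (simp add: subdivide_homotopy_nonempty as_cobound_add ac_simps)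
  qed simp
qed

lemma subdivide_zero [simp]: "subdivide b (\<lambda>_. 0) xs = 0"
  using subdivide_add[of b "\<lambda>_. 0" "\<lambda>_. 0" xs] by simp

lemma subdivide_homotopy_zero [simp]: "subdivide_homotopy b (\<lambda>_. 0) xs = 0"
  using subdivide_homotopy_add[of b "\<lambda>_. 0" "\<lambda>_. 0" xs] by simp

lemma subdivide_as_cobound: "subdivide b (as_cobound \<phi>) xs = as_cobound (subdivide b \<phi>) xs"
proof (induction xs arbitrary: \<phi> rule: length_induct)
  case (1 xs)
  show ?case
  proof (cases "xs = []")
    case False
    define \<phi>' where "\<phi>' = (\<lambda>t. \<phi> (b xs # t))"
    have "subdivide b (as_cobound \<phi>) xs = as_cobound (subdivide b (\<lambda>t. \<phi> t + as_cobound \<phi>' t)) xs"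
      using False by (simp add: subdivide_nonempty as_cobound_Cons \<phi>'_def)
    also have "\<dots> = as_cobound (\<lambda>t. subdivide b \<phi> t + as_cobound (subdivide b \<phi>') t) xs"
      by (rule as_cobound_cong) (simp add: 1 subdivide_add)
    also have "\<dots> = as_cobound (subdivide b \<phi>) xs + as_cobound (as_cobound (subdivide b \<phi>')) xs"
      by (rule as_cobound_add)
    finally show ?thesis by simp
  qed simp
qed

lemma subdivide_homotopy_as_cobound:
  "subdivide_homotopy b (as_cobound \<phi>) xs
      = \<phi> xs + subdivide b \<phi> xs + as_cobound (subdivide_homotopy b \<phi>) xs"
proof (induction xs arbitrary: \<phi> rule: length_induct)
  case (1 xs)
  show ?case
  proof (cases "xs = []")
    case False
    define \<phi>' where "\<phi>' = (\<lambda>t. \<phi> (b xs # t))"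
    have "as_cobound (subdivide_homotopy b (\<lambda>t. as_cobound \<phi> (b xs # t))) xs
        = as_cobound (subdivide_homotopy b (\<lambda>t. \<phi> t + as_cobound \<phi>' t)) xs"
      by (simp add: as_cobound_Cons \<phi>'_def)
    also have "\<dots> = as_cobound (\<lambda>t. subdivide_homotopy b \<phi> t
        + (\<phi>' t + subdivide b \<phi>' t + as_cobound (subdivide_homotopy b \<phi>') t)) xs"
      by (rule as_cobound_cong) (simp add: 1 subdivide_homotopy_add)
    also have "\<dots> = as_cobound (subdivide_homotopy b \<phi>) xs + (as_cobound \<phi>' xs + subdivide b \<phi> xs)"
      using False by (simp add: as_cobound_add subdivide_nonempty \<phi>'_def)
    finally show ?thesis using False
      by (simp add: subdivide_homotopy_nonempty as_cobound_Cons \<phi>'_def ac_simps)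
  qed simp
qed

context
  fixes ng :: "'a \<Rightarrow> 'a" and A :: "'a set" and b :: "'a list \<Rightarrow> 'a"
  assumes center: "\<And>xs. xs \<noteq> [] \<Longrightarrow> set xs \<subseteq> A \<Longrightarrow> b xs \<in> A \<and> b (map ng xs) = ng (b xs)"
begin

lemma subdivide_equivariant:
  assumes "\<And>t. set t \<subseteq> A \<Longrightarrow> \<phi> (map ng t) = \<phi>' t" "set xs \<subseteq> A"
  shows "subdivide b \<phi> (map ng xs) = subdivide b \<phi>' xs"
  using assms
proof (induction xs arbitrary: \<phi> \<phi>' rule: length_induct)
  case (1 xs)
  note IH = 1(1) and \<phi> = 1(2) and xs = 1(3)
  show ?case
  proof (cases "xs = []")
    case False
    note c = center[OF False xs]
    have "as_cobound (as_pullback ng (subdivide b (\<lambda>t. \<phi> (ng (b xs) # t)))) xs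
        = as_cobound (subdivide b (\<lambda>t. \<phi>' (b xs # t))) xs"
    proof (rule as_cobound_cong)
      fix t assume t: "length xs = Suc (length t)" "set t \<subseteq> set xs"
      have "\<phi> (ng (b xs) # map ng u) = \<phi>' (b xs # u)" if "set u \<subseteq> A" for u
        using \<phi>[of "b xs # u"] c that by auto
      then show "as_pullback ng (subdivide b (\<lambda>t. \<phi> (ng (b xs) # t))) t
          = subdivide b (\<lambda>t. \<phi>' (b xs # t)) t"
        unfolding as_pullback_def using xs t by (intro IH[rule_format]) auto
    qed
    then show ?thesis using False c by (simp add: subdivide_nonempty as_cobound_pullback)
  qed (use \<phi>[of "[]"] in auto)
qed

lemma subdivide_homotopy_equivariant:
  assumes "\<And>t. set t \<subseteq> A \<Longrightarrow> \<phi> (map ng t) = \<phi>' t" "set xs \<subseteq> A"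
  shows "subdivide_homotopy b \<phi> (map ng xs) = subdivide_homotopy b \<phi>' xs"
  using assms
proof (induction xs arbitrary: \<phi> \<phi>' rule: length_induct)
  case (1 xs)
  note IH = 1(1) and \<phi> = 1(2) and xs = 1(3)
  show ?case
  proof (cases "xs = []")
    case False
    note c = center[OF False xs]
    have "as_cobound (as_pullback ng (subdivide_homotopy b (\<lambda>t. \<phi> (ng (b xs) # t)))) xs
        = as_cobound (subdivide_homotopy b (\<lambda>t. \<phi>' (b xs # t))) xs"
    proof (rule as_cobound_cong)
      fix t assume t: "length xs = Suc (length t)" "set t \<subseteq> set xs"
      have "\<phi> (ng (b xs) # map ng u) = \<phi>' (b xs # u)" if "set u \<subseteq> A" for u
        using \<phi>[of "b xs # u"] c that by auto
      then show "as_pullback ng (subdivide_homotopy b (\<lambda>t. \<phi> (ng (b xs) # t))) t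
          = subdivide_homotopy b (\<lambda>t. \<phi>' (b xs # t)) t"
        unfolding as_pullback_def using xs t by (intro IH[rule_format]) auto
    qed
    moreover have "\<phi> (ng (b xs) # map ng xs) = \<phi>' (b xs # xs)" using \<phi>[of "b xs # xs"] c xs by auto
    ultimately show ?thesis
      using False c by (simp add: subdivide_homotopy_nonempty as_cobound_pullback)
  qed simp
qed

lemma invariant_on_subdivide: "invariant_on ng A \<phi> \<Longrightarrow> invariant_on ng A (subdivide b \<phi>)"
  unfolding invariant_on_def using subdivide_equivariant[of \<phi> \<phi>] by blast

lemma invariant_on_subdivide_homotopy:
  "invariant_on ng A \<phi> \<Longrightarrow> invariant_on ng A (subdivide_homotopy b \<phi>)"
  unfolding invariant_on_def using subdivide_homotopy_equivariant[of \<phi> \<phi>] by blast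

lemma invariant_on_subdivide_funpow:
  "invariant_on ng A \<phi> \<Longrightarrow> invariant_on ng A ((subdivide b ^^ n) \<phi>)"
  by (induction n) (auto intro: invariant_on_subdivide)

end

lemma subdivide_funpow_Nil: "(subdivide b ^^ n) \<phi> [] = \<phi> []"
  by (induction n) auto

lemma subdivide_funpow_add:
  "(subdivide b ^^ n) (\<lambda>t. \<phi> t + \<psi> t) = (\<lambda>t. (subdivide b ^^ n) \<phi> t + (subdivide b ^^ n) \<psi> t)"
  by (induction n) (auto simp: subdivide_add)

lemma subdivide_funpow_as_cobound:
  "(subdivide b ^^ n) (as_cobound \<phi>) = as_cobound ((subdivide b ^^ n) \<phi>)"
  by (induction n) (auto simp: subdivide_as_cobound)

lemma subdivide_funpow_zero: "(subdivide b ^^ n) (\<lambda>_. 0) = (\<lambda>_. 0)"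
  by (induction n) auto

lemma subdivide_funpow_cohomologous:
  assumes center: "\<And>xs. xs \<noteq> [] \<Longrightarrow> set xs \<subseteq> A \<Longrightarrow> b xs \<in> A \<and> b (map ng xs) = ng (b xs)"
    and coc: "as_cobound \<phi> = (\<lambda>_. 0)" and invariant: "invariant_on ng A \<phi>"
  shows "\<exists>\<epsilon>. invariant_on ng A \<epsilon> \<and> \<epsilon> [] = 0
      \<and> (\<forall>xs. (subdivide b ^^ n) \<phi> xs = \<phi> xs + as_cobound \<epsilon> xs)"
proof (induction n)
  case 0
  show ?case by (rule exI[of _ "\<lambda>_. 0"]) (auto simp: invariant_on_def)
next
  case (Suc n)
  then obtain \<epsilon> where \<epsilon>: "invariant_on ng A \<epsilon>" "\<epsilon> [] = 0"
    "\<And>xs. (subdivide b ^^ n) \<phi> xs = \<phi> xs + as_cobound \<epsilon> xs" by blast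
  define \<phi>\<^sub>n where "\<phi>\<^sub>n = (subdivide b ^^ n) \<phi>"
  have "as_cobound \<phi>\<^sub>n = (\<lambda>_. 0)"
    unfolding \<phi>\<^sub>n_def subdivide_funpow_as_cobound[symmetric] coc by (rule subdivide_funpow_zero)
  then have "\<phi>\<^sub>n xs + subdivide b \<phi>\<^sub>n xs + as_cobound (subdivide_homotopy b \<phi>\<^sub>n) xs = 0" for xs
    using subdivide_homotopy_as_cobound[of b \<phi>\<^sub>n xs] by simp
  then have "subdivide b \<phi>\<^sub>n xs = \<phi>\<^sub>n xs + as_cobound (subdivide_homotopy b \<phi>\<^sub>n) xs" for xs
    by (metis (no_types, lifting) add.assoc add.commute bit_add_eq_0_iff)
  moreover have "invariant_on ng A (subdivide_homotopy b \<phi>\<^sub>n)"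
    unfolding \<phi>\<^sub>n_def
    by (intro invariant_on_subdivide_homotopy invariant_on_subdivide_funpow center invariant)
  ultimately show ?case
    using \<epsilon> by (intro exI[of _ "\<lambda>t. \<epsilon> t + subdivide_homotopy b \<phi>\<^sub>n t"])
      (auto simp: \<phi>\<^sub>n_def[symmetric] invariant_on_add as_cobound_add add.assoc)
qed

text \<open>The fallback value \<open>hd xs\<close> keeps the barycentre of a tuple of nonzero vectors nonzero; it never
  occurs for tuples whose convex hull omits the origin.\<close>

definition barycenter :: "'a::real_vector list \<Rightarrow> 'a" where
  "barycenter xs = (let c = (1 / real (length xs)) *\<^sub>R sum_list xs in if c = 0 then hd xs else c)"

lemma barycenter_equivariant:
  fixes xs :: "'a::real_vector list"
  assumes "xs \<noteq> []" "set xs \<subseteq> - {0}"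
  shows "barycenter xs \<in> - {0} \<and> barycenter (map uminus xs) = - barycenter xs"
proof -
  have "sum_list (map uminus xs) = - sum_list xs" by (induction xs) auto
  moreover have "hd xs \<in> - {0}" using assms hd_in_set[of xs] by blast
  ultimately show ?thesis using assms unfolding barycenter_def by (auto simp: Let_def hd_map)
qed

lemma barycenter_mean:
  assumes "xs \<noteq> []" "0 \<notin> convex hull (set xs)"
  shows "barycenter xs = (1 / real (length xs)) *\<^sub>R sum_list xs"
    "barycenter xs \<in> convex hull (set xs)"
proof -
  have "(\<Sum>i<length xs. (1 / real (length xs)) *\<^sub>R xs ! i) \<in> convex hull (set xs)"
    using assms(1) by (intro convex_sum) (auto simp: convex_convex_hull hull_inc)
  also have "(\<Sum>i<length xs. (1 / real (length xs)) *\<^sub>R xs ! i)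
      = (1 / real (length xs)) *\<^sub>R sum_list xs"
    by (simp add: sum_list_sum_nth scaleR_sum_right atLeast0LessThan)
  finally have mean_in: "(1 / real (length xs)) *\<^sub>R sum_list xs \<in> convex hull (set xs)" .
  then have "(1 / real (length xs)) *\<^sub>R sum_list xs \<noteq> 0" using assms by metis
  then show "barycenter xs = (1 / real (length xs)) *\<^sub>R sum_list xs"
    unfolding barycenter_def by (simp add: Let_def)
  then show "barycenter xs \<in> convex hull (set xs)" using mean_in by simp
qed

text \<open>The factor by which barycentric subdivision shrinks the diameter of a tuple of \<open>n\<close> points.\<close>

definition mesh_factor :: "nat \<Rightarrow> real" where
  "mesh_factor n = (real n - 1) / real n"

lemma mesh_factor_nonneg: "0 < n \<Longrightarrow> 0 \<le> mesh_factor n"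
  by (simp add: mesh_factor_def)

lemma mesh_factor_less_1: "0 < n \<Longrightarrow> mesh_factor n < 1"
  by (simp add: mesh_factor_def)

lemma mesh_factor_mono: "0 < m \<Longrightarrow> m \<le> n \<Longrightarrow> mesh_factor m \<le> mesh_factor n"
  by (simp add: mesh_factor_def field_simps)

context seminormed
begin

definition mesh_le :: "'a list \<Rightarrow> real \<Rightarrow> bool" where
  "mesh_le xs D \<longleftrightarrow> (\<forall>x\<in>set xs. \<forall>y\<in>set xs. N (x - y) \<le> D)"

lemma mesh_leD: "mesh_le xs D \<Longrightarrow> x \<in> set xs \<Longrightarrow> y \<in> set xs \<Longrightarrow> N (x - y) \<le> D"
  by (simp add: mesh_le_def)

lemma mesh_le_mono: "mesh_le xs D \<Longrightarrow> D \<le> D' \<Longrightarrow> mesh_le xs D'"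
  unfolding mesh_le_def by fastforce

lemma mesh_le_subset: "mesh_le xs D \<Longrightarrow> set ys \<subseteq> set xs \<Longrightarrow> mesh_le ys D"
  unfolding mesh_le_def by blast

lemma convex_hull_subset_E: "S \<subseteq> E \<Longrightarrow> convex hull S \<subseteq> E"
  using subspace_E by (simp add: hull_minimal subspace_imp_convex)

lemma convex_seminorm_ball:
  assumes c: "c \<in> E"
  shows "convex {y\<in>E. N (y - c) \<le> r}"
  unfolding convex_def
proof (intro ballI allI impI)
  fix x y and u v :: real
  assume x: "x \<in> {y\<in>E. N (y - c) \<le> r}" and y: "y \<in> {y\<in>E. N (y - c) \<le> r}"
    and uv: "0 \<le> u" "0 \<le> v" "u + v = 1"
  have "u *\<^sub>R x + v *\<^sub>R y - c = u *\<^sub>R (x - c) + v *\<^sub>R (y - c) + ((u + v) *\<^sub>R c - c)"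
    by (simp add: algebra_simps)
  then have split: "u *\<^sub>R x + v *\<^sub>R y - c = u *\<^sub>R (x - c) + v *\<^sub>R (y - c)" using uv by simp
  have "N (u *\<^sub>R (x - c) + v *\<^sub>R (y - c)) \<le> u * N (x - c) + v * N (y - c)"
    using N_triangle[of "u *\<^sub>R (x - c)" "v *\<^sub>R (y - c)"] x y c uv by (simp add: N_hom)
  also have "\<dots> \<le> u * r + v * r" using x y uv by (intro add_mono mult_left_mono) auto
  also have "\<dots> = r" using uv by (metis distrib_right mult_1)
  finally show "u *\<^sub>R x + v *\<^sub>R y \<in> {y\<in>E. N (y - c) \<le> r}" using x y split by auto
qed

lemma N_sum: "finite I \<Longrightarrow> (\<And>i. i \<in> I \<Longrightarrow> f i \<in> E) \<Longrightarrow> (\<Sum>i\<in>I. f i) \<in> E \<and> N (\<Sum>i\<in>I. f i) \<le> (\<Sum>i\<in>I. N (f i))"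
proof (induction I rule: finite_induct)
  case (insert i I)
  then have "sum f I \<in> E" "N (sum f I) \<le> (\<Sum>i\<in>I. N (f i))" "f i \<in> E" by auto
  then show ?case using insert N_triangle[of "f i" "sum f I"] by auto
qed simp

lemma N_vertex_barycenter_le:
  assumes xs: "0 \<notin> convex hull (set xs)" "set xs \<subseteq> E" and mesh: "mesh_le xs D" and x: "x \<in> set xs"
  shows "N (x - barycenter xs) \<le> mesh_factor (length xs) * D"
proof -
  define n where "n = length xs"
  have xs_nonempty: "xs \<noteq> []" and n: "n > 0" using x unfolding n_def by auto
  have E: "x \<in> E" "barycenter xs \<in> E"
    using x xs(2) barycenter_mean[OF xs_nonempty xs(1)] convex_hull_subset_E[OF xs(2)] by auto
  obtain j where j: "j < n" "xs ! j = x" using x unfolding n_def by (metis in_set_conv_nth)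
  have "(\<Sum>i<n. (1 / real n) *\<^sub>R (xs ! i - x))
      = (1 / real n) *\<^sub>R (\<Sum>i<n. xs ! i) - (\<Sum>i<n. (1 / real n) *\<^sub>R x)"
    by (simp add: scaleR_diff_right sum_subtractf scaleR_sum_right)
  also have "(\<Sum>i<n. (1 / real n) *\<^sub>R x) = x" using n by (simp add: sum_constant_scaleR)
  also have "(\<Sum>i<n. xs ! i) = sum_list xs"
    unfolding n_def by (simp add: sum_list_sum_nth atLeast0LessThan)
  finally have "barycenter xs - x = (\<Sum>i<n. (1 / real n) *\<^sub>R (xs ! i - x))"
    using barycenter_mean[OF xs_nonempty xs(1)] unfolding n_def by simp
  then have "N (barycenter xs - x) \<le> (\<Sum>i<n. N ((1 / real n) *\<^sub>R (xs ! i - x)))"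
    using N_sum[of "{..<n}" "\<lambda>i. (1 / real n) *\<^sub>R (xs ! i - x)"] xs x unfolding n_def
    by (auto simp: subset_iff)
  also have "\<dots> = (\<Sum>i<n. (1 / real n) * N (xs ! i - x))"
    using xs x by (intro sum.cong refl) (subst N_hom, auto simp: n_def subset_iff)
  also have "\<dots> = (\<Sum>i\<in>{..<n} - {j}. (1 / real n) * N (xs ! i - x))"
    using j by (intro sum.mono_neutral_right) auto
  also have "\<dots> \<le> (\<Sum>i\<in>{..<n} - {j}. (1 / real n) * D)"
    using x mesh_leD[OF mesh] by (intro sum_mono mult_left_mono) (auto simp: n_def)
  also have "\<dots> = mesh_factor n * D" using j n by (simp add: of_nat_diff mesh_factor_def)
  finally show ?thesis using N_diff_commute[OF E] unfolding n_def by simp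
qed

lemma N_hull_barycenter_le:
  assumes xs: "xs \<noteq> []" "0 \<notin> convex hull (set xs)" "set xs \<subseteq> E" and mesh: "mesh_le xs D"
    and y: "y \<in> convex hull (set xs)"
  shows "N (y - barycenter xs) \<le> mesh_factor (length xs) * D"
proof -
  have "barycenter xs \<in> E" using barycenter_mean[OF xs(1,2)] convex_hull_subset_E[OF xs(3)] by auto
  then have "convex hull (set xs) \<subseteq> {y\<in>E. N (y - barycenter xs) \<le> mesh_factor (length xs) * D}"
    using N_vertex_barycenter_le[OF xs(2,3) mesh] xs(3)
    by (intro hull_minimal convex_seminorm_ball) auto
  then show ?thesis using y by auto
qed

lemma mesh_le_barycenter_Cons:
  assumes xs: "xs \<noteq> []" "0 \<notin> convex hull (set xs)" "set xs \<subseteq> E" and mesh: "mesh_le xs D" "0 \<le> D"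
    and u: "length xs = Suc (length u)" "set u \<subseteq> set xs"
    and t: "length t = length u" "set t \<subseteq> convex hull (set u)"
      "mesh_le t (mesh_factor (length u) * D)"
  shows "mesh_le (barycenter xs # t) (mesh_factor (length xs) * D)"
proof -
  let ?r = "mesh_factor (length xs) * D"
  have r0: "0 \<le> ?r" using xs(1) mesh(2) by (simp add: mesh_factor_nonneg)
  have hull: "set t \<subseteq> convex hull (set xs)" using t(2) hull_mono[OF u(2)] by blast
  have E: "set t \<subseteq> E" "barycenter xs \<in> E"
    using hull barycenter_mean[OF xs(1,2)] convex_hull_subset_E[OF xs(3)] by auto
  have b: "N (y - barycenter xs) \<le> ?r" if "y \<in> set t" for y
    using that hull by (intro N_hull_barycenter_le xs mesh(1)) auto
  have b': "N (barycenter xs - y) \<le> ?r" if "y \<in> set t" for y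
    using b[OF that] N_diff_commute[of y "barycenter xs"] E that by auto
  have "mesh_le t ?r"
  proof (cases "t = []")
    case False
    then have "mesh_factor (length u) \<le> mesh_factor (length xs)"
      using u(1) t(1) by (intro mesh_factor_mono) auto
    then show ?thesis using t(3) mesh(2) by (elim mesh_le_mono) (rule mult_right_mono)
  qed (simp add: mesh_le_def)
  then show ?thesis using b b' r0 unfolding mesh_le_def by auto
qed

lemma subdivide_eq_0:
  assumes "0 \<notin> convex hull (set xs)" "set xs \<subseteq> E" "0 \<le> D" "mesh_le xs D"
    and "\<And>t. length t = length xs \<Longrightarrow> set t \<subseteq> convex hull (set xs) \<Longrightarrow>
      mesh_le t (mesh_factor (length xs) * D) \<Longrightarrow> \<phi> t = 0"
  shows "subdivide barycenter \<phi> xs = 0"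
  using assms
proof (induction xs arbitrary: \<phi> rule: length_induct)
  case (1 xs)
  note IH = 1(1) and zero = 1(2) and xE = 1(3) and D0 = 1(4) and mesh = 1(5) and vanish = 1(6)
  show ?case
  proof (cases "xs = []")
    case True
    then show ?thesis using vanish[of "[]"] by (simp add: mesh_le_def)
  next
    case False
    have "as_cobound (subdivide barycenter (\<lambda>t. \<phi> (barycenter xs # t))) xs = as_cobound (\<lambda>t. 0) xs"
    proof (rule as_cobound_cong)
      fix u assume u: "length xs = Suc (length u)" "set u \<subseteq> set xs"
      have hull: "convex hull (set u) \<subseteq> convex hull (set xs)" using u by (intro hull_mono) auto
      show "subdivide barycenter (\<lambda>t. \<phi> (barycenter xs # t)) u = 0"
      proof (rule IH[rule_format])
        show "length u < length xs" "0 \<notin> convex hull (set u)" "set u \<subseteq> E" "mesh_le u D"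
          using u hull zero xE mesh_le_subset[OF mesh] by auto
        fix t assume t: "length t = length u" "set t \<subseteq> convex hull (set u)"
          "mesh_le t (mesh_factor (length u) * D)"
        show "\<phi> (barycenter xs # t) = 0"
        proof (rule vanish)
          show "set (barycenter xs # t) \<subseteq> convex hull (set xs)"
            using t(2) hull barycenter_mean[OF False zero] by auto
        qed (use t u mesh_le_barycenter_Cons[OF False zero xE mesh D0 u t] in auto)
      qed (rule D0)
    qed
    then show ?thesis using False by (simp add: subdivide_nonempty)
  qed
qed

lemma subdivide_funpow_eq_0:
  assumes "0 \<notin> convex hull (set xs)" "set xs \<subseteq> E" "0 \<le> D" "mesh_le xs D"
    and "\<And>t. length t = length xs \<Longrightarrow> set t \<subseteq> convex hull (set xs) \<Longrightarrow>
      mesh_le t (mesh_factor (length xs) ^ k * D) \<Longrightarrow> \<phi> t = 0"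
  shows "(subdivide barycenter ^^ k) \<phi> xs = 0"
  using assms
proof (induction k arbitrary: xs D)
  case 0
  then show ?case by (auto simp: hull_subset)
next
  case (Suc k)
  note zero = Suc.prems(1) and xE = Suc.prems(2) and D0 = Suc.prems(3) and vanish = Suc.prems(5)
  show ?case
  proof (cases "xs = []")
    case True
    then show ?thesis
      using vanish[of "[]"] subdivide_funpow_Nil[of "Suc k" barycenter \<phi>] by (simp add: mesh_le_def)
  next
    case False
    have "subdivide barycenter ((subdivide barycenter ^^ k) \<phi>) xs = 0"
    proof (rule subdivide_eq_0[OF Suc.prems(1-4)])
      fix t assume t: "length t = length xs" "set t \<subseteq> convex hull (set xs)"
        "mesh_le t (mesh_factor (length xs) * D)"
      have hull: "convex hull (set t) \<subseteq> convex hull (set xs)"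
        using t(2) by (simp add: hull_minimal convex_convex_hull)
      show "(subdivide barycenter ^^ k) \<phi> t = 0"
      proof (rule Suc.IH[OF _ _ _ t(3)])
        show "0 \<notin> convex hull (set t)" "set t \<subseteq> E"
          using hull zero t(2) convex_hull_subset_E[OF xE] by auto
        show "0 \<le> mesh_factor (length xs) * D" using False D0 by (simp add: mesh_factor_nonneg)
        fix u assume "length u = length t" "set u \<subseteq> convex hull (set t)"
          "mesh_le u (mesh_factor (length t) ^ k * (mesh_factor (length xs) * D))"
        then show "\<phi> u = 0" using t(1) hull by (intro vanish) (auto simp: ac_simps)
      qed
    qed
    then show ?thesis by simp
  qed
qed

end

subsection \<open>Sequential compactness\<close>

context seminormed
begin

definition sequentially_compact :: "'a set \<Rightarrow> bool" where
  "sequentially_compact K \<longleftrightarrow> (\<forall>\<sigma>. (\<forall>n::nat. \<sigma> n \<in> K) \<longrightarrow>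
     (\<exists>l\<in>K. \<exists>r. strict_mono (r :: nat \<Rightarrow> nat) \<and> (\<lambda>n. N (\<sigma> (r n) - l)) \<longlonglongrightarrow> 0))"

lemma sequentially_compactI:
  assumes "\<And>\<sigma>. (\<And>n::nat. \<sigma> n \<in> K) \<Longrightarrow>
    \<exists>l\<in>K. \<exists>r. strict_mono (r :: nat \<Rightarrow> nat) \<and> (\<lambda>n. N (\<sigma> (r n) - l)) \<longlonglongrightarrow> 0"
  shows "sequentially_compact K"
  using assms unfolding sequentially_compact_def by blast

lemma sequentially_compactE:
  assumes "sequentially_compact K" "\<And>n::nat. \<sigma> n \<in> K"
  obtains l r where "l \<in> K" "strict_mono (r :: nat \<Rightarrow> nat)" "(\<lambda>n. N (\<sigma> (r n) - l)) \<longlonglongrightarrow> 0"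
  using assms unfolding sequentially_compact_def by blast

lemma sequentially_compact_empty: "sequentially_compact {}"
  unfolding sequentially_compact_def by auto

lemma sequentially_compact_singleton: "sequentially_compact {x}"
  unfolding sequentially_compact_def by (auto intro!: exI[of _ id] simp: strict_mono_def)

lemma sequentially_compact_Un:
  assumes "sequentially_compact A" "sequentially_compact B"
  shows "sequentially_compact (A \<union> B)"
proof (rule sequentially_compactI)
  fix \<sigma> assume \<sigma>: "\<And>n::nat. \<sigma> n \<in> A \<union> B"
  have subseq_in: "\<exists>l\<in>C. \<exists>r. strict_mono (r :: nat \<Rightarrow> nat) \<and> (\<lambda>n. N (\<sigma> (r n) - l)) \<longlonglongrightarrow> 0"
    if infinitely_often: "infinite {n. \<sigma> n \<in> C}" and C: "sequentially_compact C" for C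
  proof -
    obtain u :: "nat \<Rightarrow> nat" where u: "strict_mono u" "\<And>n. u n \<in> {n. \<sigma> n \<in> C}"
      using infinite_enumerate[OF infinitely_often] by auto
    have "\<sigma> (u n) \<in> C" for n using u(2)[of n] by simp
    then obtain l r where "l \<in> C" "strict_mono (r :: nat \<Rightarrow> nat)" "(\<lambda>n. N (\<sigma> (u (r n)) - l)) \<longlonglongrightarrow> 0"
      using sequentially_compactE[OF C, of "\<lambda>n. \<sigma> (u n)"] by blast
    then show ?thesis using strict_mono_o[OF u(1), of r] by (auto simp: comp_def)
  qed
  have "{n. \<sigma> n \<in> A} \<union> {n. \<sigma> n \<in> B} = UNIV" using \<sigma> by auto
  then have "infinite {n. \<sigma> n \<in> A} \<or> infinite {n. \<sigma> n \<in> B}" by (metis finite_Un infinite_UNIV_nat)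
  then show "\<exists>l\<in>A \<union> B. \<exists>r. strict_mono (r :: nat \<Rightarrow> nat) \<and> (\<lambda>n. N (\<sigma> (r n) - l)) \<longlonglongrightarrow> 0"
    using subseq_in assms by blast
qed

lemma sequentially_compact_UN:
  "finite I \<Longrightarrow> (\<And>i. i \<in> I \<Longrightarrow> sequentially_compact (f i)) \<Longrightarrow> sequentially_compact (\<Union>i\<in>I. f i)"
  by (induction I rule: finite_induct)
    (auto intro: sequentially_compact_empty sequentially_compact_Un)

lemma sequentially_compact_image:
  assumes K: "sequentially_compact K"
    and cont: "\<And>u l. (\<And>n::nat. u n \<in> K) \<Longrightarrow> l \<in> K \<Longrightarrow> (\<lambda>n. N (u n - l)) \<longlonglongrightarrow> 0 \<Longrightarrow>
        (\<lambda>n. N (f (u n) - f l)) \<longlonglongrightarrow> 0"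
  shows "sequentially_compact (f ` K)"
proof (rule sequentially_compactI)
  fix \<sigma> assume "\<And>n::nat. \<sigma> n \<in> f ` K"
  then have "\<forall>n. \<exists>v. v \<in> K \<and> \<sigma> n = f v" by auto
  then obtain v where v: "\<And>n. v n \<in> K" "\<And>n. \<sigma> n = f (v n)" by metis
  obtain l r where l: "l \<in> K" "strict_mono (r :: nat \<Rightarrow> nat)" "(\<lambda>n. N (v (r n) - l)) \<longlonglongrightarrow> 0"
    by (rule sequentially_compactE[OF K v(1)])
  from cont[OF v(1) l(1,3)] show "\<exists>l\<in>f ` K. \<exists>r. strict_mono (r :: nat \<Rightarrow> nat)
      \<and> (\<lambda>n. N (\<sigma> (r n) - l)) \<longlonglongrightarrow> 0"
    using l v(2) by auto
qed

lemma sequentially_compact_uminus: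
  assumes K: "sequentially_compact K" "K \<subseteq> E"
  shows "sequentially_compact (uminus ` K)"
proof (rule sequentially_compact_image[OF K(1)])
  fix u l assume in_K: "\<And>n::nat. u n \<in> K" "l \<in> K" and lim: "(\<lambda>n. N (u n - l)) \<longlonglongrightarrow> 0"
  have "N (- u n - - l) = N (u n - l)" for n using in_K K(2) by (intro dist.d_ng) auto
  then show "(\<lambda>n. N (- u n - - l)) \<longlonglongrightarrow> 0" using lim by (simp only:)
qed

lemma sequentially_compact_cone:
  assumes K: "sequentially_compact K" "K \<subseteq> E" and a: "a \<in> E"
  shows "sequentially_compact {(1 - t) *\<^sub>R a + t *\<^sub>R y |t y. t \<in> {0..1} \<and> y \<in> K}"
    (is "sequentially_compact ?C")
proof (rule sequentially_compactI)
  fix \<sigma> assume "\<And>n::nat. \<sigma> n \<in> ?C"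
  then have "\<forall>n. \<exists>t y. t \<in> {0..1} \<and> y \<in> K \<and> \<sigma> n = (1 - t) *\<^sub>R a + t *\<^sub>R y" by blast
  then obtain t y where t: "\<And>n. t n \<in> {0..1}" and y: "\<And>n. y n \<in> K"
    and \<sigma>: "\<And>n. \<sigma> n = (1 - t n) *\<^sub>R a + t n *\<^sub>R y n" by metis
  obtain l r where l: "l \<in> {0..1}" and r: "strict_mono (r :: nat \<Rightarrow> nat)" and lim: "(t \<circ> r) \<longlonglongrightarrow> l"
    using compact_Icc[of 0 "1::real"] t unfolding compact_def by metis
  obtain z r' where z: "z \<in> K" and r': "strict_mono (r' :: nat \<Rightarrow> nat)"
    and lim': "(\<lambda>n. N (y (r (r' n)) - z)) \<longlonglongrightarrow> 0"
    by (rule sequentially_compactE[OF K(1), of "\<lambda>n. y (r n)"]) (use y in auto)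
  define T Y where "T = (\<lambda>n. t (r (r' n)))" and "Y = (\<lambda>n. y (r (r' n)))"
  define w where "w = (1 - l) *\<^sub>R a + l *\<^sub>R z"
  have E: "z \<in> E" "y n \<in> E" "Y n \<in> E" and T: "T n \<in> {0..1}" for n
    unfolding T_def Y_def using z y t K(2) by auto
  have "N (\<sigma> (r (r' n)) - w) \<le> \<bar>T n - l\<bar> * N (z - a) + N (Y n - z)" for n
  proof -
    have "\<sigma> (r (r' n)) - w = (T n - l) *\<^sub>R (z - a) + T n *\<^sub>R (Y n - z)"
      unfolding \<sigma> w_def T_def Y_def by (simp add: algebra_simps)
    then have "N (\<sigma> (r (r' n)) - w) \<le> N ((T n - l) *\<^sub>R (z - a)) + N (T n *\<^sub>R (Y n - z))"
      using N_triangle[of "(T n - l) *\<^sub>R (z - a)" "T n *\<^sub>R (Y n - z)"] a E by simp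
    also have "\<dots> = \<bar>T n - l\<bar> * N (z - a) + T n * N (Y n - z)" using a E T by (simp add: N_hom)
    also have "T n * N (Y n - z) \<le> N (Y n - z)"
      using T N_nonneg[of "Y n - z"] E by (intro mult_left_le_one_le) auto
    finally show ?thesis by simp
  qed
  moreover have "(\<lambda>n. \<bar>T n - l\<bar> * N (z - a) + N (Y n - z)) \<longlonglongrightarrow> \<bar>l - l\<bar> * N (z - a) + 0"
  proof -
    have "T \<longlonglongrightarrow> l" using LIMSEQ_subseq_LIMSEQ[OF lim r'] by (simp add: T_def comp_def)
    then show ?thesis using lim' unfolding Y_def by (intro tendsto_intros)
  qed
  moreover have "0 \<le> N (\<sigma> (r (r' n)) - w)" for n
    using a E(1,2) unfolding \<sigma> w_def by (intro N_nonneg) auto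
  ultimately have "(\<lambda>n. N (\<sigma> (r (r' n)) - w)) \<longlonglongrightarrow> 0"
    by (intro tendsto_sandwich[of "\<lambda>_. 0" "\<lambda>n. N (\<sigma> (r (r' n)) - w)" sequentially]) auto
  moreover have "w \<in> ?C" unfolding w_def using l z by blast
  ultimately show "\<exists>l\<in>?C. \<exists>r. strict_mono (r :: nat \<Rightarrow> nat) \<and> (\<lambda>n. N (\<sigma> (r n) - l)) \<longlonglongrightarrow> 0"
    using strict_mono_o[OF r r'] by (auto simp: comp_def)
qed

lemma sequentially_compact_convex_hull:
  "finite S \<Longrightarrow> S \<subseteq> E \<Longrightarrow> sequentially_compact (convex hull S)"
proof (induction S rule: finite_induct)
  case (insert a S)
  show ?case
  proof (cases "S = {}")
    case False
    have "convex hull (insert a S) = {(1 - t) *\<^sub>R a + t *\<^sub>R y |t y. t \<in> {0..1} \<and> y \<in> convex hull S}"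
      unfolding convex_hull_insert[OF False]
    proof (intro equalityI subsetI)
      fix x assume "x \<in> {x. \<exists>u\<ge>0. \<exists>v\<ge>0. \<exists>b. u + v = 1 \<and> b \<in> convex hull S \<and> x = u *\<^sub>R a + v *\<^sub>R b}"
      then obtain u v y where uv: "u \<ge> 0" "v \<ge> 0" "u + v = 1" "y \<in> convex hull S"
        "x = u *\<^sub>R a + v *\<^sub>R y" by blast
      then have "u = 1 - v" "v \<in> {0..1}" by auto
      then show "x \<in> {(1 - t) *\<^sub>R a + t *\<^sub>R y |t y. t \<in> {0..1} \<and> y \<in> convex hull S}"
        using uv by blast
    next
      fix x assume "x \<in> {(1 - t) *\<^sub>R a + t *\<^sub>R y |t y. t \<in> {0..1} \<and> y \<in> convex hull S}"
      then obtain t y where "t \<in> {0..1}" "y \<in> convex hull S" "x = (1 - t) *\<^sub>R a + t *\<^sub>R y" by blast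
      then show "x \<in> {x. \<exists>u\<ge>0. \<exists>v\<ge>0. \<exists>b. u + v = 1 \<and> b \<in> convex hull S \<and> x = u *\<^sub>R a + v *\<^sub>R b}"
        by (intro CollectI exI[of _ "1 - t"] exI[of _ t] exI[of _ y]) auto
    qed
    then show ?thesis
      using insert convex_hull_subset_E[of S]
      by (simp only:) (intro sequentially_compact_cone, auto)
  qed (simp add: sequentially_compact_singleton)
qed (simp add: sequentially_compact_empty)

lemma sequentially_compact_lebesgue_number:
  assumes K: "K \<subseteq> E" "sequentially_compact K" and e: "\<And>x. x \<in> K \<Longrightarrow> 0 < e x"
  obtains \<eta> where "\<eta> > 0"
    "\<And>t. t \<noteq> [] \<Longrightarrow> set t \<subseteq> K \<Longrightarrow> mesh_le t \<eta> \<Longrightarrow> small_tuple (\<lambda>x y. N (x - y)) K e t"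
proof (rule ccontr)
  assume "\<not> thesis"
  then have "\<exists>t. t \<noteq> [] \<and> set t \<subseteq> K \<and> mesh_le t (inverse (Suc n))
      \<and> \<not> small_tuple (\<lambda>x y. N (x - y)) K e t" for n
    using that[of "inverse (Suc n)"] by fastforce
  then obtain t where t: "\<And>n::nat. t n \<noteq> []" "\<And>n. set (t n) \<subseteq> K"
    "\<And>n. mesh_le (t n) (inverse (Suc n))"
    "\<And>n. \<not> small_tuple (\<lambda>x y. N (x - y)) K e (t n)" by metis
  have hd_in: "hd (t n) \<in> set (t n)" "hd (t n) \<in> K" for n using t(1,2)[of n] by auto
  obtain l r where l: "l \<in> K" "strict_mono (r :: nat \<Rightarrow> nat)" "(\<lambda>n. N (hd (t (r n)) - l)) \<longlonglongrightarrow> 0"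
    by (rule sequentially_compactE[OF K(2) hd_in(2)])
  have "(\<lambda>n. N (hd (t (r n)) - l) + inverse (Suc n)) \<longlonglongrightarrow> 0 + 0"
    by (intro tendsto_intros l LIMSEQ_inverse_real_of_nat)
  then have "eventually (\<lambda>n. N (hd (t (r n)) - l) + inverse (Suc n) < e l) sequentially"
    using e[OF l(1)] by (intro order_tendstoD) auto
  then obtain n where n: "N (hd (t (r n)) - l) + inverse (Suc n) < e l"
    by (auto simp: eventually_sequentially)
  have "Suc n \<le> Suc (r n)" using seq_suble[OF l(2)] by simp
  then have inverse_le: "inverse (real (Suc (r n))) \<le> inverse (Suc n)" by (simp add: field_simps)
  have "N (l - y) < e l" if y: "y \<in> set (t (r n))" for y
  proof -
    have E: "l \<in> E" "y \<in> E" "hd (t (r n)) \<in> E" using l y t(2)[of "r n"] hd_in[of "r n"] K by auto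
    have "N (l - y) \<le> N (l - hd (t (r n))) + N (hd (t (r n)) - y)"
      using E by (intro N_triangle_diff)
    then show ?thesis
      using n inverse_le mesh_leD[OF t(3) hd_in(1) y] N_diff_commute[OF E(1,3)] by linarith
  qed
  then show False using t(2,4)[of "r n"] l(1) unfolding small_tuple_def by blast
qed

end

subsection \<open>Nonvanishing powers live on compact sets\<close>

definition finitely_determined :: "('b \<Rightarrow> bit) set \<Rightarrow> bool" where
  "finitely_determined C \<longleftrightarrow> (\<exists>F. finite F \<and> (\<forall>\<psi>\<in>C. \<forall>\<psi>'. (\<forall>x\<in>F. \<psi> x = \<psi>' x) \<longrightarrow> \<psi>' \<in> C))"

lemma finitely_determined_point: "finitely_determined {\<psi>. \<psi> x = c}"
  unfolding finitely_determined_def by (rule exI[of _ "{x}"]) auto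

lemma finitely_determined_eq: "finitely_determined {\<psi>. \<psi> x = \<psi> y}"
  unfolding finitely_determined_def by (rule exI[of _ "{x, y}"]) auto

lemma finitely_determined_cobound: "finitely_determined {\<psi>. c = as_cobound \<psi> ys}"
proof -
  let ?F = "(\<lambda>i. take i ys @ drop (Suc i) ys) ` {..<length ys}"
  have "as_cobound \<psi> ys = as_cobound \<psi>' ys" if "\<forall>t\<in>?F. \<psi> t = \<psi>' t" for \<psi> \<psi>'
    using that unfolding as_cobound_def by (auto intro!: sum.cong)
  then show ?thesis unfolding finitely_determined_def by (intro exI[of _ ?F]) auto
qed

lemma closedin_finitely_determined:
  fixes C :: "('b \<Rightarrow> bit) set"
  assumes "finitely_determined C"
  shows "closedin (product_topology (\<lambda>_. discrete_topology UNIV) UNIV) C" (is "closedin ?X C")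
proof -
  obtain F where F: "finite F" "\<And>\<psi> \<psi>'. \<psi> \<in> C \<Longrightarrow> (\<forall>x\<in>F. \<psi> x = \<psi>' x) \<Longrightarrow> \<psi>' \<in> C"
    using assms unfolding finitely_determined_def by blast
  have "openin ?X (- C)"
  proof (subst openin_subopen, intro ballI)
    fix \<psi> assume \<psi>: "\<psi> \<in> - C"
    define T where "T = PiE UNIV (\<lambda>x. if x \<in> F then {\<psi> x} else (UNIV :: bit set))"
    have "openin ?X T"
      unfolding T_def
    proof (rule product_topology_basis)
      show "finite {i. (if i \<in> F then {\<psi> i} else UNIV) \<noteq> topspace (discrete_topology (UNIV :: bit set))}"
        by (rule finite_subset[OF _ F(1)]) auto
    qed auto
    moreover have "\<psi> \<in> T" unfolding T_def by auto
    moreover have "T \<subseteq> - C"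
    proof
      fix \<psi>' assume "\<psi>' \<in> T"
      then have "\<forall>x\<in>F. \<psi>' x = \<psi> x" unfolding T_def by (auto simp: PiE_iff split: if_splits)
      then show "\<psi>' \<in> - C" using F(2)[of \<psi>' \<psi>] \<psi> by auto
    qed
    ultimately show "\<exists>T. openin ?X T \<and> \<psi> \<in> T \<and> T \<subseteq> - C" by blast
  qed
  then show ?thesis unfolding closedin_def by (simp add: PiE_UNIV_domain Compl_eq_Diff_UNIV)
qed

lemma finitely_determined_finite_intersection:
  fixes \<C> :: "('b \<Rightarrow> bit) set set"
  assumes "\<And>C. C \<in> \<C> \<Longrightarrow> finitely_determined C" "\<Inter>\<C> = {}"
  obtains \<F> where "finite \<F>" "\<F> \<subseteq> \<C>" "\<Inter>\<F> = {}"
proof -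
  have "(UNIV :: bit set) = {0, 1}" by (auto intro: bit.exhaust)
  then have "finite (UNIV :: bit set)" by (metis finite.emptyI finite_insert)
  then have "compact_space (product_topology (\<lambda>_::'b. discrete_topology (UNIV :: bit set)) UNIV)"
    by (simp add: compact_space_product_topology compact_space_discrete_topology)
  then show ?thesis
    using assms closedin_finitely_determined that unfolding compact_space_fip by blast
qed

lemma omega_power_finite_obstruction:
  assumes nonzero: "\<not> omega_power_zero d ng A q" and s: "odd_on ng A s" and e: "\<And>x. x \<in> A \<Longrightarrow> 0 < e x"
  obtains F where "finite F" "F \<subseteq> {ys. length ys = Suc q \<and> small_tuple d A e ys}"
    "\<And>\<psi>. \<psi> [] = 0 \<Longrightarrow> invariant_on ng A \<psi> \<Longrightarrow> \<exists>ys\<in>F. diff_prod s ys \<noteq> as_cobound \<psi> ys"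
proof -
  define T where "T = {ys. length ys = Suc q \<and> small_tuple d A e ys}"
  define G where "G ys = {\<psi>. diff_prod s ys = as_cobound \<psi> ys}" for ys
  define I where "I xs = {\<psi> :: 'a cochain. \<psi> (map ng xs) = \<psi> xs}" for xs
  define Z where "Z = {\<psi> :: 'a cochain. \<psi> [] = 0}"
  define \<C> where "\<C> = G ` T \<union> I ` {xs. set xs \<subseteq> A} \<union> {Z}"
  have "\<psi> \<notin> \<Inter>\<C>" for \<psi>
  proof
    assume "\<psi> \<in> \<Inter>\<C>"
    then have "\<forall>ys\<in>T. \<psi> \<in> G ys" "\<forall>xs. set xs \<subseteq> A \<longrightarrow> \<psi> \<in> I xs" "\<psi> \<in> Z"
      unfolding \<C>_def by blast+
    then have "omega_power_primitive d ng A q e s \<psi>"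
      using s unfolding G_def I_def Z_def T_def omega_power_primitive_def invariant_on_def
        mem_Collect_eq by blast
    then have "omega_power_zero d ng A q" by (rule omega_power_zeroI[rotated]) (rule e)
    then show False using nonzero by contradiction
  qed
  then have "\<Inter>\<C> = {}" by blast
  moreover have "finitely_determined C" if "C \<in> \<C>" for C
    using that finitely_determined_cobound finitely_determined_eq finitely_determined_point
    unfolding \<C>_def by (auto simp: G_def I_def Z_def)
  ultimately obtain \<F> where \<F>: "finite \<F>" "\<F> \<subseteq> \<C>" "\<Inter>\<F> = {}"
    using finitely_determined_finite_intersection[of \<C>] by blast
  have "finite (\<F> \<inter> G ` T)" "\<F> \<inter> G ` T \<subseteq> G ` T" using \<F> by auto
  then obtain F where F: "F \<subseteq> T" "finite F" "\<F> \<inter> G ` T = G ` F" using finite_subset_image by metis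
  show ?thesis
  proof (rule that[OF F(2) F(1)[unfolded T_def]], rule ccontr)
    fix \<psi> assume \<psi>: "\<psi> [] = 0" "invariant_on ng A \<psi>"
      and solves: "\<not> (\<exists>ys\<in>F. diff_prod s ys \<noteq> as_cobound \<psi> ys)"
    have "C \<in> G ` F \<or> C \<in> I ` {xs. set xs \<subseteq> A} \<or> C = Z" if "C \<in> \<F>" for C
      using that \<F>(2) F(3) unfolding \<C>_def by blast
    then have "\<psi> \<in> C" if "C \<in> \<F>" for C
      using that \<psi> solves by (fastforce simp: G_def I_def Z_def invariant_on_def)
    then show False using \<F>(3) by auto
  qed
qed

context seminormed
begin

abbreviation d\<^sub>N :: "'a \<Rightarrow> 'a \<Rightarrow> real" where "d\<^sub>N x y \<equiv> N (x - y)"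

lemma convex_hull_small_tuple:
  assumes A_subset: "A \<subseteq> E" and ball: "\<And>x y. x \<in> A \<Longrightarrow> y \<in> E \<Longrightarrow> N (x - y) < e x \<Longrightarrow> y \<in> A"
    and ys: "small_tuple d\<^sub>N A e ys" "ys \<noteq> []"
  shows "convex hull (set ys) \<subseteq> A"
proof -
  obtain x where x: "x \<in> A" "\<forall>y\<in>set ys. N (x - y) < e x" and ysA: "set ys \<subseteq> A"
    using ys(1) unfolding small_tuple_def by blast
  have xE: "x \<in> E" using x A_subset by auto
  define r where "r = Max ((\<lambda>y. N (x - y)) ` set ys)"
  have r: "r < e x" unfolding r_def using x ys(2) by (subst Max_less_iff) auto
  have "set ys \<subseteq> {y\<in>E. N (y - x) \<le> r}"
  proof
    fix y assume y: "y \<in> set ys"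
    then have "N (x - y) \<le> r" unfolding r_def by (intro Max_ge) auto
    then show "y \<in> {y\<in>E. N (y - x) \<le> r}" using N_diff_commute[OF xE, of y] y ysA A_subset by auto
  qed
  then have "convex hull (set ys) \<subseteq> {y\<in>E. N (y - x) \<le> r}"
    by (intro hull_minimal convex_seminorm_ball xE)
  also have "\<dots> \<subseteq> A" using ball[OF x(1)] r N_diff_commute[OF xE] by fastforce
  finally show ?thesis .
qed

lemma omega_power_zero_compact_uniform:
  assumes K: "K \<subseteq> E - {0}" "\<And>x. x \<in> K \<Longrightarrow> - x \<in> K" "sequentially_compact K"
    and zero: "omega_power_zero d\<^sub>N uminus K q" and s: "odd_on uminus (- {0}) s"
  obtains \<eta> \<psi> where "\<eta> > 0" "\<psi> [] = 0" "invariant_on uminus (- {0}) \<psi>"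
    "\<And>t. length t = Suc q \<Longrightarrow> set t \<subseteq> K \<Longrightarrow> mesh_le t \<eta> \<Longrightarrow> diff_prod s t = as_cobound \<psi> t"
proof -
  obtain e s' \<psi>' where e: "\<And>x. x \<in> K \<Longrightarrow> 0 < e x"
    and s': "omega_power_primitive d\<^sub>N uminus K q e s' \<psi>'"
    using zero by (elim omega_power_zeroE) blast
  have "odd_on uminus K s" using s K(1) by (auto simp: odd_on_def)
  note prim = omega_power_primitiveD[OF omega_power_primitive_change_section[OF s' this]]
  obtain \<eta> where \<eta>: "\<eta> > 0" "\<And>t. t \<noteq> [] \<Longrightarrow> set t \<subseteq> K \<Longrightarrow> mesh_le t \<eta> \<Longrightarrow> small_tuple d\<^sub>N K e t"
    by (rule sequentially_compact_lebesgue_number[of K e]) (use K e in auto)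
  define \<psi> where "\<psi> t = (if set t \<subseteq> K then \<psi>' t + diff_prod_homotopy s' s t else 0)" for t
  show ?thesis
  proof (rule that[of \<eta> \<psi>])
    show "\<psi> [] = 0" using prim(2) by (simp add: \<psi>_def)
    have "set (map uminus xs) \<subseteq> K \<longleftrightarrow> set xs \<subseteq> K" for xs
      using K(2) by (metis (no_types, opaque_lifting) image_subset_iff list.set_map minus_minus
        subset_iff)
    then show "invariant_on uminus (- {0}) \<psi>"
      using invariant_onD[OF prim(3)] by (auto simp: \<psi>_def invariant_on_def)
    fix t assume t: "length t = Suc q" "set t \<subseteq> K" "mesh_le t \<eta>"
    have "t \<noteq> []" using t(1) by auto
    then have "diff_prod s t = as_cobound (\<lambda>t. \<psi>' t + diff_prod_homotopy s' s t) t"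
      using t by (intro prim(4) \<eta>(2))
    also have "\<dots> = as_cobound \<psi> t" using t(2) by (intro as_cobound_cong) (auto simp: \<psi>_def)
    finally show "diff_prod s t = as_cobound \<psi> t" .
  qed (rule \<eta>(1))
qed

lemma mesh_factor_power_small:
  assumes F: "finite F" and n: "0 < n" and \<eta>: "0 < (\<eta>::real)"
  obtains D k where "0 \<le> D" "\<And>ys. ys \<in> F \<Longrightarrow> mesh_le ys D" "mesh_factor n ^ k * D < \<eta>"
proof -
  define S where "S = (\<Union>ys\<in>F. \<Union>x\<in>set ys. (\<lambda>y. N (x - y)) ` set ys)"
  define D where "D = Max (insert 0 S)"
  have S: "finite S" unfolding S_def using F by auto
  have "(\<lambda>k. mesh_factor n ^ k * D) \<longlonglongrightarrow> 0 * D"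
    using mesh_factor_nonneg[OF n] mesh_factor_less_1[OF n]
    by (intro tendsto_intros LIMSEQ_realpow_zero) auto
  then have "eventually (\<lambda>k. mesh_factor n ^ k * D < \<eta>) sequentially"
    using \<eta> by (intro order_tendstoD) auto
  then obtain k where "mesh_factor n ^ k * D < \<eta>" by (auto simp: eventually_sequentially)
  moreover have "mesh_le ys D" if "ys \<in> F" for ys
    unfolding mesh_le_def D_def using S that by (auto intro!: Max_ge simp: S_def)
  moreover have "0 \<le> D" unfolding D_def using S by (intro Max_ge) auto
  ultimately show ?thesis using that by blast
qed

lemma omega_power_zero_compact_solves_finite:
  assumes K: "K \<subseteq> E - {0}" "\<And>x. x \<in> K \<Longrightarrow> - x \<in> K" "sequentially_compact K"
    and zero: "omega_power_zero d\<^sub>N uminus K q" and s: "odd_on uminus (- {0}) s"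
    and F: "finite F" "\<And>ys. ys \<in> F \<Longrightarrow> length ys = Suc q" "\<And>ys. ys \<in> F \<Longrightarrow> convex hull (set ys) \<subseteq> K"
  obtains \<theta> where "\<theta> [] = 0" "invariant_on uminus (- {0}) \<theta>"
    "\<And>ys. ys \<in> F \<Longrightarrow> diff_prod s ys = as_cobound \<theta> ys"
proof -
  obtain \<eta> \<psi> where \<eta>: "\<eta> > 0" and \<psi>: "\<psi> [] = 0" "invariant_on uminus (- {0}) \<psi>"
    "\<And>t. length t = Suc q \<Longrightarrow> set t \<subseteq> K \<Longrightarrow> mesh_le t \<eta> \<Longrightarrow> diff_prod s t = as_cobound \<psi> t"
    by (rule omega_power_zero_compact_uniform[OF K zero s]) (assumption, rule that)
  obtain D k where D: "0 \<le> D" "\<And>ys. ys \<in> F \<Longrightarrow> mesh_le ys D" and k: "mesh_factor (Suc q) ^ k * D < \<eta>"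
    using mesh_factor_power_small[OF F(1) _ \<eta>, of "Suc q"] by blast
  have cocycle: "as_cobound (diff_prod s) = (\<lambda>_. 0)" by (rule ext) simp
  obtain \<epsilon> where \<epsilon>: "invariant_on uminus (- {0}) \<epsilon>" "\<epsilon> [] = 0"
    "\<And>xs. (subdivide barycenter ^^ k) (diff_prod s) xs = diff_prod s xs + as_cobound \<epsilon> xs"
    using subdivide_funpow_cohomologous[where ng = uminus and b = barycenter,
        OF barycenter_equivariant cocycle
        invariant_on_diff_prod[OF s], of k] by blast
  define \<theta> where "\<theta> t = \<epsilon> t + (subdivide barycenter ^^ k) \<psi> t" for t
  show ?thesis
  proof (rule that[of \<theta>])
    show "\<theta> [] = 0" unfolding \<theta>_def by (simp add: \<epsilon> \<psi>(1) subdivide_funpow_Nil)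
    show "invariant_on uminus (- {0}) \<theta>"
      unfolding \<theta>_def
      by (intro invariant_on_add \<epsilon>(1) invariant_on_subdivide_funpow barycenter_equivariant \<psi>(2))
    fix ys assume ys: "ys \<in> F"
    have hull: "convex hull (set ys) \<subseteq> K" by (rule F(3)[OF ys])
    have "(subdivide barycenter ^^ k) (\<lambda>t. diff_prod s t + as_cobound \<psi> t) ys = 0"
    proof (rule subdivide_funpow_eq_0[OF _ _ D(1) D(2)[OF ys]])
      show "0 \<notin> convex hull (set ys)" using hull K(1) by auto
      show "set ys \<subseteq> E" using hull K(1) hull_subset[of "set ys" convex] by blast
      fix t assume t: "length t = length ys" "set t \<subseteq> convex hull (set ys)"
        "mesh_le t (mesh_factor (length ys) ^ k * D)"
      have "mesh_le t \<eta>" using mesh_le_mono[OF t(3), of \<eta>] k F(2)[OF ys] by simp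
      then show "diff_prod s t + as_cobound \<psi> t = 0" using \<psi>(3)[of t] t F(2)[OF ys] hull by auto
    qed
    then have "diff_prod s ys + as_cobound \<epsilon> ys + as_cobound ((subdivide barycenter ^^ k) \<psi>) ys = 0"
      by (simp add: subdivide_funpow_add subdivide_funpow_as_cobound \<epsilon>(3))
    then show "diff_prod s ys = as_cobound \<theta> ys"
      unfolding \<theta>_def by (simp add: as_cobound_add add.assoc bit_add_eq_0_iff)
  qed
qed

theorem omega_power_nonzero_on_compact_subset:
  assumes A: "A \<subseteq> E - {0}" "\<And>x. x \<in> A \<Longrightarrow> - x \<in> A" "relatively_open_in E A"
    and nonzero: "\<not> omega_power_zero d\<^sub>N uminus A q"
  obtains K where "K \<subseteq> A" "\<And>x. x \<in> K \<Longrightarrow> - x \<in> K" "sequentially_compact K"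
    "\<not> omega_power_zero d\<^sub>N uminus K q"
proof -
  obtain s where s: "odd_on uminus (- {0 :: 'a}) s"
    by (rule odd_on_exists[of "- {0 :: 'a}" uminus]) (auto simp: uminus_eq_self_iff)
  then have sA: "odd_on uminus A s" using A(1) by (auto simp: odd_on_def)
  have A_subset: "A \<subseteq> E" using A(1) by auto
  obtain e where e: "\<And>x. x \<in> A \<Longrightarrow> 0 < e x" "\<And>x y. x \<in> A \<Longrightarrow> y \<in> E \<Longrightarrow> N (y - x) < e x \<Longrightarrow> y \<in> A"
    using A(3) unfolding relatively_open_in_def by metis
  have ball: "y \<in> A" if "x \<in> A" "y \<in> E" "N (x - y) < e x" for x y
    using e(2)[OF that(1,2)] that A_subset N_diff_commute[of x y] by auto
  obtain F where F: "finite F" "F \<subseteq> {ys. length ys = Suc q \<and> small_tuple d\<^sub>N A e ys}"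
    "\<And>\<psi>. \<psi> [] = 0 \<Longrightarrow> invariant_on uminus A \<psi> \<Longrightarrow> \<exists>ys\<in>F. diff_prod s ys \<noteq> as_cobound \<psi> ys"
    by (rule omega_power_finite_obstruction[where e = e, OF nonzero sA e(1)])
      (assumption, rule that)
  define K where "K = (\<Union>ys\<in>F. convex hull (set ys) \<union> uminus ` (convex hull (set ys)))"
  have hull: "convex hull (set ys) \<subseteq> A" if "ys \<in> F" for ys
    using F(2) that by (intro convex_hull_small_tuple[OF A_subset ball]) auto
  have KA: "K \<subseteq> A" unfolding K_def using hull A(2) by blast
  have K_uminus: "- x \<in> K" if "x \<in> K" for x using that unfolding K_def by (auto simp: image_iff)
  have K_compact: "sequentially_compact K"
    unfolding K_def
  proof (rule sequentially_compact_UN[OF F(1)])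
    fix ys assume "ys \<in> F"
    then have E: "convex hull (set ys) \<subseteq> E" using hull A_subset by blast
    then have "set ys \<subseteq> E" using hull_subset[of "set ys" convex] by blast
    then show "sequentially_compact (convex hull (set ys) \<union> uminus ` (convex hull (set ys)))"
      using E by (intro sequentially_compact_Un sequentially_compact_uminus
        sequentially_compact_convex_hull) auto
  qed
  have "\<not> omega_power_zero d\<^sub>N uminus K q"
  proof
    assume zero: "omega_power_zero d\<^sub>N uminus K q"
    obtain \<theta> where \<theta>: "\<theta> [] = 0" "invariant_on uminus (- {0}) \<theta>"
      "\<And>ys. ys \<in> F \<Longrightarrow> diff_prod s ys = as_cobound \<theta> ys"
    proof (rule omega_power_zero_compact_solves_finite[OF _ K_uminus K_compact zero s F(1)])
      show "K \<subseteq> E - {0}" using KA A(1) by auto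
    qed (use F(2) in \<open>auto simp: K_def\<close>)
    moreover have "invariant_on uminus A \<theta>" using \<theta>(2) A(1) unfolding invariant_on_def by blast
    ultimately show False using F(3) by blast
  qed
  then show ?thesis using that KA K_uminus K_compact by blast
qed

end

subsection \<open>Nets and sequences in seminormed spaces\<close>

definition Cauchy_wrt :: "('a::minus \<Rightarrow> real) \<Rightarrow> (nat \<Rightarrow> 'a) \<Rightarrow> bool" where
  "Cauchy_wrt F u \<longleftrightarrow> (\<forall>e>0. \<exists>n0. \<forall>m\<ge>n0. \<forall>n\<ge>n0. F (u m - u n) < e)"

lemma Cauchy_wrtI: "(\<And>e. e > 0 \<Longrightarrow> \<exists>n0. \<forall>m\<ge>n0. \<forall>n\<ge>n0. F (u m - u n) < e) \<Longrightarrow> Cauchy_wrt F u"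
  by (simp add: Cauchy_wrt_def)

lemma Cauchy_wrtE:
  assumes "Cauchy_wrt F u" "e > 0"
  obtains n0 where "\<And>m n. n0 \<le> m \<Longrightarrow> n0 \<le> n \<Longrightarrow> F (u m - u n) < e"
  using assms unfolding Cauchy_wrt_def by blast

context seminormed
begin

lemma finite_net:
  assumes seq: "\<And>\<sigma>. (\<And>n::nat. \<sigma> n \<in> S) \<Longrightarrow> \<exists>m n. m < n \<and> N (\<sigma> n - \<sigma> m) < e"
  obtains F where "finite F" "F \<subseteq> S" "\<And>x. x \<in> S \<Longrightarrow> \<exists>y\<in>F. N (x - y) < e"
proof (rule ccontr)
  assume "\<not> thesis"
  then have "\<forall>F. finite F \<longrightarrow> F \<subseteq> S \<longrightarrow> (\<exists>x\<in>S. \<forall>y\<in>F. N (x - y) \<ge> e)"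
    using that by (meson not_le)
  then have far: "\<exists>x\<in>S. \<forall>y\<in>F. N (x - y) \<ge> e" if "finite F" "F \<subseteq> S" for F using that by blast
  have "\<exists>\<sigma>. \<forall>n::nat. \<sigma> n \<in> S \<and> (\<forall>m<n. N (\<sigma> n - \<sigma> m) \<ge> e)"
  proof (rule dependent_wellorder_choice)
    fix r and f g :: "nat \<Rightarrow> 'a" and x :: nat assume "\<And>y. y < x \<Longrightarrow> f y = g y"
    then show "(r \<in> S \<and> (\<forall>m<x. e \<le> N (r - f m))) = (r \<in> S \<and> (\<forall>m<x. e \<le> N (r - g m)))" by auto
  next
    fix x :: nat and f :: "nat \<Rightarrow> 'a" assume "\<And>y. y < x \<Longrightarrow> f y \<in> S \<and> (\<forall>m<y. e \<le> N (f y - f m))"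
    then have "f ` {..<x} \<subseteq> S" by auto
    then show "\<exists>r. r \<in> S \<and> (\<forall>m<x. e \<le> N (r - f m))" using far[of "f ` {..<x}"] by auto
  qed
  then obtain \<sigma> where \<sigma>: "\<And>n::nat. \<sigma> n \<in> S" "\<And>m n. m < n \<Longrightarrow> N (\<sigma> n - \<sigma> m) \<ge> e" by blast
  from seq[OF \<sigma>(1)] \<sigma>(2) show False by (meson not_le)
qed

lemma finite_net_Cauchy_subseq:
  assumes e: "e > 0"
    and seq: "\<And>\<sigma>. (\<And>n::nat. \<sigma> n \<in> S) \<Longrightarrow>
        \<exists>r. strict_mono (r :: nat \<Rightarrow> nat) \<and> Cauchy_wrt N (\<lambda>n. \<sigma> (r n))"
  obtains F where "finite F" "F \<subseteq> S" "\<And>x. x \<in> S \<Longrightarrow> \<exists>y\<in>F. N (x - y) < e"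
proof (rule finite_net)
  fix \<sigma> assume "\<And>n::nat. \<sigma> n \<in> S"
  then obtain r where r: "strict_mono (r :: nat \<Rightarrow> nat)" "Cauchy_wrt N (\<lambda>n. \<sigma> (r n))"
    using seq by blast
  obtain n0 where "\<And>m n. n0 \<le> m \<Longrightarrow> n0 \<le> n \<Longrightarrow> N (\<sigma> (r m) - \<sigma> (r n)) < e"
    by (rule Cauchy_wrtE[OF r(2) e]) (rule that)
  then have "N (\<sigma> (r (Suc n0)) - \<sigma> (r n0)) < e" by simp
  moreover have "r n0 < r (Suc n0)" using r(1) by (simp add: strict_mono_Suc_iff)
  ultimately show "\<exists>m n. m < n \<and> N (\<sigma> n - \<sigma> m) < e" by blast
qed (rule that)

definition antipodal_bump :: "real \<Rightarrow> 'a \<Rightarrow> 'a \<Rightarrow> real" where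
  "antipodal_bump r x v = max 0 (r - N (v - x)) - max 0 (r - N (v + x))"

lemma antipodal_bump_minus:
  assumes "x \<in> E" "v \<in> E"
  shows "antipodal_bump r x (- v) = - antipodal_bump r x v"
proof -
  have "N (- v - x) = N (v + x)" "N (- v + x) = N (v - x)"
    using N_minus[of "v + x"] N_minus[of "v - x"] assms by auto
  then show ?thesis by (simp add: antipodal_bump_def)
qed

lemma antipodal_bump_lipschitz:
  assumes "x \<in> E" "v \<in> E" "w \<in> E"
  shows "\<bar>antipodal_bump r x v - antipodal_bump r x w\<bar> \<le> 2 * N (v - w)"
proof -
  have "\<bar>N (v - x) - N (w - x)\<bar> \<le> N ((v - x) - (w - x))"
    "\<bar>N (v + x) - N (w + x)\<bar> \<le> N ((v + x) - (w + x))"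
    by (rule abs_N_diff_le; use assms in auto)+
  then show ?thesis unfolding antipodal_bump_def by simp
qed

lemma antipodal_bump_nonzero:
  assumes "x \<in> E" "v \<in> E" "N (v - x) < r" "2 * r \<le> N v"
  shows "antipodal_bump r x v \<noteq> 0"
proof -
  have "N (v - - v) \<le> N (v - x) + N (x - - v)" using assms by (intro N_triangle_diff) auto
  moreover have "N (v - - v) = 2 * N v" by (rule N_diff_uminus) fact
  moreover have "N (x - - v) = N (v + x)" by (simp add: add.commute)
  ultimately have "r \<le> N (v + x)" using assms(3,4) N_nonneg[of v] assms(2) by linarith
  then show ?thesis using assms by (simp add: antipodal_bump_def)
qed

lemma odd_lipschitz_map_exists:
  assumes S: "S \<subseteq> E" and \<delta>: "\<delta> > 0" "\<And>v. v \<in> S \<Longrightarrow> \<delta> \<le> N v"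
    and net: "finite F" "F \<subseteq> S" "\<And>v. v \<in> S \<Longrightarrow> \<exists>x\<in>F. N (v - x) < \<delta> / 2"
  obtains n f where "\<And>v. v \<in> S \<Longrightarrow> f v \<in> seqs_upto n - {0}" "\<And>v. v \<in> E \<Longrightarrow> f (- v) = - f v"
    "\<And>v w. v \<in> E \<Longrightarrow> w \<in> E \<Longrightarrow> l2_norm (f v - f w) \<le> (real n + 1) * (2 * N (v - w))"
proof -
  obtain xs where xs: "set xs = F" using finite_list[OF net(1)] by blast
  then have xE: "xs ! i \<in> E" if "i < length xs" for i using nth_mem[OF that] net(2) S by auto
  define f where "f v i = (if i < length xs then antipodal_bump (\<delta> / 2) (xs ! i) v else 0)" for v i
  have f_diff: "\<bar>(f v - f w) i\<bar> \<le> 2 * N (v - w)" if "v \<in> E" "w \<in> E" for v w i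
    using antipodal_bump_lipschitz[OF xE that, of i] N_nonneg[of "v - w"] that by (auto simp: f_def)
  show ?thesis
  proof (rule that[of f "length xs"])
    fix v assume v: "v \<in> S"
    obtain x where x: "x \<in> F" "N (v - x) < \<delta> / 2" using net(3)[OF v] by blast
    obtain i where i: "i < length xs" "xs ! i = x" using x(1) xs by (metis in_set_conv_nth)
    have "antipodal_bump (\<delta> / 2) x v \<noteq> 0"
      by (rule antipodal_bump_nonzero) (use x v \<delta>(2)[OF v] S net(2) in auto)
    then have "f v i \<noteq> 0" using i by (simp add: f_def)
    then have "f v \<noteq> 0" by auto
    then show "f v \<in> seqs_upto (length xs) - {0}" by (auto simp: seqs_upto_def f_def)
  next
    show "f (- v) = - f v" if "v \<in> E" for v
      using antipodal_bump_minus[OF xE that] by (auto simp: f_def)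
    show "l2_norm (f v - f w) \<le> (real (length xs) + 1) * (2 * N (v - w))" if "v \<in> E" "w \<in> E" for v w
      by (rule l2_norm_le[OF _ f_diff[OF that]]) (auto simp: seqs_upto_def f_def)
  qed
qed

lemma N_tendsto_0I:
  assumes "\<And>n. u n \<in> E" "\<And>n. N (u n) \<le> c n" "c \<longlonglongrightarrow> 0"
  shows "(\<lambda>n. N (u n)) \<longlonglongrightarrow> 0"
  by (rule tendsto_sandwich[of "\<lambda>_. 0" _ sequentially c]) (use assms N_nonneg in auto)

lemma sequentially_imp_near:
  assumes A: "A \<subseteq> E" and x: "x \<in> E"
    and seq: "\<And>u. (\<And>n::nat. u n \<in> A) \<Longrightarrow> (\<lambda>n. N (u n - x)) \<longlonglongrightarrow> 0 \<Longrightarrow>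
        eventually (\<lambda>n. P (u n)) sequentially"
  shows "\<exists>\<delta>>0. \<forall>y\<in>A. N (y - x) < \<delta> \<longrightarrow> P y"
proof (rule ccontr)
  assume not_near: "\<not> ?thesis"
  have "\<exists>y\<in>A. N (y - x) < inverse (Suc n) \<and> \<not> P y" for n
    using not_near by (metis inverse_positive_iff_positive of_nat_0_less_iff zero_less_Suc)
  then obtain u where u: "\<And>n::nat. u n \<in> A" "\<And>n. N (u n - x) < inverse (Suc n)" "\<And>n. \<not> P (u n)"
    by metis
  have "(\<lambda>n. N (u n - x)) \<longlonglongrightarrow> 0"
  proof (rule N_tendsto_0I[OF _ _ LIMSEQ_inverse_real_of_nat])
    show "u n - x \<in> E" for n using subsetD[OF A u(1)] x by auto
  qed (use u(2) in \<open>auto intro: less_imp_le\<close>)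
  then show False using seq[of u] u by simp
qed

lemma sequentially_compact_uniform_bound:
  assumes K: "sequentially_compact K"
    and cont: "\<And>u x. (\<And>n::nat. u n \<in> K) \<Longrightarrow> x \<in> K \<Longrightarrow> (\<lambda>n. N (u n - x)) \<longlonglongrightarrow> 0 \<Longrightarrow> (\<lambda>n. g (u n)) \<longlonglongrightarrow> g x"
    and below: "\<And>x. x \<in> K \<Longrightarrow> g x < b"
  obtains b' :: real where "b' < b" "\<And>x. x \<in> K \<Longrightarrow> g x \<le> b'"
proof (rule ccontr)
  assume "\<not> thesis"
  then have "\<exists>x\<in>K. g x > b - inverse (Suc n)" for n
    using that[of "b - inverse (Suc n)"] by (force simp: not_le)
  then obtain u where u: "\<And>n::nat. u n \<in> K" "\<And>n. g (u n) > b - inverse (Suc n)" by metis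
  obtain x r where x: "x \<in> K" "strict_mono (r :: nat \<Rightarrow> nat)" "(\<lambda>n. N (u (r n) - x)) \<longlonglongrightarrow> 0"
    by (rule sequentially_compactE[OF K u(1)])
  have "(\<lambda>n. b - inverse (real (Suc (r n)))) \<longlonglongrightarrow> b - 0"
    using LIMSEQ_subseq_LIMSEQ[OF LIMSEQ_inverse_real_of_nat x(2)]
    by (intro tendsto_intros) (simp add: comp_def)
  then have "b - 0 \<le> g x"
    by (rule LIMSEQ_le[OF _ cont[OF u(1) x(1,3)]]) (use u(2) less_imp_le in blast)
  then show False using below[OF x(1)] by simp
qed

end

subsection \<open>Convex p-homogeneous functionals\<close>

locale convex_homogeneous =
  fixes E :: "'a::real_vector set" and F :: "'a \<Rightarrow> real" and p :: real
  assumes subspace_E: "subspace E" and p: "1 < p"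
    and F_nonneg: "\<And>u. u \<in> E \<Longrightarrow> 0 \<le> F u"
    and F_hom: "\<And>u c. u \<in> E \<Longrightarrow> F (c *\<^sub>R u) = \<bar>c\<bar> powr p * F u"
    and F_convex: "\<And>u v t. u \<in> E \<Longrightarrow> v \<in> E \<Longrightarrow> 0 \<le> t \<Longrightarrow> t \<le> 1 \<Longrightarrow>
       F ((1 - t) *\<^sub>R u + t *\<^sub>R v) \<le> (1 - t) * F u + t * F v"
begin

lemma F_powr: "u \<in> E \<Longrightarrow> (F u powr (1 / p)) powr p = F u"
  using p F_nonneg by (simp add: powr_powr)

lemma F_minus: "u \<in> E \<Longrightarrow> F (- u) = F u"
  using F_hom[of u "-1"] by simp

lemma F_diff_commute: "u \<in> E \<Longrightarrow> v \<in> E \<Longrightarrow> F (u - v) = F (v - u)"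
  using F_minus[of "u - v"] subspace_diff[OF subspace_E] by simp

lemma root_F_less_iff:
  assumes u: "u \<in> E" and e: "e > 0"
  shows "F u powr (1 / p) < e \<longleftrightarrow> F u < e powr p"
proof -
  have "F u powr (1 / p) < e \<longleftrightarrow> (F u powr (1 / p)) powr p < e powr p"
    using p e by (metis less_imp_le linorder_not_le powr_ge_zero powr_less_mono2 powr_mono2
      order.strict_trans zero_less_one)
  then show ?thesis using F_powr[OF u] by simp
qed

lemma F_rescale_le_1:
  assumes w: "w \<in> E" and c: "c > 0" "F w powr (1 / p) < c"
  shows "F ((1 / c) *\<^sub>R w) \<le> 1"
proof -
  have "F w < c powr p" using root_F_less_iff[OF w c(1)] c(2) by simp
  moreover have "F ((1 / c) *\<^sub>R w) = F w / c powr p" using w c F_hom by (simp add: powr_divide)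
  ultimately show ?thesis using c(1) by simp
qed

lemma root_F_add_le:
  assumes u: "u \<in> E" "F u powr (1 / p) < a" and v: "v \<in> E" "F v powr (1 / p) < b"
  shows "F (u + v) powr (1 / p) \<le> a + b"
proof -
  have ab: "a > 0" "b > 0" using u v by (meson le_less_trans powr_ge_zero)+
  define t where "t = b / (a + b)"
  define w where "w = (1 - t) *\<^sub>R ((1 / a) *\<^sub>R u) + t *\<^sub>R ((1 / b) *\<^sub>R v)"
  have t: "0 \<le> t" "t \<le> 1" "1 - t = a / (a + b)" using ab unfolding t_def by (auto simp: field_simps)
  have wE: "w \<in> E" unfolding w_def using u v subspace_E by (intro subspace_add subspace_scale) auto
  have uv: "u + v = (a + b) *\<^sub>R w"
    unfolding w_def t(3) using ab unfolding t_def by (simp add: scaleR_add_right)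
  have "F w \<le> (1 - t) * F ((1 / a) *\<^sub>R u) + t * F ((1 / b) *\<^sub>R v)"
    unfolding w_def using u v t subspace_scale[OF subspace_E] by (intro F_convex) auto
  also have "\<dots> \<le> (1 - t) * 1 + t * 1"
    using t ab u v by (intro add_mono mult_left_mono F_rescale_le_1) auto
  finally have "F w \<le> 1" by simp
  then have "F (u + v) \<le> (a + b) powr p"
    unfolding uv F_hom[OF wE] using ab by (simp add: mult_left_le)
  then have "F (u + v) powr (1 / p) \<le> ((a + b) powr p) powr (1 / p)"
    using p u v subspace_add[OF subspace_E] by (intro powr_mono2) (auto intro!: F_nonneg)
  also have "\<dots> = a + b" using ab p by (simp add: powr_powr)
  finally show ?thesis .
qed

sublocale seminormed E "\<lambda>u. F u powr (1 / p)"
proof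
  show "F (u + v) powr (1 / p) \<le> F u powr (1 / p) + F v powr (1 / p)" if "u \<in> E" "v \<in> E" for u v
  proof (rule field_le_epsilon)
    fix e :: real assume "e > 0"
    then have "F (u + v) powr (1 / p) \<le> (F u powr (1 / p) + e / 2) + (F v powr (1 / p) + e / 2)"
      using that by (intro root_F_add_le) auto
    then show "F (u + v) powr (1 / p) \<le> F u powr (1 / p) + F v powr (1 / p) + e" by simp
  qed
  show "F (c *\<^sub>R u) powr (1 / p) = \<bar>c\<bar> * F u powr (1 / p)" if "u \<in> E" for u c
    using that p F_hom F_nonneg by (simp add: powr_mult powr_powr)
qed (rule subspace_E)

lemma F_0 [simp]: "F 0 = 0"
  using F_hom[of 0 0] by (simp add: subspace_0 subspace_E)

lemma F_midpoint: "u \<in> E \<Longrightarrow> v \<in> E \<Longrightarrow> F ((1/2) *\<^sub>R (u + v)) \<le> (F u + F v) / 2"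
  using F_convex[of u v "1/2"] by (simp add: scaleR_add_right)

lemma F_tendsto_0_iff:
  assumes "\<And>n. u n \<in> E"
  shows "(\<lambda>n::nat. F (u n)) \<longlonglongrightarrow> 0 \<longleftrightarrow> (\<lambda>n. F (u n) powr (1 / p)) \<longlonglongrightarrow> 0"
proof
  assume "(\<lambda>n. F (u n)) \<longlonglongrightarrow> 0"
  then have "(\<lambda>n. F (u n) powr (1 / p)) \<longlonglongrightarrow> 0 powr (1 / p)"
    using p by (intro tendsto_powr2) (auto intro!: always_eventually F_nonneg assms)
  then show "(\<lambda>n. F (u n) powr (1 / p)) \<longlonglongrightarrow> 0" by simp
next
  assume "(\<lambda>n. F (u n) powr (1 / p)) \<longlonglongrightarrow> 0"
  then have "(\<lambda>n. (F (u n) powr (1 / p)) powr p) \<longlonglongrightarrow> 0 powr p" using p by (intro tendsto_powr2) auto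
  then show "(\<lambda>n. F (u n)) \<longlonglongrightarrow> 0" using F_powr assms by simp
qed

lemma Cauchy_wrt_F_iff:
  assumes u: "\<And>n. u n \<in> E"
  shows "Cauchy_wrt F u \<longleftrightarrow> Cauchy_wrt (\<lambda>x. F x powr (1 / p)) u"
proof
  assume F: "Cauchy_wrt F u"
  show "Cauchy_wrt (\<lambda>x. F x powr (1 / p)) u"
  proof (rule Cauchy_wrtI)
    fix e :: real assume e: "e > 0"
    obtain n0 where "\<And>m n. n0 \<le> m \<Longrightarrow> n0 \<le> n \<Longrightarrow> F (u m - u n) < e powr p"
      by (rule Cauchy_wrtE[OF F, of "e powr p"]) (use e in auto)
    then show "\<exists>n0. \<forall>m\<ge>n0. \<forall>n\<ge>n0. F (u m - u n) powr (1 / p) < e" using root_F_less_iff u e by auto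
  qed
next
  assume root: "Cauchy_wrt (\<lambda>x. F x powr (1 / p)) u"
  show "Cauchy_wrt F u"
  proof (rule Cauchy_wrtI)
    fix e :: real assume e: "e > 0"
    obtain n0 where n0: "\<And>m n. n0 \<le> m \<Longrightarrow> n0 \<le> n \<Longrightarrow> F (u m - u n) powr (1 / p) < e powr (1 / p)"
      by (rule Cauchy_wrtE[OF root, of "e powr (1 / p)"]) (use e in auto)
    have "F (u m - u n) < (e powr (1 / p)) powr p" if "n0 \<le> m" "n0 \<le> n" for m n
      using n0[OF that] root_F_less_iff[of "u m - u n" "e powr (1 / p)"] u e by simp
    then show "\<exists>n0. \<forall>m\<ge>n0. \<forall>n\<ge>n0. F (u m - u n) < e" using p e by (auto simp: powr_powr)
  qed
qed

lemma F_uniformly_continuous: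
  assumes e: "e > 0"
  obtains \<delta> where "\<delta> > 0" "\<And>x y. x \<in> E \<Longrightarrow> y \<in> E \<Longrightarrow> F x powr (1 / p) \<le> R \<Longrightarrow>
    F (x - y) powr (1 / p) < \<delta> \<Longrightarrow> \<bar>F x - F y\<bar> < e"
proof -
  have "uniformly_continuous_on {0..R + 1} (\<lambda>t::real. t powr p)"
    using p by (intro compact_uniformly_continuous continuous_on_powr' continuous_intros) auto
  then obtain \<delta> where \<delta>: "\<delta> > 0"
    "\<And>s t. s \<in> {0..R + 1} \<Longrightarrow> t \<in> {0..R + 1} \<Longrightarrow> \<bar>t - s\<bar> < \<delta> \<Longrightarrow> \<bar>t powr p - s powr p\<bar> < e"
    using e unfolding uniformly_continuous_on_def dist_real_def by meson
  show ?thesis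
  proof (rule that[of "min \<delta> 1"])
    fix x y assume xy: "x \<in> E" "y \<in> E" and R: "F x powr (1 / p) \<le> R"
      and d: "F (x - y) powr (1 / p) < min \<delta> 1"
    have "\<bar>F x powr (1 / p) - F y powr (1 / p)\<bar> < min \<delta> 1" using abs_N_diff_le[OF xy] d by linarith
    then have "\<bar>(F x powr (1 / p)) powr p - (F y powr (1 / p)) powr p\<bar> < e"
      using R by (intro \<delta>(2)) auto
    then show "\<bar>F x - F y\<bar> < e" using F_powr xy by simp
  qed (use \<delta> in auto)
qed

lemma F_tendsto:
  assumes u: "\<And>n. u n \<in> E" "v \<in> E" and lim: "(\<lambda>n::nat. F (u n - v)) \<longlonglongrightarrow> 0"
  shows "(\<lambda>n. F (u n)) \<longlonglongrightarrow> F v"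
proof (rule LIMSEQ_I)
  fix e :: real assume "e > 0"
  then obtain \<delta> where \<delta>: "\<delta> > 0" "\<And>x y. x \<in> E \<Longrightarrow> y \<in> E \<Longrightarrow> F x powr (1 / p) \<le> F v powr (1 / p) \<Longrightarrow>
    F (x - y) powr (1 / p) < \<delta> \<Longrightarrow> \<bar>F x - F y\<bar> < e"
    by (rule F_uniformly_continuous) (rule that)
  have "(\<lambda>n. F (u n - v) powr (1 / p)) \<longlonglongrightarrow> 0" using lim F_tendsto_0_iff[of "\<lambda>n. u n - v"] u by auto
  then have "eventually (\<lambda>n. F (u n - v) powr (1 / p) < \<delta>) sequentially"
    using \<delta>(1) by (rule order_tendstoD)
  then have "eventually (\<lambda>n. norm (F (u n) - F v) < e) sequentially"
    by eventually_elim (use \<delta>(2)[OF u(2,1)] F_diff_commute[OF u] in \<open>auto simp: abs_minus_commute\<close>)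
  then show "\<exists>n0. \<forall>n\<ge>n0. norm (F (u n) - F v) < e" by (simp add: eventually_sequentially)
qed

end

definition uniformly_convex_on :: "'a::real_vector set \<Rightarrow> ('a \<Rightarrow> real) \<Rightarrow> bool" where
  "uniformly_convex_on E F \<longleftrightarrow> (\<forall>\<epsilon>>0. \<exists>c\<ge>0. \<forall>u\<in>E. \<forall>v\<in>E.
     F (u - v) \<le> \<epsilon> * (F u + F v) + c * ((F u + F v) / 2 - F ((1/2) *\<^sub>R (u + v))))"

lemma uniformly_convex_onE:
  assumes "uniformly_convex_on E F" "\<epsilon> > 0"
  obtains c where "c \<ge> 0"
    "\<And>u v. u \<in> E \<Longrightarrow> v \<in> E \<Longrightarrow> F (u - v)
        \<le> \<epsilon> * (F u + F v) + c * ((F u + F v) / 2 - F ((1/2) *\<^sub>R (u + v)))"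
  using assms unfolding uniformly_convex_on_def by blast

text \<open>The abstract setting of the Rayleigh quotient \<open>G/L\<close>; in the application \<open>G\<close> is the
  \<open>p\<close>-th power of the Gagliardo seminorm and \<open>L\<close> that of the \<open>L\<^sup>p\<close>-norm.\<close>

locale rayleigh = G: convex_homogeneous E G p + L: convex_homogeneous E L p
  for E :: "'a::real_vector set" and G L :: "'a \<Rightarrow> real" and p :: real +
  assumes G_uniformly_convex: "uniformly_convex_on E G"
    and L_uniformly_convex: "uniformly_convex_on E L"
    and complete: "\<And>u. (\<And>n::nat. u n \<in> E) \<Longrightarrow> Cauchy_wrt (\<lambda>x. G x + L x) u \<Longrightarrow>
       \<exists>v\<in>E. (\<lambda>n. G (u n - v) + L (u n - v)) \<longlonglongrightarrow> 0"
    and compact_embedding: "\<And>u B. (\<And>n::nat. u n \<in> E) \<Longrightarrow> (\<And>n. G (u n) + L (u n) \<le> B) \<Longrightarrow>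
       \<exists>r. strict_mono (r :: nat \<Rightarrow> nat) \<and> Cauchy_wrt L (\<lambda>n. u (r n))"
begin

abbreviation Phi :: "'a \<Rightarrow> real" where "Phi u \<equiv> G u + L u"
abbreviation N :: "'a \<Rightarrow> real" where "N u \<equiv> (G u + L u) powr (1 / p)"
abbreviation l :: "'a \<Rightarrow> real" where "l u \<equiv> L u powr (1 / p)"

sublocale Phi: convex_homogeneous E "\<lambda>u. G u + L u" p
proof
  fix u v and t :: real assume "u \<in> E" "v \<in> E" "0 \<le> t" "t \<le> 1"
  then show "G ((1 - t) *\<^sub>R u + t *\<^sub>R v) + L ((1 - t) *\<^sub>R u + t *\<^sub>R v)
      \<le> (1 - t) * (G u + L u) + t * (G v + L v)"
    using G.F_convex[of u v t] L.F_convex[of u v t] by (simp add: algebra_simps)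
qed (auto simp: L.subspace_E L.p G.F_nonneg L.F_nonneg G.F_hom L.F_hom algebra_simps)

lemma p_pos: "p > 0" using L.p by simp

lemma l_le_N: "u \<in> E \<Longrightarrow> l u \<le> N u"
  using G.F_nonneg L.F_nonneg p_pos by (intro powr_mono2) auto

lemma N_pos: "u \<in> E \<Longrightarrow> L u > 0 \<Longrightarrow> N u > 0"
  using G.F_nonneg[of u] by simp

lemma L_pos_not_fixed: "L x > 0 \<Longrightarrow> - x \<noteq> x"
  by (auto simp: uminus_eq_self_iff)

lemma tendsto_components:
  assumes u: "\<And>n. u n \<in> E" "v \<in> E" and lim: "(\<lambda>n::nat. N (u n - v)) \<longlonglongrightarrow> 0"
  shows "(\<lambda>n. G (u n)) \<longlonglongrightarrow> G v" "(\<lambda>n. L (u n)) \<longlonglongrightarrow> L v"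
proof -
  have Phi: "(\<lambda>n. Phi (u n - v)) \<longlonglongrightarrow> 0" using lim Phi.F_tendsto_0_iff[of "\<lambda>n. u n - v"] u by auto
  have nonneg: "0 \<le> G (u n - v)" "0 \<le> L (u n - v)" for n
    using u by (auto intro: G.F_nonneg L.F_nonneg)
  have "(\<lambda>n. G (u n - v)) \<longlonglongrightarrow> 0" "(\<lambda>n. L (u n - v)) \<longlonglongrightarrow> 0"
    by (rule tendsto_sandwich[OF _ _ tendsto_const Phi]; use nonneg in auto)+
  then show "(\<lambda>n. G (u n)) \<longlonglongrightarrow> G v" "(\<lambda>n. L (u n)) \<longlonglongrightarrow> L v"
    using G.F_tendsto L.F_tendsto u by auto
qed

lemma N_complete:
  assumes u: "\<And>n::nat. u n \<in> E" and Cauchy: "Cauchy_wrt N u"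
  obtains v where "v \<in> E" "(\<lambda>n. N (u n - v)) \<longlonglongrightarrow> 0"
proof -
  have "Cauchy_wrt Phi u" using Cauchy Phi.Cauchy_wrt_F_iff[OF u] by simp
  from complete[OF u this] obtain v where v: "v \<in> E" "(\<lambda>n. Phi (u n - v)) \<longlonglongrightarrow> 0" by blast
  then have "(\<lambda>n. N (u n - v)) \<longlonglongrightarrow> 0" using Phi.F_tendsto_0_iff[of "\<lambda>n. u n - v"] u by simp
  then show ?thesis by (rule that[OF v(1)])
qed

subsection \<open>The resolvent\<close>

text \<open>The functional whose minimiser over \<open>v\<close> is the resolvent of the eigenvalue operator at \<open>u\<close>.\<close>

definition resolvent_energy :: "real \<Rightarrow> 'a \<Rightarrow> 'a \<Rightarrow> real" where
  "resolvent_energy c u v = G v + c * L (u - v)"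

definition near_minimizer :: "real \<Rightarrow> real \<Rightarrow> 'a \<Rightarrow> 'a \<Rightarrow> bool" where
  "near_minimizer \<eta> c u v \<longleftrightarrow> v \<in> E \<and> (\<forall>w\<in>E. resolvent_energy c u v \<le> resolvent_energy c u w + \<eta>)"

abbreviation minimizer :: "real \<Rightarrow> 'a \<Rightarrow> 'a \<Rightarrow> bool" where
  "minimizer \<equiv> near_minimizer 0"

lemma near_minimizer_in: "near_minimizer \<eta> c u v \<Longrightarrow> v \<in> E"
  by (simp add: near_minimizer_def)

lemma near_minimizerD:
  "near_minimizer \<eta> c u v \<Longrightarrow> w \<in> E \<Longrightarrow> resolvent_energy c u v \<le> resolvent_energy c u w + \<eta>"
  by (simp add: near_minimizer_def)

lemma near_minimizer_mono: "near_minimizer \<eta> c u v \<Longrightarrow> \<eta> \<le> \<eta>' \<Longrightarrow> near_minimizer \<eta>' c u v"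
  unfolding near_minimizer_def by fastforce

lemma resolvent_energy_nonneg: "c \<ge> 0 \<Longrightarrow> u \<in> E \<Longrightarrow> v \<in> E \<Longrightarrow> resolvent_energy c u v \<ge> 0"
  unfolding resolvent_energy_def using G.F_nonneg[of v] L.F_nonneg[of "u - v"] by auto

lemma near_minimizer_energy_le:
  "near_minimizer \<eta> c u v \<Longrightarrow> u \<in> E \<Longrightarrow> resolvent_energy c u v \<le> c * L u + \<eta>"
  using near_minimizerD[of \<eta> c u v 0] by (simp add: resolvent_energy_def)

lemma resolvent_energy_uniformly_convex:
  assumes c: "c > 0" and \<epsilon>: "\<epsilon> > 0"
  obtains C where "C \<ge> 0" "\<And>u v w. u \<in> E \<Longrightarrow> v \<in> E \<Longrightarrow> w \<in> E \<Longrightarrow>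
    G (v - w) + c * L (v - w) \<le> \<epsilon> * (resolvent_energy c u v + resolvent_energy c u w)
      + C * ((resolvent_energy c u v + resolvent_energy c u w) / 2 - resolvent_energy c u ((1/2) *\<^sub>R (v + w)))"
proof -
  obtain C\<^sub>G where C\<^sub>G: "C\<^sub>G \<ge> 0" "\<And>u v. u \<in> E \<Longrightarrow> v \<in> E \<Longrightarrow>
    G (u - v) \<le> \<epsilon> * (G u + G v) + C\<^sub>G * ((G u + G v) / 2 - G ((1/2) *\<^sub>R (u + v)))"
    by (rule uniformly_convex_onE[OF G_uniformly_convex \<epsilon>]) (rule that)
  obtain C\<^sub>L where C\<^sub>L: "\<And>u v. u \<in> E \<Longrightarrow> v \<in> E \<Longrightarrow>
    L (u - v) \<le> \<epsilon> * (L u + L v) + C\<^sub>L * ((L u + L v) / 2 - L ((1/2) *\<^sub>R (u + v)))"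
    by (rule uniformly_convex_onE[OF L_uniformly_convex \<epsilon>]) (rule that)
  define C where "C = max C\<^sub>G C\<^sub>L"
  show ?thesis
  proof (rule that[of C])
    fix u v w assume uvw: "u \<in> E" "v \<in> E" "w \<in> E"
    define h where "h = (1/2) *\<^sub>R (v + w)"
    define gapG where "gapG = (G v + G w) / 2 - G h"
    define gapL where "gapL = (L (u - v) + L (u - w)) / 2 - L (u - h)"
    have "(1/2) *\<^sub>R (u + u) = u" by (simp flip: scaleR_2)
    then have uh: "u - h = (1/2) *\<^sub>R ((u - v) + (u - w))"
      unfolding h_def by (simp add: algebra_simps)
    have gap0: "0 \<le> gapG" "0 \<le> gapL"
      using G.F_midpoint[of v w] L.F_midpoint[of "u - v" "u - w", folded uh] uvw
      by (auto simp: gapG_def gapL_def h_def)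
    have "G (v - w) \<le> \<epsilon> * (G v + G w) + C\<^sub>G * gapG"
      using C\<^sub>G(2) uvw unfolding gapG_def h_def by blast
    also have "C\<^sub>G * gapG \<le> C * gapG" using gap0 by (intro mult_right_mono) (auto simp: C_def)
    finally have G_le: "G (v - w) \<le> \<epsilon> * (G v + G w) + C * gapG" by simp
    have "L (v - w) = L ((u - v) - (u - w))" using L.F_diff_commute[OF uvw(2,3)] by simp
    also have "\<dots> \<le> \<epsilon> * (L (u - v) + L (u - w)) + C\<^sub>L * gapL"
      using C\<^sub>L[of "u - v" "u - w"] uvw unfolding gapL_def uh by auto
    also have "C\<^sub>L * gapL \<le> C * gapL" using gap0 by (intro mult_right_mono) (auto simp: C_def)
    finally have "c * L (v - w) \<le> c * (\<epsilon> * (L (u - v) + L (u - w)) + C * gapL)"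
      using c by (intro mult_left_mono) auto
    then show "G (v - w) + c * L (v - w) \<le> \<epsilon> * (resolvent_energy c u v + resolvent_energy c u w)
      + C * ((resolvent_energy c u v + resolvent_energy c u w) / 2 - resolvent_energy c u ((1/2) *\<^sub>R (v + w)))"
      using G_le unfolding h_def[symmetric] resolvent_energy_def gapG_def gapL_def
      by (simp add: algebra_simps add_divide_distrib)
  qed (use C\<^sub>G in \<open>simp add: C_def\<close>)
qed

lemma near_minimizers_close:
  assumes c: "c > 0" and e: "e > 0" and B: "B \<ge> 0"
  obtains \<eta> where "\<eta> > 0" "\<And>u v w. u \<in> E \<Longrightarrow> L u \<le> B \<Longrightarrow>
    near_minimizer \<eta> c u v \<Longrightarrow> near_minimizer \<eta> c u w \<Longrightarrow> N (v - w) < e"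
proof -
  define k where "k = min 1 c * e powr p"
  have k: "k > 0" using c e by (simp add: k_def)
  have bound_pos: "c * B + 1 > 0" using c B by (simp add: add_nonneg_pos)
  define \<epsilon> where "\<epsilon> = k / (8 * (c * B + 1))"
  have \<epsilon>: "\<epsilon> > 0" "\<epsilon> * (2 * (c * B + 1)) = k / 4"
    using bound_pos k by (auto simp: \<epsilon>_def field_simps)
  obtain C where C: "C \<ge> 0" "\<And>u v w. u \<in> E \<Longrightarrow> v \<in> E \<Longrightarrow> w \<in> E \<Longrightarrow>
    G (v - w) + c * L (v - w) \<le> \<epsilon> * (resolvent_energy c u v + resolvent_energy c u w)
      + C * ((resolvent_energy c u v + resolvent_energy c u w) / 2 - resolvent_energy c u ((1/2) *\<^sub>R (v + w)))"
    by (rule resolvent_energy_uniformly_convex[OF c \<epsilon>(1)]) (rule that)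
  define \<eta> where "\<eta> = min 1 (k / (4 * (C + 1)))"
  have \<eta>: "\<eta> > 0" "\<eta> \<le> 1" using C(1) k by (auto simp: \<eta>_def)
  have "C * \<eta> \<le> C * (k / (4 * (C + 1)))" using C(1) by (intro mult_left_mono) (auto simp: \<eta>_def)
  also have "\<dots> \<le> k / 4" using C(1) k by (simp add: field_simps)
  finally have error_le: "C * \<eta> \<le> k / 4" .
  show ?thesis
  proof (rule that[OF \<eta>(1)])
    fix u v w assume u: "u \<in> E" "L u \<le> B" and v: "near_minimizer \<eta> c u v"
      and w: "near_minimizer \<eta> c u w"
    note E = u(1) near_minimizer_in[OF v] near_minimizer_in[OF w]
    have vw: "v - w \<in> E" using E by auto
    have "c * L u + \<eta> \<le> c * B + 1" using c u(2) \<eta>(2) by (intro add_mono mult_left_mono) auto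
    then have "resolvent_energy c u v \<le> c * B + 1" "resolvent_energy c u w \<le> c * B + 1"
      using near_minimizer_energy_le[OF v u(1)] near_minimizer_energy_le[OF w u(1)]
      by (auto elim: order_trans)
    then have sum_le: "resolvent_energy c u v + resolvent_energy c u w \<le> 2 * (c * B + 1)"
      unfolding mult_2 by (rule add_mono)
    have mid: "(1/2) *\<^sub>R (v + w) \<in> E" using E by auto
    have gap: "(resolvent_energy c u v + resolvent_energy c u w) / 2
        - resolvent_energy c u ((1/2) *\<^sub>R (v + w)) \<le> \<eta>"
      using near_minimizerD[OF v mid] near_minimizerD[OF w mid] by argo
    have "min 1 c * G (v - w) \<le> 1 * G (v - w)" "min 1 c * L (v - w) \<le> c * L (v - w)"
      by (rule mult_right_mono; use G.F_nonneg[OF vw] L.F_nonneg[OF vw] in simp)+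
    then have "min 1 c * Phi (v - w) \<le> G (v - w) + c * L (v - w)" by (simp add: algebra_simps)
    also have "\<dots> \<le> \<epsilon> * (2 * (c * B + 1)) + C * \<eta>"
      using C(2)[OF E] mult_left_mono[OF sum_le, of \<epsilon>] mult_left_mono[OF gap C(1)] \<epsilon>(1) by linarith
    also have "\<dots> < min 1 c * e powr p" using \<epsilon>(2) error_le k by (simp add: k_def[symmetric])
    finally have "Phi (v - w) < e powr p" using c by simp
    then show "N (v - w) < e" using Phi.root_F_less_iff[OF vw e] by simp
  qed
qed

lemma near_minimizer_exists:
  assumes c: "c > 0" and u: "u \<in> E" and \<eta>: "\<eta> > 0"
  shows "\<exists>v. near_minimizer \<eta> c u v"
proof -
  have bdd: "bdd_below (resolvent_energy c u ` E)"
    using resolvent_energy_nonneg c u by (intro bdd_belowI[of _ 0]) auto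
  have "resolvent_energy c u ` E \<noteq> {}" by auto
  then obtain v where v: "v \<in> E" "resolvent_energy c u v < Inf (resolvent_energy c u ` E) + \<eta>"
    using cInf_lessD[of "resolvent_energy c u ` E"] \<eta> by (metis imageE less_add_same_cancel1)
  have "Inf (resolvent_energy c u ` E) \<le> resolvent_energy c u w" if "w \<in> E" for w
    using bdd that by (intro cInf_lower) auto
  then show ?thesis unfolding near_minimizer_def using v by fastforce
qed

lemma minimizer_exists:
  assumes c: "c > 0" and u: "u \<in> E"
  shows "\<exists>v. minimizer c u v"
proof -
  have "\<exists>v. near_minimizer (inverse (real (Suc n))) c u v" for n
    by (rule near_minimizer_exists[OF c u]) simp
  then obtain v where v: "\<And>n. near_minimizer (inverse (real (Suc n))) c u (v n)" by metis
  note vE = near_minimizer_in[OF v]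
  have "Cauchy_wrt N v"
  proof (rule Cauchy_wrtI)
    fix e :: real assume "e > 0"
    then obtain \<eta> where \<eta>: "\<eta> > 0"
      "\<And>v w. near_minimizer \<eta> c u v \<Longrightarrow> near_minimizer \<eta> c u w \<Longrightarrow> N (v - w) < e"
      using near_minimizers_close[OF c _ L.F_nonneg[OF u]] u by (metis order_refl)
    obtain n0 where n0: "inverse (real (Suc n0)) < \<eta>" using reals_Archimedean[OF \<eta>(1)] by auto
    have "near_minimizer \<eta> c u (v n)" if "n \<ge> n0" for n
    proof (rule near_minimizer_mono[OF v])
      have "inverse (real (Suc n)) \<le> inverse (real (Suc n0))" using that by (simp add: field_simps)
      then show "inverse (real (Suc n)) \<le> \<eta>" using n0 by linarith
    qed
    then show "\<exists>n0. \<forall>m\<ge>n0. \<forall>n\<ge>n0. N (v m - v n) < e" using \<eta>(2) by blast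
  qed
  then obtain x where x: "x \<in> E" "(\<lambda>n. N (v n - x)) \<longlonglongrightarrow> 0" by (rule N_complete[OF vE])
  have "N ((u - v n) - (u - x)) = N (v n - x)" for n
    using Phi.N_diff_commute[OF vE x(1)] by simp
  then have "(\<lambda>n. L (u - v n)) \<longlonglongrightarrow> L (u - x)"
    using tendsto_components(2)[of "\<lambda>n. u - v n" "u - x"] vE x u by auto
  then have lim: "(\<lambda>n. resolvent_energy c u (v n)) \<longlonglongrightarrow> resolvent_energy c u x"
    unfolding resolvent_energy_def by (intro tendsto_intros tendsto_components(1)[OF vE x])
  have "resolvent_energy c u x \<le> resolvent_energy c u w + 0" if w: "w \<in> E" for w
  proof (rule LIMSEQ_le[OF lim])
    show "(\<lambda>n. resolvent_energy c u w + inverse (real (Suc n))) \<longlonglongrightarrow> resolvent_energy c u w + 0"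
      by (intro tendsto_intros LIMSEQ_inverse_real_of_nat)
  qed (use near_minimizerD[OF v w] in blast)
  then show ?thesis unfolding near_minimizer_def using x by blast
qed

lemma minimizer_rayleigh:
  assumes c: "c > 0" and u: "u \<in> E" "L u > 0" and v: "minimizer c u v"
  shows "G v * L u \<le> G u * L v"
proof -
  have vE: "v \<in> E" by (rule near_minimizer_in[OF v])
  have l_pos: "l u > 0" using u by simp
  define \<theta> where "\<theta> = l v / l u"
  have \<theta>: "\<theta> \<ge> 0" unfolding \<theta>_def by auto
  have "\<theta> powr p = L v / L u" unfolding \<theta>_def using L.F_powr u vE l_pos by (simp add: powr_divide)
  then have scaled: "\<theta> powr p * L u = L v" using u by simp
  have "u - \<theta> *\<^sub>R u = (1 - \<theta>) *\<^sub>R u" by (simp add: algebra_simps)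
  then have energy: "G v + c * L (u - v) \<le> \<theta> powr p * G u + c * (\<bar>1 - \<theta>\<bar> powr p * L u)"
    using near_minimizerD[OF v, of "\<theta> *\<^sub>R u"] u \<theta>
    by (simp add: resolvent_energy_def G.F_hom L.F_hom)
  have "\<bar>1 - \<theta>\<bar> * l u = \<bar>(1 - \<theta>) * l u\<bar>" using l_pos by (simp add: abs_mult)
  also have "(1 - \<theta>) * l u = l u - l v" unfolding \<theta>_def using l_pos by (simp add: field_simps)
  also have "\<bar>l u - l v\<bar> \<le> l (u - v)" using L.abs_N_diff_le u vE by auto
  finally have "(\<bar>1 - \<theta>\<bar> * l u) powr p \<le> l (u - v) powr p"
    using l_pos p_pos by (intro powr_mono2) auto
  then have "\<bar>1 - \<theta>\<bar> powr p * L u \<le> L (u - v)"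
    using L.F_powr[OF u(1)] L.F_powr[of "u - v"] u vE l_pos by (simp add: powr_mult)
  then have "c * (\<bar>1 - \<theta>\<bar> powr p * L u) \<le> c * L (u - v)" using c by simp
  then have "G v \<le> \<theta> powr p * G u" using energy by linarith
  then have "G v * L u \<le> \<theta> powr p * G u * L u" using u by (intro mult_right_mono) auto
  also have "\<dots> = G u * L v" by (simp add: ac_simps flip: scaled)
  finally show ?thesis .
qed

lemma minimizer_dist_le:
  assumes c: "c > 0" and u: "u \<in> E" and v: "minimizer c u v"
  shows "L (u - v) \<le> L u" "L (u - v) \<le> G u / c"
proof -
  have "0 \<le> G v" by (rule G.F_nonneg[OF near_minimizer_in[OF v]])
  then have "c * L (u - v) \<le> c * L u" "c * L (u - v) \<le> G u"
    using near_minimizerD[OF v, of 0] near_minimizerD[OF v u] by (auto simp: resolvent_energy_def)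
  then show "L (u - v) \<le> L u" "L (u - v) \<le> G u / c" using c by (auto simp: field_simps)
qed

lemma minimizer_lower_bound:
  assumes c: "\<kappa> < c" and u: "u \<in> E" "L u = 1" "G u \<le> \<kappa>" and v: "minimizer c u v"
  shows "1 - (\<kappa> / c) powr (1 / p) \<le> l v"
proof -
  have c_pos: "c > 0" using G.F_nonneg[OF u(1)] c u(3) by linarith
  have vE: "v \<in> E" by (rule near_minimizer_in[OF v])
  have "L (u - v) \<le> G u / c" by (rule minimizer_dist_le[OF c_pos u(1) v])
  also have "\<dots> \<le> \<kappa> / c" using u(3) c_pos by (simp add: divide_right_mono)
  finally have "l (u - v) \<le> (\<kappa> / c) powr (1 / p)"
    using p_pos u vE by (intro powr_mono2) (auto intro!: L.F_nonneg)
  moreover have "l u \<le> l v + l (u - v)" using u vE by (intro L.N_le_add_diff) auto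
  ultimately show ?thesis using u by simp
qed

lemma one_minus_ratio_powr_pos: "0 \<le> \<kappa> \<Longrightarrow> \<kappa> < c \<Longrightarrow> 0 < 1 - (\<kappa> / c) powr (1 / p)"
proof -
  assume "0 \<le> \<kappa>" "\<kappa> < c"
  then have "\<kappa> / c < 1" "0 \<le> \<kappa> / c" by (auto simp: field_simps)
  then have "(\<kappa> / c) powr (1 / p) < 1 powr (1 / p)" using p_pos by (intro powr_less_mono2) auto
  then show ?thesis by simp
qed

lemma minimizer_uniformly_continuous:
  assumes c: "c > 0" and e: "e > 0" and B: "B \<ge> 0"
  obtains \<delta> where "\<delta> > 0" "\<And>u u' v v'. u \<in> E \<Longrightarrow> u' \<in> E \<Longrightarrow> L u \<le> B \<Longrightarrow> L u' \<le> B \<Longrightarrow> l (u - u') < \<delta> \<Longrightarrow>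
    minimizer c u v \<Longrightarrow> minimizer c u' v' \<Longrightarrow> N (v - v') < e"
proof -
  obtain \<eta> where \<eta>: "\<eta> > 0" "\<And>u v v'. u \<in> E \<Longrightarrow> L u \<le> B \<Longrightarrow>
    near_minimizer \<eta> c u v \<Longrightarrow> near_minimizer \<eta> c u v' \<Longrightarrow> N (v - v') < e"
    by (rule near_minimizers_close[OF c e B]) (rule that)
  have "\<eta> / (2 * c) > 0" using \<eta> c by auto
  then obtain \<delta> where \<delta>: "\<delta> > 0" "\<And>x y. x \<in> E \<Longrightarrow> y \<in> E \<Longrightarrow> l x \<le> B powr (1 / p) \<Longrightarrow>
    l (x - y) < \<delta> \<Longrightarrow> \<bar>L x - L y\<bar> < \<eta> / (2 * c)"
    by (rule L.F_uniformly_continuous) (rule that)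
  have close: "\<bar>resolvent_energy c a w - resolvent_energy c b w\<bar> < \<eta> / 2"
    if ab: "a \<in> E" "b \<in> E" "L a \<le> B" "l (a - b) < \<delta>" and w: "minimizer c a w" for a b w
  proof -
    have wE: "w \<in> E" by (rule near_minimizer_in[OF w])
    have "L (a - w) \<le> B" using minimizer_dist_le(1)[OF c ab(1) w] ab(3) by simp
    then have "l (a - w) \<le> B powr (1 / p)"
      using p_pos ab wE by (intro powr_mono2) (auto intro!: L.F_nonneg)
    then have diff: "\<bar>L (a - w) - L (b - w)\<bar> < \<eta> / (2 * c)" using ab wE by (intro \<delta>(2)) auto
    have "\<bar>resolvent_energy c a w - resolvent_energy c b w\<bar> = \<bar>c * (L (a - w) - L (b - w))\<bar>"
      by (simp add: resolvent_energy_def right_diff_distrib)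
    also have "\<dots> = c * \<bar>L (a - w) - L (b - w)\<bar>" by (subst abs_mult) (use c in simp)
    also have "\<dots> < c * (\<eta> / (2 * c))" using diff c by (rule mult_strict_left_mono)
    also have "\<dots> = \<eta> / 2" using c by simp
    finally show ?thesis .
  qed
  show ?thesis
  proof (rule that[OF \<delta>(1)])
    fix u u' v v' assume u: "u \<in> E" "u' \<in> E" "L u \<le> B" "L u' \<le> B" "l (u - u') < \<delta>"
      and v: "minimizer c u v" "minimizer c u' v'"
    have d: "l (u' - u) < \<delta>" using u(5) L.N_diff_commute[OF u(1,2)] by simp
    have "resolvent_energy c u v' \<le> resolvent_energy c u' v' + \<eta> / 2"
      using close[OF u(2,1,4) d v(2)] by linarith
    also have "resolvent_energy c u' v' \<le> resolvent_energy c u' v"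
      using near_minimizerD[OF v(2) near_minimizer_in[OF v(1)]] by simp
    also have "resolvent_energy c u' v \<le> resolvent_energy c u v + \<eta> / 2"
      using close[OF u(1,2,3,5) v(1)] by linarith
    finally have "resolvent_energy c u v' \<le> resolvent_energy c u v + \<eta>" by simp
    then have "near_minimizer \<eta> c u v'"
      using near_minimizerD[OF v(1)] near_minimizer_in[OF v(2)] unfolding near_minimizer_def
      by fastforce
    then show "N (v - v') < e" using \<eta> near_minimizer_mono[OF v(1)] u by (intro \<eta>(2)) auto
  qed
qed

lemma minimizer_minus:
  assumes u: "u \<in> E" and v: "minimizer c u v"
  shows "minimizer c (- u) (- v)"
proof -
  have "resolvent_energy c (- u) w = resolvent_energy c u (- w)" if "w \<in> E" for w
    using L.F_minus[of "u + w"] G.F_minus[OF that] u that by (simp add: resolvent_energy_def)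
  then show ?thesis using v unfolding near_minimizer_def by auto
qed

abbreviation L_sphere :: "'a set" where "L_sphere \<equiv> {u\<in>E. L u = 1}"

lemma odd_resolvent_exists:
  assumes c: "c > 0"
  shows "\<exists>T. \<forall>u\<in>L_sphere. minimizer c u (T u) \<and> T (- u) = - T u"
proof -
  obtain T where "\<And>u. u \<in> L_sphere \<Longrightarrow> minimizer c u (T u)" "\<And>u. u \<in> L_sphere \<Longrightarrow> T (- u) = - T u"
  proof (rule equivariant_choice[of L_sphere uminus "minimizer c" uminus])
    show "- u \<noteq> u" if "u \<in> L_sphere" for u using that by (intro L_pos_not_fixed) simp
  qed (use minimizer_exists[OF c] minimizer_minus L.F_minus in auto)
  then show ?thesis by blast
qed

text \<open>Minimisers are unique only up to \<open>N\<close>-null vectors, hence the choice.\<close>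

definition resolvent :: "real \<Rightarrow> 'a \<Rightarrow> 'a" where
  "resolvent c = (SOME T. \<forall>u\<in>L_sphere. minimizer c u (T u) \<and> T (- u) = - T u)"

context
  fixes c :: real
  assumes c: "c > 0"
begin

lemma minimizer_resolvent: "u \<in> L_sphere \<Longrightarrow> minimizer c u (resolvent c u)"
  and resolvent_minus: "u \<in> L_sphere \<Longrightarrow> resolvent c (- u) = - resolvent c u"
  using someI_ex[OF odd_resolvent_exists[OF c]] unfolding resolvent_def by auto

lemma resolvent_in [simp, intro]: "u \<in> E \<Longrightarrow> L u = 1 \<Longrightarrow> resolvent c u \<in> E"
  by (rule near_minimizer_in[OF minimizer_resolvent]) simp

lemma resolvent_uniformly_continuous:
  assumes "e > 0"
  obtains \<delta> where "\<delta> > 0"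
    "\<And>u u'. u \<in> L_sphere \<Longrightarrow> u' \<in> L_sphere \<Longrightarrow> l (u - u') < \<delta> \<Longrightarrow> N (resolvent c u - resolvent c u') < e"
proof -
  obtain \<delta> where \<delta>: "\<delta> > 0" "\<And>u u' v v'. u \<in> E \<Longrightarrow> u' \<in> E \<Longrightarrow> L u \<le> 1 \<Longrightarrow> L u' \<le> 1 \<Longrightarrow> l (u - u') < \<delta> \<Longrightarrow>
    minimizer c u v \<Longrightarrow> minimizer c u' v' \<Longrightarrow> N (v - v') < e"
    by (rule minimizer_uniformly_continuous[OF c assms, of 1]) (use that in auto)
  show ?thesis
    by (rule that[OF \<delta>(1)])
      (auto intro!: \<delta>(2)[OF _ _ _ _ _ minimizer_resolvent minimizer_resolvent])
qed

lemma resolvent_Cauchy_subseq: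
  assumes u: "\<And>n::nat. u n \<in> L_sphere" "\<And>n. G (u n) \<le> \<kappa>"
  shows "\<exists>r. strict_mono (r :: nat \<Rightarrow> nat) \<and> Cauchy_wrt N (\<lambda>n. resolvent c (u (r n)))"
proof -
  have "Phi (u n) \<le> \<kappa> + 1" for n using u(1)[of n] u(2)[of n] by simp
  then obtain r where r: "strict_mono (r :: nat \<Rightarrow> nat)" "Cauchy_wrt L (\<lambda>n. u (r n))"
    using compact_embedding[of u "\<kappa> + 1"] u by auto
  have l: "Cauchy_wrt l (\<lambda>n. u (r n))" using r(2) L.Cauchy_wrt_F_iff[of "\<lambda>n. u (r n)"] u by auto
  have "Cauchy_wrt N (\<lambda>n. resolvent c (u (r n)))"
  proof (rule Cauchy_wrtI)
    fix e :: real assume "e > 0"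
    then obtain \<delta> where \<delta>: "\<delta> > 0"
      "\<And>u u'. u \<in> L_sphere \<Longrightarrow> u' \<in> L_sphere \<Longrightarrow> l (u - u') < \<delta> \<Longrightarrow>
          N (resolvent c u - resolvent c u') < e"
      by (rule resolvent_uniformly_continuous) (rule that)
    obtain n0 where "\<And>m n. n0 \<le> m \<Longrightarrow> n0 \<le> n \<Longrightarrow> l (u (r m) - u (r n)) < \<delta>"
      by (rule Cauchy_wrtE[OF l \<delta>(1)]) (rule that)
    then show "\<exists>n0. \<forall>m\<ge>n0. \<forall>n\<ge>n0. N (resolvent c (u (r m)) - resolvent c (u (r n))) < e"
      using \<delta>(2)[OF u(1) u(1)] by blast
  qed
  then show ?thesis using r(1) by blast
qed

end

subsection \<open>Sublevel sets of the Rayleigh quotient\<close>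

definition rayleigh_sublevel :: "real \<Rightarrow> 'a set" where
  "rayleigh_sublevel \<mu> = {u\<in>E. L u > 0 \<and> G u \<le> \<mu> * L u}"

definition open_rayleigh_sublevel :: "real \<Rightarrow> 'a set" where
  "open_rayleigh_sublevel \<mu> = {u\<in>E. L u > 0 \<and> G u < \<mu> * L u}"

lemma uminus_rayleigh_sublevel: "u \<in> rayleigh_sublevel \<mu> \<Longrightarrow> - u \<in> rayleigh_sublevel \<mu>"
  by (simp add: rayleigh_sublevel_def G.F_minus L.F_minus)

lemma uminus_open_rayleigh_sublevel: "u \<in> open_rayleigh_sublevel \<mu> \<Longrightarrow> - u \<in> open_rayleigh_sublevel \<mu>"
  by (simp add: open_rayleigh_sublevel_def G.F_minus L.F_minus)

lemma L_normalize:
  assumes u: "u \<in> E" "L u > 0"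
  shows "L.normalize u \<in> L_sphere" "G (L.normalize u) = G u / L u"
proof -
  have "\<bar>1 / l u\<bar> powr p = 1 / L u" using u L.F_powr[OF u(1)] by (simp add: powr_divide)
  then show "L.normalize u \<in> L_sphere" "G (L.normalize u) = G u / L u"
    using u unfolding L.normalize_def by (simp_all add: L.F_hom G.F_hom)
qed

lemma resolvent_limit_in_sublevel:
  assumes c: "\<mu> + 1 < c" "0 \<le> \<mu>" and u: "\<And>n::nat. u n \<in> L_sphere" "\<And>n. G (u n) \<le> \<mu> + e n"
    and e: "\<And>n. e n \<le> 1" "e \<longlonglongrightarrow> 0"
    and w: "w \<in> E" "(\<lambda>n. N (resolvent c (u n) - w)) \<longlonglongrightarrow> 0"
  shows "w \<in> rayleigh_sublevel \<mu>"
proof -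
  have c_pos: "c > 0" using c by simp
  define v where "v n = resolvent c (u n)" for n
  have v: "minimizer c (u n) (v n)" and vE: "v n \<in> E" for n
    using u(1) minimizer_resolvent[OF c_pos] resolvent_in[OF c_pos] unfolding v_def by auto
  note lims = tendsto_components[of v, OF vE w[folded v_def]]
  define \<delta> where "\<delta> = 1 - ((\<mu> + 1) / c) powr (1 / p)"
  have \<delta>: "\<delta> > 0" unfolding \<delta>_def using c by (intro one_minus_ratio_powr_pos) auto
  have "\<delta> powr p \<le> L (v n)" for n
  proof -
    have "G (u n) \<le> \<mu> + 1" using u(2)[of n] e(1)[of n] by linarith
    then have "\<delta> \<le> l (v n)"
      unfolding \<delta>_def using u(1) by (intro minimizer_lower_bound[OF c(1) _ _ _ v]) auto
    then have "\<delta> powr p \<le> l (v n) powr p" using \<delta> p_pos by (intro powr_mono2) auto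
    then show ?thesis using L.F_powr[OF vE] by simp
  qed
  then have "\<delta> powr p \<le> L w" by (intro LIMSEQ_le_const[OF lims(2)]) auto
  moreover have "\<delta> powr p > 0" using \<delta> by simp
  ultimately have Lw_pos: "L w > 0" by linarith
  have "G (v n) \<le> (\<mu> + e n) * L (v n)" for n
  proof -
    have "G (v n) * L (u n) \<le> G (u n) * L (v n)"
      using u(1) by (intro minimizer_rayleigh[OF c_pos _ _ v]) auto
    also have "\<dots> \<le> (\<mu> + e n) * L (v n)" using u(2) L.F_nonneg[OF vE] by (intro mult_right_mono) auto
    finally show ?thesis using u(1)[of n] by simp
  qed
  moreover have "(\<lambda>n. (\<mu> + e n) * L (v n)) \<longlonglongrightarrow> (\<mu> + 0) * L w" by (intro tendsto_intros lims e(2))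
  ultimately have "G w \<le> (\<mu> + 0) * L w" by (intro LIMSEQ_le[OF lims(1)]) auto
  then show ?thesis using w(1) Lw_pos by (simp add: rayleigh_sublevel_def)
qed

lemma resolvent_maps_into_neighbourhood:
  assumes c: "\<mu> + 1 < c" "0 \<le> \<mu>" and r: "\<And>x. x \<in> rayleigh_sublevel \<mu> \<Longrightarrow> 0 < r x"
  defines "U \<equiv> {y\<in>E. \<exists>x\<in>rayleigh_sublevel \<mu>. N (x - y) < r x}"
  obtains \<epsilon> where "\<epsilon> > 0" "\<And>u. u \<in> L_sphere \<Longrightarrow> G u \<le> \<mu> + \<epsilon> \<Longrightarrow> resolvent c u \<in> U"
proof (rule ccontr)
  assume "\<not> thesis"
  then have "\<exists>u\<in>L_sphere. G u \<le> \<mu> + inverse (real (Suc n)) \<and> resolvent c u \<notin> U" for n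
    using that[of "inverse (real (Suc n))"] by force
  then obtain u where u: "\<And>n::nat. u n \<in> L_sphere" "\<And>n. G (u n) \<le> \<mu> + inverse (real (Suc n))"
    and v: "\<And>n. resolvent c (u n) \<notin> U" by metis
  have c_pos: "c > 0" using c by simp
  have inverse_le: "inverse (real (Suc n)) \<le> 1" for n by (simp add: field_simps)
  have "G (u n) \<le> \<mu> + 1" for n using u(2)[of n] inverse_le[of n] by linarith
  from resolvent_Cauchy_subseq[where u = u, OF c_pos u(1) this]
  obtain k where k: "strict_mono (k :: nat \<Rightarrow> nat)" "Cauchy_wrt N (\<lambda>n. resolvent c (u (k n)))"
    by blast
  have vE: "resolvent c (u n) \<in> E" for n using u(1) resolvent_in[OF c_pos] by auto
  obtain w where w: "w \<in> E" "(\<lambda>n. N (resolvent c (u (k n)) - w)) \<longlonglongrightarrow> 0"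
    by (rule N_complete[OF _ k(2)]) (use vE that in auto)
  have wC: "w \<in> rayleigh_sublevel \<mu>"
  proof (rule resolvent_limit_in_sublevel[OF c u(1) u(2) inverse_le _ w])
    show "(\<lambda>n. inverse (real (Suc (k n)))) \<longlonglongrightarrow> 0"
      using LIMSEQ_subseq_LIMSEQ[OF LIMSEQ_inverse_real_of_nat k(1)] by (simp add: comp_def)
  qed
  have "eventually (\<lambda>n. N (resolvent c (u (k n)) - w) < r w) sequentially"
    using w(2) r[OF wC] by (rule order_tendstoD)
  then obtain n where "N (resolvent c (u (k n)) - w) < r w" by (auto simp: eventually_sequentially)
  then have "N (w - resolvent c (u (k n))) < r w" using Phi.N_diff_commute[OF w(1) vE] by simp
  then have "resolvent c (u (k n)) \<in> U" using wC vE[of "k n"] unfolding U_def by blast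
  then show False using v by simp
qed

theorem omega_power_zero_sublevel_propagates:
  assumes \<mu>: "0 \<le> \<mu>" and zero: "omega_power_zero Phi.d\<^sub>N uminus (rayleigh_sublevel \<mu>) q"
  obtains \<epsilon> where "\<epsilon> > 0" "omega_power_zero Phi.d\<^sub>N uminus {u\<in>L_sphere. G u \<le> \<mu> + \<epsilon>} q"
proof -
  obtain r where r: "\<And>x. x \<in> rayleigh_sublevel \<mu> \<Longrightarrow> 0 < r x"
    "omega_power_zero Phi.d\<^sub>N uminus {y\<in>E. \<exists>x\<in>rayleigh_sublevel \<mu>. N (x - y) < r x} q"
  proof (rule Phi.dist.omega_power_zero_neighbourhood[OF _ uminus_rayleigh_sublevel _ zero])
    show "rayleigh_sublevel \<mu> \<subseteq> E" by (auto simp: rayleigh_sublevel_def)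
    show "0 < N (x - - x)" if "x \<in> rayleigh_sublevel \<mu>" for x
      using that N_pos[of x] unfolding rayleigh_sublevel_def by (subst Phi.N_diff_uminus) auto
  qed (assumption, rule that)
  define U where "U = {y\<in>E. \<exists>x\<in>rayleigh_sublevel \<mu>. N (x - y) < r x}"
  define c where "c = \<mu> + 2"
  have c: "\<mu> + 1 < c" "c > 0" using \<mu> unfolding c_def by auto
  obtain \<epsilon> where \<epsilon>: "\<epsilon> > 0" "\<And>u. u \<in> L_sphere \<Longrightarrow> G u \<le> \<mu> + \<epsilon> \<Longrightarrow> resolvent c u \<in> U"
    by (rule resolvent_maps_into_neighbourhood[where r = r, OF c(1) \<mu> r(1), folded U_def])
      (assumption, rule that)
  show ?thesis
  proof (rule that[OF \<epsilon>(1)])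
    define B where "B = {u\<in>L_sphere. G u \<le> \<mu> + \<epsilon>}"
    have B_sphere: "u \<in> L_sphere" if "u \<in> B" for u using that by (simp add: B_def)
    show "omega_power_zero Phi.d\<^sub>N uminus {u\<in>L_sphere. G u \<le> \<mu> + \<epsilon>} q"
      unfolding B_def[symmetric]
    proof (rule omega_power_zero_pullback[OF r(2)[folded U_def]])
      show "resolvent c u \<in> U" "resolvent c (- u) = - resolvent c u" if "u \<in> B" for u
        using that \<epsilon>(2) resolvent_minus[OF c(2)] by (auto simp: B_def)
      fix u and e :: real assume u: "u \<in> B" and e: "e > 0"
      obtain \<delta> where \<delta>: "\<delta> > 0" "\<And>u u'. u \<in> L_sphere \<Longrightarrow> u' \<in> L_sphere \<Longrightarrow> l (u - u') < \<delta> \<Longrightarrow>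
          N (resolvent c u - resolvent c u') < e"
        by (rule resolvent_uniformly_continuous[OF c(2) e]) (rule that)
      have "N (resolvent c u - resolvent c u') < e" if "u' \<in> B" "N (u - u') < \<delta>" for u'
        using that u B_sphere l_le_N[of "u - u'"] by (intro \<delta>(2)) auto
      then show "\<exists>\<delta>>0. \<forall>u'\<in>B. N (u - u') < \<delta> \<longrightarrow> N (resolvent c u - resolvent c u') < e"
        using \<delta>(1) by blast
    qed
  qed
qed

lemma resolvent_normalize_continuous:
  assumes c: "c > 0" and u: "u \<in> E" "L u > 0" and e: "e > 0"
  shows "\<exists>\<delta>>0. \<forall>v\<in>E. L v > 0 \<longrightarrow> N (u - v) < \<delta> \<longrightarrow>
    N (resolvent c (L.normalize v) - resolvent c (L.normalize u)) < e"
proof -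
  obtain \<delta> where \<delta>: "\<delta> > 0" "\<And>u u'. u \<in> L_sphere \<Longrightarrow> u' \<in> L_sphere \<Longrightarrow> l (u - u') < \<delta> \<Longrightarrow>
      N (resolvent c u - resolvent c u') < e"
    by (rule resolvent_uniformly_continuous[OF c e]) (rule that)
  have "N (resolvent c (L.normalize v) - resolvent c (L.normalize u)) < e"
    if v: "v \<in> E" "L v > 0" "N (u - v) < \<delta> * l u / 2" for v
  proof (rule \<delta>(2)[OF L_normalize(1)[OF v(1,2)] L_normalize(1)[OF u]])
    have "l (v - u) < \<delta> * l u / 2"
      using v u l_le_N[of "u - v"] L.N_diff_commute[OF u(1) v(1)] by auto
    then show "l (L.normalize v - L.normalize u) < \<delta>"
      using u v by (intro L.normalize_dist_less) auto
  qed
  then show ?thesis using \<delta>(1) u by (intro exI[of _ "\<delta> * l u / 2"]) auto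
qed

lemma resolvent_image_odd_map_exists:
  assumes \<kappa>: "0 \<le> \<kappa>" "\<kappa> < c"
  obtains n g where "\<And>u. u \<in> L_sphere \<Longrightarrow> G u \<le> \<kappa> \<Longrightarrow> g (resolvent c u) \<in> seqs_upto n - {0}"
    "\<And>v. v \<in> E \<Longrightarrow> g (- v) = - g v"
    "\<And>v w. v \<in> E \<Longrightarrow> w \<in> E \<Longrightarrow> l2_norm (g v - g w) \<le> (real n + 1) * (2 * N (v - w))"
proof -
  define \<delta> where "\<delta> = 1 - (\<kappa> / c) powr (1 / p)"
  define S where "S = {u\<in>L_sphere. G u \<le> \<kappa>}"
  have c: "c > 0" using \<kappa> by simp
  have \<delta>: "\<delta> > 0" unfolding \<delta>_def using \<kappa> by (intro one_minus_ratio_powr_pos) auto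
  have TE: "resolvent c ` S \<subseteq> E" using c by (auto simp: S_def)
  have lower: "\<delta> \<le> N v" if "v \<in> resolvent c ` S" for v
  proof -
    from that obtain u where u: "u \<in> S" "v = resolvent c u" by blast
    have "\<delta> \<le> l v"
      unfolding \<delta>_def u(2) using u(1)
      by (intro minimizer_lower_bound[OF \<kappa>(2) _ _ _ minimizer_resolvent[OF c]]) (auto simp: S_def)
    then show ?thesis using l_le_N[of v] that TE by auto
  qed
  obtain F where F: "finite F" "F \<subseteq> resolvent c ` S"
    "\<And>v. v \<in> resolvent c ` S \<Longrightarrow> \<exists>x\<in>F. N (v - x) < \<delta> / 2"
  proof (rule Phi.finite_net_Cauchy_subseq[OF half_gt_zero[OF \<delta>]])
    fix \<sigma> assume "\<And>n::nat. \<sigma> n \<in> resolvent c ` S"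
    then have "\<forall>n. \<exists>u. u \<in> S \<and> \<sigma> n = resolvent c u" by blast
    then obtain u where u: "\<And>n::nat. u n \<in> S" "\<And>n. \<sigma> n = resolvent c (u n)" by metis
    show "\<exists>r. strict_mono (r :: nat \<Rightarrow> nat) \<and> Cauchy_wrt N (\<lambda>n. \<sigma> (r n))"
      unfolding u(2)
      by (rule resolvent_Cauchy_subseq[where u = u, OF c]) (use u(1) in \<open>auto simp: S_def\<close>)
  qed (rule that)
  obtain n g where g: "\<And>v. v \<in> resolvent c ` S \<Longrightarrow> g v \<in> seqs_upto n - {0}"
    "\<And>v. v \<in> E \<Longrightarrow> g (- v) = - g v"
    "\<And>v w. v \<in> E \<Longrightarrow> w \<in> E \<Longrightarrow> l2_norm (g v - g w) \<le> (real n + 1) * (2 * N (v - w))"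
    by (rule Phi.odd_lipschitz_map_exists[OF TE \<delta> lower F]) (assumption, assumption, rule that)
  have "g (resolvent c u) \<in> seqs_upto n - {0}" if "u \<in> L_sphere" "G u \<le> \<kappa>" for u
    using that by (intro g(1)) (auto simp: S_def)
  then show ?thesis using g(2,3) by (rule that)
qed

theorem sublevel_odd_map_exists:
  assumes \<kappa>: "0 \<le> \<kappa>"
  obtains n f where "\<And>u. u \<in> rayleigh_sublevel \<kappa> \<Longrightarrow> f u \<in> seqs_upto n - {0}"
    "\<And>u. u \<in> rayleigh_sublevel \<kappa> \<Longrightarrow> f (- u) = - f u"
    "\<And>u e. u \<in> rayleigh_sublevel \<kappa> \<Longrightarrow> e > 0 \<Longrightarrow>
       \<exists>\<delta>>0. \<forall>v\<in>rayleigh_sublevel \<kappa>. N (u - v) < \<delta> \<longrightarrow> l2_norm (f v - f u) < e"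
proof -
  define c where "c = \<kappa> + 1"
  have c: "c > 0" "\<kappa> < c" using \<kappa> unfolding c_def by auto
  obtain n g where g: "\<And>u. u \<in> L_sphere \<Longrightarrow> G u \<le> \<kappa> \<Longrightarrow> g (resolvent c u) \<in> seqs_upto n - {0}"
    "\<And>v. v \<in> E \<Longrightarrow> g (- v) = - g v"
    "\<And>v w. v \<in> E \<Longrightarrow> w \<in> E \<Longrightarrow> l2_norm (g v - g w) \<le> (real n + 1) * (2 * N (v - w))"
    by (rule resolvent_image_odd_map_exists[OF \<kappa> c(2)]) (rule that)
  have normalize: "L.normalize u \<in> L_sphere" "G (L.normalize u) \<le> \<kappa>"
    if "u \<in> rayleigh_sublevel \<kappa>" for u
    using that L_normalize[of u] by (auto simp: rayleigh_sublevel_def divide_le_eq)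
  define T where "T u = resolvent c (L.normalize u)" for u
  have T: "T u \<in> E" if "u \<in> rayleigh_sublevel \<kappa>" for u
    using normalize(1)[OF that] resolvent_in[OF c(1)] unfolding T_def by auto
  show ?thesis
  proof (rule that[of "\<lambda>u. g (T u)" n])
    fix u assume u: "u \<in> rayleigh_sublevel \<kappa>"
    have uE: "u \<in> E" "L u > 0" using u by (auto simp: rayleigh_sublevel_def)
    show "g (T u) \<in> seqs_upto n - {0}" unfolding T_def by (rule g(1)[OF normalize[OF u]])
    have "T (- u) = - T u"
      unfolding T_def L.normalize_minus[OF uE(1)]
      by (rule resolvent_minus[OF c(1) L_normalize(1)[OF uE]])
    then show "g (T (- u)) = - g (T u)" using g(2)[OF T[OF u]] by simp
    fix e :: real assume e: "e > 0"
    define e' where "e' = e / (2 * (real n + 1))"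
    have e': "e' > 0" "(real n + 1) * (2 * e') = e"
      using e unfolding e'_def by (auto simp: field_simps)
    obtain \<rho> where \<rho>: "\<rho> > 0" "\<And>v. v \<in> E \<Longrightarrow> L v > 0 \<Longrightarrow> N (u - v) < \<rho> \<Longrightarrow> N (T v - T u) < e'"
      using resolvent_normalize_continuous[OF c(1) uE e'(1)] unfolding T_def by blast
    have "l2_norm (g (T v) - g (T u)) < e" if v: "v \<in> rayleigh_sublevel \<kappa>" "N (u - v) < \<rho>" for v
    proof -
      have "N (T v - T u) < e'" using v by (intro \<rho>(2)) (auto simp: rayleigh_sublevel_def)
      then have "(real n + 1) * (2 * N (T v - T u)) < e"
        unfolding e'(2)[symmetric] by (intro mult_strict_left_mono) auto
      then show ?thesis using g(3)[OF T[OF v(1)] T[OF u]] by linarith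
    qed
    then show "\<exists>\<delta>>0. \<forall>v\<in>rayleigh_sublevel \<kappa>. N (u - v) < \<delta> \<longrightarrow> l2_norm (g (T v) - g (T u)) < e"
      using \<rho>(1) by blast
  qed
qed

lemma L_normalize_tendsto:
  assumes u: "\<And>n::nat. u n \<in> E" "\<And>n. L (u n) > 0" and w: "w \<in> E" "L w > 0"
    and lim: "(\<lambda>n. N (u n - w)) \<longlonglongrightarrow> 0"
  shows "(\<lambda>n. N (L.normalize (u n) - L.normalize w)) \<longlonglongrightarrow> 0"
proof (rule Phi.N_tendsto_0I)
  have l_lim: "(\<lambda>n. l (u n)) \<longlonglongrightarrow> l w"
    using tendsto_components(2)[OF u(1) w(1) lim] w(2) by (intro tendsto_powr) auto
  show "N (L.normalize (u n) - L.normalize w)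
      \<le> N (u n - w) / l (u n) + \<bar>1 / l (u n) - 1 / l w\<bar> * N w" for n
  proof -
    have "L.normalize (u n) - L.normalize w
        = (1 / l (u n)) *\<^sub>R (u n - w) + (1 / l (u n) - 1 / l w) *\<^sub>R w"
      by (simp add: L.normalize_def scaleR_diff_right scaleR_diff_left)
    then have "N (L.normalize (u n) - L.normalize w)
        \<le> N ((1 / l (u n)) *\<^sub>R (u n - w)) + N ((1 / l (u n) - 1 / l w) *\<^sub>R w)"
      using Phi.N_triangle[of "(1 / l (u n)) *\<^sub>R (u n - w)" "(1 / l (u n) - 1 / l w) *\<^sub>R w"] u w
      by simp
    also have "N ((1 / l (u n)) *\<^sub>R (u n - w)) = N (u n - w) / l (u n)"
      using u w by (subst Phi.N_hom) auto
    also have "N ((1 / l (u n) - 1 / l w) *\<^sub>R w) = \<bar>1 / l (u n) - 1 / l w\<bar> * N w"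
      using w by (subst Phi.N_hom) auto
    finally show ?thesis .
  qed
  have "(\<lambda>n. N (u n - w) / l (u n) + \<bar>1 / l (u n) - 1 / l w\<bar> * N w)
      \<longlonglongrightarrow> 0 / l w + \<bar>1 / l w - 1 / l w\<bar> * N w"
    using w(2) by (intro tendsto_intros lim l_lim) auto
  then show "(\<lambda>n. N (u n - w) / l (u n) + \<bar>1 / l (u n) - 1 / l w\<bar> * N w) \<longlonglongrightarrow> 0" by simp
qed (use u w in auto)

lemma relatively_open_open_rayleigh_sublevel: "Phi.relatively_open_in E (open_rayleigh_sublevel \<mu>)"
  unfolding Phi.relatively_open_in_def
proof
  fix x assume "x \<in> open_rayleigh_sublevel \<mu>"
  then have x: "x \<in> E" "L x > 0" "G x < \<mu> * L x" unfolding open_rayleigh_sublevel_def by auto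
  show "\<exists>e>0. \<forall>y\<in>E. N (y - x) < e \<longrightarrow> y \<in> open_rayleigh_sublevel \<mu>"
  proof (rule Phi.sequentially_imp_near[OF subset_refl x(1)])
    fix u assume u: "\<And>n::nat. u n \<in> E" and lim: "(\<lambda>n. N (u n - x)) \<longlonglongrightarrow> 0"
    note lims = tendsto_components[OF u x(1) lim]
    have "(\<lambda>n. \<mu> * L (u n) - G (u n)) \<longlonglongrightarrow> \<mu> * L x - G x" by (intro tendsto_intros lims)
    then have "eventually (\<lambda>n. 0 < \<mu> * L (u n) - G (u n)) sequentially"
      by (rule order_tendstoD(1)) (use x in simp)
    moreover have "eventually (\<lambda>n. 0 < L (u n)) sequentially"
      using lims(2) x by (intro order_tendstoD) auto
    ultimately show "eventually (\<lambda>n. u n \<in> open_rayleigh_sublevel \<mu>) sequentially"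
      by eventually_elim (use u in \<open>auto simp: open_rayleigh_sublevel_def\<close>)
  qed
qed

lemma omega_power_zero_normalize_pullback:
  assumes A: "A \<subseteq> {u\<in>E. L u > 0}" and zero: "omega_power_zero Phi.d\<^sub>N uminus (L.normalize ` A) q"
  shows "omega_power_zero Phi.d\<^sub>N uminus A q"
proof (rule omega_power_zero_pullback[OF zero])
  show "L.normalize x \<in> L.normalize ` A" "L.normalize (- x) = - L.normalize x" if "x \<in> A" for x
    using that A by (auto intro!: L.normalize_minus)
  fix x and e :: real assume x: "x \<in> A" and e: "e > 0"
  have A_subset: "A \<subseteq> E" and xE: "x \<in> E" using A x by auto
  have "\<exists>\<delta>>0. \<forall>z\<in>A. N (z - x) < \<delta> \<longrightarrow> N (L.normalize z - L.normalize x) < e"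
  proof (rule Phi.sequentially_imp_near[OF A_subset xE])
    fix u assume u: "\<And>n::nat. u n \<in> A" and lim: "(\<lambda>n. N (u n - x)) \<longlonglongrightarrow> 0"
    have "(\<lambda>n. N (L.normalize (u n) - L.normalize x)) \<longlonglongrightarrow> 0"
      using u x A by (intro L_normalize_tendsto lim) auto
    then show "eventually (\<lambda>n. N (L.normalize (u n) - L.normalize x) < e) sequentially"
      using e by (rule order_tendstoD)
  qed
  moreover have "N (x - z) = N (z - x)"
    "N (L.normalize x - L.normalize z) = N (L.normalize z - L.normalize x)"
    if "z \<in> A" for z using that A_subset xE by (auto intro!: Phi.N_diff_commute)
  ultimately show "\<exists>\<delta>>0. \<forall>z\<in>A. N (x - z) < \<delta> \<longrightarrow> N (L.normalize x - L.normalize z) < e" by metis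
qed

theorem omega_power_nonzero_compact_sublevel:
  assumes nonzero: "\<not> omega_power_zero Phi.d\<^sub>N uminus (open_rayleigh_sublevel \<mu>) q"
  obtains K \<mu>' where "K \<subseteq> {u\<in>L_sphere. G u \<le> \<mu>'}" "\<mu>' < \<mu>" "\<And>u. u \<in> K \<Longrightarrow> - u \<in> K"
    "Phi.sequentially_compact K" "\<not> omega_power_zero Phi.d\<^sub>N uminus K q"
proof -
  obtain A where A: "A \<subseteq> open_rayleigh_sublevel \<mu>" "\<And>x. x \<in> A \<Longrightarrow> - x \<in> A"
    "Phi.sequentially_compact A"
    "\<not> omega_power_zero Phi.d\<^sub>N uminus A q"
  proof (rule Phi.omega_power_nonzero_on_compact_subset[OF _ uminus_open_rayleigh_sublevel
        relatively_open_open_rayleigh_sublevel nonzero])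
    show "open_rayleigh_sublevel \<mu> \<subseteq> E - {0}" by (auto simp: open_rayleigh_sublevel_def)
  qed (assumption, rule that)
  have A_subset: "A \<subseteq> {u\<in>E. L u > 0}" using A(1) by (auto simp: open_rayleigh_sublevel_def)
  define K where "K = L.normalize ` A"
  have K: "u \<in> L_sphere" "G u < \<mu>" "- u \<in> K" if u: "u \<in> K" for u
  proof -
    obtain v where v: "v \<in> A" "u = L.normalize v" using u unfolding K_def by auto
    have vE: "v \<in> E" "L v > 0" "G v < \<mu> * L v"
      using v(1) A(1) by (auto simp: open_rayleigh_sublevel_def)
    show "u \<in> L_sphere" "G u < \<mu>"
      using L_normalize[OF vE(1,2)] vE by (auto simp: v(2) divide_less_eq)
    show "- u \<in> K"
      unfolding K_def v(2) L.normalize_minus[OF vE(1), symmetric] using A(2)[OF v(1)]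
      by (rule imageI)
  qed
  have K_compact: "Phi.sequentially_compact K"
    unfolding K_def
    by (rule Phi.sequentially_compact_image[OF A(3)])
      (use A_subset in \<open>auto intro!: L_normalize_tendsto\<close>)
  obtain \<mu>' where \<mu>': "\<mu>' < \<mu>" "\<And>u. u \<in> K \<Longrightarrow> G u \<le> \<mu>'"
  proof (rule Phi.sequentially_compact_uniform_bound[OF K_compact])
    show "(\<lambda>n. G (u n)) \<longlonglongrightarrow> G x" if "\<And>n. u n \<in> K" "x \<in> K" "(\<lambda>n. N (u n - x)) \<longlonglongrightarrow> 0" for u x
      using that(3) by (rule tendsto_components(1)[rotated -1]) (use K(1) that(1,2) in auto)
  qed (use K(2) in auto)
  show ?thesis
  proof (rule that[of K \<mu>'])
    show "\<not> omega_power_zero Phi.d\<^sub>N uminus K q"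
      using A(4) omega_power_zero_normalize_pullback[OF A_subset] unfolding K_def by blast
  qed (use K \<mu>' K_compact in auto)
qed

end

subsection \<open>Uniform convexity of p-th powers\<close>

lemma continuous_on_abs_powr:
  fixes f :: "'a::topological_space \<Rightarrow> real"
  assumes "continuous_on S f" "p > 0"
  shows "continuous_on S (\<lambda>x. \<bar>f x\<bar> powr p)"
  using assms by (intro continuous_on_powr' continuous_intros) auto

lemma powr_mean_value:
  fixes a b p :: real
  assumes p: "0 < p" and ab: "0 \<le> a" "a < b"
  obtains z where "a < z" "z < b" "b powr p - a powr p = (b - a) * (p * z powr (p - 1))"
proof -
  have deriv: "((\<lambda>t. t powr p) has_real_derivative p * z powr (p - 1)) (at z)"
    if "z > 0" for z :: real
    using that by (auto intro!: derivative_eq_intros)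
  have "continuous_on {a..b} (\<lambda>t. t powr p)"
    using p ab by (intro continuous_on_powr' continuous_intros) auto
  then obtain D z where z: "a < z" "z < b" "DERIV (\<lambda>t. t powr p) z :> D"
    "b powr p - a powr p = (b - a) * D"
    using MVT[OF ab(2), of "\<lambda>t. t powr p"] deriv ab by (metis le_less_trans real_differentiable_def)
  moreover have "D = p * z powr (p - 1)" using DERIV_unique[OF z(3) deriv] z ab by auto
  ultimately show ?thesis using that by blast
qed

lemma powr_strict_midpoint:
  fixes x y p :: real
  assumes p: "1 < p" and xy: "0 \<le> x" "x < y"
  shows "((x + y) / 2) powr p < (x powr p + y powr p) / 2"
proof -
  define m where "m = (x + y) / 2"
  have m: "x < m" "m < y" "0 \<le> m" and half: "m - x = y - m"
    using xy unfolding m_def by (auto simp: field_simps)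
  obtain z where z: "x < z" "z < m" "m powr p - x powr p = (m - x) * (p * z powr (p - 1))"
    by (rule powr_mean_value[of p x m]) (use p xy m in auto)
  obtain z' where z': "m < z'" "z' < y" "y powr p - m powr p = (y - m) * (p * z' powr (p - 1))"
    by (rule powr_mean_value[of p m y]) (use p xy m in auto)
  have "z powr (p - 1) < z' powr (p - 1)" using z z' xy p by (intro powr_less_mono2) auto
  then have "m powr p - x powr p < y powr p - m powr p" unfolding z(3) z'(3) half using m p by simp
  then show ?thesis unfolding m_def by simp
qed

lemma abs_powr_strict_midpoint:
  fixes a b p :: real
  assumes p: "1 < p" and "a \<noteq> b"
  shows "\<bar>(a + b) / 2\<bar> powr p < (\<bar>a\<bar> powr p + \<bar>b\<bar> powr p) / 2"
proof (cases "\<bar>a\<bar> = \<bar>b\<bar>")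
  case True
  then have "a + b = 0" "b \<noteq> 0" using assms by (auto simp: abs_if split: if_splits)
  then show ?thesis using True by simp
next
  case False
  have "\<bar>(a + b) / 2\<bar> powr p \<le> ((\<bar>a\<bar> + \<bar>b\<bar>) / 2) powr p" using p by (intro powr_mono2) auto
  also have "\<dots> < (\<bar>a\<bar> powr p + \<bar>b\<bar> powr p) / 2"
    using False powr_strict_midpoint[OF p, of "\<bar>a\<bar>" "\<bar>b\<bar>"]
      powr_strict_midpoint[OF p, of "\<bar>b\<bar>" "\<bar>a\<bar>"]
    by (cases "\<bar>a\<bar> < \<bar>b\<bar>") (auto simp: add.commute)
  finally show ?thesis .
qed

lemma abs_powr_convex:
  fixes a b p t :: real
  assumes p: "1 < p" and t: "0 \<le> t" "t \<le> 1"
  shows "\<bar>(1 - t) * a + t * b\<bar> powr p \<le> (1 - t) * \<bar>a\<bar> powr p + t * \<bar>b\<bar> powr p"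
proof -
  have powr_le: "s powr p \<le> s" if "0 \<le> s" "s \<le> 1" for s :: real
    using powr_mono'[of 1 p s] that p by (cases "s = 0") auto
  have "\<bar>(1 - t) * a + t * b\<bar> \<le> (1 - t) * \<bar>a\<bar> + t * \<bar>b\<bar>"
    using t by (intro order_trans[OF abs_triangle_ineq]) (auto simp: abs_mult)
  then have "\<bar>(1 - t) * a + t * b\<bar> powr p \<le> ((1 - t) * \<bar>a\<bar> + t * \<bar>b\<bar>) powr p"
    using p by (intro powr_mono2) auto
  also have "\<dots> \<le> (1 - t) * \<bar>a\<bar> powr p + t * \<bar>b\<bar> powr p"
  proof (cases "a = 0 \<or> b = 0")
    case True
    then show ?thesis
      using t powr_le[of t] powr_le[of "1 - t"] by (auto simp: powr_mult intro!: mult_right_mono)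
  next
    case False
    then show ?thesis using convex_onD[OF powr_convex[of p], of t "\<bar>a\<bar>" "\<bar>b\<bar>"] t p by auto
  qed
  finally show ?thesis .
qed

definition midpoint_gap :: "real \<Rightarrow> real \<Rightarrow> real \<Rightarrow> real" where
  "midpoint_gap p a b = (\<bar>a\<bar> powr p + \<bar>b\<bar> powr p) / 2 - \<bar>(a + b) / 2\<bar> powr p"

lemma midpoint_gap_nonneg: "1 < p \<Longrightarrow> 0 \<le> midpoint_gap p a b"
  using abs_powr_convex[of p "1/2" a b] by (simp add: midpoint_gap_def add_divide_distrib)

lemma midpoint_gap_pos_on_compact:
  assumes p: "1 < p" and S: "compact S" "\<And>x. x \<in> S \<Longrightarrow> fst x \<noteq> snd x"
  obtains m where "m > 0" "\<And>x. x \<in> S \<Longrightarrow> m \<le> midpoint_gap p (fst x) (snd x)"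
proof (cases "S = {}")
  case False
  have "continuous_on S (\<lambda>x. midpoint_gap p (fst x) (snd x))"
    unfolding midpoint_gap_def using p by (intro continuous_intros continuous_on_abs_powr) auto
  then obtain x where x: "x \<in> S"
    "\<And>y. y \<in> S \<Longrightarrow> midpoint_gap p (fst x) (snd x) \<le> midpoint_gap p (fst y) (snd y)"
    using continuous_attains_inf[OF S(1) False] by blast
  have "midpoint_gap p (fst x) (snd x) > 0"
    using abs_powr_strict_midpoint[OF p S(2)[OF x(1)]] by (simp add: midpoint_gap_def)
  then show ?thesis using that x(2) by blast
qed (use that[of 1] in auto)

lemma abs_powr_uniformly_convex_unit:
  assumes p: "1 < p" and \<epsilon>: "\<epsilon> > 0"
  obtains c where "c \<ge> 0" "\<And>a b::real. max \<bar>a\<bar> \<bar>b\<bar> = 1 \<Longrightarrow>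
    \<bar>a - b\<bar> powr p \<le> \<epsilon> * (\<bar>a\<bar> powr p + \<bar>b\<bar> powr p) + c * midpoint_gap p a b"
proof -
  define S where "S = {x::real\<times>real. max \<bar>fst x\<bar> \<bar>snd x\<bar> = 1 \<and>
    \<epsilon> * (\<bar>fst x\<bar> powr p + \<bar>snd x\<bar> powr p) \<le> \<bar>fst x - snd x\<bar> powr p}"
  have "closed S" unfolding S_def using p
    by (intro closed_Collect_conj closed_Collect_eq closed_Collect_le continuous_intros
      continuous_on_abs_powr) auto
  moreover have "S \<subseteq> cbox (-1, -1) (1, 1)"
  proof
    fix x assume "x \<in> S"
    then have "\<bar>fst x\<bar> \<le> 1" "\<bar>snd x\<bar> \<le> 1" unfolding S_def by auto
    then show "x \<in> cbox (-1, -1) (1, 1)" by (cases x) (auto simp: mem_box Basis_prod_def)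
  qed
  ultimately have S: "compact S"
    using bounded_subset[OF bounded_cbox] by (simp add: compact_eq_bounded_closed)
  have S_offdiag: "fst x \<noteq> snd x" if x: "x \<in> S" for x
  proof
    assume "fst x = snd x"
    then have "\<bar>snd x\<bar> = 1" "\<epsilon> * (\<bar>snd x\<bar> powr p + \<bar>snd x\<bar> powr p) \<le> 0"
      using x unfolding S_def by auto
    then show False using \<epsilon> by simp
  qed
  obtain m where m: "m > 0" "\<And>x. x \<in> S \<Longrightarrow> m \<le> midpoint_gap p (fst x) (snd x)"
    by (rule midpoint_gap_pos_on_compact[OF p S S_offdiag]) (assumption, rule that)
  show ?thesis
  proof (rule that[of "2 powr p / m"])
    fix a b :: real assume unit: "max \<bar>a\<bar> \<bar>b\<bar> = 1"
    have gap: "0 \<le> 2 powr p / m * midpoint_gap p a b" using m midpoint_gap_nonneg[OF p] by simp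
    show "\<bar>a - b\<bar> powr p \<le> \<epsilon> * (\<bar>a\<bar> powr p + \<bar>b\<bar> powr p) + 2 powr p / m * midpoint_gap p a b"
    proof (cases "(a, b) \<in> S")
      case True
      have "\<bar>a - b\<bar> \<le> 2" using unit by (auto simp: max_def split: if_splits)
      then have "\<bar>a - b\<bar> powr p \<le> 2 powr p" using p by (intro powr_mono2) auto
      also have "\<dots> \<le> 2 powr p / m * midpoint_gap p a b"
        using m(2)[OF True] m(1) by (simp add: field_simps)
      finally show ?thesis using \<epsilon> by (smt (verit) mult_nonneg_nonneg powr_ge_zero)
    next
      case False
      then have "\<bar>a - b\<bar> powr p \<le> \<epsilon> * (\<bar>a\<bar> powr p + \<bar>b\<bar> powr p)" using unit unfolding S_def by auto
      then show ?thesis using gap by linarith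
    qed
  qed (use m in simp)
qed

lemma abs_powr_uniformly_convex:
  assumes p: "1 < p" and \<epsilon>: "\<epsilon> > 0"
  obtains c where "c \<ge> 0"
    "\<And>a b::real. \<bar>a - b\<bar> powr p \<le> \<epsilon> * (\<bar>a\<bar> powr p + \<bar>b\<bar> powr p) + c * midpoint_gap p a b"
proof -
  obtain c where c: "c \<ge> 0" "\<And>a b::real. max \<bar>a\<bar> \<bar>b\<bar> = 1 \<Longrightarrow>
      \<bar>a - b\<bar> powr p \<le> \<epsilon> * (\<bar>a\<bar> powr p + \<bar>b\<bar> powr p) + c * midpoint_gap p a b"
    by (rule abs_powr_uniformly_convex_unit[OF p \<epsilon>]) (rule that)
  have "\<bar>a - b\<bar> powr p \<le> \<epsilon> * (\<bar>a\<bar> powr p + \<bar>b\<bar> powr p) + c * midpoint_gap p a b" for a b :: real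
  proof (cases "max \<bar>a\<bar> \<bar>b\<bar> = 0")
    case True
    then have "a = 0" "b = 0" by (auto simp: max_def split: if_splits)
    then show ?thesis by (simp add: midpoint_gap_def)
  next
    case False
    define r where "r = max \<bar>a\<bar> \<bar>b\<bar>"
    have r: "r > 0" using False unfolding r_def by auto
    define x y where "x = a / r" and "y = b / r"
    have "max \<bar>x\<bar> \<bar>y\<bar> = 1" using r unfolding x_def y_def r_def by (auto simp: max_def field_simps)
    then have unit: "\<bar>x - y\<bar> powr p \<le> \<epsilon> * (\<bar>x\<bar> powr p + \<bar>y\<bar> powr p) + c * midpoint_gap p x y"
      by (rule c(2))
    have scale: "\<bar>r * t\<bar> powr p = r powr p * \<bar>t\<bar> powr p" for t
      using r by (simp add: abs_mult powr_mult)
    have ab: "a = r * x" "b = r * y" using r by (auto simp: x_def y_def)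
    have "a - b = r * (x - y)" "(a + b) / 2 = r * ((x + y) / 2)"
      by (auto simp: ab right_diff_distrib distrib_left)
    then have "\<bar>a - b\<bar> powr p = r powr p * \<bar>x - y\<bar> powr p"
      "\<bar>(a + b) / 2\<bar> powr p = r powr p * \<bar>(x + y) / 2\<bar> powr p"
      by (simp_all only: scale)
    moreover have "\<bar>a\<bar> powr p = r powr p * \<bar>x\<bar> powr p" "\<bar>b\<bar> powr p = r powr p * \<bar>y\<bar> powr p"
      by (simp_all only: ab scale)
    moreover have "r powr p * \<bar>x - y\<bar> powr p
        \<le> r powr p * (\<epsilon> * (\<bar>x\<bar> powr p + \<bar>y\<bar> powr p) + c * midpoint_gap p x y)"
      using unit by (intro mult_left_mono) auto
    ultimately show ?thesis by (simp add: midpoint_gap_def algebra_simps)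
  qed
  then show ?thesis using that c(1) by blast
qed

subsection \<open>Integral functionals\<close>

definition Lp_space :: "'b measure \<Rightarrow> real \<Rightarrow> ('b \<Rightarrow> real) set" where
  "Lp_space M p = {f \<in> borel_measurable M. (\<integral>\<^sup>+x. ennreal (\<bar>f x\<bar> powr p) \<partial>M) < \<infinity>}"

lemma abs_powr_add_le:
  fixes a b p :: real
  assumes "0 < p"
  shows "\<bar>a + b\<bar> powr p \<le> 2 powr p * (\<bar>a\<bar> powr p + \<bar>b\<bar> powr p)"
proof -
  have "\<bar>a + b\<bar> powr p \<le> (2 * max \<bar>a\<bar> \<bar>b\<bar>) powr p" using assms by (intro powr_mono2) auto
  also have "\<dots> = 2 powr p * max \<bar>a\<bar> \<bar>b\<bar> powr p" by (simp add: powr_mult)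
  also have "\<dots> \<le> 2 powr p * (\<bar>a\<bar> powr p + \<bar>b\<bar> powr p)"
    by (intro mult_left_mono) (auto simp: max_def)
  finally show ?thesis .
qed

lemma Lp_space_add:
  assumes p: "0 < p" and f: "f \<in> Lp_space M p" and g: "g \<in> Lp_space M p"
  shows "f + g \<in> Lp_space M p"
proof -
  have meas [measurable]: "f \<in> borel_measurable M" "g \<in> borel_measurable M"
    using f g by (auto simp: Lp_space_def)
  have "(\<integral>\<^sup>+x. ennreal (\<bar>f x + g x\<bar> powr p) \<partial>M)
      \<le> (\<integral>\<^sup>+x. ennreal (2 powr p) * (ennreal (\<bar>f x\<bar> powr p) + ennreal (\<bar>g x\<bar> powr p)) \<partial>M)"
    using abs_powr_add_le[OF p]
    by (intro nn_integral_mono)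
      (auto simp: ennreal_mult[symmetric] ennreal_plus[symmetric] simp del: ennreal_plus)
  also have "\<dots> = ennreal (2 powr p) * ((\<integral>\<^sup>+x. ennreal (\<bar>f x\<bar> powr p) \<partial>M)
      + (\<integral>\<^sup>+x. ennreal (\<bar>g x\<bar> powr p) \<partial>M))"
    by (simp add: nn_integral_cmult nn_integral_add)
  also have "\<dots> < \<infinity>" using f g by (simp add: Lp_space_def ennreal_mult_less_top)
  finally show ?thesis by (simp add: Lp_space_def plus_fun_def)
qed

lemma subspace_Lp_space:
  assumes p: "0 < p"
  shows "subspace (Lp_space M p)"
  unfolding subspace_def
proof (intro conjI ballI allI)
  show "0 \<in> Lp_space M p" using p by (simp add: Lp_space_def zero_fun_def)
  fix f and c :: real assume f: "f \<in> Lp_space M p"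
  then have [measurable]: "f \<in> borel_measurable M" by (simp add: Lp_space_def)
  have "(\<integral>\<^sup>+x. ennreal (\<bar>c * f x\<bar> powr p) \<partial>M)
      = ennreal (\<bar>c\<bar> powr p) * (\<integral>\<^sup>+x. ennreal (\<bar>f x\<bar> powr p) \<partial>M)"
    by (simp add: abs_mult powr_mult ennreal_mult nn_integral_cmult)
  also have "\<dots> < \<infinity>" using f by (simp add: Lp_space_def ennreal_mult_less_top)
  finally show "c *\<^sub>R f \<in> Lp_space M p" by (simp add: Lp_space_def scaleR_fun_def)
qed (rule Lp_space_add[OF p])

lemma nn_integral_abs_powr_Fatou:
  fixes f :: "nat \<Rightarrow> 'b \<Rightarrow> real"
  assumes p: "0 < p" and meas: "\<And>k. f k \<in> borel_measurable M"
    and lim: "AE x in M. (\<lambda>k. f k x) \<longlonglongrightarrow> g x"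
    and bound: "\<And>k. k \<ge> k0 \<Longrightarrow> (\<integral>\<^sup>+x. ennreal (\<bar>f k x\<bar> powr p) \<partial>M) \<le> c"
  shows "(\<integral>\<^sup>+x. ennreal (\<bar>g x\<bar> powr p) \<partial>M) \<le> c"
proof -
  have "AE x in M. ennreal (\<bar>g x\<bar> powr p) = liminf (\<lambda>k. ennreal (\<bar>f k x\<bar> powr p))"
    using lim
  proof eventually_elim
    fix x assume "(\<lambda>k. f k x) \<longlonglongrightarrow> g x"
    then have "(\<lambda>k. \<bar>f k x\<bar> powr p) \<longlonglongrightarrow> \<bar>g x\<bar> powr p"
      using p by (intro tendsto_powr2 tendsto_rabs tendsto_const) auto
    then have "(\<lambda>k. ennreal (\<bar>f k x\<bar> powr p)) \<longlonglongrightarrow> ennreal (\<bar>g x\<bar> powr p)" by (rule tendsto_ennrealI)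
    then show "ennreal (\<bar>g x\<bar> powr p) = liminf (\<lambda>k. ennreal (\<bar>f k x\<bar> powr p))"
      using lim_imp_Liminf[OF trivial_limit_sequentially] by metis
  qed
  then have "(\<integral>\<^sup>+x. ennreal (\<bar>g x\<bar> powr p) \<partial>M) = (\<integral>\<^sup>+x. liminf (\<lambda>k. ennreal (\<bar>f k x\<bar> powr p)) \<partial>M)"
    by (rule nn_integral_cong_AE)
  also have "\<dots> \<le> liminf (\<lambda>k. \<integral>\<^sup>+x. ennreal (\<bar>f k x\<bar> powr p) \<partial>M)"
    using meas by (intro nn_integral_liminf) measurable
  also have "\<dots> \<le> limsup (\<lambda>k. \<integral>\<^sup>+x. ennreal (\<bar>f k x\<bar> powr p) \<partial>M)" by (rule Liminf_le_Limsup) simp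
  also have "\<dots> \<le> c" by (rule Limsup_bounded) (use bound in \<open>auto simp: eventually_sequentially\<close>)
  finally show ?thesis .
qed

lemma convergent_of_weighted_suminf:
  fixes a :: "nat \<Rightarrow> real"
  assumes p: "0 < p" and fin: "(\<Sum>k. ennreal ((2 ^ k * \<bar>a (Suc k) - a k\<bar>) powr p)) \<noteq> \<infinity>"
  shows "convergent a"
proof -
  define h where "h k = ennreal ((2 ^ k * \<bar>a (Suc k) - a k\<bar>) powr p)" for k
  define S where "S = enn2real (\<Sum>k. h k)"
  have "(\<Sum>k. h k) = ennreal S" using fin unfolding S_def h_def[symmetric] by (simp add: less_top)
  have bound: "\<bar>a (Suc k) - a k\<bar> \<le> S powr (1 / p) * (1/2) ^ k" for k
  proof -
    have "h k \<le> (\<Sum>k. h k)" using sum_le_suminf[of h "{k}"] by auto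
    also have "\<dots> = ennreal S" by fact
    finally have "(2 ^ k * \<bar>a (Suc k) - a k\<bar>) powr p \<le> S" by (simp add: h_def S_def)
    then have "((2 ^ k * \<bar>a (Suc k) - a k\<bar>) powr p) powr (1 / p) \<le> S powr (1 / p)"
      using p by (intro powr_mono2) auto
    then show ?thesis using p by (simp add: powr_powr field_simps power_one_over)
  qed
  have "summable (\<lambda>k. S powr (1 / p) * (1/2) ^ k)" by (intro summable_mult summable_geometric) auto
  then have "summable (\<lambda>k. a (Suc k) - a k)" by (rule summable_comparison_test') (use bound in auto)
  then have "convergent (\<lambda>n. (\<Sum>k<n. a (Suc k) - a k) + a 0)"
    by (intro convergent_add convergent_const) (simp add: summable_iff_convergent)
  moreover have "(\<Sum>k<n. a (Suc k) - a k) + a 0 = a n" for n by (simp add: sum_lessThan_telescope)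
  ultimately show ?thesis by simp
qed

text \<open>Both the Gagliardo seminorm and the norm of \<open>L\<^sup>p(\<Omega>)\<close> are \<open>L\<^sup>p\<close> norms of a linear image \<open>A u\<close>.\<close>

locale Lp_functional =
  fixes E :: "'a::real_vector set" and M :: "'b measure" and A :: "'a \<Rightarrow> 'b \<Rightarrow> real" and p :: real
  assumes subspace_E: "subspace E" and p: "1 < p" and A_linear: "linear A"
    and A_Lp: "\<And>u. u \<in> E \<Longrightarrow> A u \<in> Lp_space M p"
begin

definition F :: "'a \<Rightarrow> real" where
  "F u = enn2real (\<integral>\<^sup>+x. ennreal (\<bar>A u x\<bar> powr p) \<partial>M)"

lemma A_measurable: "u \<in> E \<Longrightarrow> A u \<in> borel_measurable M"
  using A_Lp by (simp add: Lp_space_def)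

lemma A_add: "A (u + v) x = A u x + A v x"
  and A_diff: "A (u - v) x = A u x - A v x"
  and A_scale: "A (c *\<^sub>R u) x = c * A u x"
  using A_linear by (simp_all add: linear_add linear_diff linear_scale)

lemma F_ennreal: "u \<in> E \<Longrightarrow> ennreal (F u) = (\<integral>\<^sup>+x. ennreal (\<bar>A u x\<bar> powr p) \<partial>M)"
  unfolding F_def using A_Lp[of u] by (simp add: Lp_space_def)

lemma A_integrable: "u \<in> E \<Longrightarrow> integrable M (\<lambda>x. \<bar>A u x\<bar> powr p)"
  using A_Lp[of u] by (intro integrableI_bounded) (auto simp: Lp_space_def)

lemma F_integral: "u \<in> E \<Longrightarrow> F u = (\<integral>x. \<bar>A u x\<bar> powr p \<partial>M)"
  unfolding F_def using A_measurable[of u] by (subst integral_eq_nn_integral) auto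

sublocale convex_homogeneous E F p
proof
  show "subspace E" "1 < p" by (rule subspace_E, rule p)
  show "0 \<le> F u" for u unfolding F_def by simp
  fix u v assume u: "u \<in> E"
  show "F (c *\<^sub>R u) = \<bar>c\<bar> powr p * F u" for c
    using F_integral[OF u] F_integral[of "c *\<^sub>R u"] u subspace_scale[OF subspace_E u]
    by (simp add: A_scale abs_mult powr_mult)
  fix t :: real assume v: "v \<in> E" and t: "0 \<le> t" "t \<le> 1"
  have w: "(1 - t) *\<^sub>R u + t *\<^sub>R v \<in> E"
    using u v subspace_E by (intro subspace_add subspace_scale) auto
  have "F ((1 - t) *\<^sub>R u + t *\<^sub>R v) \<le> (\<integral>x. (1 - t) * \<bar>A u x\<bar> powr p + t * \<bar>A v x\<bar> powr p \<partial>M)"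
    unfolding F_integral[OF w]
    using A_integrable[OF u] A_integrable[OF v] A_integrable[OF w] abs_powr_convex[OF p t]
    by (intro integral_mono) (auto simp: A_add A_scale)
  also have "\<dots> = (1 - t) * F u + t * F v"
    using A_integrable[OF u] A_integrable[OF v] F_integral u v by simp
  finally show "F ((1 - t) *\<^sub>R u + t *\<^sub>R v) \<le> (1 - t) * F u + t * F v" .
qed

lemma F_uniformly_convex: "uniformly_convex_on E F"
  unfolding uniformly_convex_on_def
proof (intro allI impI)
  fix \<epsilon> :: real assume "\<epsilon> > 0"
  then obtain c where c: "c \<ge> 0"
    "\<And>a b::real. \<bar>a - b\<bar> powr p \<le> \<epsilon> * (\<bar>a\<bar> powr p + \<bar>b\<bar> powr p) + c * midpoint_gap p a b"
    by (rule abs_powr_uniformly_convex[OF p]) (rule that)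
  show "\<exists>c\<ge>0. \<forall>u\<in>E. \<forall>v\<in>E. F (u - v)
      \<le> \<epsilon> * (F u + F v) + c * ((F u + F v) / 2 - F ((1/2) *\<^sub>R (u + v)))"
  proof (intro exI[of _ c] conjI ballI c(1))
    fix u v assume u: "u \<in> E" and v: "v \<in> E"
    define w where "w = (1/2) *\<^sub>R (u + v)"
    have d: "u - v \<in> E" and w: "w \<in> E" using u v by (auto simp: w_def)
    note int = A_integrable[OF u] A_integrable[OF v] A_integrable[OF w]
    have gap: "midpoint_gap p (A u x) (A v x)
        = (\<bar>A u x\<bar> powr p + \<bar>A v x\<bar> powr p) / 2 - \<bar>A w x\<bar> powr p" for x
      by (simp add: midpoint_gap_def w_def A_add A_scale)
    have "F (u - v) \<le> (\<integral>x. \<epsilon> * (\<bar>A u x\<bar> powr p + \<bar>A v x\<bar> powr p)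
        + c * midpoint_gap p (A u x) (A v x) \<partial>M)"
      unfolding F_integral[OF d]
    proof (rule integral_mono)
      show "integrable M (\<lambda>x. \<epsilon> * (\<bar>A u x\<bar> powr p + \<bar>A v x\<bar> powr p)
          + c * midpoint_gap p (A u x) (A v x))"
        unfolding gap using int by auto
    qed (use A_integrable[OF d] c(2) in \<open>auto simp: A_diff\<close>)
    also have "\<dots> = \<epsilon> * (F u + F v) + c * ((F u + F v) / 2 - F w)"
      using int F_integral[OF u] F_integral[OF v] F_integral[OF w] by (simp add: gap)
    finally show "F (u - v) \<le> \<epsilon> * (F u + F v) + c * ((F u + F v) / 2 - F ((1/2) *\<^sub>R (u + v)))"
      unfolding w_def .
  qed
qed

lemma AE_convergent_of_fast:
  assumes f: "\<And>k. f k \<in> E" and fast: "\<And>k. F (f (Suc k) - f k) \<le> ((1/4) ^ k) powr p"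
  shows "AE x in M. convergent (\<lambda>k. A (f k) x)"
proof -
  define h where "h k x = ennreal ((2 ^ k * \<bar>A (f (Suc k)) x - A (f k) x\<bar>) powr p)" for k x
  have h [measurable]: "h k \<in> borel_measurable M" for k
  proof -
    note [measurable] = A_measurable[OF f]
    show ?thesis unfolding h_def by measurable
  qed
  define q where "q = (1/2) powr p"
  have q: "0 < q" "q < 1" unfolding q_def using p powr_less_mono2[of p "1/2" 1] by auto
  have "(\<integral>\<^sup>+x. h k x \<partial>M) \<le> ennreal (q ^ k)" for k
  proof -
    have fE: "f (Suc k) - f k \<in> E" using f by auto
    have "(\<integral>\<^sup>+x. h k x \<partial>M) = (\<integral>\<^sup>+x. ennreal ((2 ^ k) powr p)
        * ennreal (\<bar>A (f (Suc k) - f k) x\<bar> powr p) \<partial>M)"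
      unfolding h_def A_diff by (simp add: powr_mult ennreal_mult)
    also have "\<dots> = ennreal ((2 ^ k) powr p) * ennreal (F (f (Suc k) - f k))"
      unfolding F_ennreal[OF fE] using A_measurable[OF fE] by (subst nn_integral_cmult) auto
    also have "\<dots> \<le> ennreal ((2 ^ k) powr p) * ennreal (((1/4) ^ k) powr p)"
      by (intro mult_left_mono ennreal_leI fast) auto
    also have "\<dots> = ennreal ((2 ^ k * (1/4) ^ k) powr p)" by (simp add: powr_mult ennreal_mult)
    also have "2 ^ k * (1/4) ^ k = (1/2::real) ^ k" by (simp flip: power_mult_distrib)
    also have "((1/2::real) ^ k) powr p = q ^ k"
      unfolding q_def by (simp add: powr_realpow[symmetric] powr_powr mult.commute)
    finally show ?thesis .
  qed
  then have "(\<Sum>k. \<integral>\<^sup>+x. h k x \<partial>M) \<le> (\<Sum>k. ennreal (q ^ k))" by (intro suminf_le) auto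
  also have "\<dots> = ennreal (\<Sum>k. q ^ k)"
    using q by (intro suminf_ennreal2) (auto intro!: summable_geometric)
  finally have "(\<integral>\<^sup>+x. (\<Sum>k. h k x) \<partial>M) \<noteq> \<infinity>"
    unfolding nn_integral_suminf[OF h] by (auto simp: top_unique)
  then have "AE x in M. (\<Sum>k. h k x) \<noteq> \<infinity>" by (intro nn_integral_noteq_infinite) measurable
  then show ?thesis
    by eventually_elim (rule convergent_of_weighted_suminf[of p], use p in \<open>auto simp: h_def\<close>)
qed

lemma F_Fatou:
  assumes f: "\<And>k. f k \<in> E" and lim: "AE x in M. (\<lambda>k. A (f k) x) \<longlonglongrightarrow> A u x"
    and meas: "A u \<in> borel_measurable M" and c: "0 \<le> c" and bound: "\<And>k. k \<ge> k0 \<Longrightarrow> F (f k) \<le> c"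
  shows "A u \<in> Lp_space M p" "F u \<le> c"
proof -
  have "(\<integral>\<^sup>+x. ennreal (\<bar>A u x\<bar> powr p) \<partial>M) \<le> ennreal c"
  proof (rule nn_integral_abs_powr_Fatou[OF _ A_measurable[OF f] lim])
    show "(\<integral>\<^sup>+x. ennreal (\<bar>A (f k) x\<bar> powr p) \<partial>M) \<le> ennreal c" if "k \<ge> k0" for k
      unfolding F_ennreal[OF f, symmetric] using bound[OF that] by (rule ennreal_leI)
  qed (use p in simp)
  then show "A u \<in> Lp_space M p" "F u \<le> c"
    using meas c unfolding Lp_space_def F_def
    by (auto simp: enn2real_leI le_less_trans[OF _ ennreal_less_top])
qed

end

subsection \<open>Lebesgue measure on products\<close>

lemma measurable_lebesgue_null_preserving:
  fixes g :: "'a::euclidean_space \<Rightarrow> 'b::euclidean_space"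
  assumes g: "g \<in> borel_measurable borel"
    and null: "\<And>N. N \<in> null_sets lborel \<Longrightarrow> g -` N \<in> null_sets lborel"
  shows "g \<in> lebesgue \<rightarrow>\<^sub>M lebesgue"
proof (rule completion.measurable_completion2)
  show g': "g \<in> lebesgue \<rightarrow>\<^sub>M lborel"
    using g by (intro measurable_completion) (simp add: measurable_lborel1 measurable_lborel2)
  show "null_sets lborel \<subseteq> null_sets (distr lebesgue lborel g)"
  proof
    fix N :: "'b set" assume N: "N \<in> null_sets lborel"
    then show "N \<in> null_sets (distr lebesgue lborel g)"
      using null[OF N] g' by (auto simp: null_sets_def emeasure_distr)
  qed
qed

lemma AE_lborel_vimage:
  fixes g :: "'a::euclidean_space \<Rightarrow> 'b::euclidean_space"
  assumes null: "\<And>N. N \<in> null_sets lborel \<Longrightarrow> g -` N \<in> null_sets lborel" and P: "AE x in lborel. P x"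
  shows "AE z in lborel. P (g z)"
proof -
  obtain N where N: "N \<in> null_sets lborel" "{x \<in> space lborel. \<not> P x} \<subseteq> N"
    using P unfolding eventually_ae_filter by auto
  show ?thesis by (rule AE_I'[OF null[OF N(1)]]) (use N(2) in auto)
qed

lemma null_sets_vimage_fst:
  assumes "N \<in> null_sets (lborel :: 'a::euclidean_space measure)"
  shows "fst -` N \<in> null_sets (lborel :: ('a \<times> 'b::euclidean_space) measure)"
proof -
  have "fst -` N = N \<times> (UNIV :: 'b set)" by auto
  then show ?thesis using lborel.times_in_null_sets1[OF assms, of UNIV] by (simp add: lborel_prod)
qed

lemma null_sets_vimage_snd:
  assumes "N \<in> null_sets (lborel :: 'b::euclidean_space measure)"
  shows "snd -` N \<in> null_sets (lborel :: ('a::euclidean_space \<times> 'b) measure)"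
proof -
  have "snd -` N = (UNIV :: 'a set) \<times> N" by auto
  then show ?thesis
    using lborel.times_in_null_sets2[OF _ assms, of UNIV lborel] by (simp add: lborel_prod)
qed

lemma measurable_lebesgue_fst:
  "(fst :: 'a::euclidean_space \<times> 'b::euclidean_space \<Rightarrow> 'a) \<in> lebesgue \<rightarrow>\<^sub>M lebesgue"
  and measurable_lebesgue_snd: "(snd :: 'a \<times> 'b \<Rightarrow> 'b) \<in> lebesgue \<rightarrow>\<^sub>M lebesgue"
  by (auto intro!: measurable_lebesgue_null_preserving null_sets_vimage_fst null_sets_vimage_snd
      borel_measurable_continuous_onI continuous_intros)

lemma AE_lborel_fst:
  "AE x in lborel. P x \<Longrightarrow> AE z in lborel. P (fst (z :: 'a::euclidean_space \<times> 'b::euclidean_space))"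
  by (rule AE_lborel_vimage[OF null_sets_vimage_fst])

lemma AE_lborel_snd:
  "AE x in lborel. P x \<Longrightarrow> AE z in lborel. P (snd (z :: 'a::euclidean_space \<times> 'b::euclidean_space))"
  by (rule AE_lborel_vimage[OF null_sets_vimage_snd])

lemma AE_lborel_imp_ex:
  fixes U :: "'a::euclidean_space set"
  assumes "open U" "U \<noteq> {}" and P: "AE x in lborel. x \<in> U \<longrightarrow> P x"
  shows "\<exists>x\<in>U. P x"
proof (rule ccontr)
  assume "\<not> ?thesis"
  then have "AE x in lborel. x \<notin> U" using P by (auto elim: eventually_mono)
  then have U0: "emeasure lborel U = 0"
    using AE_iff_measurable[of U lborel "\<lambda>x. x \<notin> U"] assms(1) by auto
  obtain x e where "e > 0" "ball x e \<subseteq> U" using assms(1,2) by (meson ex_in_conv openE)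
  then have "emeasure lborel (ball x e) \<le> emeasure lborel U"
    using assms(1) by (intro emeasure_mono) auto
  moreover have "emeasure lborel (ball x e) > 0" using \<open>e > 0\<close> by (simp add: emeasure_ball)
  ultimately show False using U0 by simp
qed

subsection \<open>The Neumann space\<close>

lemma Cauchy_wrt_fast_subseq:
  assumes Cauchy: "Cauchy_wrt F u" and \<epsilon>: "\<And>k::nat. \<epsilon> k > 0"
  obtains r where "strict_mono (r :: nat \<Rightarrow> nat)" "\<And>k. F (u (r (Suc k)) - u (r k)) < \<epsilon> k"
proof -
  have "\<exists>n0. \<forall>m\<ge>n0. \<forall>n\<ge>n0. F (u m - u n) < \<epsilon> k" for k
    using Cauchy \<epsilon> unfolding Cauchy_wrt_def by blast
  then obtain n0 where n0: "\<And>k m n. m \<ge> n0 k \<Longrightarrow> n \<ge> n0 k \<Longrightarrow> F (u m - u n) < \<epsilon> k" by metis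
  define r where "r k = k + (\<Sum>j\<le>k. n0 j)" for k
  have r: "strict_mono r" unfolding r_def by (intro strict_monoI_Suc) simp
  have n0_le: "n0 k \<le> r k" for k unfolding r_def using member_le_sum[of k "{..k}" n0] by auto
  have "n0 k \<le> r (Suc k)" for k using n0_le[of k] strict_mono_less[OF r, of k "Suc k"] by linarith
  then show ?thesis using that[OF r] n0 n0_le by blast
qed

definition pair_diff :: "('a \<Rightarrow> real) \<Rightarrow> 'a \<times> 'a \<Rightarrow> real" where
  "pair_diff u z = u (fst z) - u (snd z)"

lemma linear_pair_diff: "linear pair_diff"
  by (rule linearI) (auto simp: pair_diff_def algebra_simps)

lemma pair_diff_measurable:
  fixes u :: "'a::euclidean_space \<Rightarrow> real"
  assumes "u \<in> borel_measurable lebesgue"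
  shows "pair_diff u \<in> borel_measurable lebesgue"
  unfolding pair_diff_def using assms
  by (intro borel_measurable_diff measurable_compose[OF measurable_lebesgue_fst]
    measurable_compose[OF measurable_lebesgue_snd])

locale neumann =
  fixes p s :: real and \<Omega> :: "(real^'n) set"
  assumes s: "0 < s" and p: "1 < p" and \<Omega>: "open \<Omega>" "\<Omega> \<noteq> {}" "bounded \<Omega>"
begin

abbreviation X :: "(real^'n \<Rightarrow> real) set" where "X \<equiv> Xraw p s \<Omega>"

definition \<kappa> :: real where "\<kappa> = real CARD('n) + p * s"

definition kernel :: "(real^'n) \<times> (real^'n) \<Rightarrow> ennreal" where
  "kernel z = ennreal (1 / norm (fst z - snd z) powr \<kappa>) * indicator (Qset \<Omega>) z"

definition \<mu>\<^sub>G :: "((real^'n) \<times> (real^'n)) measure" where "\<mu>\<^sub>G = density lebesgue kernel"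
definition \<mu>\<^sub>L :: "(real^'n) measure" where "\<mu>\<^sub>L = density lebesgue (indicator \<Omega>)"

lemma \<kappa>_pos: "\<kappa> > 0" using s p unfolding \<kappa>_def by (simp add: add_pos_pos)

lemma \<Omega>_sets [measurable]: "\<Omega> \<in> sets lborel" "\<Omega> \<in> sets lebesgue" "\<Omega> \<in> sets borel"
  using \<Omega>(1) by auto

lemma kernel_borel [measurable]: "kernel \<in> borel_measurable borel"
proof -
  have "Qset \<Omega> = \<Omega> \<times> UNIV \<union> UNIV \<times> \<Omega>" unfolding Qset_def by auto
  then have "open (Qset \<Omega>)" using \<Omega>(1) by (auto intro!: open_Un open_Times)
  then have [measurable]: "Qset \<Omega> \<in> sets borel" by (rule borel_open)
  have [measurable]: "(\<lambda>z::(real^'n) \<times> (real^'n). norm (fst z - snd z)) \<in> borel_measurable borel"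
    by (intro borel_measurable_continuous_onI continuous_intros)
  show ?thesis unfolding kernel_def by measurable
qed

lemma kernel_lebesgue [measurable]: "kernel \<in> borel_measurable lebesgue"
  using kernel_borel by (intro measurable_completion) simp

lemma indicator_\<Omega>_lebesgue: "(indicator \<Omega> :: real^'n \<Rightarrow> ennreal) \<in> borel_measurable lebesgue"
  by simp

lemma kernel_pos: "z \<in> Qset \<Omega> \<Longrightarrow> fst z \<noteq> snd z \<Longrightarrow> kernel z > 0"
  unfolding kernel_def by simp

lemma gagp_lborel: "gagp p s \<Omega> u = (\<integral>\<^sup>+z. kernel z * ennreal (\<bar>pair_diff u z\<bar> powr p) \<partial>lborel)"
  unfolding gagp_def kernel_def pair_diff_def \<kappa>_def nn_integral_completion
  by (intro nn_integral_cong) (auto simp: ennreal_mult[symmetric] indicator_def)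

lemma gagp_eq:
  assumes u: "u \<in> borel_measurable lebesgue"
  shows "gagp p s \<Omega> u = (\<integral>\<^sup>+z. ennreal (\<bar>pair_diff u z\<bar> powr p) \<partial>\<mu>\<^sub>G)"
proof -
  note [measurable] = pair_diff_measurable[OF u]
  have "(\<integral>\<^sup>+z. ennreal (\<bar>pair_diff u z\<bar> powr p) \<partial>\<mu>\<^sub>G)
      = (\<integral>\<^sup>+z. kernel z * ennreal (\<bar>pair_diff u z\<bar> powr p) \<partial>lebesgue)"
    unfolding \<mu>\<^sub>G_def by (intro nn_integral_density) measurable
  then show ?thesis unfolding gagp_lborel nn_integral_completion by simp
qed

lemma Lpp_eq:
  assumes [measurable]: "u \<in> borel_measurable lebesgue"
  shows "Lpp p \<Omega> u = (\<integral>\<^sup>+x. ennreal (\<bar>u x\<bar> powr p) \<partial>\<mu>\<^sub>L)"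
  unfolding \<mu>\<^sub>L_def Lpp_def
  by (subst nn_integral_density) (auto intro!: nn_integral_cong simp: mult.commute)

lemma measurable_\<mu>: "u \<in> borel_measurable lebesgue \<Longrightarrow> pair_diff u \<in> borel_measurable \<mu>\<^sub>G"
  "u \<in> borel_measurable lebesgue \<Longrightarrow> u \<in> borel_measurable \<mu>\<^sub>L"
  unfolding \<mu>\<^sub>G_def \<mu>\<^sub>L_def using pair_diff_measurable by auto

lemma X_iff:
  "u \<in> X \<longleftrightarrow> u \<in> borel_measurable lebesgue \<and> pair_diff u \<in> Lp_space \<mu>\<^sub>G p \<and> u \<in> Lp_space \<mu>\<^sub>L p"
proof (cases "u \<in> borel_measurable lebesgue")
  case True
  show ?thesis using gagp_eq[OF True] Lpp_eq[OF True] measurable_\<mu>[OF True] True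
    by (simp add: Xraw_def Lp_space_def)
qed (simp add: Xraw_def)

lemma X_measurable: "u \<in> X \<Longrightarrow> u \<in> borel_measurable lebesgue"
  by (simp add: X_iff)

lemma subspace_X: "subspace X"
proof -
  have "0 < p" using p by simp
  note Lp = subspace_Lp_space[OF this]
  have "subspace (borel_measurable lebesgue :: (real^'n \<Rightarrow> real) set)"
    unfolding subspace_def plus_fun_def scaleR_fun_def zero_fun_def by auto
  moreover have "subspace (pair_diff -` Lp_space \<mu>\<^sub>G p :: (real^'n \<Rightarrow> real) set)"
    by (rule linear_subspace_vimage[OF linear_pair_diff Lp])
  ultimately have "subspace (borel_measurable lebesgue \<inter> pair_diff -` Lp_space \<mu>\<^sub>G p \<inter> Lp_space \<mu>\<^sub>L p)"
    using Lp by (intro subspace_inter)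
  also have "borel_measurable lebesgue \<inter> pair_diff -` Lp_space \<mu>\<^sub>G p \<inter> Lp_space \<mu>\<^sub>L p = X"
    by (auto simp: X_iff)
  finally show ?thesis .
qed

sublocale G: Lp_functional X \<mu>\<^sub>G pair_diff p
  by (rule Lp_functional.intro) (auto simp: subspace_X p linear_pair_diff X_iff)

sublocale L: Lp_functional X \<mu>\<^sub>L "\<lambda>u. u" p
  by (rule Lp_functional.intro) (auto simp: subspace_X p linear_ident X_iff)

lemma G_gagp: "u \<in> X \<Longrightarrow> G.F u = enn2real (gagp p s \<Omega> u)"
  unfolding G.F_def by (simp add: gagp_eq X_measurable)

lemma L_Lpp: "u \<in> X \<Longrightarrow> L.F u = enn2real (Lpp p \<Omega> u)"
  unfolding L.F_def by (simp add: Lpp_eq X_measurable)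

lemma AE_\<mu>\<^sub>G_iff: "(AE z in \<mu>\<^sub>G. P z) \<longleftrightarrow> (AE z in lborel. 0 < kernel z \<longrightarrow> P z)"
  unfolding \<mu>\<^sub>G_def AE_density[OF kernel_lebesgue] AE_completion_iff ..

lemma AE_\<mu>\<^sub>L_iff: "(AE x in \<mu>\<^sub>L. P x) \<longleftrightarrow> (AE x in lborel. x \<in> \<Omega> \<longrightarrow> P x)"
  unfolding \<mu>\<^sub>L_def AE_density[OF indicator_\<Omega>_lebesgue] AE_completion_iff
  by (simp add: indicator_def)

text \<open>The differences \<open>f k x - f k y\<close> with \<open>x \<in> \<Omega>\<close> and \<open>y\<close> arbitrary carry convergence from \<open>\<Omega>\<close>
  to the whole space.\<close>

lemma AE_convergent_lborel:
  assumes G: "AE z in \<mu>\<^sub>G. convergent (\<lambda>k. pair_diff (f k) z)"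
    and L: "AE x in \<mu>\<^sub>L. convergent (\<lambda>k. f k x)"
  shows "AE x in lborel. convergent (\<lambda>k. f k x)"
proof -
  have "AE z in lborel. fst z \<in> \<Omega> \<and> fst z \<noteq> snd z \<longrightarrow> convergent (\<lambda>k. pair_diff (f k) z)"
    using G unfolding AE_\<mu>\<^sub>G_iff
    by eventually_elim (use kernel_pos in \<open>auto simp: Qset_def case_prod_beta\<close>)
  then have "AE z in lborel \<Otimes>\<^sub>M lborel. fst z \<in> \<Omega> \<and> fst z \<noteq> snd z \<longrightarrow>
      convergent (\<lambda>k. pair_diff (f k) z)"
    unfolding lborel_prod .
  then have G': "AE x in lborel. AE y in lborel. x \<in> \<Omega> \<and> x \<noteq> y \<longrightarrow> convergent (\<lambda>k. f k x - f k y)"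
    using lborel_pair.AE_pair[of "\<lambda>z. fst z \<in> \<Omega> \<and> fst z \<noteq> snd z \<longrightarrow>
        convergent (\<lambda>k. pair_diff (f k) z)"]
    by (simp add: pair_diff_def)
  have "\<exists>x\<in>\<Omega>. convergent (\<lambda>k. f k x) \<and> (AE y in lborel. x \<noteq> y \<longrightarrow> convergent (\<lambda>k. f k x - f k y))"
  proof (rule AE_lborel_imp_ex[OF \<Omega>(1,2)])
    show "AE x in lborel. x \<in> \<Omega> \<longrightarrow> convergent (\<lambda>k. f k x) \<and> (AE y in lborel. x \<noteq> y \<longrightarrow>
        convergent (\<lambda>k. f k x - f k y))"
      using G' L[unfolded AE_\<mu>\<^sub>L_iff] by eventually_elim auto
  qed
  then obtain x where x: "convergent (\<lambda>k. f k x)"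
    "AE y in lborel. x \<noteq> y \<longrightarrow> convergent (\<lambda>k. f k x - f k y)" by blast
  show ?thesis using x(2) AE_lborel_singleton[of x]
  proof eventually_elim
    fix y assume "x \<noteq> y \<longrightarrow> convergent (\<lambda>k. f k x - f k y)" "y \<noteq> x"
    then have "convergent (\<lambda>k. f k x - f k y)" by auto
    with x(1) have "convergent (\<lambda>k. f k x - (f k x - f k y))" by (rule convergent_diff)
    then show "convergent (\<lambda>k. f k y)" by simp
  qed
qed

lemma X_Fatou:
  assumes w: "\<And>k. w k \<in> X" and v: "v \<in> borel_measurable lebesgue"
    and lim: "AE x in lborel. (\<lambda>k. w k x) \<longlonglongrightarrow> v x"
    and c: "0 \<le> c" and bound: "\<And>k. k \<ge> k0 \<Longrightarrow> G.F (w k) + L.F (w k) \<le> c"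
  shows "v \<in> X" "G.F v \<le> c" "L.F v \<le> c"
proof -
  have bounds: "G.F (w k) \<le> c" "L.F (w k) \<le> c" if "k \<ge> k0" for k
    using bound[OF that] G.F_nonneg[OF w] L.F_nonneg[OF w] by (smt (verit))+
  have limG: "AE z in \<mu>\<^sub>G. (\<lambda>k. pair_diff (w k) z) \<longlonglongrightarrow> pair_diff v z"
    unfolding AE_\<mu>\<^sub>G_iff
    using AE_lborel_fst[OF lim, where 'b = "real^'n"] AE_lborel_snd[OF lim, where 'a = "real^'n"]
    by eventually_elim (auto simp: pair_diff_def intro!: tendsto_diff)
  have limL: "AE x in \<mu>\<^sub>L. (\<lambda>k. w k x) \<longlonglongrightarrow> v x" using lim unfolding AE_\<mu>\<^sub>L_iff by eventually_elim simp
  have G: "pair_diff v \<in> Lp_space \<mu>\<^sub>G p" "G.F v \<le> c"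
    by (rule G.F_Fatou[where f = w, OF w limG measurable_\<mu>(1)[OF v] c]; rule bounds; assumption)+
  have L: "v \<in> Lp_space \<mu>\<^sub>L p" "L.F v \<le> c"
    by (rule L.F_Fatou[where f = w, OF w limL measurable_\<mu>(2)[OF v] c]; rule bounds; assumption)+
  show "v \<in> X" unfolding X_iff by (intro conjI v G(1) L(1))
  show "G.F v \<le> c" "L.F v \<le> c" by (rule G(2), rule L(2))
qed

lemma AE_limit_of_fast:
  assumes f: "\<And>k. f k \<in> X"
    and fast: "\<And>k. G.F (f (Suc k) - f k) + L.F (f (Suc k) - f k) \<le> ((1/4) ^ k) powr p"
  obtains v where "v \<in> borel_measurable lebesgue" "AE x in lborel. (\<lambda>k. f k x) \<longlonglongrightarrow> v x"
proof -
  have "G.F (f (Suc k) - f k) \<le> ((1/4) ^ k) powr p"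
    "L.F (f (Suc k) - f k) \<le> ((1/4) ^ k) powr p" for k
    using fast[of k] G.F_nonneg[of "f (Suc k) - f k"] L.F_nonneg[of "f (Suc k) - f k"] f by auto
  then have conv: "AE x in lborel. convergent (\<lambda>k. f k x)"
    by (intro AE_convergent_lborel G.AE_convergent_of_fast L.AE_convergent_of_fast f)
  define v where "v x = lim (\<lambda>k. f k x)" for x
  show ?thesis
  proof (rule that)
    show "v \<in> borel_measurable lebesgue"
      unfolding v_def using X_measurable[OF f] by (intro borel_measurable_lim_metric)
    show "AE x in lborel. (\<lambda>k. f k x) \<longlonglongrightarrow> v x"
      using conv unfolding v_def by eventually_elim (simp add: convergent_LIMSEQ_iff)
  qed
qed

lemma X_complete:
  assumes u: "\<And>n::nat. u n \<in> X" and Cauchy: "Cauchy_wrt (\<lambda>w. G.F w + L.F w) u"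
  shows "\<exists>v\<in>X. (\<lambda>n. G.F (u n - v) + L.F (u n - v)) \<longlonglongrightarrow> 0"
proof -
  obtain r where r: "strict_mono (r :: nat \<Rightarrow> nat)"
    and fast: "\<And>k. G.F (u (r (Suc k)) - u (r k)) + L.F (u (r (Suc k)) - u (r k))
        < ((1/4) ^ k) powr p"
    by (rule Cauchy_wrt_fast_subseq[OF Cauchy, of "\<lambda>k. ((1/4) ^ k) powr p"]) (use that in auto)
  obtain v where v: "v \<in> borel_measurable lebesgue" and lim: "AE x in lborel. (\<lambda>k. u (r k) x) \<longlonglongrightarrow> v x"
    by (rule AE_limit_of_fast[where f = "\<lambda>k. u (r k)", OF u less_imp_le[OF fast]]) (rule that)
  have diffX: "u n - u (r k) \<in> X" for k n using u by auto
  have tail: "\<exists>n0. \<forall>n\<ge>n0. u n - v \<in> X \<and> G.F (u n - v) \<le> e \<and> L.F (u n - v) \<le> e" if e: "e > 0" for e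
  proof -
    obtain n0 where n0: "\<And>m n. n0 \<le> m \<Longrightarrow> n0 \<le> n \<Longrightarrow> G.F (u m - u n) + L.F (u m - u n) < e"
      by (rule Cauchy_wrtE[OF Cauchy e]) (rule that)
    have "u n - v \<in> X \<and> G.F (u n - v) \<le> e \<and> L.F (u n - v) \<le> e" if n: "n \<ge> n0" for n
    proof -
      have meas: "u n - v \<in> borel_measurable lebesgue"
        using X_measurable[OF u] v by (simp add: fun_diff_def)
      have "AE x in lborel. (\<lambda>k. (u n - u (r k)) x) \<longlonglongrightarrow> (u n - v) x"
        using lim by eventually_elim (auto intro!: tendsto_intros)
      moreover have "G.F (u n - u (r k)) + L.F (u n - u (r k)) \<le> e" if "k \<ge> n0" for k
        using n0[OF n, of "r k"] seq_suble[OF r, of k] that by auto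
      ultimately show ?thesis
        using X_Fatou[where w = "\<lambda>k. u n - u (r k)", OF diffX meas] e by (meson less_imp_le)
    qed
    then show ?thesis by blast
  qed
  obtain n where "u n - v \<in> X" using tail[of 1] by auto
  then have vX: "v \<in> X" using subspace_diff[OF subspace_X u, of "u n - v" n] by simp
  have "(\<lambda>n. G.F (u n - v) + L.F (u n - v)) \<longlonglongrightarrow> 0"
  proof (rule LIMSEQ_I)
    fix e :: real assume "e > 0"
    then obtain n0 where n0: "\<And>n. n \<ge> n0 \<Longrightarrow> G.F (u n - v) \<le> e / 3 \<and> L.F (u n - v) \<le> e / 3"
      using tail[of "e / 3"] by auto
    have "norm (G.F (u n - v) + L.F (u n - v) - 0) < e" if "n \<ge> n0" for n
      using n0[OF that] G.F_nonneg[of "u n - v"] L.F_nonneg[of "u n - v"] u vX \<open>e > 0\<close> by auto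
    then show "\<exists>n0. \<forall>n\<ge>n0. norm (G.F (u n - v) + L.F (u n - v) - 0) < e" by blast
  qed
  then show ?thesis using vX by blast
qed

end

subsection \<open>Compact embedding\<close>

context seminormed
begin

lemma bounded_combinations_Cauchy_subseq:
  fixes a :: "nat \<Rightarrow> 'i \<Rightarrow> real" and v :: "'i \<Rightarrow> 'a"
  assumes I: "finite I" and v: "\<And>i. i \<in> I \<Longrightarrow> v i \<in> E"
    and bound: "\<And>n i. i \<in> I \<Longrightarrow> \<bar>a n i\<bar> * N (v i) \<le> C"
  shows "\<exists>r. strict_mono (r :: nat \<Rightarrow> nat) \<and> Cauchy_wrt N (\<lambda>n. \<Sum>i\<in>I. a (r n) i *\<^sub>R v i)"
proof -
  define b where "b n i = a n i * N (v i)" for n i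
  have "\<forall>J\<subseteq>I. \<exists>l r. strict_mono (r :: nat \<Rightarrow> nat) \<and>
      (\<forall>\<epsilon>>0. eventually (\<lambda>n. \<forall>i\<in>J. dist (b (r n) i) (l i) < \<epsilon>) sequentially)"
  proof (rule compact_lemma_general[where proj = "\<lambda>x i. x i" and unproj = "\<lambda>x. x", OF I])
    fix i assume i: "i \<in> I"
    then have "\<bar>b n i\<bar> \<le> C" for n using bound v N_nonneg by (simp add: b_def abs_mult)
    then show "bounded ((\<lambda>x. x i) ` range b)" unfolding bounded_iff by (intro exI[of _ C]) auto
  qed auto
  then obtain l r where r: "strict_mono (r :: nat \<Rightarrow> nat)"
    and lim: "\<And>\<epsilon>. \<epsilon> > 0 \<Longrightarrow> eventually (\<lambda>n. \<forall>i\<in>I. dist (b (r n) i) (l i) < \<epsilon>) sequentially" by blast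
  have "Cauchy_wrt N (\<lambda>n. \<Sum>i\<in>I. a (r n) i *\<^sub>R v i)"
  proof (rule Cauchy_wrtI)
    fix e :: real assume e: "e > 0"
    define \<epsilon> where "\<epsilon> = e / (2 * (real (card I) + 1))"
    have \<epsilon>: "\<epsilon> > 0" "real (card I) * (2 * \<epsilon>) < e"
      using e unfolding \<epsilon>_def by (auto simp: field_simps)
    obtain n0 where n0: "\<And>n i. n \<ge> n0 \<Longrightarrow> i \<in> I \<Longrightarrow> dist (b (r n) i) (l i) < \<epsilon>"
      using lim[OF \<epsilon>(1)] by (auto simp: eventually_sequentially)
    have "N ((\<Sum>i\<in>I. a (r m) i *\<^sub>R v i) - (\<Sum>i\<in>I. a (r n) i *\<^sub>R v i)) < e"
      if mn: "m \<ge> n0" "n \<ge> n0" for m n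
    proof -
      have "(\<Sum>i\<in>I. a (r m) i *\<^sub>R v i) - (\<Sum>i\<in>I. a (r n) i *\<^sub>R v i)
          = (\<Sum>i\<in>I. (a (r m) i - a (r n) i) *\<^sub>R v i)"
        by (simp add: scaleR_diff_left sum_subtractf)
      then have "N ((\<Sum>i\<in>I. a (r m) i *\<^sub>R v i) - (\<Sum>i\<in>I. a (r n) i *\<^sub>R v i))
          \<le> (\<Sum>i\<in>I. N ((a (r m) i - a (r n) i) *\<^sub>R v i))"
        using N_sum[OF I, of "\<lambda>i. (a (r m) i - a (r n) i) *\<^sub>R v i"] v by simp
      also have "\<dots> \<le> (\<Sum>i\<in>I. 2 * \<epsilon>)"
      proof (rule sum_mono)
        fix i assume i: "i \<in> I"
        have "N ((a (r m) i - a (r n) i) *\<^sub>R v i) = \<bar>b (r m) i - b (r n) i\<bar>"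
          using v[OF i] N_nonneg[OF v[OF i]]
          by (simp add: N_hom b_def abs_mult left_diff_distrib[symmetric])
        also have "\<dots> \<le> 2 * \<epsilon>" using n0[OF mn(1) i] n0[OF mn(2) i] by (simp add: dist_real_def)
        finally show "N ((a (r m) i - a (r n) i) *\<^sub>R v i) \<le> 2 * \<epsilon>" .
      qed
      finally show ?thesis using \<epsilon>(2) by simp
    qed
    then show "\<exists>n0. \<forall>m\<ge>n0. \<forall>n\<ge>n0. N ((\<Sum>i\<in>I. a (r m) i *\<^sub>R v i) - (\<Sum>i\<in>I. a (r n) i *\<^sub>R v i)) < e"
      by blast
  qed
  then show ?thesis using r by blast
qed

lemma Cauchy_subseq_of_close_subseqs:
  assumes close: "\<And>e s. e > 0 \<Longrightarrow> strict_mono (s :: nat \<Rightarrow> nat) \<Longrightarrow>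
    \<exists>r. strict_mono (r :: nat \<Rightarrow> nat) \<and> (\<forall>i j. N (u (s (r i)) - u (s (r j))) < e)"
  shows "\<exists>r. strict_mono (r :: nat \<Rightarrow> nat) \<and> Cauchy_wrt N (\<lambda>n. u (r n))"
proof -
  define P where "P k r \<longleftrightarrow> (\<forall>i j. N (u (r i) - u (r j)) < inverse (real (Suc k)))"
    for k and r :: "nat \<Rightarrow> nat"
  interpret subseqs P
  proof
    fix k and s :: "nat \<Rightarrow> nat" assume "strict_mono s"
    then show "\<exists>r. strict_mono r \<and> P k (s \<circ> r)"
      using close[of "inverse (real (Suc k))" s] by (simp add: P_def)
  qed
  have diag: "P k (diagseq \<circ> ((+) (Suc k)))" for k by (rule diagseq_holds) (auto simp: P_def)
  have "Cauchy_wrt N (\<lambda>n. u (diagseq n))"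
  proof (rule Cauchy_wrtI)
    fix e :: real assume "e > 0"
    then obtain k where k: "inverse (real (Suc k)) < e" using reals_Archimedean by blast
    have "N (u (diagseq m) - u (diagseq n)) < e" if "m \<ge> Suc k" "n \<ge> Suc k" for m n
    proof -
      obtain i j where "m = Suc k + i" "n = Suc k + j"
        using \<open>m \<ge> Suc k\<close> \<open>n \<ge> Suc k\<close> le_Suc_ex by metis
      then have "N (u (diagseq m) - u (diagseq n)) < inverse (real (Suc k))"
        using diag[of k] unfolding P_def comp_def by blast
      then show ?thesis using k by linarith
    qed
    then show "\<exists>n0. \<forall>m\<ge>n0. \<forall>n\<ge>n0. N (u (diagseq m) - u (diagseq n)) < e" by blast
  qed
  then show ?thesis using subseq_diagseq by blast
qed

lemma close_subseq_of_approximation: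
  assumes u: "\<And>n::nat. u n \<in> E" and w: "\<And>n. w n \<in> E" "\<And>n. N (u n - w n) < e / 3"
    and r: "strict_mono (r :: nat \<Rightarrow> nat)" "Cauchy_wrt N (\<lambda>n. w (r n))" and e: "e > 0"
  shows "\<exists>r. strict_mono (r :: nat \<Rightarrow> nat) \<and> (\<forall>i j. N (u (r i) - u (r j)) < e)"
proof -
  obtain n0 where n0: "\<And>m n. n0 \<le> m \<Longrightarrow> n0 \<le> n \<Longrightarrow> N (w (r m) - w (r n)) < e / 3"
    by (rule Cauchy_wrtE[OF r(2), of "e / 3"]) (use e in auto)
  have "N (u (r (n0 + i)) - u (r (n0 + j))) < e" for i j
  proof -
    define m n where "m = r (n0 + i)" and "n = r (n0 + j)"
    have "N (u m - u n) \<le> N (u m - w m) + N (w m - u n)" using u w by (intro N_triangle_diff)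
    also have "N (w m - u n) \<le> N (w m - w n) + N (w n - u n)" using u w by (intro N_triangle_diff)
    also have "N (w n - u n) = N (u n - w n)" using u w by (intro N_diff_commute)
    finally show ?thesis
      using n0[of "n0 + i" "n0 + j"] w(2)[of m] w(2)[of n] unfolding m_def n_def by simp
  qed
  moreover have "strict_mono (\<lambda>i. r (n0 + i))" using r(1) by (simp add: strict_mono_def)
  ultimately show ?thesis by blast
qed

end

lemma nn_integral_ex_le_average:
  assumes B: "B \<in> sets M" "0 < emeasure M B" "emeasure M B < \<infinity>"
    and g [measurable]: "g \<in> borel_measurable M"
  shows "\<exists>y\<in>B. g y * emeasure M B \<le> (\<integral>\<^sup>+y. g y * indicator B y \<partial>M)"
proof (rule ccontr)
  define I where "I = (\<integral>\<^sup>+y. g y * indicator B y \<partial>M)"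
  note [measurable] = B(1)
  assume "\<not> ?thesis"
  then have less_integral: "I < g y * emeasure M B" if "y \<in> B" for y
    using that by (auto simp: I_def not_le)
  have "B \<noteq> {}" using B(2) by auto
  then have I: "I < \<infinity>"
    using less_integral
    by (metis all_not_in_conv infinity_ennreal_def less_top order_less_imp_le top.not_eq_extremum
      top_unique)
  have "(\<integral>\<^sup>+y. I * indicator B y \<partial>M) < (\<integral>\<^sup>+y. emeasure M B * (g y * indicator B y) \<partial>M)"
  proof (rule nn_integral_less)
    show "(\<integral>\<^sup>+y. I * indicator B y \<partial>M) \<noteq> \<infinity>"
      using I B(3) by (simp add: nn_integral_cmult_indicator ennreal_mult_eq_top_iff less_top)
    show "AE y in M. I * indicator B y \<le> emeasure M B * (g y * indicator B y)"
      using less_integral by (intro AE_I2) (auto simp: indicator_def mult.commute less_imp_le)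
    show "\<not> (AE y in M. emeasure M B * (g y * indicator B y) \<le> I * indicator B y)"
    proof
      assume "AE y in M. emeasure M B * (g y * indicator B y) \<le> I * indicator B y"
      then have "AE y in M. y \<notin> B"
      proof eventually_elim
        case (elim y)
        then show ?case using less_integral[of y] by (auto simp: mult.commute dest: leD)
      qed
      then have "emeasure M B = 0"
        using AE_iff_measurable[of B M "\<lambda>y. y \<notin> B"] B(1) sets.sets_into_space[OF B(1)] by auto
      then show False using B(2) by simp
    qed
  qed measurable
  also have "\<dots> = emeasure M B * I" unfolding I_def by (rule nn_integral_cmult) measurable
  finally show False by (simp add: nn_integral_cmult_indicator mult.commute)
qed

lemma finite_cell_partition:
  fixes U :: "'a::euclidean_space set"
  assumes U: "U \<in> sets borel" "bounded U" and h: "h > 0"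
  obtains S c and m :: nat where "\<And>i. S i \<in> sets borel" "disjoint_family S" "(\<Union>i<m. S i) = U"
    "\<And>i. i < m \<Longrightarrow> S i \<subseteq> ball (c i) h"
proof -
  have "compact (closure U)" using U(2) by simp
  then obtain C where C: "finite C" "closure U \<subseteq> (\<Union>x\<in>C. ball x h)"
    using compact_imp_seq_compact[THEN seq_compact_imp_totally_bounded] h by metis
  obtain xs where xs: "set xs = C" using finite_list[OF C(1)] by blast
  define b where "b i = (if i < length xs then ball (xs ! i) h else {})" for i
  define S where "S i = U \<inter> disjointed b i" for i
  show ?thesis
  proof (rule that[of S "length xs" "\<lambda>i. xs ! i"])
    show "S i \<in> sets borel" for i
    proof -
      have "b j \<in> sets borel" for j unfolding b_def by auto
      then have "disjointed b i \<in> sets borel"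
        unfolding disjointed_def by (intro sets.Diff sets.finite_UN) auto
      then show ?thesis unfolding S_def using U(1) by (intro sets.Int)
    qed
    show "disjoint_family S"
      using disjoint_family_disjointed[of b] unfolding S_def disjoint_family_on_def by auto
    show "S i \<subseteq> ball (xs ! i) h" if "i < length xs" for i
      using disjointed_subset[of b i] that unfolding S_def b_def by auto
    show "(\<Union>i<length xs. S i) = U"
    proof
      show "U \<subseteq> (\<Union>i<length xs. S i)"
      proof
        fix x assume x: "x \<in> U"
        then have "x \<in> (\<Union>x\<in>C. ball x h)" using C(2) closure_subset by blast
        then obtain i where "i < length xs" "x \<in> ball (xs ! i) h"
          unfolding xs[symmetric] by (auto simp: in_set_conv_nth)
        then have "x \<in> (\<Union>i. b i)" unfolding b_def by auto
        then obtain j where j: "x \<in> disjointed b j" using UN_disjointed_eq[of b] by blast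
        then have "x \<in> b j" using disjointed_subset[of b j] by (rule subsetD[rotated])
        then have "j < length xs" unfolding b_def by (auto split: if_splits)
        then show "x \<in> (\<Union>i<length xs. S i)" using x j unfolding S_def by auto
      qed
    qed (auto simp: S_def)
  qed
qed

lemma sum_fun_apply: "(\<Sum>i\<in>I. f i) x = (\<Sum>i\<in>I. f i x)"
  by (induction I rule: infinite_finite_induct) auto

definition step_function :: "(nat \<Rightarrow> 'a set) \<Rightarrow> nat \<Rightarrow> (nat \<Rightarrow> real) \<Rightarrow> 'a \<Rightarrow> real" where
  "step_function S m a = (\<Sum>i<m. a i *\<^sub>R indicator (S i))"

lemma step_function_eq:
  assumes S: "disjoint_family S" and i: "i < m" "x \<in> S i"
  shows "step_function S m a x = a i"
proof -
  have "x \<notin> S j" if "j \<noteq> i" for j using S i(2) that unfolding disjoint_family_on_def by blast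
  then have "(\<Sum>j\<in>{..<m} - {i}. (a j *\<^sub>R indicator (S j)) x) = (0 :: real)"
    by (intro sum.neutral) auto
  then show ?thesis
    unfolding step_function_def sum_fun_apply using i by (subst sum.remove[of _ i]) auto
qed

context Lp_functional
begin

lemma F_mono:
  assumes "u \<in> E" "v \<in> E" "\<And>x. \<bar>A u x\<bar> \<le> \<bar>A v x\<bar>"
  shows "F u \<le> F v"
  unfolding F_integral[OF assms(1)] F_integral[OF assms(2)] using assms p
  by (intro integral_mono A_integrable) (auto intro: powr_mono2)

end

context neumann
begin

lemma abs_powr_le_kernel:
  assumes x: "x \<in> \<Omega>" and D: "norm (x - y) \<le> D"
  shows "ennreal (\<bar>u x - u y\<bar> powr p)
      \<le> ennreal (D powr \<kappa>) * (kernel (x, y) * ennreal (\<bar>pair_diff u (x, y)\<bar> powr p))"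
proof (cases "x = y")
  case False
  define d where "d = norm (x - y)"
  have d: "d powr \<kappa> > 0" "d powr \<kappa> \<le> D powr \<kappa>"
    using False D \<kappa>_pos unfolding d_def by (auto intro!: powr_mono2)
  have "kernel (x, y) = ennreal (1 / d powr \<kappa>)" using x by (simp add: kernel_def Qset_def d_def)
  then have "ennreal (D powr \<kappa>) * (kernel (x, y) * ennreal (\<bar>pair_diff u (x, y)\<bar> powr p))
      = ennreal (D powr \<kappa> * (1 / d powr \<kappa>) * \<bar>u x - u y\<bar> powr p)"
    by (simp add: ennreal_mult[symmetric] pair_diff_def)
  moreover have "1 \<le> D powr \<kappa> * (1 / d powr \<kappa>)" using d by (simp add: field_simps)
  then have "1 * \<bar>u x - u y\<bar> powr p \<le> D powr \<kappa> * (1 / d powr \<kappa>) * \<bar>u x - u y\<bar> powr p"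
    by (rule mult_right_mono) simp
  ultimately show ?thesis by (simp add: ennreal_leI)
qed simp

lemma energy_density_measurable:
  assumes [measurable]: "u \<in> borel_measurable borel"
  shows "(\<lambda>z. kernel z * ennreal (\<bar>pair_diff u z\<bar> powr p)) \<in> borel_measurable (lborel \<Otimes>\<^sub>M lborel)"
proof -
  have [measurable]: "kernel \<in> borel_measurable (lborel \<Otimes>\<^sub>M lborel)" unfolding lborel_prod by simp
  show ?thesis unfolding pair_diff_def by measurable
qed

text \<open>On a cell \<open>S \<subseteq> \<Omega>\<close> inside a ball, \<open>u\<close> is compared with one of its values on the whole ball; this
  is where the part of the seminorm outside \<open>\<Omega> \<times> \<Omega>\<close> replaces an extension theorem.\<close>

lemma cell_oscillation:
  fixes u :: "real^'n \<Rightarrow> real"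
  assumes u [measurable]: "u \<in> borel_measurable borel" and h: "h > 0"
    and S: "S \<in> sets borel" "S \<subseteq> \<Omega>" "S \<subseteq> ball c h"
  shows "\<exists>y. (\<integral>\<^sup>+x. ennreal (\<bar>u x
      - u y\<bar> powr p) * indicator S x \<partial>lborel) * emeasure lborel (ball c h)
     \<le> ennreal ((2 * h) powr \<kappa>) *
        (\<integral>\<^sup>+z. kernel z * ennreal (\<bar>pair_diff u z\<bar> powr p) * indicator S (fst z) \<partial>lborel)"
proof -
  note [measurable] = S(1)
  define W where "W z = kernel z * ennreal (\<bar>pair_diff u z\<bar> powr p) * indicator S (fst z)" for z
  define g where "g y = (\<integral>\<^sup>+x. ennreal (\<bar>u x - u y\<bar> powr p) * indicator S x \<partial>lborel)" for y
  note [measurable] = energy_density_measurable[OF u]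
  have W [measurable]: "W \<in> borel_measurable (lborel \<Otimes>\<^sub>M lborel)" unfolding W_def by measurable
  have "\<exists>y\<in>ball c h. g y * emeasure lborel (ball c h)
      \<le> (\<integral>\<^sup>+y. g y * indicator (ball c h) y \<partial>lborel)"
  proof (rule nn_integral_ex_le_average)
    show "g \<in> borel_measurable lborel" unfolding g_def by measurable
  qed (use h in \<open>auto simp: emeasure_ball\<close>)
  then obtain y where "g y * emeasure lborel (ball c h)
      \<le> (\<integral>\<^sup>+y. g y * indicator (ball c h) y \<partial>lborel)" by blast
  also have "\<dots> = (\<integral>\<^sup>+y. (\<integral>\<^sup>+x. ennreal (\<bar>u x - u y\<bar> powr p) * indicator S x
      * indicator (ball c h) y \<partial>lborel) \<partial>lborel)"
    unfolding g_def by (intro nn_integral_cong nn_integral_multc[symmetric]) measurable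
  also have "\<dots> \<le> (\<integral>\<^sup>+y. (\<integral>\<^sup>+x. ennreal ((2 * h) powr \<kappa>) * W (x, y) \<partial>lborel) \<partial>lborel)"
  proof (intro nn_integral_mono)
    fix x y
    show "ennreal (\<bar>u x - u y\<bar> powr p) * indicator S x * indicator (ball c h) y
        \<le> ennreal ((2 * h) powr \<kappa>) * W (x, y)"
    proof (cases "x \<in> S \<and> y \<in> ball c h")
      case True
      then have "dist x y \<le> dist c x + dist c y" by (metis dist_commute dist_triangle)
      then have "norm (x - y) \<le> 2 * h" using True S(3) by (auto simp: dist_norm subset_iff)
      then show ?thesis using abs_powr_le_kernel[of x y "2 * h" u] True S(2) by (auto simp: W_def)
    qed (auto simp: indicator_def)
  qed
  also have "\<dots> = (\<integral>\<^sup>+z. ennreal ((2 * h) powr \<kappa>) * W z \<partial>(lborel \<Otimes>\<^sub>M lborel))"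
    by (rule lborel_pair.nn_integral_snd) measurable
  also have "\<dots> = ennreal ((2 * h) powr \<kappa>) * (\<integral>\<^sup>+z. W z \<partial>(lborel \<Otimes>\<^sub>M lborel))"
    by (rule nn_integral_cmult) measurable
  finally show ?thesis unfolding g_def W_def lborel_prod by blast
qed

definition cell_constant :: "real \<Rightarrow> real" where
  "cell_constant h = (2 * h) powr \<kappa> / (unit_ball_vol (real CARD('n)) * h ^ CARD('n))"

lemma cell_constant_nonneg: "h > 0 \<Longrightarrow> 0 \<le> cell_constant h"
  by (simp add: cell_constant_def)

lemma cell_constant_eq:
  assumes h: "h > 0"
  shows "cell_constant h = 2 powr \<kappa> / unit_ball_vol (real CARD('n)) * h powr (p * s)"
proof -
  have "cell_constant h = 2 powr \<kappa>
      * (h powr (real CARD('n)) * h powr (p * s)) / (unit_ball_vol (real CARD('n)) * h ^ CARD('n))"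
    unfolding cell_constant_def \<kappa>_def using h by (simp add: powr_mult powr_add)
  then show ?thesis using h by (simp add: powr_realpow)
qed

lemma cell_constant_small:
  assumes e: "e > 0" and B: "B \<ge> 0"
  obtains h where "h > 0" "cell_constant h * B < e"
proof -
  define K where "K = 2 powr \<kappa> / unit_ball_vol (real CARD('n))"
  have K: "K > 0" unfolding K_def by simp
  define h where "h = (e / (K * (B + 1))) powr (1 / (p * s))"
  have h: "h > 0" unfolding h_def using e K B by simp
  have "h powr (p * s) = e / (K * (B + 1))" unfolding h_def using p s e K B by (simp add: powr_powr)
  then have "cell_constant h = e / (B + 1)"
    unfolding cell_constant_eq[OF h] K_def[symmetric] using K by simp
  moreover have "e / (B + 1) * B < e" using e B by (simp add: field_simps)
  ultimately show ?thesis using that[OF h] by simp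
qed

lemma cell_approximation:
  fixes u :: "real^'n \<Rightarrow> real"
  assumes "u \<in> borel_measurable borel" and h: "h > 0" and "S \<in> sets borel" "S \<subseteq> \<Omega>" "S \<subseteq> ball c h"
  shows "\<exists>a. (\<integral>\<^sup>+x. ennreal (\<bar>u x - a\<bar> powr p) * indicator S x \<partial>lborel)
     \<le> ennreal (cell_constant h) * (\<integral>\<^sup>+z. kernel z * ennreal (\<bar>pair_diff u z\<bar> powr p) * indicator S (fst z) \<partial>lborel)"
proof -
  define V where "V = unit_ball_vol (real CARD('n)) * h ^ CARD('n)"
  have V: "V > 0" "emeasure lborel (ball c h) = ennreal V"
    unfolding V_def using h by (simp_all add: emeasure_ball)
  define W where "W = (\<integral>\<^sup>+z. kernel z * ennreal (\<bar>pair_diff u z\<bar> powr p)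
      * indicator S (fst z) \<partial>lborel)"
  obtain y where y: "(\<integral>\<^sup>+x. ennreal (\<bar>u x - u y\<bar> powr p) * indicator S x \<partial>lborel) * ennreal V
      \<le> ennreal ((2 * h) powr \<kappa>) * W"
    using cell_oscillation[OF assms] unfolding W_def V(2) by blast
  define I where "I = (\<integral>\<^sup>+x. ennreal (\<bar>u x - u y\<bar> powr p) * indicator S x \<partial>lborel)"
  have "I = I * ennreal V * ennreal (1 / V)"
    using V(1) by (simp add: mult.assoc ennreal_mult[symmetric])
  also have "\<dots> \<le> ennreal ((2 * h) powr \<kappa>) * W * ennreal (1 / V)"
    using y unfolding I_def by (rule mult_right_mono) simp
  also have "\<dots> = ennreal ((2 * h) powr \<kappa>) * ennreal (1 / V) * W" by (simp only: ac_simps)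
  also have "ennreal ((2 * h) powr \<kappa>) * ennreal (1 / V) = ennreal (cell_constant h)"
    using V(1) by (simp add: ennreal_mult[symmetric] cell_constant_def V_def)
  finally show ?thesis unfolding I_def W_def by blast
qed

lemma step_approximation_borel:
  fixes u :: "real^'n \<Rightarrow> real" and m :: nat
  assumes u [measurable]: "u \<in> borel_measurable borel" and h: "h > 0"
    and S: "\<And>i. S i \<in> sets borel" "disjoint_family S" "(\<Union>i<m. S i) = \<Omega>"
      "\<And>i. i < m \<Longrightarrow> S i \<subseteq> ball (c i) h"
  shows "\<exists>a. (\<Sum>i<m. \<integral>\<^sup>+x. ennreal (\<bar>u x - a i\<bar> powr p) * indicator (S i) x \<partial>lborel)
    \<le> ennreal (cell_constant h) * gagp p s \<Omega> u"
proof -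
  define W where "W z = kernel z * ennreal (\<bar>pair_diff u z\<bar> powr p)" for z
  have W [measurable]: "W \<in> borel_measurable lborel"
    using energy_density_measurable[OF u] unfolding W_def lborel_prod .
  define close where "close i t \<longleftrightarrow> (\<integral>\<^sup>+x. ennreal (\<bar>u x - t\<bar> powr p) * indicator (S i) x \<partial>lborel)
     \<le> ennreal (cell_constant h) * (\<integral>\<^sup>+z. W z * indicator (S i) (fst z) \<partial>lborel)" for i t
  have "\<exists>t. close i t" if "i < m" for i
    unfolding close_def W_def using that S by (intro cell_approximation[OF u h]) auto
  then obtain a where a: "\<And>i. i < m \<Longrightarrow> close i (a i)" by metis
  have ind [measurable]: "(\<lambda>z. indicator (S i) (fst z) :: ennreal)
      \<in> borel_measurable (lborel :: ((real^'n) \<times> (real^'n)) measure)" for i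
    using S(1)[of i] unfolding lborel_prod[symmetric] by measurable
  have "(\<Sum>i<m. \<integral>\<^sup>+z. W z * indicator (S i) (fst z) \<partial>lborel)
      = (\<integral>\<^sup>+z. (\<Sum>i<m. W z * indicator (S i) (fst z)) \<partial>lborel)"
    by (rule nn_integral_sum[symmetric]) measurable
  also have "\<dots> \<le> (\<integral>\<^sup>+z. W z \<partial>lborel)"
  proof (rule nn_integral_mono)
    fix z :: "(real^'n) \<times> (real^'n)"
    have "(\<Sum>i<m. W z * indicator (S i) (fst z)) = W z * indicator (\<Union>i<m. S i) (fst z)"
      using S(2) by (subst indicator_UN_disjoint)
        (auto simp: disjoint_family_on_def sum_distrib_left)
    also have "\<dots> \<le> W z * 1" by (intro mult_left_mono) (auto simp: indicator_def)
    finally show "(\<Sum>i<m. W z * indicator (S i) (fst z)) \<le> W z" by simp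
  qed
  also have "\<dots> = gagp p s \<Omega> u" unfolding gagp_lborel W_def ..
  finally have W_le: "(\<Sum>i<m. \<integral>\<^sup>+z. W z * indicator (S i) (fst z) \<partial>lborel) \<le> gagp p s \<Omega> u" .
  have "(\<Sum>i<m. \<integral>\<^sup>+x. ennreal (\<bar>u x - a i\<bar> powr p) * indicator (S i) x \<partial>lborel)
      \<le> (\<Sum>i<m. ennreal (cell_constant h) * (\<integral>\<^sup>+z. W z * indicator (S i) (fst z) \<partial>lborel))"
    using a unfolding close_def by (intro sum_mono) auto
  also have "\<dots> \<le> ennreal (cell_constant h) * gagp p s \<Omega> u"
    unfolding sum_distrib_left[symmetric] using W_le by (intro mult_left_mono) auto
  finally show ?thesis by blast
qed

lemma Lp_space_\<mu>\<^sub>L_measurable: "u \<in> Lp_space \<mu>\<^sub>L p \<Longrightarrow> u \<in> borel_measurable lebesgue"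
  by (simp add: Lp_space_def \<mu>\<^sub>L_def)

sublocale Lp: Lp_functional "Lp_space \<mu>\<^sub>L p" \<mu>\<^sub>L "\<lambda>u. u" p
  by (rule Lp_functional.intro) (use p in \<open>auto intro: subspace_Lp_space linear_ident\<close>)

lemma indicator_in_Lp_space:
  assumes S: "S \<in> sets borel"
  shows "indicator S \<in> Lp_space \<mu>\<^sub>L p"
proof -
  have [measurable]: "S \<in> sets lebesgue" using S by auto
  have "(\<integral>\<^sup>+x. ennreal (\<bar>indicator S x\<bar> powr p) \<partial>\<mu>\<^sub>L) = Lpp p \<Omega> (indicator S)"
    by (rule Lpp_eq[symmetric]) measurable
  also have "\<dots> \<le> (\<integral>\<^sup>+x. indicator \<Omega> x \<partial>lebesgue)"
    unfolding Lpp_def using p by (intro nn_integral_mono) (auto simp: indicator_def)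
  also have "\<dots> < \<infinity>" using emeasure_bounded_finite[OF \<Omega>(3)] by simp
  finally show ?thesis using measurable_\<mu>(2)[of "indicator S"] unfolding Lp_space_def by simp
qed

lemma step_in_Lp_space:
  "(\<And>i. S i \<in> sets borel) \<Longrightarrow> step_function S m a \<in> Lp_space \<mu>\<^sub>L p"
  unfolding step_function_def using indicator_in_Lp_space
  by (intro subspace_sum Lp.subspace_E subspace_scale) auto

lemma nn_integral_minus_step:
  fixes u :: "real^'n \<Rightarrow> real" and m :: nat
  assumes u: "u \<in> Lp_space \<mu>\<^sub>L p"
    and S: "\<And>i. S i \<in> sets borel" "disjoint_family S" "(\<Union>i<m. S i) = \<Omega>"
  shows "ennreal (Lp.F (u - step_function S m a))
    = (\<Sum>i<m. \<integral>\<^sup>+x. ennreal (\<bar>u x - a i\<bar> powr p) * indicator (S i) x \<partial>lborel)"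
proof -
  define w where "w = step_function S m a"
  have uw: "u - w \<in> Lp_space \<mu>\<^sub>L p"
    unfolding w_def using u step_in_Lp_space[OF S(1)] by (intro subspace_diff Lp.subspace_E) auto
  have [measurable]: "S i \<in> sets lebesgue" "u \<in> borel_measurable lebesgue" for i
    using S(1) Lp_space_\<mu>\<^sub>L_measurable[OF u] by auto
  have pointwise: "ennreal (\<bar>(u - w) x\<bar> powr p) * indicator \<Omega> x
      = (\<Sum>i<m. ennreal (\<bar>u x - a i\<bar> powr p) * indicator (S i) x)" for x
  proof (cases "x \<in> \<Omega>")
    case True
    then obtain i where i: "i < m" "x \<in> S i" using S(3) by auto
    then have "w x = a i" unfolding w_def by (rule step_function_eq[OF S(2)])
    moreover have "x \<notin> S j" if "j \<noteq> i" for j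
      using S(2) i(2) that unfolding disjoint_family_on_def by blast
    ultimately show ?thesis using True i by (subst sum.remove[of _ i]) (auto simp: indicator_def)
  next
    case False
    then have "(\<Sum>i<m. ennreal (\<bar>u x - a i\<bar> powr p) * indicator (S i) x) = 0"
      using S(3) by (intro sum.neutral) auto
    then show ?thesis using False by (simp only: indicator_simps(2)[OF False] mult_zero_right)
  qed
  have "ennreal (Lp.F (u - w)) = Lpp p \<Omega> (u - w)"
    using Lp.F_ennreal[OF uw] Lpp_eq[OF Lp_space_\<mu>\<^sub>L_measurable[OF uw]] by simp
  also have "\<dots> = (\<integral>\<^sup>+x. (\<Sum>i<m. ennreal (\<bar>u x - a i\<bar> powr p) * indicator (S i) x) \<partial>lebesgue)"
    unfolding Lpp_def pointwise ..
  also have "\<dots> = (\<Sum>i<m. \<integral>\<^sup>+x. ennreal (\<bar>u x - a i\<bar> powr p) * indicator (S i) x \<partial>lebesgue)"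
    by (rule nn_integral_sum) measurable
  finally show ?thesis unfolding w_def nn_integral_completion .
qed

lemma step_approximation:
  fixes m :: nat
  assumes u: "u \<in> X" and h: "h > 0"
    and S: "\<And>i. S i \<in> sets borel" "disjoint_family S" "(\<Union>i<m. S i) = \<Omega>"
      "\<And>i. i < m \<Longrightarrow> S i \<subseteq> ball (c i) h"
  shows "\<exists>a. L.F (u - step_function S m a) \<le> cell_constant h * G.F u"
proof -
  obtain u' where u': "u' \<in> borel_measurable borel" "AE x in lborel. u x = u' x"
    using completion_ex_borel_measurable_real[OF X_measurable[OF u]] by auto
  have "gagp p s \<Omega> u' = gagp p s \<Omega> u"
    unfolding gagp_lborel
  proof (rule nn_integral_cong_AE)
    show "AE z in lborel. kernel z * ennreal (\<bar>pair_diff u' z\<bar> powr p)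
        = kernel z * ennreal (\<bar>pair_diff u z\<bar> powr p)"
      using AE_lborel_fst[OF u'(2), where 'b = "real^'n"]
        AE_lborel_snd[OF u'(2), where 'a = "real^'n"]
      by eventually_elim (simp add: pair_diff_def)
  qed
  also have "\<dots> = ennreal (G.F u)" using G.F_ennreal[OF u] gagp_eq[OF X_measurable[OF u]] by simp
  finally have gagp: "gagp p s \<Omega> u' = ennreal (G.F u)" .
  from step_approximation_borel[where S = S and c = c and m = m, OF u'(1) h S]
  obtain a where a: "(\<Sum>i<m. \<integral>\<^sup>+x. ennreal (\<bar>u' x - a i\<bar> powr p) * indicator (S i) x \<partial>lborel)
      \<le> ennreal (cell_constant h) * ennreal (G.F u)" unfolding gagp by blast
  have "ennreal (L.F (u - step_function S m a))
      = (\<Sum>i<m. \<integral>\<^sup>+x. ennreal (\<bar>u x - a i\<bar> powr p) * indicator (S i) x \<partial>lborel)"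
    using u by (intro nn_integral_minus_step S) (simp add: X_iff)
  also have "\<dots> = (\<Sum>i<m. \<integral>\<^sup>+x. ennreal (\<bar>u' x - a i\<bar> powr p) * indicator (S i) x \<partial>lborel)"
    by (intro sum.cong refl nn_integral_cong_AE) (use u'(2) in \<open>eventually_elim, simp\<close>)
  also have "\<dots> \<le> ennreal (cell_constant h * G.F u)"
    using a cell_constant_nonneg[OF h] G.F_nonneg[OF u] by (simp add: ennreal_mult)
  finally have "L.F (u - step_function S m a) \<le> cell_constant h * G.F u"
    using cell_constant_nonneg[OF h] G.F_nonneg[OF u] by (simp add: ennreal_le_iff)
  then show ?thesis by blast
qed

lemma step_coefficient_bound:
  fixes m :: nat
  assumes S: "\<And>i. S i \<in> sets borel" "disjoint_family S" and i: "i < m"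
  shows "\<bar>a i\<bar> * Lp.F (indicator (S i)) powr (1 / p) \<le> Lp.F (step_function S m a) powr (1 / p)"
proof -
  have ind: "indicator (S i) \<in> Lp_space \<mu>\<^sub>L p" by (rule indicator_in_Lp_space[OF S(1)])
  have step_in_Lp: "step_function S m a \<in> Lp_space \<mu>\<^sub>L p" by (rule step_in_Lp_space[OF S(1)])
  have "Lp.F (a i *\<^sub>R indicator (S i)) \<le> Lp.F (step_function S m a)"
  proof (rule Lp.F_mono[OF _ step_in_Lp])
    show "a i *\<^sub>R indicator (S i) \<in> Lp_space \<mu>\<^sub>L p"
      using ind by (rule subspace_scale[OF Lp.subspace_E])
    show "\<bar>(a i *\<^sub>R indicator (S i)) x\<bar> \<le> \<bar>step_function S m a x\<bar>" for x
      using step_function_eq[OF S(2) i, of x a] by (cases "x \<in> S i") auto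
  qed
  then have "Lp.F (a i *\<^sub>R indicator (S i)) powr (1 / p) \<le> Lp.F (step_function S m a) powr (1 / p)"
    using p ind by (intro powr_mono2) (auto intro!: Lp.F_nonneg)
  then show ?thesis using Lp.N_hom[OF ind] by simp
qed

lemma X_close_subseq:
  assumes u: "\<And>n::nat. u n \<in> X" and B: "\<And>n. G.F (u n) + L.F (u n) \<le> B" and e: "e > 0"
  shows "\<exists>r. strict_mono (r :: nat \<Rightarrow> nat) \<and> (\<forall>i j. L.F (u (r i) - u (r j)) powr (1 / p) < e)"
proof -
  have nonneg: "0 \<le> G.F (u n)" "0 \<le> L.F (u n)" for n using u by (auto intro: G.F_nonneg L.F_nonneg)
  have bounds: "G.F (u n) \<le> B" "L.F (u n) \<le> B" for n using B[of n] nonneg[of n] by auto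
  have B_nonneg: "B \<ge> 0" using bounds(1)[of 0] nonneg(1)[of 0] by linarith
  have Lp: "u n \<in> Lp_space \<mu>\<^sub>L p" for n using u by (simp add: X_iff)
  have "(e / 3) powr p > 0" using e by simp
  then obtain h where h: "h > 0" "cell_constant h * B < (e / 3) powr p"
    by (rule cell_constant_small[OF _ B_nonneg])
  obtain S c and m :: nat where S: "\<And>i. S i \<in> sets borel" "disjoint_family S" "(\<Union>i<m. S i) = \<Omega>"
      "\<And>i. i < m \<Longrightarrow> S i \<subseteq> ball (c i) h"
    by (rule finite_cell_partition[OF \<Omega>_sets(3) \<Omega>(3) h(1)]) (rule that)
  have "\<exists>a. L.F (u n - step_function S m a) \<le> cell_constant h * G.F (u n)" for n
    by (rule step_approximation[where c = c, OF u h(1) S])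
  then obtain a where a: "\<And>n. L.F (u n - step_function S m (a n)) \<le> cell_constant h * G.F (u n)"
    by metis
  define w where "w n = step_function S m (a n)" for n
  have w: "w n \<in> Lp_space \<mu>\<^sub>L p" for n unfolding w_def by (rule step_in_Lp_space[OF S(1)])
  have close: "L.F (u n - w n) powr (1 / p) < e / 3" for n
  proof -
    have "L.F (u n - w n) \<le> cell_constant h * B"
      unfolding w_def using a[of n] mult_left_mono[OF bounds(1) cell_constant_nonneg[OF h(1)]]
      by (rule order_trans)
    then show ?thesis using h(2) e Lp w by (subst Lp.root_F_less_iff) auto
  qed
  have "\<bar>a n i\<bar> * L.F (indicator (S i)) powr (1 / p) \<le> B powr (1 / p) + e / 3"
    if "i \<in> {..<m}" for n i
  proof -
    have "\<bar>a n i\<bar> * L.F (indicator (S i)) powr (1 / p) \<le> L.F (w n) powr (1 / p)"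
      unfolding w_def using that by (intro step_coefficient_bound S(1,2)) auto
    also have "\<dots> \<le> L.F (u n) powr (1 / p) + L.F (w n - u n) powr (1 / p)"
      by (rule Lp.N_le_add_diff[OF w Lp])
    also have "L.F (w n - u n) powr (1 / p) = L.F (u n - w n) powr (1 / p)"
      by (rule Lp.N_diff_commute[OF w Lp])
    finally show ?thesis
      using close[of n] powr_mono2[OF _ nonneg(2) bounds(2), of "1 / p" n] p by simp
  qed
  then obtain r where r: "strict_mono (r :: nat \<Rightarrow> nat)"
    "Cauchy_wrt (\<lambda>u. L.F u powr (1 / p)) (\<lambda>n. w (r n))"
    using Lp.bounded_combinations_Cauchy_subseq[of "{..<m}"
      "\<lambda>i. indicator (S i)" a "B powr (1 / p) + e / 3"]
      indicator_in_Lp_space[OF S(1)] unfolding w_def step_function_def by auto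
  show ?thesis by (rule Lp.close_subseq_of_approximation[OF Lp w close r e])
qed

lemma X_compact_embedding:
  assumes u: "\<And>n::nat. u n \<in> X" and B: "\<And>n. G.F (u n) + L.F (u n) \<le> B"
  shows "\<exists>r. strict_mono (r :: nat \<Rightarrow> nat) \<and> Cauchy_wrt L.F (\<lambda>n. u (r n))"
proof -
  have "\<exists>r. strict_mono (r :: nat \<Rightarrow> nat) \<and> Cauchy_wrt (\<lambda>u. L.F u powr (1 / p)) (\<lambda>n. u (r n))"
    by (rule L.Cauchy_subseq_of_close_subseqs) (rule X_close_subseq[OF u B])
  then show ?thesis using L.Cauchy_wrt_F_iff[OF u] by blast
qed

sublocale rayleigh X G.F L.F p
  by unfold_locales (fact G.F_uniformly_convex L.F_uniformly_convex X_complete X_compact_embedding)+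

end

subsection \<open>The space of classes\<close>

lemma (in seminormed) N_diff_cong_null:
  assumes "x \<in> E" "y \<in> E" "x' \<in> E" "y' \<in> E" "N (x - x') = 0" "N (y - y') = 0"
  shows "N (x - y) = N (x' - y')"
proof -
  have "N (x - y) \<le> N (x - x') + (N (x' - y') + N (y' - y))"
    using N_triangle_diff[of x x' y] N_triangle_diff[of x' y' y] assms by linarith
  moreover have "N (x' - y') \<le> N (x' - x) + (N (x - y) + N (y - y'))"
    using N_triangle_diff[of x' x y'] N_triangle_diff[of x y y'] assms by linarith
  ultimately show ?thesis using assms N_diff_commute[of x x'] N_diff_commute[of y y'] by simp
qed

lemma (in rayleigh) cong_null:
  assumes u: "u \<in> E" "v \<in> E" and null: "N (u - v) = 0"
  shows "G u = G v" "L u = L v"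
proof -
  have d: "u - v \<in> E" using u by auto
  have "G (u - v) = 0" "L (u - v) = 0"
    using null G.F_nonneg[OF d] L.F_nonneg[OF d] by (auto simp: add_nonneg_eq_0_iff)
  then have "G u powr (1 / p) = G v powr (1 / p)" "l u = l v"
    using G.abs_N_diff_le[OF u] L.abs_N_diff_le[OF u] by auto
  then show "G u = G v" "L u = L v" using G.F_powr L.F_powr u by metis+
qed

lemma convergent_of_nat_mult_iff: "convergent (\<lambda>k. real k * x) \<longleftrightarrow> x = 0"
proof
  assume "convergent (\<lambda>k. real k * x)"
  then obtain b where b: "\<And>k. norm (real k * x) \<le> b" using Bseq_def convergent_imp_Bseq by metis
  show "x = 0"
  proof (rule ccontr)
    assume "x \<noteq> 0"
    then obtain k where "real k * \<bar>x\<bar> > b" using reals_Archimedean3[of "\<bar>x\<bar>"] by auto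
    then show False using b[of k] by (simp add: abs_mult)
  qed
qed (simp add: convergent_const)

context neumann
begin

abbreviation \<X> :: "(real^'n \<Rightarrow> real) set set" where "\<X> \<equiv> Xsp p s \<Omega>"
abbreviation cls :: "(real^'n \<Rightarrow> real) \<Rightarrow> (real^'n \<Rightarrow> real) set" where "cls \<equiv> Xcls p s \<Omega>"
abbreviation d\<^sub>X :: "(real^'n \<Rightarrow> real) set \<Rightarrow> (real^'n \<Rightarrow> real) set \<Rightarrow> real" where "d\<^sub>X \<equiv> Xdist p s \<Omega>"
abbreviation G\<^sub>X :: "(real^'n \<Rightarrow> real) set \<Rightarrow> real" where "G\<^sub>X \<equiv> semp p s \<Omega>"
abbreviation L\<^sub>X :: "(real^'n \<Rightarrow> real) set \<Rightarrow> real" where "L\<^sub>X \<equiv> lpp p \<Omega>"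

lemma nn_integral_abs_powr_eq_0_iff:
  assumes "f \<in> borel_measurable M"
  shows "(\<integral>\<^sup>+x. ennreal (\<bar>f x\<bar> powr p) \<partial>M) = 0 \<longleftrightarrow> (AE x in M. f x = 0)"
  using assms p by (subst nn_integral_0_iff_AE) (auto simp: ennreal_eq_0_iff)

text \<open>A null \<open>w\<close> vanishes almost everywhere because \<open>k * w x\<close> converges only where \<open>w x = 0\<close>.\<close>

lemma N_zero_iff:
  assumes w: "w \<in> X"
  shows "N w = 0 \<longleftrightarrow> (AE x in lebesgue. w x = 0)"
proof -
  have "N w = 0 \<longleftrightarrow> G.F w = 0 \<and> L.F w = 0"
    using G.F_nonneg[OF w] L.F_nonneg[OF w] p by (simp add: add_nonneg_eq_0_iff)
  also have "\<dots> \<longleftrightarrow> (AE z in \<mu>\<^sub>G. pair_diff w z = 0) \<and> (AE x in \<mu>\<^sub>L. w x = 0)"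
    using nn_integral_abs_powr_eq_0_iff[OF G.A_measurable[OF w]]
      nn_integral_abs_powr_eq_0_iff[OF L.A_measurable[OF w]]
      G.F_ennreal[OF w] L.F_ennreal[OF w]
      ennreal_eq_zero_iff[OF G.F_nonneg[OF w]] ennreal_eq_zero_iff[OF L.F_nonneg[OF w]]
    by metis
  also have "\<dots> \<longleftrightarrow> (AE x in lborel. w x = 0)"
  proof
    assume zero: "(AE z in \<mu>\<^sub>G. pair_diff w z = 0) \<and> (AE x in \<mu>\<^sub>L. w x = 0)"
    have "AE x in lborel. convergent (\<lambda>k. real k * w x)"
    proof (rule AE_convergent_lborel)
      have "pair_diff (\<lambda>x. real k * w x) z = real k * pair_diff w z" for k z
        by (simp add: pair_diff_def right_diff_distrib)
      then show "AE z in \<mu>\<^sub>G. convergent (\<lambda>k. pair_diff (\<lambda>x. real k * w x) z)"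
        using zero by (simp add: convergent_of_nat_mult_iff)
      show "AE x in \<mu>\<^sub>L. convergent (\<lambda>k. real k * w x)"
        using zero by (simp add: convergent_of_nat_mult_iff)
    qed
    then show "AE x in lborel. w x = 0" by (simp add: convergent_of_nat_mult_iff)
  next
    assume zero: "AE x in lborel. w x = 0"
    have "AE z in lborel. pair_diff w z = 0"
      using AE_lborel_fst[OF zero, where 'b = "real^'n"]
        AE_lborel_snd[OF zero, where 'a = "real^'n"]
      by eventually_elim (simp add: pair_diff_def)
    then show "(AE z in \<mu>\<^sub>G. pair_diff w z = 0) \<and> (AE x in \<mu>\<^sub>L. w x = 0)"
      using zero unfolding AE_\<mu>\<^sub>G_iff AE_\<mu>\<^sub>L_iff by (auto elim: eventually_mono)
  qed
  finally show ?thesis unfolding AE_completion_iff .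
qed

lemma cls_eq_iff:
  assumes u: "u \<in> X" and v: "v \<in> X"
  shows "cls u = cls v \<longleftrightarrow> N (u - v) = 0"
proof -
  have "cls u = cls v \<longleftrightarrow> (AE x in lebesgue. u x = v x)"
  proof
    have "u \<in> cls u" unfolding Xcls_def using u by simp
    also assume "cls u = cls v"
    finally show "AE x in lebesgue. u x = v x" unfolding Xcls_def by simp
  next
    assume ae_eq: "AE x in lebesgue. u x = v x"
    have "(AE x in lebesgue. w x = u x) \<longleftrightarrow> (AE x in lebesgue. w x = v x)" for w
      using ae_eq by (auto elim: eventually_elim2)
    then show "cls u = cls v" unfolding Xcls_def by simp
  qed
  then show ?thesis using N_zero_iff[of "u - v"] u v by simp
qed

lemma cls_in: "u \<in> X \<Longrightarrow> cls u \<in> \<X>"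
  unfolding Xsp_def by auto

lemma rep_in: "U \<in> \<X> \<Longrightarrow> rep U \<in> X"
  and cls_rep: "U \<in> \<X> \<Longrightarrow> cls (rep U) = U"
proof -
  assume "U \<in> \<X>"
  then obtain u where u: "u \<in> X" "U = cls u" unfolding Xsp_def by auto
  then have "u \<in> U" unfolding Xcls_def by simp
  then have "rep U \<in> U" unfolding rep_def by (rule someI[of "\<lambda>u. u \<in> U"])
  then have rep: "rep U \<in> X" "AE x in lebesgue. rep U x = u x" unfolding u(2) Xcls_def by auto
  then show "rep U \<in> X" by simp
  have "AE x in lebesgue. (rep U - u) x = 0" using rep(2) by eventually_elim simp
  then have "N (rep U - u) = 0" using N_zero_iff[of "rep U - u"] rep(1) u(1) by auto
  then show "cls (rep U) = U" using cls_eq_iff[OF rep(1) u(1)] u(2) by simp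
qed

lemma rep_cls_null: "u \<in> X \<Longrightarrow> N (rep (cls u) - u) = 0"
  using cls_eq_iff[of "rep (cls u)" u] rep_in cls_rep cls_in by blast

lemma G\<^sub>X_cls: "u \<in> X \<Longrightarrow> G\<^sub>X (cls u) = G.F u"
  and L\<^sub>X_cls: "u \<in> X \<Longrightarrow> L\<^sub>X (cls u) = L.F u"
proof -
  assume u: "u \<in> X"
  note rep = rep_in[OF cls_in[OF u]]
  show "G\<^sub>X (cls u) = G.F u" "L\<^sub>X (cls u) = L.F u"
    using G_gagp[OF rep] L_Lpp[OF rep] cong_null[OF rep u rep_cls_null[OF u]]
    by (simp_all add: semp_def lpp_def)
qed

lemma d\<^sub>X_cls:
  assumes u: "u \<in> X" and v: "v \<in> X"
  shows "d\<^sub>X (cls u) (cls v) = N (u - v)"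
proof -
  define u' v' where "u' = rep (cls u)" and "v' = rep (cls v)"
  have rep: "u' \<in> X" "v' \<in> X" "u' - v' \<in> X" using u v rep_in cls_in by (auto simp: u'_def v'_def)
  have "d\<^sub>X (cls u) (cls v) = N (u' - v')"
    unfolding Xdist_def Let_def u'_def[symmetric] v'_def[symmetric]
    using G_gagp[OF rep(3)] L_Lpp[OF rep(3)] by (simp add: fun_diff_def)
  also have "\<dots> = N (u - v)"
    using rep u v rep_cls_null[OF u] rep_cls_null[OF v] unfolding u'_def v'_def
    by (intro Phi.N_diff_cong_null)
  finally show ?thesis .
qed

lemma classE:
  assumes "U \<in> \<X>"
  obtains u where "u \<in> X" "U = cls u"
  using assms unfolding Xsp_def by auto

lemma Xneg_Xneg: "Xneg (Xneg U) = U"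
  unfolding Xneg_def by (auto simp: image_image)

lemma Xneg_cls:
  assumes u: "u \<in> X"
  shows "Xneg (cls u) = cls (- u)"
proof -
  have Xneg_subset: "Xneg (cls u) \<subseteq> cls (- u)" for u
  proof
    fix v assume "v \<in> Xneg (cls u)"
    then obtain w where w: "w \<in> X" "AE x in lebesgue. w x = u x" "v = - w"
      unfolding Xneg_def Xcls_def by (auto simp: fun_Compl_def)
    have "AE x in lebesgue. (- w) x = (- u) x" using w(2) by eventually_elim simp
    then show "v \<in> cls (- u)" unfolding Xcls_def using w by auto
  qed
  have "Xneg (Xneg (cls (- u))) \<subseteq> Xneg (cls (- (- u)))"
    unfolding Xneg_def[of "Xneg _"] Xneg_def[of "cls (- (- u))"] using Xneg_subset[of "- u"]
    by (rule image_mono)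
  then show ?thesis using Xneg_subset[of u] by (auto simp: Xneg_Xneg)
qed

lemma Xdist_commute: "d\<^sub>X U V = d\<^sub>X V U"
proof -
  have "\<bar>(f x - g x) - (f y - g y)\<bar> = \<bar>(g x - f x) - (g y - f y)\<bar>"
    for f g :: "real^'n \<Rightarrow> real" and x y
    by linarith
  then have "gagp p s \<Omega> (\<lambda>x. f x - g x) = gagp p s \<Omega> (\<lambda>x. g x - f x)" for f g :: "real^'n \<Rightarrow> real"
    unfolding gagp_def by presburger
  moreover have "Lpp p \<Omega> (\<lambda>x. f x - g x) = Lpp p \<Omega> (\<lambda>x. g x - f x)" for f g :: "real^'n \<Rightarrow> real"
    unfolding Lpp_def by (simp add: abs_minus_commute)
  ultimately show ?thesis unfolding Xdist_def Let_def by metis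
qed

sublocale IM: metric_involution \<X> d\<^sub>X Xneg
proof
  show "0 \<le> d\<^sub>X U V" for U V unfolding Xdist_def Let_def by simp
  show "d\<^sub>X U V = d\<^sub>X V U" for U V by (rule Xdist_commute)
  show "d\<^sub>X U V = 0 \<longleftrightarrow> U = V" if "U \<in> \<X>" "V \<in> \<X>" for U V
    using that by (elim classE) (simp add: d\<^sub>X_cls cls_eq_iff)
  show "d\<^sub>X U U = 0" if "U \<in> \<X>" for U
    using that by (elim classE) (simp add: d\<^sub>X_cls)
  show "d\<^sub>X U W \<le> d\<^sub>X U V + d\<^sub>X V W" if "U \<in> \<X>" "V \<in> \<X>" "W \<in> \<X>" for U V W
    using that by (elim classE) (simp add: d\<^sub>X_cls Phi.N_triangle_diff)
  show "Xneg U \<in> \<X>" if "U \<in> \<X>" for U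
    using that by (elim classE) (simp add: Xneg_cls cls_in)
  show "Xneg (Xneg U) = U" for U by (rule Xneg_Xneg)
  show "d\<^sub>X (Xneg U) (Xneg V) = d\<^sub>X U V" if "U \<in> \<X>" "V \<in> \<X>" for U V
    using that by (elim classE) (simp add: Xneg_cls d\<^sub>X_cls Phi.N_diff_commute)
qed (rule Xdist_commute)

lemma Xindex_eq: "Xindex p s \<Omega> A = FR_index IM.mtopology Xneg A"
  unfolding Xindex_def Xtop_def ..

lemma Xneg_invariant:
  assumes "U \<in> \<X>"
  shows "G\<^sub>X (Xneg U) = G\<^sub>X U" "L\<^sub>X (Xneg U) = L\<^sub>X U"
  using assms by (auto elim!: classE simp: Xneg_cls G\<^sub>X_cls L\<^sub>X_cls G.F_minus L.F_minus)

lemma Xneg_not_fixed: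
  assumes U: "U \<in> \<X>" "L\<^sub>X U > 0"
  shows "Xneg U \<noteq> U"
proof
  assume "Xneg U = U"
  obtain u where u: "u \<in> X" "U = cls u" using U(1) by (rule classE)
  then have "N (u - - u) = 0" using \<open>Xneg U = U\<close> cls_eq_iff[of u "- u"] by (simp add: Xneg_cls)
  then have "N u = 0" unfolding Phi.N_diff_uminus[OF u(1)] by simp
  then show False using N_pos[OF u(1)] U(2) L\<^sub>X_cls[OF u(1)] u(2) by simp
qed

definition representatives :: "(real^'n \<Rightarrow> real) set set \<Rightarrow> (real^'n \<Rightarrow> real) set" where
  "representatives A = {u \<in> X. cls u \<in> A}"

context
  fixes A :: "(real^'n \<Rightarrow> real) set set"
  assumes A: "A \<subseteq> \<X>" and A_neg: "\<And>U. U \<in> A \<Longrightarrow> Xneg U \<in> A" and A_pos: "\<And>U. U \<in> A \<Longrightarrow> L\<^sub>X U > 0"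
begin

lemma Xneg_free: "U \<in> A \<Longrightarrow> Xneg U \<noteq> U"
  using A A_pos Xneg_not_fixed by blast

lemma odd_section:
  obtains \<sigma> where "\<And>U. U \<in> A \<Longrightarrow> \<sigma> U \<in> representatives A" "\<And>U. U \<in> A \<Longrightarrow> \<sigma> (Xneg U) = - \<sigma> U"
    "\<And>U V. U \<in> A \<Longrightarrow> V \<in> A \<Longrightarrow> N (\<sigma> U - \<sigma> V) = d\<^sub>X U V"
proof -
  obtain \<sigma> where \<sigma>: "\<And>U. U \<in> A \<Longrightarrow> \<sigma> U \<in> X \<and> cls (\<sigma> U) = U" "\<And>U. U \<in> A \<Longrightarrow> \<sigma> (Xneg U) = - \<sigma> U"
  proof (rule equivariant_choice[of A Xneg "\<lambda>U u. u \<in> X \<and> cls u = U" uminus])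
    show "\<exists>u. u \<in> X \<and> cls u = U" if "U \<in> A" for U using rep_in cls_rep that A by blast
    show "- u \<in> X \<and> cls (- u) = Xneg U" if "U \<in> A" "u \<in> X \<and> cls u = U" for U u
      using that Xneg_cls by auto
    show "Xneg (Xneg U) = U" for U by (rule Xneg_Xneg)
  qed (auto intro: A_neg dest: Xneg_free)
  have "N (\<sigma> U - \<sigma> V) = d\<^sub>X U V" if "U \<in> A" "V \<in> A" for U V
    using d\<^sub>X_cls[of "\<sigma> U" "\<sigma> V"] \<sigma>(1)[OF that(1)] \<sigma>(1)[OF that(2)] by simp
  then show ?thesis using \<sigma> by (intro that[of \<sigma>]) (auto simp: representatives_def)
qed

lemma omega_power_zero_representatives_iff:
  "omega_power_zero d\<^sub>X Xneg A q \<longleftrightarrow> omega_power_zero Phi.d\<^sub>N uminus (representatives A) q"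
proof
  assume "omega_power_zero d\<^sub>X Xneg A q"
  then show "omega_power_zero Phi.d\<^sub>N uminus (representatives A) q"
  proof (rule omega_power_zero_pullback[where f = cls])
    show "\<exists>\<delta>>0. \<forall>v\<in>representatives A. N (u - v) < \<delta> \<longrightarrow> d\<^sub>X (cls u) (cls v) < e"
      if "u \<in> representatives A" "e > 0" for u e
      using that d\<^sub>X_cls unfolding representatives_def by (intro exI[of _ e]) auto
  qed (auto simp: representatives_def Xneg_cls)
next
  assume zero: "omega_power_zero Phi.d\<^sub>N uminus (representatives A) q"
  obtain \<sigma> where \<sigma>: "\<And>U. U \<in> A \<Longrightarrow> \<sigma> U \<in> representatives A" "\<And>U. U \<in> A \<Longrightarrow> \<sigma> (Xneg U) = - \<sigma> U"
    "\<And>U V. U \<in> A \<Longrightarrow> V \<in> A \<Longrightarrow> N (\<sigma> U - \<sigma> V) = d\<^sub>X U V"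
    by (rule odd_section) (rule that)
  show "omega_power_zero d\<^sub>X Xneg A q"
  proof (rule omega_power_zero_pullback[where f = \<sigma>, OF zero \<sigma>(1,2)])
    show "\<exists>\<delta>>0. \<forall>V\<in>A. d\<^sub>X U V < \<delta> \<longrightarrow> N (\<sigma> U - \<sigma> V) < e" if "U \<in> A" "e > 0" for U e
      using that \<sigma>(3) by (intro exI[of _ e]) auto
  qed
qed

lemma odd_map_of_rayleigh_bound:
  assumes \<mu>: "0 \<le> \<mu>" and bound: "\<And>U. U \<in> A \<Longrightarrow> G\<^sub>X U \<le> \<mu> * L\<^sub>X U"
  shows "\<exists>g. IM.odd_map A g"
proof -
  obtain \<sigma> where \<sigma>: "\<And>U. U \<in> A \<Longrightarrow> \<sigma> U \<in> representatives A" "\<And>U. U \<in> A \<Longrightarrow> \<sigma> (Xneg U) = - \<sigma> U"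
    "\<And>U V. U \<in> A \<Longrightarrow> V \<in> A \<Longrightarrow> N (\<sigma> U - \<sigma> V) = d\<^sub>X U V"
    by (rule odd_section) (rule that)
  have "representatives A \<subseteq> rayleigh_sublevel \<mu>"
    using bound A_pos G\<^sub>X_cls L\<^sub>X_cls by (fastforce simp: representatives_def rayleigh_sublevel_def)
  then have \<sigma>_sub: "\<sigma> U \<in> rayleigh_sublevel \<mu>" if "U \<in> A" for U using \<sigma>(1)[OF that] by blast
  obtain n f where f: "\<And>u. u \<in> rayleigh_sublevel \<mu> \<Longrightarrow> f u \<in> seqs_upto n - {0}"
    "\<And>u. u \<in> rayleigh_sublevel \<mu> \<Longrightarrow> f (- u) = - f u"
    "\<And>u e. u \<in> rayleigh_sublevel \<mu> \<Longrightarrow> e > 0 \<Longrightarrow>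
       \<exists>\<delta>>0. \<forall>v\<in>rayleigh_sublevel \<mu>. N (u - v) < \<delta> \<longrightarrow> l2_norm (f v - f u) < e"
    by (rule sublevel_odd_map_exists[OF \<mu>]) (rule that)
  have "IM.odd_map A (\<lambda>U. l2.normalize (f (\<sigma> U)))"
  proof (rule IM.odd_map_normalize[OF A A_neg Xneg_free])
    show "f (\<sigma> U) \<in> seqs_upto n - {0}" "f (\<sigma> (Xneg U)) = - f (\<sigma> U)" if "U \<in> A" for U
      using f(1,2)[OF \<sigma>_sub[OF that]] \<sigma>(2)[OF that] by simp_all
    show "\<exists>\<delta>>0. \<forall>V\<in>A. d\<^sub>X U V < \<delta> \<longrightarrow> l2_norm (f (\<sigma> V) - f (\<sigma> U)) < e" if U: "U \<in> A" "e > 0" for U e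
    proof -
      obtain \<delta> where "\<delta> > 0"
        "\<And>v. v \<in> rayleigh_sublevel \<mu> \<Longrightarrow> N (\<sigma> U - v) < \<delta> \<Longrightarrow> l2_norm (f v - f (\<sigma> U)) < e"
        using f(3)[OF \<sigma>_sub[OF U(1)] U(2)] by blast
      then show ?thesis using \<sigma>_sub \<sigma>(3)[OF U(1)] by (intro exI[of _ \<delta>]) auto
    qed
  qed
  then show ?thesis by blast
qed

end

lemma compactin_cls_image:
  assumes K: "K \<subseteq> X" "Phi.sequentially_compact K"
  shows "compactin IM.mtopology (cls ` K)"
  unfolding IM.compactin_sequentially
proof (intro conjI allI impI)
  show "cls ` K \<subseteq> \<X>" using K cls_in by auto
  fix \<sigma> :: "nat \<Rightarrow> (real^'n \<Rightarrow> real) set" assume "range \<sigma> \<subseteq> cls ` K"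
  then have "\<forall>n. \<exists>u. u \<in> K \<and> \<sigma> n = cls u" by auto
  then obtain u where u: "\<And>n::nat. u n \<in> K" "\<And>n. \<sigma> n = cls (u n)" by metis
  obtain v r where v: "v \<in> K" "strict_mono (r :: nat \<Rightarrow> nat)" "(\<lambda>n. N (u (r n) - v)) \<longlonglongrightarrow> 0"
    by (rule Phi.sequentially_compactE[OF K(2) u(1)])
  have "limitin IM.mtopology (\<sigma> \<circ> r) (cls v) sequentially"
    unfolding IM.limitin_metric
  proof (intro conjI allI impI)
    show "cls v \<in> \<X>" using v K cls_in by auto
    fix e :: real assume "e > 0"
    then have "eventually (\<lambda>n. N (u (r n) - v) < e) sequentially"
      using v(3) by (intro order_tendstoD) auto
    then show "\<forall>\<^sub>F n in sequentially. (\<sigma> \<circ> r) n \<in> \<X> \<and> d\<^sub>X ((\<sigma> \<circ> r) n) (cls v) < e"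
      by eventually_elim (use u v K cls_in d\<^sub>X_cls in \<open>auto simp: subset_iff\<close>)
  qed
  then show "\<exists>l r. l \<in> cls ` K \<and> strict_mono r \<and> limitin IM.mtopology (\<sigma> \<circ> r) l sequentially"
    using v by blast
qed

lemma bdd_above_G\<^sub>X_compact:
  assumes "compactin IM.mtopology K"
  shows "bdd_above (G\<^sub>X ` K)"
proof -
  obtain C b where C: "K \<subseteq> IM.mcball C b"
    using IM.compactin_imp_mbounded[OF assms] unfolding IM.mbounded_def by blast
  have "G\<^sub>X U \<le> (N (rep C) + b) powr p" if "U \<in> K" for U
  proof -
    have U: "C \<in> \<X>" "U \<in> \<X>" "d\<^sub>X C U \<le> b" using C that by (auto simp: IM.in_mcball subset_iff)
    obtain u where u: "u \<in> X" "U = cls u" using U(2) by (rule classE)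
    have rep: "rep C \<in> X" by (rule rep_in[OF U(1)])
    have "N u \<le> N (rep C) + N (u - rep C)" using u rep by (intro Phi.N_le_add_diff)
    also have "N (u - rep C) = d\<^sub>X C U"
      using Phi.N_diff_commute[OF u(1) rep] d\<^sub>X_cls[OF rep u(1)] cls_rep[OF U(1)] u(2) by simp
    finally have "N u \<le> N (rep C) + b" using U(3) by linarith
    then have "N u powr p \<le> (N (rep C) + b) powr p" using p by (intro powr_mono2) auto
    then show ?thesis using Phi.F_powr[OF u(1)] L.F_nonneg[OF u(1)] G\<^sub>X_cls[OF u(1)] u(2) by simp
  qed
  then show ?thesis by (rule bdd_aboveI2)
qed

subsection \<open>The minimax eigenvalues and the index of the cones\<close>

abbreviation \<Lambda> :: "nat \<Rightarrow> real" where "\<Lambda> \<equiv> eigval p s \<Omega>"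

definition admissible :: "nat \<Rightarrow> (real^'n \<Rightarrow> real) set set \<Rightarrow> bool" where
  "admissible m K \<longleftrightarrow> K \<subseteq> Mset p s \<Omega> \<and> (\<forall>U\<in>K. Xneg U \<in> K) \<and> compactin IM.mtopology K
      \<and> enat m \<le> Xindex p s \<Omega> K"

lemma eigval_eq: "\<Lambda> m = Inf ((\<lambda>K. SUP U\<in>K. G\<^sub>X U) ` {K. admissible m K})"
  unfolding eigval_def admissible_def Xtop_def by (intro arg_cong[where f = Inf]) auto

lemma G\<^sub>X_nonneg: "0 \<le> G\<^sub>X U"
  unfolding semp_def by simp

lemma admissible_facts:
  assumes "admissible m K"
  shows "K \<subseteq> \<X>" "\<And>U. U \<in> K \<Longrightarrow> Xneg U \<in> K" "\<And>U. U \<in> K \<Longrightarrow> L\<^sub>X U = 1" "bdd_above (G\<^sub>X ` K)"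
  using assms bdd_above_G\<^sub>X_compact unfolding admissible_def Mset_def by auto

lemma admissible_nonzero:
  assumes K: "admissible m K" and m: "1 \<le> m"
  shows "\<not> omega_power_zero d\<^sub>X Xneg K (m - 1)" "K \<noteq> {}"
proof -
  have free: "Xneg U \<noteq> U" if "U \<in> K" for U
    using that admissible_facts[OF K] by (intro Xneg_not_fixed) auto
  have "enat m \<le> FR_index IM.mtopology Xneg K" using K Xindex_eq unfolding admissible_def by auto
  then show "\<not> omega_power_zero d\<^sub>X Xneg K (m - 1)"
    using IM.FR_index_ge_iff[OF admissible_facts(1,2)[OF K] free m] by blast
  then show "K \<noteq> {}" using omega_power_zero_empty by metis
qed

lemma SUP_G\<^sub>X_nonneg: "admissible m K \<Longrightarrow> 1 \<le> m \<Longrightarrow> 0 \<le> (SUP U\<in>K. G\<^sub>X U)"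
  using admissible_nonzero(2) admissible_facts(4) G\<^sub>X_nonneg by (metis all_not_in_conv cSUP_upper2)

lemma eigval_le:
  assumes m: "1 \<le> m" and K: "admissible m K" and bound: "\<And>U. U \<in> K \<Longrightarrow> G\<^sub>X U \<le> b"
  shows "\<Lambda> m \<le> b"
proof -
  have "\<Lambda> m \<le> (SUP U\<in>K. G\<^sub>X U)"
    unfolding eigval_eq
  proof (rule cInf_lower)
    show "bdd_below ((\<lambda>K. SUP U\<in>K. G\<^sub>X U) ` {K. admissible m K})"
      by (rule bdd_belowI[of _ 0]) (use SUP_G\<^sub>X_nonneg m in auto)
  qed (use K in auto)
  also have "\<dots> \<le> b" using admissible_nonzero(2)[OF K m] bound by (rule cSUP_least)
  finally show ?thesis .
qed

lemma eigval_nonneg: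
  assumes m: "1 \<le> m" and admissible_ex: "\<exists>K. admissible m K"
  shows "0 \<le> \<Lambda> m"
  unfolding eigval_eq using admissible_ex SUP_G\<^sub>X_nonneg m by (intro cInf_greatest) auto

lemma admissible_near_eigval:
  assumes admissible_ex: "\<exists>K. admissible m K" and e: "e > 0"
  obtains K where "admissible m K" "\<And>U. U \<in> K \<Longrightarrow> G\<^sub>X U \<le> \<Lambda> m + e"
proof -
  have "Inf ((\<lambda>K. SUP U\<in>K. G\<^sub>X U) ` {K. admissible m K}) < \<Lambda> m + e"
    using e unfolding eigval_eq by simp
  then obtain K where K: "admissible m K" "(SUP U\<in>K. G\<^sub>X U) < \<Lambda> m + e"
    using cInf_lessD[of "(\<lambda>K. SUP U\<in>K. G\<^sub>X U) ` {K. admissible m K}"] admissible_ex by blast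
  have "G\<^sub>X U \<le> \<Lambda> m + e" if "U \<in> K" for U
    using cSUP_upper[OF that admissible_facts(4)[OF K(1)]] K(2) by linarith
  then show ?thesis by (rule that[OF K(1)])
qed

text \<open>Without admissible sets both infima would be the junk value \<open>Inf {}\<close>.\<close>

lemma eigval_gap_imp_admissible:
  assumes gap: "\<Lambda> m < \<Lambda> (Suc m)"
  shows "\<exists>K. admissible m K"
proof (rule ccontr)
  assume none: "\<not> ?thesis"
  have "admissible m K" if "admissible (Suc m) K" for K
    using that order_trans[of "enat m" "enat (Suc m)"] unfolding admissible_def by auto
  then have "{K. admissible m K} = {K. admissible (Suc m) K}" using none by blast
  then show False using gap unfolding eigval_eq by simp
qed

definition class_sublevel :: "real \<Rightarrow> (real^'n \<Rightarrow> real) set set" where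
  "class_sublevel \<mu> = {U\<in>\<X>. L\<^sub>X U > 0 \<and> G\<^sub>X U \<le> \<mu> * L\<^sub>X U}"

definition open_class_sublevel :: "real \<Rightarrow> (real^'n \<Rightarrow> real) set set" where
  "open_class_sublevel \<mu> = {U\<in>\<X>. L\<^sub>X U > 0 \<and> G\<^sub>X U < \<mu> * L\<^sub>X U}"

lemma class_sublevel_facts:
  "class_sublevel \<mu> \<subseteq> \<X>" "U \<in> class_sublevel \<mu> \<Longrightarrow> Xneg U \<in> class_sublevel \<mu>"
    "U \<in> class_sublevel \<mu> \<Longrightarrow> L\<^sub>X U > 0"
  by (auto simp: class_sublevel_def Xneg_invariant IM.ng_closed)

lemma open_class_sublevel_facts:
  "open_class_sublevel \<mu> \<subseteq> \<X>" "U \<in> open_class_sublevel \<mu> \<Longrightarrow> Xneg U \<in> open_class_sublevel \<mu>"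
  "U \<in> open_class_sublevel \<mu> \<Longrightarrow> L\<^sub>X U > 0"
  by (auto simp: open_class_sublevel_def Xneg_invariant IM.ng_closed)

lemma representatives_class_sublevel: "representatives (class_sublevel \<mu>) = rayleigh_sublevel \<mu>"
  by (auto simp: representatives_def class_sublevel_def rayleigh_sublevel_def G\<^sub>X_cls L\<^sub>X_cls
    cls_in)

lemma representatives_open_class_sublevel:
  "representatives (open_class_sublevel \<mu>) = open_rayleigh_sublevel \<mu>"
  by (auto simp: representatives_def open_class_sublevel_def open_rayleigh_sublevel_def G\<^sub>X_cls
    L\<^sub>X_cls cls_in)

lemma omega_power_nonzero_class_sublevel:
  assumes m: "1 \<le> m" and admissible_ex: "\<exists>K. admissible m K"
  shows "\<not> omega_power_zero d\<^sub>X Xneg (class_sublevel (\<Lambda> m)) (m - 1)"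
proof
  assume "omega_power_zero d\<^sub>X Xneg (class_sublevel (\<Lambda> m)) (m - 1)"
  then have "omega_power_zero Phi.d\<^sub>N uminus (rayleigh_sublevel (\<Lambda> m)) (m - 1)"
    using omega_power_zero_representatives_iff[OF class_sublevel_facts]
    by (simp add: representatives_class_sublevel)
  then obtain \<epsilon> where \<epsilon>: "\<epsilon> > 0"
    "omega_power_zero Phi.d\<^sub>N uminus {u\<in>L_sphere. G.F u \<le> \<Lambda> m + \<epsilon>} (m - 1)"
    by (rule omega_power_zero_sublevel_propagates[OF eigval_nonneg[OF m admissible_ex]])
  obtain K where K: "admissible m K" "\<And>U. U \<in> K \<Longrightarrow> G\<^sub>X U \<le> \<Lambda> m + \<epsilon>"
    by (rule admissible_near_eigval[OF admissible_ex \<epsilon>(1)]) (rule that)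
  note facts = admissible_facts[OF K(1)]
  have "omega_power_zero Phi.d\<^sub>N uminus (representatives K) (m - 1)"
  proof (rule omega_power_zero_subset[OF \<epsilon>(2)])
    show "representatives K \<subseteq> {u\<in>L_sphere. G.F u \<le> \<Lambda> m + \<epsilon>}"
      using K(2) facts(3) G\<^sub>X_cls L\<^sub>X_cls by (fastforce simp: representatives_def)
  qed
  then have "omega_power_zero d\<^sub>X Xneg K (m - 1)"
    using omega_power_zero_representatives_iff[OF facts(1,2)] facts(3) by auto
  then show False using admissible_nonzero(1)[OF K(1) m] by contradiction
qed

lemma omega_power_zero_open_class_sublevel:
  assumes m: "1 \<le> m"
  shows "omega_power_zero d\<^sub>X Xneg (open_class_sublevel (\<Lambda> m)) (m - 1)"
proof (rule ccontr)
  assume "\<not> ?thesis"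
  then have nonzero: "\<not> omega_power_zero Phi.d\<^sub>N uminus (open_rayleigh_sublevel (\<Lambda> m)) (m - 1)"
    using omega_power_zero_representatives_iff[OF open_class_sublevel_facts]
    by (simp add: representatives_open_class_sublevel)
  obtain K \<mu> where K: "K \<subseteq> {u\<in>L_sphere. G.F u \<le> \<mu>}" "\<mu> < \<Lambda> m" "\<And>u. u \<in> K \<Longrightarrow> - u \<in> K"
    "Phi.sequentially_compact K" "\<not> omega_power_zero Phi.d\<^sub>N uminus K (m - 1)"
    by (rule omega_power_nonzero_compact_sublevel[OF nonzero]) (rule that)
  define C where "C = cls ` K"
  have KX: "K \<subseteq> X" using K(1) by auto
  have C: "U \<in> \<X>" "L\<^sub>X U = 1" "G\<^sub>X U \<le> \<mu>" "Xneg U \<in> C" if U: "U \<in> C" for U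
  proof -
    obtain u where u: "u \<in> K" "U = cls u" using U unfolding C_def by auto
    then have uX: "u \<in> X" using KX by auto
    show "U \<in> \<X>" "L\<^sub>X U = 1" "G\<^sub>X U \<le> \<mu>"
      using u(1) K(1) uX by (auto simp: u(2) cls_in L\<^sub>X_cls G\<^sub>X_cls)
    show "Xneg U \<in> C" unfolding C_def u(2) Xneg_cls[OF uX] using K(3)[OF u(1)] by (rule imageI)
  qed
  have CX: "C \<subseteq> \<X>" using C(1) by blast
  have C_pos: "L\<^sub>X U > 0" if "U \<in> C" for U using C(2)[OF that] by simp
  have nonzeroC: "\<not> omega_power_zero d\<^sub>X Xneg C (m - 1)"
  proof
    assume "omega_power_zero d\<^sub>X Xneg C (m - 1)"
    then have "omega_power_zero Phi.d\<^sub>N uminus (representatives C) (m - 1)"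
      using omega_power_zero_representatives_iff[OF CX C(4) C_pos] by simp
    then have "omega_power_zero Phi.d\<^sub>N uminus K (m - 1)"
      by (rule omega_power_zero_subset) (use KX in \<open>auto simp: representatives_def C_def\<close>)
    then show False using K(5) by contradiction
  qed
  have "G\<^sub>X U \<le> \<bar>\<mu>\<bar> * L\<^sub>X U" if "U \<in> C" for U using C(2,3)[OF that] by simp
  then have "\<exists>g. IM.odd_map C g" by (intro odd_map_of_rayleigh_bound[OF CX C(4) C_pos abs_ge_zero])
  moreover have "Xneg U \<noteq> U" if "U \<in> C" for U using C(1,2)[OF that] by (intro Xneg_not_fixed) auto
  ultimately have "enat m \<le> FR_index IM.mtopology Xneg C"
    using IM.FR_index_ge_iff[OF CX C(4) _ m] nonzeroC by blast
  then have "admissible m C"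
    unfolding admissible_def Xindex_eq Mset_def using C compactin_cls_image[OF KX K(4)]
    by (auto simp: C_def[symmetric])
  then have "\<Lambda> m \<le> \<mu>" using C(3) by (rule eigval_le[OF m])
  then show False using K(2) by simp
qed

theorem Xindex_between_sublevels:
  assumes m: "1 \<le> m" and gap: "\<Lambda> m < \<Lambda> (Suc m)"
    and A: "class_sublevel (\<Lambda> m) \<subseteq> A" "A \<subseteq> open_class_sublevel (\<Lambda> (Suc m))" "\<And>U. U \<in> A \<Longrightarrow> Xneg U \<in> A"
  shows "Xindex p s \<Omega> A = enat m"
proof -
  have admissible_ex: "\<exists>K. admissible m K" by (rule eigval_gap_imp_admissible[OF gap])
  have A_pos: "U \<in> \<X>" "L\<^sub>X U > 0" "G\<^sub>X U \<le> \<Lambda> (Suc m) * L\<^sub>X U" if "U \<in> A" for U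
    using that A(2) by (auto simp: open_class_sublevel_def)
  then have A_subset: "A \<subseteq> \<X>" by blast
  have "0 \<le> \<Lambda> (Suc m)" using eigval_nonneg[OF m admissible_ex] gap by linarith
  then obtain g where g: "IM.odd_map A g"
    using odd_map_of_rayleigh_bound[OF A_subset A(3) A_pos(2) _ A_pos(3)] by blast
  have "\<not> omega_power_zero d\<^sub>X Xneg A (m - 1)"
    using omega_power_nonzero_class_sublevel[OF m admissible_ex] omega_power_zero_subset[OF _ A(1)]
    by blast
  moreover have "omega_power_zero d\<^sub>X Xneg A m"
    using omega_power_zero_subset[OF omega_power_zero_open_class_sublevel[of "Suc m"] A(2)] by simp
  ultimately show ?thesis
    unfolding Xindex_eq using A_pos Xneg_not_fixed
    by (intro IM.FR_index_eqI[OF A_subset A(3) _ m g]) auto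
qed

lemma Cminus_eq: "Cminus p s \<Omega> m - {Xzero p s \<Omega>} = class_sublevel (\<Lambda> m)"
proof -
  have zero: "Xzero p s \<Omega> = cls 0" unfolding Xzero_def zero_fun_def by simp
  have "U \<noteq> Xzero p s \<Omega> \<longleftrightarrow> L\<^sub>X U > 0" if U: "U \<in> \<X>" "G\<^sub>X U \<le> \<Lambda> m * L\<^sub>X U" for U
  proof -
    obtain u where u: "u \<in> X" "U = cls u" using U(1) by (rule classE)
    have nonneg: "0 \<le> G.F u" "0 \<le> L.F u" using G.F_nonneg[OF u(1)] L.F_nonneg[OF u(1)] .
    have "U = cls 0 \<longleftrightarrow> G.F u + L.F u = 0" using cls_eq_iff[OF u(1) Phi.E_simps(1)] u(2) by simp
    also have "\<dots> \<longleftrightarrow> L.F u = 0"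
      using U(2) nonneg by (auto simp: u(2) G\<^sub>X_cls[OF u(1)] L\<^sub>X_cls[OF u(1)] add_nonneg_eq_0_iff)
    finally have "U \<noteq> cls 0 \<longleftrightarrow> L.F u > 0" using nonneg(2) by linarith
    then show ?thesis by (simp only: zero u(2) L\<^sub>X_cls[OF u(1)])
  qed
  then show ?thesis unfolding Cminus_def class_sublevel_def by blast
qed

lemma Cplus_eq:
  assumes "0 \<le> \<Lambda> (Suc m)"
  shows "\<X> - Cplus p s \<Omega> m = open_class_sublevel (\<Lambda> (Suc m))"
proof -
  have "L\<^sub>X U > 0" if "U \<in> \<X>" "G\<^sub>X U < \<Lambda> (Suc m) * L\<^sub>X U" for U
  proof -
    have "0 < \<Lambda> (Suc m) * L\<^sub>X U" using that(2) G\<^sub>X_nonneg[of U] by linarith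
    then show ?thesis using assms by (simp add: zero_less_mult_iff)
  qed
  then show ?thesis unfolding Cplus_def open_class_sublevel_def by auto
qed

lemma class_sublevel_subset_open:
  assumes "\<mu> < \<nu>"
  shows "class_sublevel \<mu> \<subseteq> open_class_sublevel \<nu>"
proof
  fix U assume "U \<in> class_sublevel \<mu>"
  then have U: "U \<in> \<X>" "L\<^sub>X U > 0" "G\<^sub>X U \<le> \<mu> * L\<^sub>X U" unfolding class_sublevel_def by auto
  have "\<mu> * L\<^sub>X U < \<nu> * L\<^sub>X U" using assms U(2) by (rule mult_strict_right_mono)
  with U(3) have "G\<^sub>X U < \<nu> * L\<^sub>X U" by (rule le_less_trans)
  then show "U \<in> open_class_sublevel \<nu>" using U(1,2) unfolding open_class_sublevel_def by blast
qed

end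

theorem mainTheorem2:
  fixes p s :: real and \<Omega> :: "(real^'n) set" and m :: nat
  assumes "0 < s" "s < 1" "1 < p"
    and "bounded_Lipschitz_domain \<Omega>"
    and "1 \<le> m"
    and "eigval p s \<Omega> m < eigval p s \<Omega> (Suc m)"
  shows "Xindex p s \<Omega> (Cminus p s \<Omega> m - {Xzero p s \<Omega>}) = enat m
       \<and> Xindex p s \<Omega> (Xsp p s \<Omega> - Cplus p s \<Omega> m) = enat m"
proof -
  interpret neumann p s \<Omega>
    using assms by unfold_locales (auto simp: bounded_Lipschitz_domain_def)
  have "0 \<le> \<Lambda> m" using eigval_nonneg[OF assms(5) eigval_gap_imp_admissible[OF assms(6)]] .
  then have "0 \<le> \<Lambda> (Suc m)" using assms(6) by linarith
  note sublevel_subset = class_sublevel_subset_open[OF assms(6)]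
  show ?thesis
    unfolding Cminus_eq Cplus_eq[OF \<open>0 \<le> \<Lambda> (Suc m)\<close>]
    using Xindex_between_sublevels[OF assms(5,6) subset_refl sublevel_subset class_sublevel_facts(2)]
      Xindex_between_sublevels[OF assms(5,6) sublevel_subset subset_refl open_class_sublevel_facts(2)] by simp
qed

end
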